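(* Let $0\le\gamma\le\alpha\le1$ and fix $n\in\mathbb{N}$. Let $(\hat T_n(m))_{m\in\mathbb{N}_0}$ be a semi-planar $(\alpha,\gamma)$-chain on $\hat{\mathbb{T}}_{[n]}$, and let $T_n(m):=\hat\pi(\hat T_n(m))$ be its projection onto $\mathbb{T}_{[n]}$. If $\hat T_n(0)\sim\hat\Pi_n(t,\cdot)$ for some $t\in\mathbb{T}_{[n]}$, then $(T_n(m))_{m\in\mathbb{N}_0}$ is the $(\alpha,\gamma)$-chain started from $t$, i.e. the Markov chain on $\mathbb{T}_{[n]}$ started from $t$ with transition kernel $K_n=\hat\Pi_n\hat K_n\hat\pi$, and its stationary distribution is that of $T_n$, the $n$th step of the $(\alpha,\gamma)$-growth process.
   Context: Trees. $[n]=\{1,\dots,n\}$. For a finite set $A\subset\mathbb{N}$, $\mathbb{T}_A$ is the set of rooted non-planar trees whose leaves are labelled bijectively by $A$, with one additional vertex of degree 1 called the root (not a leaf), and all of whose other vertices, called branch points, have degree at least 3 (trees are identified up to label- and root-preserving isomorphism). Parents and children are taken with respect to the root. An edge is external if it ends in a leaf and internal otherwise. $\mathrm{ins}(t)$ is the set of all edges and branch points of $t$. Inserting a leaf $j$ at a branch point $v$: add leaf $j$ as a new child of $v$. Inserting $j$ at an edge: subdivide the edge by a new branch point and attach leaf $j$ to it. Deleting a leaf: remove it and its edge; if its parent had only 2 children, that parent is suppressed (its two remaining edges are merged). For a leaf $i$, let $v_1,v_2,\dots$ be the successive branch points on the path from $i$ to the root ($v_1$ the parent of $i$). The $r$th spinal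 bush on the ancestral line from $i$ is the collection of subtrees of $v_r$ not containing $i$. $(\alpha,\gamma)$-growth process. $T_1$ is the unique element of $\mathbb{T}_{[1]}$; given $T_n=s$, $T_{n+1}$ is obtained by inserting leaf $n+1$ at $x\in\mathrm{ins}(s)$ with probability $w_x/(n-\alpha)$, where $w_x=1-\alpha$ if $x$ is an external edge, $w_x=\gamma$ if $x$ is an internal edge, $w_x=(c_x-1)\alpha-\gamma$ if $x$ is a branch point with $c_x$ children. ($T_2$ is the unique element of $\mathbb{T}_{[2]}$, also if $\alpha=1$.) Semi-planar trees. $\hat{\mathbb{T}}_A$ is the set of pairs $\hat t=(t,(\sigma_v)_v)$ with $t\in\mathbb{T}_A$ and, for each branch point $v$ of $t$ with $c_v$ children, $\sigma_v$ a permutation of $[c_v-2]$ (trivial if $c_v=2$). Meaning: enumerate the subtrees of $v$ by increasing least leaf label; the first and second are the two leftmost subtrees of $v$ (with no order distinguished between these two) and, for $3\le l\le c_v$, the $l$th subtree is the $\sigma_v(l-2)$-th from the left among the remaining $c_v-2$ subtrees. $\hat\pi(t,\sigma)=t$. Semi-planar insertion. Inserting leaf $j$ (larger than all labels present) at an edge (location $l=0$) creates a new branch point with two children. Inserting $j$ at a branch point $v$ with $c$ children in location $l\in[c-1]$: leaf $j$ becomes the $l$th from the left among the $c-1$ subtrees of $v$ other than the two leftmost ones, the relative order of the other subtrees being unchanged. Semi-planar growth step from $\hat{\mathbb{T}}_{[n]}$ to $\hat{\mathbb{T}}_{[n+1]}$: leaf $n+1$ is inserted at $x$ in location $l$ with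 probability $w_{x,l}/(n-\alpha)$, where $w_{x,0}=1-\alpha$ for external edges $x$, $w_{x,0}=\gamma$ for internal edges $x$, and for a branch point $x$ with $c_x$ children $w_{x,l}=\alpha$ for $l\in[c_x-2]$ and $w_{x,c_x-1}=\alpha-\gamma$ (the step from $n=1$ is the unique possible one, also if $\alpha=1$). Semi-planar $(\alpha,\gamma)$-chain on $\hat{\mathbb{T}}_{[n]}$, with transition kernel $\hat K_n$. For $n=1$ it is constant. For $n\ge2$ the transition from $\hat t$ is as follows. Select $i$ uniformly from $[n]$. Let $v$ be the parent of leaf $i$, $c_v$ its number of children, $l_i$ the rank of $i$ among the least leaf labels of the $c_v$ subtrees of $v$. Let $a$ be the least leaf label in the first spinal bush on the ancestral line from $i$. Let $b$ be: if $c_v=2$, the least leaf label in the second spinal bush on the ancestral line from $i$ ($b=0$ if there is none); if $c_v>2$ and $l_i\le2$, the least leaf label in the first subtree of $v$ not containing $a$ to the right of leaf $i$ (i.e. the third subtree of $v$ from the left); if $c_v>2$ and $l_i>2$, the least leaf label in the first subtree of $v$ not containing $a$ to the left of leaf $i$. (For these purposes, order the two leftmost subtrees by least label.) Put $\tilde\imath=\max\{i,a,b\}$. Swap the labels $i$ and $\tilde\imath$, leaving all positions (the left-to-right arrangement at every branch point) unchanged; delete the leaf now labelled $\tilde\imath$, keeping the relative left-to-right order of all remaining subtrees; relabel $\tilde\imath+1,\dots,n$ by $\tilde\imath,\dots,n-1$ increasingly. The result is again a semi-planar tree (element of $\hat{\mathbb{T}}_{[n-1]}$). Finally insert leaf $n$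 by the semi-planar growth step from $\hat{\mathbb{T}}_{[n-1]}$ to $\hat{\mathbb{T}}_{[n]}$. Kernel $\hat\Pi_n$. For $L\ge0$ and $\theta\ge0$ let $p^L_{\alpha,\theta}$ be the following law on permutations $\sigma$ of $[L]$: tables $1,\dots,L$ are placed one after another in a row; given the arrangement of the first $k\ge1$ tables, table $k+1$ is placed leftmost with probability $\frac{\alpha}{k\alpha+\theta}$, in each of the $k-1$ spaces between neighbouring tables with probability $\frac{\alpha}{k\alpha+\theta}$, and rightmost with probability $\frac{\theta}{k\alpha+\theta}$; $\sigma(j)$ is the final position from the left of table $j$. (If $\alpha=\theta=0$, read these as $\frac1k,\frac1k,0$.) For $t\in\mathbb{T}_{[n]}$, $\hat\Pi_n(t,\{(t,\sigma)\})=\prod_vp^{c_v-2}_{\alpha,\alpha-\gamma}(\sigma_v)$, the product over branch points $v$ of $t$ with $c_v$ children. (This is the conditional law of the $n$th step $\hat T_n$ of the semi-planar growth process given $\hat\pi(\hat T_n)=t$.) The $(\alpha,\gamma)$-chain on $\mathbb{T}_{[n]}$ is the Markov chain with kernel $K_n=\hat\Pi_n\hat K_n\hat\pi$: from $t$, sample $\hat t$ from $\hat\Pi_n(t,\cdot)$, make one transition of $\hat K_n$, and apply $\hat\pi$. *)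

theory Defs
  imports
    "HOL-Probability.Probability"
    "HOL-Library.FSet"
    "HOL-Combinatorics.Multiset_Permutations"
begin

section \<open>Non-planar trees\<close>

text \<open>
  The root (the extra vertex of degree 1) and the edge below it are implicit.  Every other vertex is
  identified with the subtree above it, and every edge with the subtree above its upper
  end point.  The children of a branch point form a finite set; since distinct subtrees of a
  well-formed tree carry distinct sets of labels, equality of such terms is equality up to label- and
  root-preserving isomorphism.
\<close>

datatype (labels: 'a) tree = Leaf 'a | Branch "'a tree fset"

primrec subtrees :: "'a tree \<Rightarrow> 'a tree set" where
  "subtrees (Leaf i) = {Leaf i}"
| "subtrees (Branch cs) = insert (Branch cs) (\<Union> (fset (subtrees |`| cs)))"

definition branch_points :: "'a tree \<Rightarrow> 'a tree fset set" where
  "branch_points t = {cs. Branch cs \<in> subtrees t}"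

definition trees :: "nat set \<Rightarrow> nat tree set" where
  "trees A = {t. labels t = A \<and>
     (\<forall>cs \<in> branch_points t. 2 \<le> fcard cs \<and>
        (\<forall>c \<in> fset cs. \<forall>d \<in> fset cs. c \<noteq> d \<longrightarrow> labels c \<inter> labels d = {}))}"

text \<open>The elements of \<open>ins(t)\<close>: \<open>Edge u\<close> is the edge leading up to the subtree \<open>u\<close>, which is
  external iff \<open>u\<close> is a leaf.\<close>

datatype site = Edge "nat tree" | Vertex "nat tree fset"

definition sites :: "nat tree \<Rightarrow> site set" where
  "sites t = Edge ` subtrees t \<union> Vertex ` branch_points t"

primrec replace :: "'a tree \<Rightarrow> 'a tree \<Rightarrow> 'a tree \<Rightarrow> 'a tree" where
  "replace u u' (Leaf i) = (if Leaf i = u then u' else Leaf i)"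
| "replace u u' (Branch cs) =
     (if Branch cs = u then u' else Branch (replace u u' |`| cs))"

fun insert_leaf :: "nat \<Rightarrow> site \<Rightarrow> nat tree \<Rightarrow> nat tree" where
  "insert_leaf j (Edge u) t = replace u (Branch {|u, Leaf j|}) t"
| "insert_leaf j (Vertex cs) t = replace (Branch cs) (Branch (finsert (Leaf j) cs)) t"

fun weight :: "real \<Rightarrow> real \<Rightarrow> site \<Rightarrow> real" where
  "weight \<alpha> \<gamma> (Edge (Leaf i)) = 1 - \<alpha>"
| "weight \<alpha> \<gamma> (Edge (Branch cs)) = \<gamma>"
| "weight \<alpha> \<gamma> (Vertex cs) = (real (fcard cs) - 1) * \<alpha> - \<gamma>"

definition growth_step :: "real \<Rightarrow> real \<Rightarrow> nat \<Rightarrow> nat tree \<Rightarrow> nat tree \<Rightarrow> real" where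
  "growth_step \<alpha> \<gamma> n t t' =
     (if n = 1 then of_bool (t' = insert_leaf 2 (Edge t) t)
      else \<Sum>x | x \<in> sites t \<and> insert_leaf (n + 1) x t = t'. weight \<alpha> \<gamma> x / (real n - \<alpha>))"

text \<open>The law of \<open>T\<^sub>n\<close>; index 0 is a dummy.\<close>

fun growth_law :: "real \<Rightarrow> real \<Rightarrow> nat \<Rightarrow> nat tree \<Rightarrow> real" where
  "growth_law \<alpha> \<gamma> 0 t = 0"
| "growth_law \<alpha> \<gamma> (Suc 0) t = of_bool (t = Leaf 1)"
| "growth_law \<alpha> \<gamma> (Suc (Suc n)) t =
     (\<Sum>s \<in> trees {1..Suc n}. growth_law \<alpha> \<gamma> (Suc n) s * growth_step \<alpha> \<gamma> (Suc n) s t)"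


section \<open>Semi-planar trees\<close>

text \<open>
  A pair \<open>(t, (\<sigma>\<^sub>v)\<^sub>v)\<close> is represented by its drawing: the subtrees of each branch point are listed from
  left to right, where the two leftmost subtrees, between which no order is distinguished, are put in
  increasing order of their least labels.  The permutation \<open>\<sigma>\<^sub>v\<close> is recovered by \<open>sigma\<close>, and
  \<open>bij_betw_to_pair\<close> below shows that drawings and pairs are in bijection.
\<close>

datatype (plabels: 'a) ptree = PLeaf 'a | PBranch "'a ptree list"

primrec psubtrees :: "'a ptree \<Rightarrow> 'a ptree set" where
  "psubtrees (PLeaf i) = {PLeaf i}"
| "psubtrees (PBranch ss) = insert (PBranch ss) (\<Union> (set (map psubtrees ss)))"

definition pbranch_points :: "'a ptree \<Rightarrow> 'a ptree list set" where
  "pbranch_points s = {ss. PBranch ss \<in> psubtrees s}"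

primrec proj :: "'a ptree \<Rightarrow> 'a tree" where
  "proj (PLeaf i) = Leaf i"
| "proj (PBranch ss) = Branch (fset_of_list (map proj ss))"

definition least :: "nat ptree \<Rightarrow> nat" where
  "least u = Min (plabels u)"

definition semiplanar :: "nat set \<Rightarrow> nat ptree set" where
  "semiplanar A = {s. proj s \<in> trees A \<and>
     (\<forall>ss \<in> pbranch_points s. distinct (map least ss) \<and>
        least (ss ! 0) < least (ss ! 1) \<and>
        (\<forall>k \<in> {2..<length ss}. least (ss ! 1) < least (ss ! k)))}"

text \<open>\<open>sigma ss\<close> is \<open>\<sigma>\<^sub>v\<close> for the branch point \<open>v\<close> with subtrees \<open>ss\<close>.  The \<open>k\<close>-th subtree from the
  left among those other than the two leftmost ones is \<open>ss ! (k + 1)\<close>, and the least label of the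
  \<open>(j + 2)\<close>-th subtree in the enumeration by least labels is \<open>sort (map least ss) ! (j + 1)\<close>.\<close>

definition sigma :: "nat ptree list \<Rightarrow> nat \<Rightarrow> nat" where
  "sigma ss j =
     (if j \<in> {1..length ss - 2}
      then THE k. k \<in> {1..length ss - 2} \<and> least (ss ! (k + 1)) = sort (map least ss) ! (j + 1)
      else j)"

definition semiplanar_pairs :: "nat set \<Rightarrow> (nat tree \<times> (nat tree fset \<Rightarrow> nat \<Rightarrow> nat)) set" where
  "semiplanar_pairs A = {(t, \<sigma>). t \<in> trees A \<and>
     (\<forall>cs \<in> branch_points t. \<sigma> cs permutes {1..fcard cs - 2}) \<and>
     (\<forall>cs. cs \<notin> branch_points t \<longrightarrow> \<sigma> cs = id)}"

definition to_pair :: "nat ptree \<Rightarrow> nat tree \<times> (nat tree fset \<Rightarrow> nat \<Rightarrow> nat)" where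
  "to_pair s = (proj s, \<lambda>cs. if cs \<in> branch_points (proj s)
     then sigma (THE ss. ss \<in> pbranch_points s \<and> fset_of_list (map proj ss) = cs) else id)"

subsection \<open>Drawings and pairs are in bijection\<close>

lemma labels_proj: "labels (proj s) = plabels s"
  by (induction s) (auto simp: fset_of_list.rep_eq)

lemma finite_plabels: "finite (plabels s)"
  by (induction s) auto

lemma subtrees_proj: "subtrees (proj s) = proj ` psubtrees s"
  by (induction s) (auto simp: fset_of_list.rep_eq)

lemma branch_points_proj:
  "branch_points (proj s) = (\<lambda>ss. fset_of_list (map proj ss)) ` pbranch_points s"
proof -
  have "Branch cs \<in> proj ` psubtrees s \<longleftrightarrow>
      (\<exists>ss. PBranch ss \<in> psubtrees s \<and> cs = fset_of_list (map proj ss))" for cs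
  proof
    assume "Branch cs \<in> proj ` psubtrees s"
    then obtain u where u: "u \<in> psubtrees s" "Branch cs = proj u" by auto
    then show "\<exists>ss. PBranch ss \<in> psubtrees s \<and> cs = fset_of_list (map proj ss)"
      by (cases u) auto
  next
    assume "\<exists>ss. PBranch ss \<in> psubtrees s \<and> cs = fset_of_list (map proj ss)"
    then obtain ss where "PBranch ss \<in> psubtrees s" "cs = fset_of_list (map proj ss)" by auto
    then show "Branch cs \<in> proj ` psubtrees s"
      by (intro image_eqI[of _ _ "PBranch ss"]) auto
  qed
  then show ?thesis
    by (auto simp: branch_points_def pbranch_points_def subtrees_proj)
qed

lemma branch_points_Branch:
  "branch_points (Branch cs) = insert cs (\<Union>c \<in> fset cs. branch_points c)"
  by (auto simp: branch_points_def)

lemma pbranch_points_PBranch: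
  "pbranch_points (PBranch ss) = insert ss (\<Union>u \<in> set ss. pbranch_points u)"
  by (auto simp: pbranch_points_def)

lemma branch_points_Leaf: "branch_points (Leaf i) = {}"
  by (auto simp: branch_points_def)

lemma pbranch_points_PLeaf: "pbranch_points (PLeaf i) = {}"
  by (auto simp: pbranch_points_def)

lemma semiplanar_child:
  assumes "PBranch ss \<in> semiplanar A" and "u \<in> set ss"
  shows "u \<in> semiplanar (plabels u)"
proof -
  have "branch_points (proj u) \<subseteq> branch_points (proj (PBranch ss))"
    using assms(2) by (auto simp: branch_points_Branch fset_of_list.rep_eq)
  moreover have "pbranch_points u \<subseteq> pbranch_points (PBranch ss)"
    using assms(2) by (auto simp: pbranch_points_PBranch)
  ultimately show ?thesis
    using assms(1) unfolding semiplanar_def trees_def mem_Collect_eq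
    by (metis (no_types, lifting) labels_proj subset_iff)
qed

lemma trees_child:
  assumes "Branch cs \<in> trees A" and "c \<in> fset cs"
  shows "c \<in> trees (labels c)"
  using assms by (auto simp: trees_def branch_points_Branch)

lemma trees_labels: "t \<in> trees A \<Longrightarrow> finite A \<and> A \<noteq> {}"
proof (induction t arbitrary: A)
  case (Leaf x)
  then show ?case by (auto simp: trees_def)
next
  case (Branch cs)
  have c: "finite (labels c) \<and> labels c \<noteq> {}" if "c \<in> fset cs" for c
    using Branch.IH[OF that trees_child[OF Branch.prems that]] .
  have "fset cs \<noteq> {}"
    using Branch.prems by (auto simp: trees_def branch_points_Branch fcard.rep_eq)
  moreover have "A = (\<Union>c \<in> fset cs. labels c)"
    using Branch.prems by (auto simp: trees_def)
  ultimately show ?case using c by auto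
qed

lemma semiplanar_top:
  assumes "PBranch ss \<in> semiplanar A"
  shows "distinct (map least ss)" "least (ss ! 0) < least (ss ! 1)"
    "\<And>k. 2 \<le> k \<Longrightarrow> k < length ss \<Longrightarrow> least (ss ! 1) < least (ss ! k)"
    "2 \<le> length ss" "fcard (fset_of_list (map proj ss)) = length ss"
    "\<And>u u'. u \<in> set ss \<Longrightarrow> u' \<in> set ss \<Longrightarrow> u \<noteq> u' \<Longrightarrow> plabels u \<inter> plabels u' = {}"
    "\<And>u. u \<in> set ss \<Longrightarrow> plabels u \<noteq> {}"
proof -
  have b: "ss \<in> pbranch_points (PBranch ss)" by (simp add: pbranch_points_PBranch)
  show d: "distinct (map least ss)" and "least (ss ! 0) < least (ss ! 1)"
    "\<And>k. 2 \<le> k \<Longrightarrow> k < length ss \<Longrightarrow> least (ss ! 1) < least (ss ! k)"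
    using assms b by (auto simp: semiplanar_def)
  have inj: "inj_on proj (set ss)"
  proof (rule inj_onI)
    fix u w assume "u \<in> set ss" "w \<in> set ss" "proj u = proj w"
    then have "least u = least w" by (metis labels_proj least_def)
    then show "u = w" using d \<open>u \<in> set ss\<close> \<open>w \<in> set ss\<close> by (auto simp: distinct_map inj_on_def)
  qed
  have ds: "distinct ss" using d by (simp add: distinct_map)
  show l: "fcard (fset_of_list (map proj ss)) = length ss"
    using ds inj by (simp add: fcard.rep_eq fset_of_list.rep_eq card_image distinct_card)
  have tr: "Branch (fset_of_list (map proj ss)) \<in> trees A"
    using assms by (simp add: semiplanar_def)
  show "2 \<le> length ss" using tr l by (auto simp: trees_def branch_points_Branch)
  show "plabels u \<inter> plabels u' = {}" if "u \<in> set ss" "u' \<in> set ss" "u \<noteq> u'" for u u'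
  proof -
    have "proj u \<noteq> proj u'" using inj that by (auto simp: inj_on_def)
    then have "labels (proj u) \<inter> labels (proj u') = {}"
      using tr that by (auto simp: trees_def branch_points_Branch fset_of_list.rep_eq)
    then show ?thesis by (simp add: labels_proj)
  qed
  show "plabels u \<noteq> {}" if "u \<in> set ss" for u
    using semiplanar_child[OF assms that] trees_labels by (auto simp: semiplanar_def)
qed

lemma plabels_subtree: "u \<in> psubtrees s \<Longrightarrow> plabels u \<subseteq> plabels s"
  by (induction s) auto

lemma semiplanar_subtree:
  "s \<in> semiplanar A \<Longrightarrow> u \<in> psubtrees s \<Longrightarrow> u \<in> semiplanar (plabels u)"
proof (induction s arbitrary: A)
  case (PLeaf i)
  then show ?case by (auto simp: semiplanar_def trees_def)
next
  case (PBranch ss)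
  show ?case
  proof (cases "u = PBranch ss")
    case True
    then show ?thesis using PBranch.prems(1) by (auto simp: semiplanar_def trees_def simp flip: labels_proj)
  next
    case False
    then obtain w where "w \<in> set ss" "u \<in> psubtrees w" using PBranch.prems(2) by auto
    then show ?thesis using PBranch.IH semiplanar_child[OF PBranch.prems(1)] by blast
  qed
qed

lemma semiplanar_labels: "s \<in> semiplanar A \<Longrightarrow> plabels s = A"
  by (auto simp: semiplanar_def trees_def simp flip: labels_proj)

lemma semiplanar_nonempty: "s \<in> semiplanar A \<Longrightarrow> plabels s \<noteq> {}"
  using trees_labels[of "proj s" A] semiplanar_labels[of s A] by (simp add: semiplanar_def)

lemma strict_child_labels:
  assumes "PBranch ss \<in> semiplanar A" and "w \<in> set ss"
  shows "plabels w \<noteq> plabels (PBranch ss)"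
proof -
  have "\<exists>w' \<in> set ss. w' \<noteq> w"
  proof -
    have "ss ! 0 \<noteq> ss ! 1" using semiplanar_top(2)[OF assms(1)] by auto
    moreover have "ss ! 0 \<in> set ss" "ss ! 1 \<in> set ss"
      using semiplanar_top(4)[OF assms(1)] by (auto intro!: nth_mem)
    ultimately show ?thesis by metis
  qed
  then obtain w' where "w' \<in> set ss" "w' \<noteq> w" by auto
  then have "plabels w' \<inter> plabels w = {}" "plabels w' \<noteq> {}"
    using semiplanar_top(6,7)[OF assms(1)] assms(2) by auto
  then show ?thesis using \<open>w' \<in> set ss\<close> by auto
qed

lemma psubtrees_eqI:
  "s \<in> semiplanar A \<Longrightarrow> u \<in> psubtrees s \<Longrightarrow> u' \<in> psubtrees s \<Longrightarrow> plabels u = plabels u' \<Longrightarrow> u = u'"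
proof (induction s arbitrary: A)
  case (PLeaf i)
  then show ?case by auto
next
  case (PBranch ss)
  have sub: "plabels z \<subseteq> plabels w \<and> plabels z \<noteq> {} \<and> plabels z \<noteq> plabels (PBranch ss)"
    if "w \<in> set ss" "z \<in> psubtrees w" for w z
  proof -
    have "z \<in> semiplanar (plabels z)"
      using semiplanar_subtree[OF semiplanar_child[OF PBranch.prems(1) that(1)] that(2)] .
    moreover have "plabels z \<subseteq> plabels w" by (rule plabels_subtree[OF that(2)])
    moreover have "plabels w \<subset> plabels (PBranch ss)"
      using strict_child_labels[OF PBranch.prems(1) that(1)] that(1) by auto
    ultimately show ?thesis using semiplanar_nonempty by blast
  qed
  show ?case
  proof (cases "u = PBranch ss \<or> u' = PBranch ss")
    case True
    have "z = PBranch ss" if z: "z \<in> psubtrees (PBranch ss)" "plabels z = plabels (PBranch ss)" for z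
    proof (rule ccontr)
      assume "z \<noteq> PBranch ss"
      then obtain w where "w \<in> set ss" "z \<in> psubtrees w" using z(1) by auto
      then show False using sub z(2) by blast
    qed
    then show ?thesis using True PBranch.prems(2-4) by metis
  next
    case False
    then obtain w w' where w: "w \<in> set ss" "u \<in> psubtrees w" "w' \<in> set ss" "u' \<in> psubtrees w'"
      using PBranch.prems(2,3) by auto
    have "w = w'"
    proof (rule ccontr)
      assume "w \<noteq> w'"
      then have "plabels w \<inter> plabels w' = {}"
        using semiplanar_top(6)[OF PBranch.prems(1)] w by auto
      then show False using sub[OF w(1,2)] sub[OF w(3,4)] PBranch.prems(4) by auto
    qed
    then show ?thesis using PBranch.IH[OF w(1) semiplanar_child[OF PBranch.prems(1) w(1)]] w PBranch.prems(4)
      by auto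
  qed
qed

lemma pbranch_points_eqI:
  assumes "s \<in> semiplanar A" "ss \<in> pbranch_points s" "ss' \<in> pbranch_points s"
    and "fset_of_list (map proj ss) = fset_of_list (map proj ss')"
  shows "ss = ss'"
proof -
  have "proj (PBranch ss) = proj (PBranch ss')" using assms(4) by simp
  then have "plabels (PBranch ss) = plabels (PBranch ss')" by (metis labels_proj)
  then show ?thesis
    using psubtrees_eqI[OF assms(1), of "PBranch ss" "PBranch ss'"] assms(2,3)
    by (simp add: pbranch_points_def)
qed

text \<open>The list of least labels from left to right, in terms of the sorted list and \<open>sigma\<close>.\<close>

lemma sorted_first_two:
  fixes xs :: "nat list"
  assumes "2 \<le> length xs" "xs ! 0 < xs ! 1" "\<And>k. 2 \<le> k \<Longrightarrow> k < length xs \<Longrightarrow> xs ! 1 < xs ! k"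
  shows "sort xs = xs ! 0 # xs ! 1 # sort (drop 2 xs)"
proof -
  obtain a b ys where xs: "xs = a # b # ys"
    using assms(1) by (metis One_nat_def Suc_1 Suc_le_length_iff)
  have y: "\<forall>y \<in> set ys. b < y"
  proof
    fix y assume "y \<in> set ys"
    then obtain k where "k < length ys" "y = ys ! k" by (metis in_set_conv_nth)
    then show "b < y" using assms(3)[of "k + 2"] xs by simp
  qed
  have ab: "a < b" using assms(2) xs by simp
  have "sorted (a # b # sort ys)" using y ab by fastforce
  then have "sort (a # b # ys) = a # b # sort ys"
    by (intro properties_for_sort) auto
  then show ?thesis using xs by simp
qed

lemma sort_least:
  assumes l: "2 \<le> length ss" and f: "least (ss ! 0) < least (ss ! 1)"
    "\<And>k. 2 \<le> k \<Longrightarrow> k < length ss \<Longrightarrow> least (ss ! 1) < least (ss ! k)"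
  shows "sort (map least ss) = least (ss ! 0) # least (ss ! 1) # sort (drop 2 (map least ss))"
proof -
  let ?xs = "map least ss"
  have 1: "0 < length ss" "1 < length ss" using l by auto
  have "sort ?xs = ?xs ! 0 # ?xs ! 1 # sort (drop 2 ?xs)"
  proof (intro sorted_first_two)
    show "?xs ! 0 < ?xs ! 1" using f(1) 1 by (simp only: nth_map)
    show "?xs ! 1 < ?xs ! k" if "2 \<le> k" "k < length ?xs" for k
      using f(2)[OF that(1)] that(2) 1 by (simp only: nth_map length_map)
  qed (use l in simp)
  then show ?thesis using 1 by (simp only: nth_map)
qed

lemma sigma_spec:
  assumes d: "distinct (map least ss)" and l: "2 \<le> length ss"
    and f: "least (ss ! 0) < least (ss ! 1)"
      "\<And>k. 2 \<le> k \<Longrightarrow> k < length ss \<Longrightarrow> least (ss ! 1) < least (ss ! k)"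
  shows "sigma ss permutes {1..length ss - 2}"
    and "\<And>j. j \<in> {1..length ss - 2} \<Longrightarrow>
      least (ss ! (sigma ss j + 1)) = sort (map least ss) ! (j + 1)"
    and "\<And>j k. j \<in> {1..length ss - 2} \<Longrightarrow> k \<in> {1..length ss - 2} \<Longrightarrow>
      least (ss ! (k + 1)) = sort (map least ss) ! (j + 1) \<Longrightarrow> sigma ss j = k"
proof -
  let ?L = "length ss - 2" and ?xs = "map least ss"
  have srt: "sort ?xs = least (ss ! 0) # least (ss ! 1) # sort (drop 2 ?xs)"
    using sort_least[OF l f] .
  have ex1: "\<exists>!k. k \<in> {1..?L} \<and> least (ss ! (k + 1)) = sort ?xs ! (j + 1)"
    if j: "j \<in> {1..?L}" for j
  proof -
    have "sort ?xs ! (j + 1) = sort (drop 2 ?xs) ! (j - 1)"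
      using srt j by (auto simp: nth_Cons split: nat.splits)
    also have "\<dots> \<in> set (sort (drop 2 ?xs))" using j by (intro nth_mem) auto
    finally have "sort ?xs ! (j + 1) \<in> set (drop 2 ?xs)" by simp
    then obtain i where i: "i < length (drop 2 ?xs)" "drop 2 ?xs ! i = sort ?xs ! (j + 1)"
      by (metis in_set_conv_nth)
    have 1: "i + 1 \<in> {1..?L}" "least (ss ! (i + 1 + 1)) = sort ?xs ! (j + 1)"
      using i by auto
    show ?thesis
    proof (rule ex1I[of _ "i + 1"])
      show "i + 1 \<in> {1..?L} \<and> least (ss ! (i + 1 + 1)) = sort ?xs ! (j + 1)" using 1 by blast
      fix k assume k: "k \<in> {1..?L} \<and> least (ss ! (k + 1)) = sort ?xs ! (j + 1)"
      then have "?xs ! (k + 1) = ?xs ! (i + 1 + 1)" "k + 1 < length ?xs" "i + 1 + 1 < length ?xs"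
        using 1 i(1) by auto
      then show "k = i + 1" using d nth_eq_iff_index_eq by (metis add_right_cancel)
    qed
  qed
  have sp: "sigma ss j \<in> {1..?L} \<and> least (ss ! (sigma ss j + 1)) = sort ?xs ! (j + 1)"
    if "j \<in> {1..?L}" for j
    using theI'[OF ex1[OF that]] that unfolding sigma_def by simp
  show s2: "least (ss ! (sigma ss j + 1)) = sort ?xs ! (j + 1)" if "j \<in> {1..?L}" for j
    using sp that by blast
  show "sigma ss j = k" if "j \<in> {1..?L}" "k \<in> {1..?L}"
    "least (ss ! (k + 1)) = sort ?xs ! (j + 1)" for j k
    using ex1[OF that(1)] sp[OF that(1)] that by blast
  have "inj_on (sigma ss) {1..?L}"
  proof (rule inj_onI)
    fix i j assume i: "i \<in> {1..?L}" and j: "j \<in> {1..?L}" and "sigma ss i = sigma ss j"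
    then have "sort ?xs ! (i + 1) = sort ?xs ! (j + 1)" using sp by metis
    moreover have "distinct (sort ?xs)" using d by simp
    ultimately have "i + 1 = j + 1"
      using i j by (subst (asm) nth_eq_iff_index_eq) auto
    then show "i = j" by simp
  qed
  moreover have "sigma ss ` {1..?L} \<subseteq> {1..?L}" using sp by blast
  ultimately have "bij_betw (sigma ss) {1..?L} {1..?L}"
    by (simp add: bij_betw_def endo_inj_surj)
  then show "sigma ss permutes {1..?L}"
    by (intro bij_imp_permutes) (auto simp: sigma_def)
qed

lemma drawing_eqI:
  "s \<in> semiplanar A \<Longrightarrow> s' \<in> semiplanar A' \<Longrightarrow> proj s = proj s' \<Longrightarrow>
   (\<And>ss ss'. ss \<in> pbranch_points s \<Longrightarrow> ss' \<in> pbranch_points s' \<Longrightarrow>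
     fset_of_list (map proj ss) = fset_of_list (map proj ss') \<Longrightarrow> sigma ss = sigma ss') \<Longrightarrow> s = s'"
proof (induction s arbitrary: s' A A')
  case (PLeaf i)
  then show ?case by (cases s') auto
next
  case (PBranch ss)
  obtain ss' where s': "s' = PBranch ss'" using PBranch.prems(3) by (cases s') auto
  have P: "PBranch ss \<in> semiplanar A" and P': "PBranch ss' \<in> semiplanar A'"
    using PBranch.prems(1,2) s' by auto
  have fs: "fset_of_list (map proj ss) = fset_of_list (map proj ss')"
    using PBranch.prems(3) s' by simp
  have len: "length ss = length ss'"
    using fs semiplanar_top(5)[OF P] semiplanar_top(5)[OF P'] by simp
  have sig: "sigma ss = sigma ss'"
    using PBranch.prems(4)[of ss ss'] fs s' by (simp add: pbranch_points_PBranch)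
  have st: "proj ` set ss = proj ` set ss'"
    using arg_cong[OF fs, of fset] by (simp add: fset_of_list.rep_eq)
  have lp: "least u = Min (labels (proj u))" for u by (simp add: least_def labels_proj)
  have "set (map least ss) = (\<lambda>c. Min (labels c)) ` proj ` set ss"
    by (auto simp: lp image_iff)
  also have "\<dots> = set (map least ss')" unfolding st by (auto simp: lp image_iff)
  finally have sset: "set (map least ss) = set (map least ss')" .
  have srt: "sort (map least ss) = sort (map least ss')"
    using sset semiplanar_top(1)[OF P] semiplanar_top(1)[OF P']
    by (metis distinct_sort set_sort sorted_distinct_set_unique sorted_sort)
  have f: "sort (map least xs) = least (xs ! 0) # least (xs ! 1) # sort (drop 2 (map least xs))"
    if "PBranch xs \<in> semiplanar B" for xs B
    using sort_least[OF semiplanar_top(4,2,3)[OF that]] .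
  have le: "least (ss ! k) = least (ss' ! k)" if k: "k < length ss" for k
  proof -
    consider "k = 0" | "k = 1" | "2 \<le> k" by linarith
    then show ?thesis
    proof cases
      case 1 then show ?thesis using f[OF P] f[OF P'] srt by simp
    next
      case 2 then show ?thesis using f[OF P] f[OF P'] srt by simp
    next
      case 3
      then have "k - 1 \<in> {1..length ss - 2}" using k by auto
      then obtain j where j: "j \<in> {1..length ss - 2}" "sigma ss j = k - 1"
        using permutes_image[OF sigma_spec(1)[OF semiplanar_top(1,4,2,3)[OF P]]] by (metis imageE)
      have "least (ss ! (sigma ss j + 1)) = sort (map least ss) ! (j + 1)"
        using sigma_spec(2)[OF semiplanar_top(1,4,2,3)[OF P]] j(1) by blast
      moreover have "least (ss' ! (sigma ss' j + 1)) = sort (map least ss') ! (j + 1)"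
        using sigma_spec(2)[OF semiplanar_top(1,4,2,3)[OF P']] j(1) len by auto
      ultimately show ?thesis using j(2) sig srt 3 by simp
    qed
  qed
  have pr: "proj (ss ! k) = proj (ss' ! k)" if k: "k < length ss" for k
  proof -
    have "proj (ss ! k) \<in> proj ` set ss'" using st k by (metis imageI nth_mem)
    then obtain m where m: "m < length ss'" "proj (ss ! k) = proj (ss' ! m)"
      by (auto simp: in_set_conv_nth)
    then have "least (ss' ! m) = least (ss' ! k)" using le[OF k] lp by metis
    then have "map least ss' ! m = map least ss' ! k" using m(1) k len by simp
    then have "m = k" using semiplanar_top(1)[OF P'] m(1) k len nth_eq_iff_index_eq by fastforce
    then show ?thesis using m(2) by simp
  qed
  have "ss = ss'"
  proof (rule nth_equalityI[OF len])
    fix k assume k: "k < length ss"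
    have in1: "ss ! k \<in> set ss" and in2: "ss' ! k \<in> set ss'" using k len by auto
    show "ss ! k = ss' ! k"
    proof (rule PBranch.IH[OF in1 semiplanar_child[OF P in1] semiplanar_child[OF P' in2] pr[OF k]])
      fix xs ys assume "xs \<in> pbranch_points (ss ! k)" "ys \<in> pbranch_points (ss' ! k)"
        "fset_of_list (map proj xs) = fset_of_list (map proj ys)"
      then show "sigma xs = sigma ys"
        using PBranch.prems(4)[of xs ys] in1 in2 s' by (auto simp: pbranch_points_PBranch)
    qed
  qed
  then show ?case using s' by simp
qed

lemma drawing_exists:
  "t \<in> trees A \<Longrightarrow> (\<And>cs. cs \<in> branch_points t \<Longrightarrow> \<sigma> cs permutes {1..fcard cs - 2}) \<Longrightarrow>
   \<exists>s \<in> semiplanar A. proj s = t \<and>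
     (\<forall>ss \<in> pbranch_points s. sigma ss = \<sigma> (fset_of_list (map proj ss)))"
proof (induction t arbitrary: A)
  case (Leaf i)
  then show ?case by (intro bexI[of _ "PLeaf i"]) (auto simp: semiplanar_def pbranch_points_PLeaf)
next
  case (Branch cs)
  define good where "good c s \<longleftrightarrow> s \<in> semiplanar (labels c) \<and> proj s = c \<and>
     (\<forall>ss \<in> pbranch_points s. sigma ss = \<sigma> (fset_of_list (map proj ss)))" for c s
  have ex: "\<exists>s. good c s" if c: "c \<in> fset cs" for c
  proof -
    have "\<sigma> ds permutes {1..fcard ds - 2}" if "ds \<in> branch_points c" for ds
      using Branch.prems(2)[of ds] c that by (auto simp: branch_points_Branch)
    then show ?thesis
      using Branch.IH[OF c trees_child[OF Branch.prems(1) c]] unfolding good_def by blast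
  qed
  define d where "d c = (SOME s. good c s)" for c
  have dd: "good c (d c)" if "c \<in> fset cs" for c
    using someI_ex[OF ex[OF that]] by (simp add: d_def)
  have d1: "d c \<in> semiplanar (labels c)" and d2: "proj (d c) = c" if "c \<in> fset cs" for c
    using dd[OF that] by (simp_all add: good_def)
  have d3: "sigma ss = \<sigma> (fset_of_list (map proj ss))"
    if "c \<in> fset cs" "ss \<in> pbranch_points (d c)" for c ss
    using dd[OF that(1)] that(2) by (simp add: good_def)
  note d = d1 d2 d3
  let ?m = "\<lambda>c. Min (labels c)"
  have lab: "finite (labels c)" "labels c \<noteq> {}" if "c \<in> fset cs" for c
    using trees_labels[OF trees_child[OF Branch.prems(1) that]] by simp_all
  have top: "2 \<le> fcard cs \<and>
      (\<forall>c \<in> fset cs. \<forall>c' \<in> fset cs. c \<noteq> c' \<longrightarrow> labels c \<inter> labels c' = {})"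
    using Branch.prems(1) by (simp add: trees_def branch_points_Branch)
  have two: "2 \<le> fcard cs" using top by (rule conjunct1)
  have disj: "labels c \<inter> labels c' = {}" if "c \<in> fset cs" "c' \<in> fset cs" "c \<noteq> c'" for c c'
    using top that by simp
  have minj: "inj_on ?m (fset cs)"
  proof (rule inj_onI, rule ccontr)
    fix c c' assume c: "c \<in> fset cs" "c' \<in> fset cs" "?m c = ?m c'" "c \<noteq> c'"
    have "?m c \<in> labels c" by (rule Min_in[OF lab[OF c(1)]])
    moreover have "?m c' \<in> labels c'" by (rule Min_in[OF lab[OF c(2)]])
    ultimately have "?m c \<in> labels c \<inter> labels c'" using c(3) by simp
    then show False unfolding disj[OF c(1,2,4)] by simp
  qed
  obtain cl0 where cl0: "set cl0 = fset cs" "distinct cl0"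
    using finite_distinct_list[OF finite_fset[of cs]] by blast
  define cl where "cl = sort_key ?m cl0"
  have cl: "set cl = fset cs" "distinct cl" "sorted (map ?m cl)" using cl0 by (auto simp: cl_def)
  have lcl: "length cl = fcard cs" using distinct_card[OF cl(2)] cl(1) by (simp add: fcard.rep_eq)
  have dm: "distinct (map ?m cl)" using cl minj by (simp add: distinct_map)
  have lt: "?m (cl ! i) < ?m (cl ! j)" if "i < j" "j < length cl" for i j
  proof -
    have "?m (cl ! i) \<le> ?m (cl ! j)"
      using sorted_nth_mono[OF cl(3), of i j] that by simp
    moreover have "?m (cl ! i) \<noteq> ?m (cl ! j)"
      using nth_eq_iff_index_eq[OF dm, of i j] that by simp
    ultimately show ?thesis by simp
  qed
  define L where "L = fcard cs - 2"
  have perm: "\<sigma> cs permutes {1..L}"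
    using Branch.prems(2) by (simp add: L_def branch_points_Branch)
  define q where "q k = (if k < 2 then k else inv (\<sigma> cs) (k - 1) + 1)" for k
  have pinv: "inv (\<sigma> cs) permutes {1..L}" using perm by (rule permutes_inv)
  have q2: "2 \<le> q k \<and> q k < fcard cs" if "2 \<le> k" "k < fcard cs" for k
  proof -
    have "k - 1 \<in> {1..L}" using that by (auto simp: L_def)
    then have "inv (\<sigma> cs) (k - 1) \<in> {1..L}" by (subst permutes_in_image[OF pinv])
    then show ?thesis using that by (auto simp: q_def L_def)
  qed
  have qlt: "q k < fcard cs" if "k < fcard cs" for k
    using q2[of k] that by (cases "k < 2") (auto simp: q_def)
  have qiff: "k < 2 \<longleftrightarrow> q k < 2" if "k < fcard cs" for k
  proof (cases "k < 2")
    case True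
    then show ?thesis by (simp add: q_def)
  next
    case False
    then show ?thesis using q2[of k] that by simp
  qed
  have qinj: "inj_on q {..<fcard cs}"
  proof (rule inj_onI)
    fix k k' assume k: "k \<in> {..<fcard cs}" "k' \<in> {..<fcard cs}" and e: "q k = q k'"
    have iff: "k < 2 \<longleftrightarrow> k' < 2" using qiff[of k] qiff[of k'] k e by simp
    show "k = k'"
    proof (cases "k < 2")
      case True
      then show ?thesis using iff e by (simp add: q_def)
    next
      case False
      then have "inv (\<sigma> cs) (k - 1) = inv (\<sigma> cs) (k' - 1)"
        using iff e by (simp add: q_def)
      then have "k - 1 = k' - 1" by (rule injD[OF permutes_inj[OF pinv]])
      then show ?thesis using False iff by linarith
    qed
  qed
  have qsurj: "q ` {..<fcard cs} = {..<fcard cs}"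
    using qinj qlt by (intro endo_inj_surj) auto
  define ss where "ss = map (\<lambda>k. d (cl ! q k)) [0..<fcard cs]"
  have lss: "length ss = fcard cs" by (simp add: ss_def)
  have nss: "ss ! k = d (cl ! q k)" if "k < fcard cs" for k using that by (simp add: ss_def)
  have incs: "cl ! q k \<in> fset cs" if "k < fcard cs" for k using qlt[OF that] lcl cl(1) by (metis nth_mem)
  have "set ss = (\<lambda>i. d (cl ! i)) ` q ` {..<fcard cs}"
    by (simp add: ss_def image_image atLeast0LessThan)
  also have "\<dots> = d ` set cl"
    unfolding qsurj set_conv_nth lcl by (auto simp: image_iff)
  finally have sss: "set ss = d ` fset cs" using cl by simp
  have ld: "least (d c) = ?m c" if "c \<in> fset cs" for c
    using d(2)[OF that] by (metis labels_proj least_def)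
  have lss': "least (ss ! k) = ?m (cl ! q k)" if "k < fcard cs" for k
    using nss[OF that] ld[OF incs[OF that]] by simp
  have pss: "fset_of_list (map proj ss) = cs"
    by (rule fset_inject[THEN iffD1])
       (simp add: fset_of_list.rep_eq sss image_image d(2) cong: image_cong)
  have dss: "distinct (map least ss)"
  proof (subst distinct_conv_nth, intro allI impI)
    fix i j assume "i < length (map least ss)" "j < length (map least ss)" "i \<noteq> j"
    then have ij: "i < fcard cs" "j < fcard cs" "q i \<noteq> q j"
      using qinj lss by (auto simp: inj_on_def)
    then have "?m (cl ! q i) \<noteq> ?m (cl ! q j)"
      using nth_eq_iff_index_eq[OF dm, of "q i" "q j"] qlt lcl by auto
    then show "map least ss ! i \<noteq> map least ss ! j" using lss' ij lss by simp
  qed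
  have f1: "least (ss ! 0) < least (ss ! 1)"
    using lss'[of 0] lss'[of 1] lt[of 0 1] two lcl by (simp add: q_def)
  have f2: "least (ss ! 1) < least (ss ! k)" if "2 \<le> k" "k < length ss" for k
    using lss'[of 1] lss'[of k] lt[of 1 "q k"] q2[of k] two lcl lss that by (simp add: q_def)
  have l2: "2 \<le> length ss" using two lss by simp
  have srt: "sort (map least ss) = map ?m cl"
  proof (rule sorted_distinct_set_unique)
    show "set (sort (map least ss)) = set (map ?m cl)"
      using sss ld cl(1) by (auto simp: image_image)
  qed (use dss dm cl(3) in auto)
  have sig: "sigma ss = \<sigma> cs"
  proof
    fix j
    show "sigma ss j = \<sigma> cs j"
    proof (cases "j \<in> {1..L}")
      case True
      then have k: "\<sigma> cs j \<in> {1..L}" by (subst permutes_in_image[OF perm])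
      have "q (\<sigma> cs j + 1) = j + 1"
        using k permutes_inverses(2)[OF perm] by (auto simp: q_def)
      then have "least (ss ! (\<sigma> cs j + 1)) = sort (map least ss) ! (j + 1)"
        using lss'[of "\<sigma> cs j + 1"] k True srt lcl by (auto simp: L_def)
      then show ?thesis
        using sigma_spec(3)[OF dss l2 f1 f2, of j "\<sigma> cs j"] True k lss by (simp add: L_def)
    next
      case False
      then have "sigma ss j = j" unfolding sigma_def using lss by (auto simp: L_def)
      then show ?thesis using permutes_not_in[OF perm False] by simp
    qed
  qed
  have proj: "proj (PBranch ss) = Branch cs" using pss by simp
  have "PBranch ss \<in> semiplanar A"
    unfolding semiplanar_def
  proof (intro CollectI conjI)
    show "proj (PBranch ss) \<in> trees A" using proj Branch.prems(1) by simp
    show "\<forall>xs \<in> pbranch_points (PBranch ss). distinct (map least xs) \<and>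
        least (xs ! 0) < least (xs ! 1) \<and> (\<forall>k \<in> {2..<length xs}. least (xs ! 1) < least (xs ! k))"
    proof
      fix xs assume "xs \<in> pbranch_points (PBranch ss)"
      then consider "xs = ss" | c where "c \<in> fset cs" "xs \<in> pbranch_points (d c)"
        using sss by (auto simp: pbranch_points_PBranch)
      then show "distinct (map least xs) \<and> least (xs ! 0) < least (xs ! 1) \<and>
          (\<forall>k \<in> {2..<length xs}. least (xs ! 1) < least (xs ! k))"
      proof cases
        case 1
        then show ?thesis using dss f1 f2 by auto
      next
        case 2
        then show ?thesis using d(1)[OF 2(1)] by (auto simp: semiplanar_def)
      qed
    qed
  qed
  moreover have "\<forall>xs \<in> pbranch_points (PBranch ss). sigma xs = \<sigma> (fset_of_list (map proj xs))"
  proof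
    fix xs assume "xs \<in> pbranch_points (PBranch ss)"
    then consider "xs = ss" | c where "c \<in> fset cs" "xs \<in> pbranch_points (d c)"
      using sss by (auto simp: pbranch_points_PBranch)
    then show "sigma xs = \<sigma> (fset_of_list (map proj xs))"
    proof cases
      case 1
      then show ?thesis using sig pss by simp
    next
      case 2
      then show ?thesis using d(3) by blast
    qed
  qed
  ultimately show ?case using proj by blast
qed

lemma to_pair_sigma:
  assumes "s \<in> semiplanar A" and "ss \<in> pbranch_points s"
  shows "snd (to_pair s) (fset_of_list (map proj ss)) = sigma ss"
proof -
  have "(THE xs. xs \<in> pbranch_points s \<and>
      fset_of_list (map proj xs) = fset_of_list (map proj ss)) = ss"
    using assms pbranch_points_eqI[OF assms(1)] by (intro the_equality) auto
  moreover have "fset_of_list (map proj ss) \<in> branch_points (proj s)"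
    using assms(2) by (auto simp: branch_points_proj)
  ultimately show ?thesis by (simp add: to_pair_def)
qed

theorem bij_betw_to_pair: "bij_betw to_pair (semiplanar A) (semiplanar_pairs A)"
  unfolding bij_betw_def
proof
  show "inj_on to_pair (semiplanar A)"
  proof (rule inj_onI)
    fix s s' assume s: "s \<in> semiplanar A" "s' \<in> semiplanar A" "to_pair s = to_pair s'"
    show "s = s'"
    proof (rule drawing_eqI[OF s(1,2)])
      show "proj s = proj s'" using s(3) by (simp add: to_pair_def)
    next
      fix ss ss' assume "ss \<in> pbranch_points s" "ss' \<in> pbranch_points s'"
        "fset_of_list (map proj ss) = fset_of_list (map proj ss')"
      then show "sigma ss = sigma ss'"
        using to_pair_sigma[OF s(1)] to_pair_sigma[OF s(2)] s(3) by metis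
    qed
  qed
next
  show "to_pair ` semiplanar A = semiplanar_pairs A"
  proof (intro equalityI subsetI)
    fix p assume "p \<in> to_pair ` semiplanar A"
    then obtain s where s: "s \<in> semiplanar A" "p = to_pair s" by blast
    have "snd (to_pair s) cs permutes {1..fcard cs - 2}" if cs: "cs \<in> branch_points (proj s)" for cs
    proof -
      obtain ss where ss: "ss \<in> pbranch_points s" "cs = fset_of_list (map proj ss)"
        using cs by (auto simp: branch_points_proj)
      have P: "PBranch ss \<in> semiplanar (plabels (PBranch ss))"
        using semiplanar_subtree[OF s(1) ss(1)[unfolded pbranch_points_def mem_Collect_eq]] .
      show ?thesis
        using sigma_spec(1)[OF semiplanar_top(1,4,2,3)[OF P]] semiplanar_top(5)[OF P]
          to_pair_sigma[OF s(1) ss(1)] ss(2) by simp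
    qed
    then show "p \<in> semiplanar_pairs A"
      using s by (auto simp: semiplanar_pairs_def to_pair_def semiplanar_def)
  next
    fix p assume p: "p \<in> semiplanar_pairs A"
    obtain t \<sigma> where p': "p = (t, \<sigma>)" by (cases p)
    have t: "t \<in> trees A" "\<And>cs. cs \<in> branch_points t \<Longrightarrow> \<sigma> cs permutes {1..fcard cs - 2}"
      "\<And>cs. cs \<notin> branch_points t \<Longrightarrow> \<sigma> cs = id"
      using p p' by (auto simp: semiplanar_pairs_def)
    obtain s where s: "s \<in> semiplanar A" "proj s = t"
      "\<And>ss. ss \<in> pbranch_points s \<Longrightarrow> sigma ss = \<sigma> (fset_of_list (map proj ss))"
      using drawing_exists[OF t(1,2)] by blast
    have "snd (to_pair s) cs = \<sigma> cs" for cs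
    proof (cases "cs \<in> branch_points t")
      case True
      then obtain ss where "ss \<in> pbranch_points s" "cs = fset_of_list (map proj ss)"
        using True[folded s(2)] by (auto simp: branch_points_proj)
      then show ?thesis using to_pair_sigma[OF s(1)] s(3) by simp
    next
      case False
      then show ?thesis using t(3) s(2) by (simp add: to_pair_def)
    qed
    then have "to_pair s = p" using p' s(2) by (auto simp: to_pair_def)
    then show "p \<in> to_pair ` semiplanar A" using s(1) by blast
  qed
qed

section \<open>Semi-planar growth\<close>

text \<open>\<open>PVertex ss l\<close> is location \<open>l\<close> at the branch point with subtrees \<open>ss\<close>.\<close>

datatype psite = PEdge "nat ptree" | PVertex "nat ptree list" nat

definition psites :: "nat ptree \<Rightarrow> psite set" where
  "psites s = PEdge ` psubtrees s \<union>
     {PVertex ss l | ss l. ss \<in> pbranch_points s \<and> l \<in> {1..length ss - 1}}"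

primrec preplace :: "'a ptree \<Rightarrow> 'a ptree \<Rightarrow> 'a ptree \<Rightarrow> 'a ptree" where
  "preplace u u' (PLeaf i) = (if PLeaf i = u then u' else PLeaf i)"
| "preplace u u' (PBranch ss) =
     (if PBranch ss = u then u' else PBranch (map (preplace u u') ss))"

fun pinsert :: "nat \<Rightarrow> psite \<Rightarrow> nat ptree \<Rightarrow> nat ptree" where
  "pinsert j (PEdge u) s = preplace u (PBranch [u, PLeaf j]) s"
| "pinsert j (PVertex ss l) s =
     preplace (PBranch ss) (PBranch (take (l + 1) ss @ PLeaf j # drop (l + 1) ss)) s"

fun pweight :: "real \<Rightarrow> real \<Rightarrow> psite \<Rightarrow> real" where
  "pweight \<alpha> \<gamma> (PEdge (PLeaf i)) = 1 - \<alpha>"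
| "pweight \<alpha> \<gamma> (PEdge (PBranch ss)) = \<gamma>"
| "pweight \<alpha> \<gamma> (PVertex ss l) = (if l \<le> length ss - 2 then \<alpha> else \<alpha> - \<gamma>)"

definition pgrowth_step :: "real \<Rightarrow> real \<Rightarrow> nat \<Rightarrow> nat ptree \<Rightarrow> nat ptree \<Rightarrow> real" where
  "pgrowth_step \<alpha> \<gamma> n s s' =
     (if n = 1 then of_bool (s' = pinsert 2 (PEdge s) s)
      else \<Sum>x | x \<in> psites s \<and> pinsert (n + 1) x s = s'. pweight \<alpha> \<gamma> x / (real n - \<alpha>))"


section \<open>The semi-planar chain\<close>

text \<open>The branch points on the path from leaf \<open>i\<close> to the root, parent of \<open>i\<close> first.\<close>

primrec spine :: "nat \<Rightarrow> nat ptree \<Rightarrow> nat ptree list list" where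
  "spine i (PLeaf j) = []"
| "spine i (PBranch ss) =
     (if i \<in> plabels (PBranch ss) then concat (map (spine i) ss) @ [ss] else [])"

text \<open>The least label in the spinal bush at the branch point with subtrees \<open>ss\<close>.\<close>

definition bush_least :: "nat \<Rightarrow> nat ptree list \<Rightarrow> nat" where
  "bush_least i ss = Min (\<Union>u \<in> {u \<in> set ss. i \<notin> plabels u}. plabels u)"

definition label_a :: "nat \<Rightarrow> nat ptree \<Rightarrow> nat" where
  "label_a i s = bush_least i (spine i s ! 0)"

definition label_b :: "nat \<Rightarrow> nat ptree \<Rightarrow> nat" where
  "label_b i s =
     (let vs = spine i s;
          ss = vs ! 0;
          l = card {u \<in> set ss. least u \<le> i};
          right = tl (dropWhile (\<lambda>u. u \<noteq> PLeaf i) ss);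
          left = rev (takeWhile (\<lambda>u. u \<noteq> PLeaf i) ss);
          first = (\<lambda>us. hd (filter (\<lambda>u. label_a i s \<notin> plabels u) us))
      in if length ss = 2 then (if length vs \<ge> 2 then bush_least i (vs ! 1) else 0)
         else if l \<le> 2 then least (first right)
         else least (first left))"

definition label_tilde :: "nat \<Rightarrow> nat ptree \<Rightarrow> nat" where
  "label_tilde i s = max i (max (label_a i s) (label_b i s))"

text \<open>Only applied to trees with at least two leaves.\<close>

primrec delete_leaf :: "nat \<Rightarrow> nat ptree \<Rightarrow> nat ptree" where
  "delete_leaf j (PLeaf i) = PLeaf i"
| "delete_leaf j (PBranch ss) =
     (case filter (\<lambda>u. u \<noteq> PLeaf j) (map (delete_leaf j) ss) of
        [u] \<Rightarrow> u
      | us \<Rightarrow> PBranch us)"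

text \<open>Restores the convention that the two leftmost subtrees are listed by least label.\<close>

primrec normalise :: "nat ptree \<Rightarrow> nat ptree" where
  "normalise (PLeaf i) = PLeaf i"
| "normalise (PBranch ss) =
     (case map normalise ss of
        u # w # us \<Rightarrow> PBranch (if least w < least u then w # u # us else u # w # us)
      | us \<Rightarrow> PBranch us)"

definition down_step :: "nat \<Rightarrow> nat ptree \<Rightarrow> nat ptree" where
  "down_step i s =
     (let i' = label_tilde i s
      in normalise (map_ptree (\<lambda>k. if i' < k then k - 1 else k)
           (delete_leaf i' (map_ptree (Transposition.transpose i i') s))))"

definition pkernel :: "real \<Rightarrow> real \<Rightarrow> nat \<Rightarrow> nat ptree \<Rightarrow> nat ptree \<Rightarrow> real" where
  "pkernel \<alpha> \<gamma> n s s' =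
     (if n = 1 then of_bool (s' = s)
      else \<Sum>i = 1..n. 1 / real n * pgrowth_step \<alpha> \<gamma> (n - 1) (down_step i s) s')"


section \<open>The kernel from trees to semi-planar trees and the chain on trees\<close>

text \<open>With \<open>k\<close> tables in the row, the probability that the next table is placed with exactly \<open>j\<close> tables
  to its left; \<open>j = 0\<close> is leftmost and \<open>j = k\<close> is rightmost.\<close>

definition seat_prob :: "real \<Rightarrow> real \<Rightarrow> nat \<Rightarrow> nat \<Rightarrow> real" where
  "seat_prob \<alpha> \<theta> k j =
     (if k = 0 then 1
      else if \<alpha> = 0 \<and> \<theta> = 0 then (if j < k then 1 / real k else 0)
      else if j < k then \<alpha> / (real k * \<alpha> + \<theta>) else \<theta> / (real k * \<alpha> + \<theta>))"

text \<open>The law of the row of the first \<open>L\<close> tables, listed from left to right.\<close>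

primrec row_law :: "real \<Rightarrow> real \<Rightarrow> nat \<Rightarrow> nat list \<Rightarrow> real" where
  "row_law \<alpha> \<theta> 0 xs = of_bool (xs = [])"
| "row_law \<alpha> \<theta> (Suc k) xs =
     (\<Sum>ys \<in> permutations_of_set {1..k}. \<Sum>j = 0..k.
        of_bool (xs = take j ys @ Suc k # drop j ys) * row_law \<alpha> \<theta> k ys * seat_prob \<alpha> \<theta> k j)"

text \<open>\<open>\<sigma> j\<close> is the position of table \<open>j\<close>, so the table at position \<open>k\<close> is \<open>\<sigma>\<^sup>-\<^sup>1 k\<close>.\<close>

definition perm_law :: "real \<Rightarrow> real \<Rightarrow> nat \<Rightarrow> (nat \<Rightarrow> nat) \<Rightarrow> real" where
  "perm_law \<alpha> \<theta> L \<sigma> = row_law \<alpha> \<theta> L (map (inv_into {1..L} \<sigma>) [1..<L + 1])"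

definition Pi_kernel :: "real \<Rightarrow> real \<Rightarrow> nat tree \<Rightarrow> nat ptree \<Rightarrow> real" where
  "Pi_kernel \<alpha> \<gamma> t s =
     (if proj s = t
      then \<Prod>ss \<in> pbranch_points s. perm_law \<alpha> (\<alpha> - \<gamma>) (length ss - 2) (sigma ss)
      else 0)"

definition tree_kernel :: "real \<Rightarrow> real \<Rightarrow> nat \<Rightarrow> nat tree \<Rightarrow> nat tree \<Rightarrow> real" where
  "tree_kernel \<alpha> \<gamma> n t t' =
     (\<Sum>s \<in> semiplanar {1..n}. Pi_kernel \<alpha> \<gamma> t s *
        (\<Sum>s' | s' \<in> semiplanar {1..n} \<and> proj s' = t'. pkernel \<alpha> \<gamma> n s s'))"


section \<open>Markov chains on discrete state spaces\<close>

definition markov_chain ::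
  "'w measure \<Rightarrow> 's set \<Rightarrow> ('s \<Rightarrow> real) \<Rightarrow> ('s \<Rightarrow> 's \<Rightarrow> real) \<Rightarrow> (nat \<Rightarrow> 'w \<Rightarrow> 's) \<Rightarrow> bool" where
  "markov_chain M S \<mu> K X \<longleftrightarrow>
     prob_space M \<and>
     (\<forall>m. X m \<in> M \<rightarrow>\<^sub>M count_space S) \<and>
     (\<forall>x \<in> S. measure M {\<omega> \<in> space M. X 0 \<omega> = x} = \<mu> x) \<and>
     (\<forall>m x. \<forall>y \<in> S. (\<forall>k \<le> m. x k \<in> S) \<longrightarrow>
        measure M {\<omega> \<in> space M. \<forall>k \<le> m. X k \<omega> = x k} > 0 \<longrightarrow>
        cond_prob M (\<lambda>\<omega>. X (Suc m) \<omega> = y) (\<lambda>\<omega>. \<forall>k \<le> m. X k \<omega> = x k) = K (x m) y)"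

definition stationary :: "'s set \<Rightarrow> ('s \<Rightarrow> 's \<Rightarrow> real) \<Rightarrow> ('s \<Rightarrow> real) \<Rightarrow> bool" where
  "stationary S K \<mu> \<longleftrightarrow>
     (\<forall>x \<in> S. 0 \<le> \<mu> x) \<and> (\<Sum>x \<in> S. \<mu> x) = 1 \<and> (\<forall>y \<in> S. (\<Sum>x \<in> S. \<mu> x * K x y) = \<mu> y)"

end

theory Submission
  imports Defs
begin

text \<open>
  Write \<open>Up\<close> for the growth step and \<open>Dn\<close> for the deletion step with uniform \<open>i\<close>, so that the chain is \<open>Dn\<close> followed
  by \<open>Up\<close>. Deleting \<open>i\<close> (after swapping it with the label tilde, written \<open>i'\<close>) destroys locations of total weight \<open>1\<close>.
  If the new leaf \<open>n + 1\<close> has been inserted at one of these, then \<open>i' = n + 1\<close> and the deletion undoes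
  the insertion; insertions at all other locations commute with the deletion. Hence \<open>Up\<close> followed by \<open>Dn\<close> is a combination of the
  identity and of the chain one level below, with coefficients that depend on \<open>n\<close> only. By induction on \<open>n\<close>, this yields the stationarity
  of the law of the growth process, the uniqueness of the stationary law, and that both steps map mixtures of the laws \<open>\<Pi>\<^sub>n(t, \<cdot>)\<close> to
  mixtures of such laws. The last property is the intertwining relation under which the projection of the chain is again Markov.
\<close>

section \<open>Inserting a leaf\<close>

text \<open>The labels \<open>a\<close> and \<open>b\<close> are chosen so that the lost weight is
  1: with \<open>i\<close> goes its external edge (\<open>1 - \<alpha>\<close>), together with the
  edge and the only location of a binary parent (\<open>\<gamma>\<close> and
  \<open>\<alpha> - \<gamma>\<close>), or with one location of weight \<alpha> at a larger parent.
  The obstacle to the intertwining is that the label tilde, and with it the relabelling after the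
  deletion, depends on the drawing and not only on the tree. The induction therefore treats the
  deletion restricted to each single value \<open>k\<close> of the label tilde. Locations are
  recorded by label sets instead of positions, because these survive projection and can be followed
  through deletion and relabelling. A mixture of the laws on the fibres is written
  \<open>m (proj s) * W s\<close> with one weight \<open>W\<close> for all trees; what has to be
  shown is that the density remains a function of \<open>proj s\<close>. Growth preserves this form
  since the weight of a branch point is the normalising constant of the seating rule with
  \<open>\<theta> = \<alpha> - \<gamma>\<close>.\<close>

lemma sum_mset_image_sum:
  fixes F :: "'b \<Rightarrow> 'c::comm_monoid_add"
  shows "finite A \<Longrightarrow> (\<Sum>x\<in>#(\<Sum>k\<in>A. M k). F x) = (\<Sum>k\<in>A. \<Sum>x\<in>#M k. F x)"
  by (induction A rule: finite_induct) auto

lemma image_mset_sum: "finite A \<Longrightarrow> image_mset f (\<Sum>k\<in>A. M k) = (\<Sum>k\<in>A. image_mset f (M k))"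
  by (induction A rule: finite_induct) auto

lemma in_sum_mset_iff: "finite A \<Longrightarrow> x \<in># (\<Sum>k\<in>A. M k) \<longleftrightarrow> (\<exists>k\<in>A. x \<in># M k)"
  by (induction A rule: finite_induct) auto

section \<open>Recursive description of semi-planar trees\<close>

abbreviation disj :: "nat ptree list \<Rightarrow> bool" where
  "disj \<equiv> sorted_wrt (\<lambda>u w. plabels u \<inter> plabels w = {})"

text \<open>\<open>ok\<close> makes the tree well formed and \<open>sp\<close> its drawing; they are
  kept apart because arguments on label sets need only \<open>ok\<close>. Disjointness in
  \<open>disj\<close> is between positions, so that a child cannot be listed twice.\<close>

primrec ok :: "nat ptree \<Rightarrow> bool" where
  "ok (PLeaf i) = True"
| "ok (PBranch ss) = (2 \<le> length ss \<and> disj ss \<and> (\<forall>b \<in> set (map ok ss). b))"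

definition ordered :: "nat ptree list \<Rightarrow> bool" where
  "ordered ss \<longleftrightarrow> least (ss ! 0) < least (ss ! 1) \<and> (\<forall>u \<in> set (drop 2 ss). least (ss ! 1) < least u)"

primrec sp :: "nat ptree \<Rightarrow> bool" where
  "sp (PLeaf i) = True"
| "sp (PBranch ss) = (ordered ss \<and> (\<forall>b \<in> set (map sp ss). b))"

lemma two_list: "2 \<le> length ss \<Longrightarrow> \<exists>u w us. ss = u # w # us"
  by (metis One_nat_def Suc_1 Suc_le_length_iff)

lemma plabels_ne: "ok s \<Longrightarrow> plabels s \<noteq> {}"
proof (induction s)
  case (PBranch ss)
  then obtain u where "u \<in> set ss" by (cases ss) auto
  then show ?case using PBranch by auto
qed auto

lemma least_in: "ok s \<Longrightarrow> least s \<in> plabels s"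
  unfolding least_def using plabels_ne finite_plabels by (metis Min_in)

lemma disj_nth: "disj ss \<Longrightarrow> k < length ss \<Longrightarrow> l < length ss \<Longrightarrow> k \<noteq> l \<Longrightarrow> plabels (ss ! k) \<inter> plabels (ss ! l) = {}"
  using sorted_wrt_nth_less[of "\<lambda>u w. plabels u \<inter> plabels w = {}" ss k l]
    sorted_wrt_nth_less[of "\<lambda>u w. plabels u \<inter> plabels w = {}" ss l k]
  by (cases "k < l") auto

lemma disj_distinct_map:
  assumes "disj ss" "\<And>u. u \<in> set ss \<Longrightarrow> ok u" "\<And>u w. u \<in> set ss \<Longrightarrow> w \<in> set ss \<Longrightarrow> f u = f w \<Longrightarrow> plabels u \<inter> plabels w \<noteq> {}"
  shows "distinct (map f ss)"
  unfolding distinct_conv_nth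
proof (intro allI impI)
  fix i j assume ij: "i < length (map f ss)" "j < length (map f ss)" "i \<noteq> j"
  then show "map f ss ! i \<noteq> map f ss ! j"
    using disj_nth[OF assms(1), of i j] assms(3)[of "ss ! i" "ss ! j"] by auto
qed

lemma distinct_least:
  assumes "disj ss" "\<And>u. u \<in> set ss \<Longrightarrow> ok u"
  shows "distinct (map least ss)"
proof (rule disj_distinct_map[OF assms])
  fix u w assume "u \<in> set ss" "w \<in> set ss" "least u = least w"
  then have "least u \<in> plabels u" "least u \<in> plabels w" using assms(2) least_in by metis+
  then show "plabels u \<inter> plabels w \<noteq> {}" by blast
qed

lemma distinct_proj:
  assumes "disj ss" "\<And>u. u \<in> set ss \<Longrightarrow> ok u"
  shows "distinct (map proj ss)"
proof (rule disj_distinct_map[OF assms])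
  fix u w assume "u \<in> set ss" "w \<in> set ss" "proj u = proj w"
  then have "plabels u = plabels w" "plabels u \<noteq> {}" using assms(2) plabels_ne labels_proj by metis+
  then show "plabels u \<inter> plabels w \<noteq> {}" by blast
qed

lemma ok_sub: "ok s \<Longrightarrow> u \<in> psubtrees s \<Longrightarrow> ok u"
  by (induction s) auto

lemma sp_sub: "sp s \<Longrightarrow> u \<in> psubtrees s \<Longrightarrow> sp u"
  by (induction s) auto

lemma ordered_nth: "ordered ss \<longleftrightarrow> least (ss ! 0) < least (ss ! 1) \<and>
        (\<forall>k \<in> {2..<length ss}. least (ss ! 1) < least (ss ! k))"
proof -
  have "set (drop 2 ss) = (!) ss ` {2..<length ss}"
  proof -
    have "set (drop 2 ss) = set (map ((!) ss) [2..<length ss])"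
      by (metis drop_map drop_upt map_nth plus_nat.add_0)
    then show ?thesis by simp
  qed
  then show ?thesis by (auto simp: ordered_def)
qed

text \<open>Replaces the condition on the set of all branch points by structural recursion, the form
  suited to induction over insertions and deletions.\<close>

lemma semiplanar_iff: "s \<in> semiplanar A \<longleftrightarrow> plabels s = A \<and> ok s \<and> sp s"
proof
  assume s: "s \<in> semiplanar A"
  have "s \<in> semiplanar A \<Longrightarrow> ok s \<and> sp s"
  proof (induction s arbitrary: A)
    case (PBranch ss)
    note t = semiplanar_top[OF PBranch.prems]
    have c: "ok u \<and> sp u" if "u \<in> set ss" for u
      using PBranch.IH[OF that semiplanar_child[OF PBranch.prems that]] .
    have "disj ss"
      unfolding sorted_wrt_iff_nth_less
    proof (intro allI impI)
      fix i j assume ij: "i < j" "j < length ss"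
      have "ss ! i \<noteq> ss ! j" using t(1) ij by (auto simp: distinct_map nth_eq_iff_index_eq)
      then show "plabels (ss ! i) \<inter> plabels (ss ! j) = {}" using ij t(6)[of "ss ! i" "ss ! j"] by auto
    qed
    moreover have "ordered ss" using t by (simp add: ordered_nth)
    ultimately show ?case using t c by auto
  qed auto
  then show "plabels s = A \<and> ok s \<and> sp s" using s semiplanar_labels by auto
next
  assume s: "plabels s = A \<and> ok s \<and> sp s"
  have pb: "2 \<le> length ss \<and> disj ss \<and> (\<forall>u\<in>set ss. ok u) \<and> ordered ss" if "ss \<in> pbranch_points s" for ss
    using that ok_sub[of s "PBranch ss"] sp_sub[of s "PBranch ss"] s by (auto simp: pbranch_points_def)
  have "proj s \<in> trees A"
    unfolding trees_def
  proof (intro CollectI conjI ballI)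
    show "labels (proj s) = A" using s by (simp add: labels_proj)
    fix cs assume "cs \<in> branch_points (proj s)"
    then obtain ss where ss: "ss \<in> pbranch_points s" "cs = fset_of_list (map proj ss)"
      by (auto simp: branch_points_proj)
    have "distinct (map proj ss)" using pb[OF ss(1)] by (intro distinct_proj) auto
    then have "fcard cs = length ss"
      unfolding ss(2) fcard.rep_eq fset_of_list.rep_eq by (metis distinct_card length_map)
    then show "2 \<le> fcard cs" using pb[OF ss(1)] by simp
    have "labels (proj u) \<inter> labels (proj w) = {}" if uw: "u \<in> set ss" "w \<in> set ss" "proj u \<noteq> proj w" for u w
    proof -
      obtain i j where "i < length ss" "j < length ss" "u = ss ! i" "w = ss ! j"
        using uw by (metis in_set_conv_nth)
      then show ?thesis using disj_nth[of ss i j] pb[OF ss(1)] uw by (cases "i = j") (auto simp: labels_proj)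
    qed
    then show "c \<noteq> d \<longrightarrow> labels c \<inter> labels d = {}" if "c \<in> fset cs" "d \<in> fset cs" for c d
      using that by (auto simp: ss(2) fset_of_list.rep_eq)
  qed
  moreover have "distinct (map least ss) \<and> least (ss ! 0) < least (ss ! 1) \<and>
        (\<forall>k \<in> {2..<length ss}. least (ss ! 1) < least (ss ! k))" if "ss \<in> pbranch_points s" for ss
    using pb[OF that] ordered_nth[of ss] distinct_least[of ss] by auto
  ultimately show "s \<in> semiplanar A" by (auto simp: semiplanar_def)
qed

text \<open>\<open>E b C\<close> is the edge below the subtree with label set \<open>C\<close>, external if \<open>b\<close>; \<open>V b C c\<close> is a location at the branch point with
  label set \<open>C\<close> and \<open>c\<close> children, the rightmost one if \<open>b\<close>. The other locations at a branch point are not distinguished: they have the same weight.\<close>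

datatype desc = E bool "nat set" | V bool "nat set" nat

text \<open>A multiset, since locations with equal description must be counted separately. The index
  \<open>l\<close> starts at 0: it stands for location \<open>l + 1\<close>, and the new leaf takes
  list position \<open>l + 2\<close>, to the right of the two leftmost subtrees. The detour
  \<open>map (insertions j) ss ! k\<close> is the form that primitive recursion accepts.\<close>

primrec insertions :: "nat \<Rightarrow> nat ptree \<Rightarrow> (desc \<times> nat ptree) multiset" where
  "insertions j (PLeaf i) = {#(E True {i}, PBranch [PLeaf i, PLeaf j])#}"
| "insertions j (PBranch ss) =
     {#(E False (plabels (PBranch ss)), PBranch [PBranch ss, PLeaf j])#}
   + (\<Sum>l<length ss - 1. {#(V (l = length ss - 2) (plabels (PBranch ss)) (length ss),
        PBranch (take (l + 2) ss @ PLeaf j # drop (l + 2) ss))#})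
   + (\<Sum>k<length ss. image_mset (apsnd (\<lambda>u. PBranch (ss[k := u]))) (map (insertions j) ss ! k))"

lemma in_image_apsnd: "(d, s') \<in> apsnd f ` A \<longleftrightarrow> (\<exists>u. (d, u) \<in> A \<and> s' = f u)"
  by (simp add: image_iff Bex_def)

lemma insertions_PBranch:
  "insertions j (PBranch ss) =
     {#(E False (plabels (PBranch ss)), PBranch [PBranch ss, PLeaf j])#}
   + (\<Sum>l<length ss - 1. {#(V (l = length ss - 2) (plabels (PBranch ss)) (length ss),
        PBranch (take (l + 2) ss @ PLeaf j # drop (l + 2) ss))#})
   + (\<Sum>k<length ss. image_mset (apsnd (\<lambda>u. PBranch (ss[k := u]))) (insertions j (ss ! k)))"
  by simp

lemma in_insertions_PBranch:
  "(d, s') \<in># insertions j (PBranch ss) \<longleftrightarrow>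
     (d = E False (plabels (PBranch ss)) \<and> s' = PBranch [PBranch ss, PLeaf j]) \<or>
     (\<exists>l<length ss - 1. d = V (l = length ss - 2) (plabels (PBranch ss)) (length ss) \<and>
        s' = PBranch (take (l + 2) ss @ PLeaf j # drop (l + 2) ss)) \<or>
     (\<exists>k<length ss. \<exists>u. (d, u) \<in># insertions j (ss ! k) \<and> s' = PBranch (ss[k := u]))"
  unfolding insertions_PBranch
  by (auto simp: in_sum_mset_iff in_image_apsnd simp del: ptree.set(2))

text \<open>Isolates the first two children, the only ones that normalisation can exchange.\<close>

lemma insertions_two:
  "insertions j (PBranch (u # w # us)) =
     {#(E False (plabels (PBranch (u # w # us))), PBranch [PBranch (u # w # us), PLeaf j])#}
   + (\<Sum>l\<le>length us. {#(V (l = length us) (plabels (PBranch (u # w # us))) (length us + 2),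
        PBranch (u # w # take l us @ PLeaf j # drop l us))#})
   + image_mset (apsnd (\<lambda>x. PBranch (x # w # us))) (insertions j u)
   + image_mset (apsnd (\<lambda>x. PBranch (u # x # us))) (insertions j w)
   + (\<Sum>k<length us. image_mset (apsnd (\<lambda>x. PBranch (u # w # us[k := x]))) (insertions j (us ! k)))"
proof -
  have "(\<Sum>k<length (u # w # us). image_mset (apsnd (\<lambda>x. PBranch ((u # w # us)[k := x]))) (insertions j ((u # w # us) ! k)))
    = image_mset (apsnd (\<lambda>x. PBranch (x # w # us))) (insertions j u)
   + image_mset (apsnd (\<lambda>x. PBranch (u # x # us))) (insertions j w)
   + (\<Sum>k<length us. image_mset (apsnd (\<lambda>x. PBranch (u # w # us[k := x]))) (insertions j (us ! k)))"
    by (simp add: sum.lessThan_Suc_shift add.assoc del: sum.lessThan_Suc)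
  moreover have "(\<Sum>l<length (u # w # us) - 1. {#(V (l = length (u # w # us) - 2) (plabels (PBranch (u # w # us))) (length (u # w # us)),
        PBranch (take (l + 2) (u # w # us) @ PLeaf j # drop (l + 2) (u # w # us)))#})
    = (\<Sum>l\<le>length us. {#(V (l = length us) (plabels (PBranch (u # w # us))) (length us + 2),
        PBranch (u # w # take l us @ PLeaf j # drop l us))#})"
    by (simp add: lessThan_Suc_atMost del: sum.lessThan_Suc sum.atMost_Suc ptree.set(2))
  ultimately show ?thesis unfolding insertions_PBranch by (simp only: add.assoc)
qed

declare insertions.simps(2) [simp del]

lemma nth_in_plabels: "k < length ss \<Longrightarrow> plabels (ss ! k) \<subseteq> plabels (PBranch ss)"
  by (auto intro: nth_mem)

lemma Union_list_update:
  "k < length ss \<Longrightarrow> plabels u = insert j (plabels (ss ! k)) \<Longrightarrow>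
   plabels (PBranch (ss[k := u])) = insert j (plabels (PBranch ss))"
proof -
  assume k: "k < length ss" and u: "plabels u = insert j (plabels (ss ! k))"
  have "ss[k := u] = take k ss @ u # drop (Suc k) ss" "ss = take k ss @ ss ! k # drop (Suc k) ss"
    using k by (simp_all add: upd_conv_take_nth_drop id_take_nth_drop[symmetric])
  then have "set (ss[k := u]) = insert u (set (take k ss) \<union> set (drop (Suc k) ss))"
    "set ss = insert (ss ! k) (set (take k ss) \<union> set (drop (Suc k) ss))"
    by (metis list.simps(15) set_append Un_insert_right)+
  then show ?thesis using u by auto
qed

lemma set_take_insert: "set (take l ss @ x # drop l ss) = insert x (set ss)"
  by (metis Un_insert_right append_take_drop_id list.simps(15) set_append)

lemma plabels_insertions: "(d, s') \<in># insertions j s \<Longrightarrow> plabels s' = insert j (plabels s)"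
proof (induction s arbitrary: d s')
  case (PLeaf x)
  then show ?case by auto
next
  case (PBranch ss)
  from PBranch.prems consider "s' = PBranch [PBranch ss, PLeaf j]"
    | l where "s' = PBranch (take (l + 2) ss @ PLeaf j # drop (l + 2) ss)"
    | k u where "k < length ss" "(d, u) \<in># insertions j (ss ! k)" "s' = PBranch (ss[k := u])"
    unfolding in_insertions_PBranch by blast
  then show ?case
  proof cases
    case 2 then show ?thesis by (simp add: set_take_insert del: set_append)
  next
    case 3 then show ?thesis using Union_list_update[OF 3(1)] PBranch.IH[of "ss ! k"] by simp
  qed auto
qed

fun map_cluster :: "(nat set \<Rightarrow> nat set) \<Rightarrow> desc \<Rightarrow> desc" where
  "map_cluster g (E b C) = E b (g C)"
| "map_cluster g (V b C c) = V b (g C) c"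

text \<open>Insertions are described by positions, so relabelling only renames the clusters. Later
  \<open>f\<close> is the relabelling of the deletion step, which turns leaf \<open>n + 1\<close>
  into leaf \<open>n\<close>.\<close>

lemma insertions_map:
  "insertions (f j) (map_ptree f s) = image_mset (map_prod (map_cluster (image f)) (map_ptree f)) (insertions j s)"
proof (induction s)
  case (PLeaf x)
  then show ?case by simp
next
  case (PBranch ss)
  have 1: "image_mset (apsnd (\<lambda>u. PBranch ((map (map_ptree f) ss)[k := u]))) (insertions (f j) (map (map_ptree f) ss ! k))
     = image_mset (map_prod (map_cluster (image f)) (map_ptree f)) (image_mset (apsnd (\<lambda>u. PBranch (ss[k := u]))) (insertions j (ss ! k)))"
    if "k < length ss" for k
    using PBranch[of "ss ! k"] that
    by (auto simp: multiset.map_comp map_update intro!: image_mset_cong)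
  have p: "plabels (PBranch (map (map_ptree f) ss)) = f ` plabels (PBranch ss)"
    by (auto simp: ptree.set_map)
  have 2: "(\<Sum>k<length ss. image_mset (apsnd (\<lambda>u. PBranch ((map (map_ptree f) ss)[k := u]))) (insertions (f j) (map_ptree f (ss ! k))))
     = (\<Sum>k<length ss. image_mset (map_prod (map_cluster (image f)) (map_ptree f)) (image_mset (apsnd (\<lambda>u. PBranch (ss[k := u]))) (insertions j (ss ! k))))"
    using 1 by (intro sum.cong) auto
  show ?case
    by (simp add: insertions_PBranch image_mset_sum 2 take_map drop_map p del: ptree.set(2))
qed

section \<open>Restoring the order of the two leftmost subtrees\<close>

definition ord2 :: "nat ptree list \<Rightarrow> nat ptree list" where
  "ord2 us = (case us of u # w # us \<Rightarrow> if least w < least u then w # u # us else u # w # us | us \<Rightarrow> us)"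

lemma normalise_PBranch: "normalise (PBranch ss) = PBranch (ord2 (map normalise ss))"
  by (auto simp: ord2_def split: list.splits)

lemma set_ord2: "set (ord2 us) = set us"
  unfolding ord2_def by (cases us; cases "tl us") auto

lemma plabels_normalise: "plabels (normalise s) = plabels s"
  by (induction s) (auto simp: normalise_PBranch set_ord2 simp del: normalise.simps(2))

lemma least_normalise: "least (normalise s) = least s"
  by (simp add: least_def plabels_normalise)

lemma normalise_two:
  "normalise (PBranch (u # w # us)) = PBranch (if least w < least u
     then normalise w # normalise u # map normalise us else normalise u # normalise w # map normalise us)"
  by (simp add: least_normalise)

declare normalise.simps(2) [simp del]

text \<open>A largest new label changes no minimum; hence insertions disturb neither the order of
  the two leftmost subtrees nor the enumeration at any older branch point.\<close>

lemma least_insertions: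
  assumes "(d, s') \<in># insertions j s" "plabels s \<noteq> {}" "\<forall>x\<in>plabels s. x < j"
  shows "least s' = least s"
proof -
  have "Min (plabels s) < j" using assms(2,3) finite_plabels[of s] by simp
  then show ?thesis
    using plabels_insertions[OF assms(1)] assms(2) finite_plabels[of s]
    by (simp add: least_def Min_insert)
qed

text \<open>The weak invariant that holds after deletion and after any relabelling, before
  disjointness or order is known again.\<close>

primrec two :: "nat ptree \<Rightarrow> bool" where
  "two (PLeaf i) = True"
| "two (PBranch ss) = (2 \<le> length ss \<and> (\<forall>b \<in> set (map two ss). b))"

lemma two_ne: "two s \<Longrightarrow> plabels s \<noteq> {}"
proof (induction s)
  case (PBranch ss)
  then obtain u where "u \<in> set ss" by (cases ss) auto
  then show ?case using PBranch by auto
qed auto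

lemma ok_two: "ok s \<Longrightarrow> two s"
  by (induction s) auto

lemma swap34: "a + b + c + d + e = a + b + d + c + (e :: 'a multiset)"
  by (simp add: add_ac)

text \<open>The new label is the largest, so it does not influence which of the first two subtrees
  comes first; all new locations lie to the right of these two, and a new pair above an edge is
  already in order.\<close>

lemma insertions_normalise:
  "two s \<Longrightarrow> \<forall>x\<in>plabels s. x < j \<Longrightarrow>
   insertions j (normalise s) = image_mset (apsnd normalise) (insertions j s)"
proof (induction s)
  case (PLeaf x)
  then show ?case by (simp add: normalise_PBranch ord2_def least_def)
next
  case (PBranch ss)
  obtain u w us where ss: "ss = u # w # us" using two_list PBranch.prems(1) by fastforce
  have IH: "insertions j (normalise x) = image_mset (apsnd normalise) (insertions j x)" if "x \<in> set ss" for x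
    using PBranch.IH[OF that] PBranch.prems that by auto
  have le: "least y = least x" if "x \<in> set ss" "(d, y) \<in># insertions j x" for x y d
    using least_insertions[OF that(2)] two_ne[of x] PBranch.prems that by auto
  have ne: "plabels (PBranch ss) \<noteq> {}" using two_ne[OF PBranch.prems(1)] .
  have edge: "normalise (PBranch [PBranch ss, PLeaf j]) = PBranch [normalise (PBranch ss), PLeaf j]"
  proof -
    have "least (PBranch ss) < j" unfolding least_def
      using Min_in[OF finite_plabels ne] PBranch.prems(2) by blast
    moreover have "least (PLeaf j) = j" by (simp add: least_def)
    ultimately show ?thesis by (simp add: normalise_two)
  qed
  have pl: "plabels (normalise (PBranch ss)) = plabels (PBranch ss)" by (rule plabels_normalise)
  let ?us = "map normalise us"
  have I: "image_mset (apsnd normalise) (image_mset (apsnd f) (insertions j x))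
      = image_mset (apsnd g) (insertions j (normalise x))"
    if "x \<in> set ss" "\<And>d y. (d, y) \<in># insertions j x \<Longrightarrow> normalise (f y) = g (normalise y)" for f g x
    unfolding IH[OF that(1)] multiset.map_comp using that(2)
    by (intro image_mset_cong) auto
  show ?case
  proof (cases "least w < least u")
    case True
    have n: "normalise (PBranch ss) = PBranch (normalise w # normalise u # ?us)"
      using True by (simp add: ss normalise_two)
    have 1: "image_mset (apsnd normalise) (image_mset (apsnd (\<lambda>x. PBranch (x # w # us))) (insertions j u))
      = image_mset (apsnd (\<lambda>x. PBranch (normalise w # x # ?us))) (insertions j (normalise u))"
      by (rule I) (use le[of u] True in \<open>auto simp: ss normalise_two\<close>)
    have 2: "image_mset (apsnd normalise) (image_mset (apsnd (\<lambda>x. PBranch (u # x # us))) (insertions j w))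
      = image_mset (apsnd (\<lambda>x. PBranch (x # normalise u # ?us))) (insertions j (normalise w))"
      by (rule I) (use le[of w] True in \<open>auto simp: ss normalise_two\<close>)
    have 3: "image_mset (apsnd normalise) (image_mset (apsnd (\<lambda>x. PBranch (u # w # us[k := x]))) (insertions j (us ! k)))
      = image_mset (apsnd (\<lambda>x. PBranch (normalise w # normalise u # ?us[k := x]))) (insertions j (?us ! k))" if "k < length us" for k
      using that by (subst nth_map, simp, intro I) (use True in \<open>auto simp: ss normalise_two map_update\<close>)
    have 4: "normalise (PBranch (u # w # take l us @ PLeaf j # drop l us)) =
        PBranch (normalise w # normalise u # take l ?us @ PLeaf j # drop l ?us)" for l
      using True by (simp add: normalise_two take_map drop_map)
    have 5: "(\<Sum>k<length us. image_mset (apsnd normalise) (image_mset (apsnd (\<lambda>x. PBranch (u # w # us[k := x]))) (insertions j (us ! k))))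
      = (\<Sum>k<length ?us. image_mset (apsnd (\<lambda>x. PBranch (normalise w # normalise u # ?us[k := x]))) (insertions j (?us ! k)))"
      using 3 by (intro sum.cong) auto
    \<comment> \<open>The first two children have changed places, so their summands occur in the
      opposite order; \<open>swap34\<close> exchanges them.\<close>
    show ?thesis
      using edge pl
      unfolding n unfolding ss insertions_two image_mset_union image_mset_sum[OF finite_lessThan] image_mset_sum[OF finite_atMost]
        image_mset_single apsnd_conv 1 2 4 5
      by (simp only: length_map) (rule swap34)
  next
    case False
    have n: "normalise (PBranch ss) = PBranch (normalise u # normalise w # ?us)"
      using False by (simp add: ss normalise_two)
    have 1: "image_mset (apsnd normalise) (image_mset (apsnd (\<lambda>x. PBranch (x # w # us))) (insertions j u))
      = image_mset (apsnd (\<lambda>x. PBranch (x # normalise w # ?us))) (insertions j (normalise u))"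
      by (rule I) (use le[of u] False in \<open>auto simp: ss normalise_two\<close>)
    have 2: "image_mset (apsnd normalise) (image_mset (apsnd (\<lambda>x. PBranch (u # x # us))) (insertions j w))
      = image_mset (apsnd (\<lambda>x. PBranch (normalise u # x # ?us))) (insertions j (normalise w))"
      by (rule I) (use le[of w] False in \<open>auto simp: ss normalise_two\<close>)
    have 3: "image_mset (apsnd normalise) (image_mset (apsnd (\<lambda>x. PBranch (u # w # us[k := x]))) (insertions j (us ! k)))
      = image_mset (apsnd (\<lambda>x. PBranch (normalise u # normalise w # ?us[k := x]))) (insertions j (?us ! k))" if "k < length us" for k
      using that by (subst nth_map, simp, intro I) (use False in \<open>auto simp: ss normalise_two map_update\<close>)
    have 4: "normalise (PBranch (u # w # take l us @ PLeaf j # drop l us)) =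
        PBranch (normalise u # normalise w # take l ?us @ PLeaf j # drop l ?us)" for l
      using False by (simp add: normalise_two take_map drop_map)
    have 5: "(\<Sum>k<length us. image_mset (apsnd normalise) (image_mset (apsnd (\<lambda>x. PBranch (u # w # us[k := x]))) (insertions j (us ! k))))
      = (\<Sum>k<length ?us. image_mset (apsnd (\<lambda>x. PBranch (normalise u # normalise w # ?us[k := x]))) (insertions j (?us ! k)))"
      using 3 by (intro sum.cong) auto
    show ?thesis
      using edge pl
      unfolding n unfolding ss insertions_two image_mset_union image_mset_sum[OF finite_lessThan] image_mset_sum[OF finite_atMost]
        image_mset_single apsnd_conv 1 2 4 5
      by (simp only: length_map)
  qed
qed

primrec cluster :: "desc \<Rightarrow> nat set" where
  "cluster (E b C) = C"
| "cluster (V b C c) = C"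

lemma ok_PBranch: "ok (PBranch ss) \<longleftrightarrow> 2 \<le> length ss \<and> disj ss \<and> (\<forall>u\<in>set ss. ok u)"
  by simp

lemma sp_PBranch: "sp (PBranch ss) \<longleftrightarrow> ordered ss \<and> (\<forall>u\<in>set ss. sp u)"
  by simp

declare ok.simps(2) [simp del] sp.simps(2) [simp del]

lemma cluster_insertions: "ok s \<Longrightarrow> (d, s') \<in># insertions j s \<Longrightarrow> cluster d \<subseteq> plabels s \<and> cluster d \<noteq> {}"
proof (induction s arbitrary: s')
  case (PLeaf x)
  then show ?case by simp
next
  case (PBranch ss)
  consider "cluster d = plabels (PBranch ss)" | k u where "k < length ss" "(d, u) \<in># insertions j (ss ! k)"
    using PBranch.prems(2) unfolding in_insertions_PBranch by fastforce
  then show ?case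
  proof cases
    case 1
    then show ?thesis using plabels_ne[OF PBranch.prems(1)] by simp
  next
    case 2
    then have "cluster d \<subseteq> plabels (ss ! k) \<and> cluster d \<noteq> {}"
      using PBranch.IH[of "ss ! k" u] PBranch.prems(1) by (simp add: ok_PBranch)
    then show ?thesis using nth_in_plabels[OF 2(1)] by blast
  qed
qed

lemma disj_append_mid: "disj (xs @ u # ys) \<longleftrightarrow>
   disj (xs @ ys) \<and> (\<forall>w \<in> set xs \<union> set ys. plabels w \<inter> plabels u = {})"
  unfolding sorted_wrt_append sorted_wrt.simps by (auto simp: Int_commute; blast)

lemma ok_insertions: "ok s \<Longrightarrow> j \<notin> plabels s \<Longrightarrow> (d, s') \<in># insertions j s \<Longrightarrow> ok s'"
proof (induction s arbitrary: s' d)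
  case (PLeaf x)
  then show ?case by (auto simp: ok_PBranch)
next
  case (PBranch ss)
  from PBranch.prems(3) consider "s' = PBranch [PBranch ss, PLeaf j]"
    | l where "s' = PBranch (take (l + 2) ss @ PLeaf j # drop (l + 2) ss)"
    | k u where "k < length ss" "(d, u) \<in># insertions j (ss ! k)" "s' = PBranch (ss[k := u])"
    unfolding in_insertions_PBranch by blast
  then show ?case
  proof cases
    case 1
    then show ?thesis using PBranch.prems by (simp add: ok_PBranch)
  next
    case 2
    have "\<forall>w\<in>set (take (l + 2) ss) \<union> set (drop (l + 2) ss). plabels w \<inter> plabels (PLeaf j) = {}"
      using PBranch.prems(2) in_set_takeD[of _ "l + 2" ss] in_set_dropD[of _ "l + 2" ss] by auto
    then have "disj (take (l + 2) ss @ PLeaf j # drop (l + 2) ss)"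
      using PBranch.prems(1) unfolding disj_append_mid append_take_drop_id by (simp add: ok_PBranch)
    moreover have "\<forall>u\<in>set (take (l + 2) ss @ PLeaf j # drop (l + 2) ss). ok u"
      using PBranch.prems(1) unfolding set_take_insert by (auto simp: ok_PBranch)
    moreover have "2 \<le> length (take (l + 2) ss @ PLeaf j # drop (l + 2) ss)"
      using PBranch.prems(1) by (auto simp: ok_PBranch min_def)
    ultimately show ?thesis unfolding 2 ok_PBranch by blast
  next
    case 3
    have o: "ok u" "plabels u = insert j (plabels (ss ! k))"
      using PBranch.IH[of "ss ! k" d u] PBranch.prems 3 plabels_insertions[OF 3(2)]
      by (auto simp: ok_PBranch)
    have "disj (ss[k := u])"
      unfolding sorted_wrt_iff_nth_less
    proof (intro allI impI)
      fix a b assume ab: "a < b" "b < length (ss[k := u])"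
      have "j \<notin> plabels (ss ! a)" "j \<notin> plabels (ss ! b)" using ab PBranch.prems(2) by auto
      then show "plabels (ss[k := u] ! a) \<inter> plabels (ss[k := u] ! b) = {}"
        using disj_nth[of ss a b] ab PBranch.prems(1) o(2) 3(1) by (auto simp: ok_PBranch nth_list_update)
    qed
    then show ?thesis using o PBranch.prems(1) 3(1,3) set_update_subset_insert[of ss k u]
      by (auto simp: ok_PBranch)
  qed
qed

lemma sp_insertions: "ok s \<Longrightarrow> sp s \<Longrightarrow> \<forall>x\<in>plabels s. x < j \<Longrightarrow> (d, s') \<in># insertions j s \<Longrightarrow> sp s'"
proof (induction s arbitrary: s' d)
  case (PLeaf x)
  then show ?case by (auto simp: sp_PBranch ordered_def least_def)
next
  case (PBranch ss)
  have lt: "least u < j" if "u = PBranch ss \<or> u \<in> set ss" for u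
    using least_in[of u] that PBranch.prems(1,3) by (auto simp: ok_PBranch)
  have lj: "least (PLeaf j) = j" by (simp add: least_def)
  from PBranch.prems(4) consider "s' = PBranch [PBranch ss, PLeaf j]"
    | l where "l < length ss - 1" "s' = PBranch (take (l + 2) ss @ PLeaf j # drop (l + 2) ss)"
    | k u where "k < length ss" "(d, u) \<in># insertions j (ss ! k)" "s' = PBranch (ss[k := u])"
    unfolding in_insertions_PBranch by blast
  then show ?case
  proof cases
    case 1
    then show ?thesis using lt[of "PBranch ss"] PBranch.prems lj by (auto simp: sp_PBranch ordered_def)
  next
    case 2
    obtain u w us where ss: "ss = u # w # us" using two_list PBranch.prems(1) by (metis ok_PBranch)
    have "ordered (take (l + 2) ss @ PLeaf j # drop (l + 2) ss)"
      using PBranch.prems(2) lt[of w] lj in_set_takeD[of _ l us] in_set_dropD[of _ l us]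
      by (auto simp: ordered_def ss sp_PBranch)
    moreover have "\<forall>u\<in>set (take (l + 2) ss @ PLeaf j # drop (l + 2) ss). sp u"
      using PBranch.prems(2) unfolding set_take_insert by (auto simp: sp_PBranch)
    ultimately show ?thesis unfolding 2 sp_PBranch by blast
  next
    case 3
    have lab: "\<forall>x\<in>plabels (ss ! k). x < j" using PBranch.prems(3) 3(1) by auto
    have le: "least u = least (ss ! k)"
      using least_insertions[OF 3(2) _ lab] plabels_ne[of "ss ! k"] PBranch.prems(1) 3(1) by (auto simp: ok_PBranch)
    have "sp u" using PBranch.IH[of "ss ! k" d u] PBranch.prems 3 lab by (auto simp: sp_PBranch ok_PBranch)
    moreover have "ordered (ss[k := u])"
    proof -
      have "least (ss[k := u] ! a) = least (ss ! a)" for a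
        using le 3(1) by (cases "a = k") auto
      then show ?thesis using PBranch.prems(2) by (simp add: ordered_nth sp_PBranch)
    qed
    ultimately show ?thesis using PBranch.prems(2) 3(3) set_update_subset_insert[of ss k u]
      by (auto simp: sp_PBranch)
  qed
qed

lemma ok_nth: "ok (PBranch ss) \<Longrightarrow> k < length ss \<Longrightarrow> ok (ss ! k)"
  by (simp add: ok_PBranch)

lemma ok_child: "ok (PBranch ss) \<Longrightarrow> u \<in> set ss \<Longrightarrow> ok u"
  by (simp add: ok_PBranch)

lemma ok_disj_nth: "ok (PBranch ss) \<Longrightarrow> k < length ss \<Longrightarrow> l < length ss \<Longrightarrow> k \<noteq> l \<Longrightarrow> x \<in> plabels (ss ! k) \<Longrightarrow> x \<notin> plabels (ss ! l)"
  using disj_nth[of ss k l] by (auto simp: ok_PBranch)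

section \<open>Spines, spinal bushes and the label tilde\<close>

lemma spine_empty: "i \<notin> plabels s \<Longrightarrow> spine i s = []"
  by (induction s) auto

lemma concat_single: "m < length xs \<Longrightarrow> (\<And>k. k < length xs \<Longrightarrow> k \<noteq> m \<Longrightarrow> xs ! k = []) \<Longrightarrow> concat xs = xs ! m"
proof -
  assume m: "m < length xs" and o: "\<And>k. k < length xs \<Longrightarrow> k \<noteq> m \<Longrightarrow> xs ! k = []"
  have "\<forall>x \<in> set (take m xs). x = []" "\<forall>x \<in> set (drop (Suc m) xs). x = []"
    using m o by (auto simp: in_set_conv_nth)
  then have "concat (take m xs) = []" "concat (drop (Suc m) xs) = []" by (simp_all only: concat_eq_Nil_conv)
  then show ?thesis
    by (subst id_take_nth_drop[OF m]) (simp del: concat_eq_Nil_conv)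
qed

text \<open>By disjointness only the child containing \<open>i\<close> contributes to the
  concatenation.\<close>

lemma spine_PBranch:
  assumes "ok (PBranch ss)" "m < length ss" "i \<in> plabels (ss ! m)"
  shows "spine i (PBranch ss) = spine i (ss ! m) @ [ss]"
proof -
  have "concat (map (spine i) ss) = map (spine i) ss ! m"
    by (rule concat_single) (use assms ok_disj_nth spine_empty in auto)
  moreover have "i \<in> plabels (PBranch ss)" using assms by auto
  ultimately show ?thesis using assms(2) by simp
qed

lemma spine_nonempty: "i \<in> plabels s \<Longrightarrow> s \<noteq> PLeaf i \<Longrightarrow> spine i s \<noteq> []"
  by (cases s) auto

declare spine.simps(2) [simp del]

text \<open>As a difference of label sets, the bush is easy to follow when a large label is
  inserted.\<close>

lemma bush_least_eq:
  assumes "ok (PBranch ss)" "m < length ss" "i \<in> plabels (ss ! m)"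
  shows "bush_least i ss = Min (plabels (PBranch ss) - plabels (ss ! m))"
proof -
  have "(\<Union>u \<in> {u \<in> set ss. i \<notin> plabels u}. plabels u) = plabels (PBranch ss) - plabels (ss ! m)"
  proof (intro set_eqI iffI)
    fix x assume "x \<in> (\<Union>u \<in> {u \<in> set ss. i \<notin> plabels u}. plabels u)"
    then obtain u where u: "u \<in> set ss" "i \<notin> plabels u" "x \<in> plabels u" by blast
    then obtain k where k: "k < length ss" "u = ss ! k" by (metis in_set_conv_nth)
    then have "k \<noteq> m" using u assms(3) by metis
    then show "x \<in> plabels (PBranch ss) - plabels (ss ! m)"
      using u k ok_disj_nth[OF assms(1) k(1) assms(2), of x] by auto
  next
    fix x assume x: "x \<in> plabels (PBranch ss) - plabels (ss ! m)"
    then obtain k where k: "k < length ss" "x \<in> plabels (ss ! k)" by (auto simp: in_set_conv_nth)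
    then have "k \<noteq> m" using x by auto
    then have "i \<notin> plabels (ss ! k)" using ok_disj_nth[OF assms(1,2) k(1)] assms(3) by auto
    then have "ss ! k \<in> {u \<in> set ss. i \<notin> plabels u}" using k by simp
    then show "x \<in> (\<Union>u \<in> {u \<in> set ss. i \<notin> plabels u}. plabels u)" using k by blast
  qed
  then show ?thesis by (simp add: bush_least_def)
qed

text \<open>In this case there is no second spinal bush, but there will be one as soon as the tree is a proper subtree of another tree; hence
  the correction term in the recursion for \<open>label_tilde\<close>.\<close>

definition pend :: "nat \<Rightarrow> nat ptree \<Rightarrow> bool" where
  "pend i s \<longleftrightarrow> length (spine i s) = 1 \<and> length (spine i s ! 0) = 2"

text \<open>The spine grows by one entry at its root end. This entry is consulted only if the parent
  of \<open>i\<close> is binary and was the top of the child: then \<open>b\<close> was the default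
  0 and becomes the least label of the siblings, which enters through a maximum.\<close>

lemma label_tilde_child:
  assumes "ok (PBranch ss)" "m < length ss" "i \<in> plabels (ss ! m)" "ss ! m \<noteq> PLeaf i"
  shows "label_tilde i (PBranch ss) = (if pend i (ss ! m) then max (label_tilde i (ss ! m)) (Min (plabels (PBranch ss) - plabels (ss ! m)))
     else label_tilde i (ss ! m))"
    "\<not> pend i (PBranch ss)" "spine i (PBranch ss) ! 0 = spine i (ss ! m) ! 0"
proof -
  note s = spine_PBranch[OF assms(1-3)]
  have ne: "spine i (ss ! m) \<noteq> []" using spine_nonempty assms by simp
  then show "\<not> pend i (PBranch ss)" unfolding pend_def s by simp
  show 0: "spine i (PBranch ss) ! 0 = spine i (ss ! m) ! 0" using ne unfolding s by (simp add: nth_append)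
  obtain v vs where v: "spine i (ss ! m) = v # vs" using ne by (cases "spine i (ss ! m)") auto
  have a: "label_a i (PBranch ss) = label_a i (ss ! m)" unfolding label_a_def 0 ..
  show "label_tilde i (PBranch ss) = (if pend i (ss ! m) then max (label_tilde i (ss ! m)) (Min (plabels (PBranch ss) - plabels (ss ! m)))
     else label_tilde i (ss ! m))"
  proof (cases "length v = 2 \<and> vs = []")
    case True
    then have p: "pend i (ss ! m)" by (simp add: pend_def v)
    have "label_b i (PBranch ss) = Min (plabels (PBranch ss) - plabels (ss ! m))"
      using True unfolding label_b_def s v by (simp add: bush_least_eq[OF assms(1-3)])
    moreover have "label_b i (ss ! m) = 0" using True unfolding label_b_def v by simp
    ultimately show ?thesis using p a unfolding label_tilde_def by simp
  next
    case False
    then have p: "\<not> pend i (ss ! m)" by (auto simp: pend_def v)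
    have "label_b i (PBranch ss) = label_b i (ss ! m)"
      using False unfolding label_b_def a unfolding s v by (cases vs) (auto simp: Let_def)
    then show ?thesis using p a unfolding label_tilde_def by simp
  qed
qed

lemma takeWhile_nth: "m < length xs \<Longrightarrow> xs ! m = x \<Longrightarrow> (\<And>k. k < m \<Longrightarrow> xs ! k \<noteq> x) \<Longrightarrow>
   takeWhile (\<lambda>u. u \<noteq> x) xs = take m xs \<and> dropWhile (\<lambda>u. u \<noteq> x) xs = drop m xs"
proof -
  assume a: "m < length xs" "xs ! m = x" "\<And>k. k < m \<Longrightarrow> xs ! k \<noteq> x"
  have "takeWhile (\<lambda>u. u \<noteq> x) xs = take m xs" by (rule takeWhile_eq_take_P_nth) (use a in auto)
  then show ?thesis by (simp add: a(1) dropWhile_eq_drop)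
qed

text \<open>If \<open>i\<close> is one of the two leftmost subtrees, \<open>b\<close> belongs to the
  third subtree; otherwise \<open>a\<close> lies in the very first subtree, so that \<open>b\<close>
  belongs to the left neighbour of \<open>i\<close>, which is the second subtree at the
  nearest.\<close>

lemma label_tilde_direct:
  assumes "ok (PBranch ss)" "ordered ss" "m < length ss" "ss ! m = PLeaf i"
  shows "label_tilde i (PBranch ss) = (let a = Min (plabels (PBranch ss) - {i}) in if length ss = 2 then max i a
    else max i (max a (least (ss ! (if m < 2 then 2 else m - 1)))))"
    "pend i (PBranch ss) \<longleftrightarrow> length ss = 2" "spine i (PBranch ss) = [ss]"
proof -
  have i: "i \<in> plabels (ss ! m)" using assms(4) by simp
  have ii: "i \<notin> plabels (ss ! k)" if "k < length ss" "k \<noteq> m" for k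
    using ok_disj_nth[OF assms(1,3) that(1)] that(2) i by auto
  show s: "spine i (PBranch ss) = [ss]"
    using spine_PBranch[OF assms(1,3) i] by (simp add: assms(4))
  then show "pend i (PBranch ss) \<longleftrightarrow> length ss = 2" by (simp add: pend_def)
  define a where "a = Min (plabels (PBranch ss) - {i})"
  have a: "label_a i (PBranch ss) = a"
    unfolding label_a_def s a_def using bush_least_eq[OF assms(1,3) i] assms(4) by simp
  have l2: "2 \<le> length ss" and okc: "\<And>u. u \<in> set ss \<Longrightarrow> ok u" using assms(1) by (auto simp: ok_PBranch)
  have ain: "a \<in> plabels (PBranch ss) - {i}"
  proof -
    have "ss ! (if m = 0 then 1 else 0) \<in> set ss" using l2 by (intro nth_mem) auto
    moreover have "i \<notin> plabels (ss ! (if m = 0 then 1 else 0))"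
      using ii[of 0] ii[of 1] l2 by (cases "m = 0") (simp_all add: Suc_le_eq flip: length_greater_0_conv)
    ultimately have "plabels (PBranch ss) - {i} \<noteq> {}" using plabels_ne[OF okc] by fastforce
    then show ?thesis unfolding a_def by (intro Min_in) (auto simp: finite_plabels)
  qed
  have lin: "k < length ss \<Longrightarrow> least (ss ! k) \<in> plabels (ss ! k)" for k using least_in okc by simp
  have lem: "k < length ss \<Longrightarrow> x \<in> plabels (ss ! k) \<Longrightarrow> least (ss ! k) \<le> x" for k x
    by (simp add: least_def finite_plabels)
  have lm: "least (ss ! m) = i" by (simp add: assms(4) least_def)
  have o: "least (ss ! 0) < least (ss ! 1)" "\<And>k. 2 \<le> k \<Longrightarrow> k < length ss \<Longrightarrow> least (ss ! 1) < least (ss ! k)"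
    using assms(2) by (auto simp: ordered_nth)
  \<comment> \<open>The position of the child that contains \<open>a\<close>: the first one, unless
    this is \<open>i\<close> itself.\<close>
  define q where "q = (if m = 0 then 1 else 0 :: nat)"
  have q: "q < length ss" "q \<noteq> m" using l2 by (auto simp: q_def)
  have aq: "a \<in> plabels (ss ! q)"
  proof -
    obtain k where k: "k < length ss" "a \<in> plabels (ss ! k)" "a \<noteq> i" using ain by (auto simp: in_set_conv_nth)
    have "k \<noteq> m" using k assms(4) by auto
    have "a \<le> least (ss ! q)"
    proof -
      have "least (ss ! q) \<in> plabels (PBranch ss) - {i}" using lin[OF q(1)] ii[OF q] q(1) by fastforce
      then show ?thesis unfolding a_def by (intro Min_le) (auto simp: finite_plabels)
    qed
    moreover have "least (ss ! k) \<le> a" using lem k by simp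
    moreover have "least (ss ! q) < least (ss ! k)" if "k \<noteq> q"
    proof (cases "k < 2")
      case True
      then have "k = 0 \<or> k = 1" by auto
      then show ?thesis using that \<open>k \<noteq> m\<close> o(1) by (auto simp: q_def split: if_splits)
    next
      case False
      then show ?thesis using o(1) o(2)[of k] k(1) by (auto simp: q_def)
    qed
    ultimately show ?thesis using k by (cases "k = q") auto
  qed
  have aother: "a \<notin> plabels (ss ! k)" if "k < length ss" "k \<noteq> q" for k
    using ok_disj_nth[OF assms(1) q(1) that(1)] that(2) aq by auto
  have tw: "takeWhile (\<lambda>u. u \<noteq> PLeaf i) ss = take m ss \<and> dropWhile (\<lambda>u. u \<noteq> PLeaf i) ss = drop m ss"
  proof (rule takeWhile_nth[OF assms(3,4)])
    fix k assume "k < m"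
    then have "i \<notin> plabels (ss ! k)" using ii[of k] assms(3) by simp
    then show "ss ! k \<noteq> PLeaf i" by auto
  qed
  have inj: "inj_on (\<lambda>k. ss ! k) {..<length ss}"
    using distinct_least[of ss] assms(1) by (auto simp: ok_PBranch distinct_map inj_on_nth)
  let ?S = "{u \<in> set ss. least u \<le> i}"
  have b: "label_b i (PBranch ss) = (if length ss = 2 then 0 else least (ss ! (if m < 2 then 2 else m - 1)))"
  proof (cases "length ss = 2")
    case True
    then show ?thesis unfolding label_b_def s by simp
  next
    case False
    then have l3: "3 \<le> length ss" using l2 by simp
    show ?thesis
    proof (cases "m < 2")
      case True
      \<comment> \<open>Only the two leftmost subtrees can have least label at most
        \<open>i\<close>, so the rank of \<open>i\<close> is at most 2.\<close>
      have sub: "?S \<subseteq> {ss ! 0, ss ! 1}"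
      proof
        fix u assume u: "u \<in> ?S"
        then obtain k where k: "k < length ss" "u = ss ! k" by (auto simp: in_set_conv_nth)
        have "i \<le> least (ss ! 1)"
        proof -
          have "m = 0 \<or> m = 1" using True by auto
          then show ?thesis using lm o(1) by auto
        qed
        then have "k < 2" using o(2)[of k] k u by (cases "k < 2") auto
        then have "k = 0 \<or> k = 1" by auto
        then show "u \<in> {ss ! 0, ss ! 1}" using k by auto
      qed
      have c: "card ?S \<le> 2"

      proof -
        have "card {ss ! 0, ss ! 1} \<le> 2" by (simp add: card_insert_if)
        then show ?thesis using card_mono[OF _ sub] by simp
      qed
      \<comment> \<open>For \<open>m = 0\<close> the child with \<open>a\<close> stands right of
        \<open>i\<close> and is filtered out, for \<open>m = 1\<close> it stands on the left; in
        both cases position 2 comes next.\<close>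
      have f: "filter (\<lambda>u. a \<notin> plabels u) (tl (drop m ss)) = drop 2 ss"
      proof -
        have fa: "filter (\<lambda>u. a \<notin> plabels u) (drop 2 ss) = drop 2 ss"

        proof -
          have "a \<notin> plabels u" if u: "u \<in> set (drop 2 ss)" for u
          proof -
            obtain k where "k < length ss - 2" "u = ss ! (2 + k)"
              using u unfolding in_set_conv_nth by auto
            then show ?thesis using aother[of "2 + k"] by (auto simp: q_def)
          qed
          then show ?thesis by (simp add: filter_id_conv)
        qed
        have "tl (drop m ss) = (if m = 0 then ss ! 1 # drop 2 ss else drop 2 ss)"
        proof (cases "m = 0")
          case True
          then show ?thesis using l2 Cons_nth_drop_Suc[of 1 ss] by (cases ss; cases "tl ss") auto
        next
          case False
          then have "m = 1" using \<open>m < 2\<close> by simp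
          then show ?thesis by (cases ss; cases "tl ss") auto
        qed
        then show ?thesis using fa aq by (cases "m = 0") (simp_all add: q_def)
      qed
      have "label_b i (PBranch ss) = least (hd (drop 2 ss))"
        using False c f tw a by (simp add: label_b_def s Let_def)
      then show ?thesis using True False l3 by (simp add: hd_drop_conv_nth)
    next
      case m2: False
      \<comment> \<open>Three subtrees with least label at most \<open>i\<close> force the rank of
        \<open>i\<close> above 2.\<close>
      have "{ss ! 0, ss ! 1, ss ! m} \<subseteq> ?S"
      proof -
        have "ss ! 0 \<in> set ss" "ss ! 1 \<in> set ss" "ss ! m \<in> set ss"
          using l2 assms(3) by (auto intro!: nth_mem)
        then show ?thesis using o(1) o(2)[of m] m2 assms(3) lm by auto
      qed
      moreover have "card {ss ! 0, ss ! 1, ss ! m} = 3"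
      proof -
        have "ss ! 0 \<noteq> ss ! 1" "ss ! 0 \<noteq> ss ! m" "ss ! 1 \<noteq> ss ! m"
          using o(1) o(2)[of m] m2 assms(3) by auto
        then show ?thesis by simp
      qed
      ultimately have c: "\<not> card ?S \<le> 2" using card_mono[of ?S "{ss ! 0, ss ! 1, ss ! m}"] by simp
      have q0: "q = 0" using m2 by (simp add: q_def)
      \<comment> \<open>The filter removes only position 0, the last entry of the reversed list, so
        its head is still the left neighbour of \<open>i\<close>.\<close>
      have "rev (take m ss) = rev (tl (take m ss)) @ [ss ! 0]"
        using m2 assms(3) by (cases ss; cases m) auto
      moreover have "filter (\<lambda>u. a \<notin> plabels u) (rev (tl (take m ss))) = rev (tl (take m ss))"

      proof -
        have "a \<notin> plabels u" if u: "u \<in> set (tl (take m ss))" for u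
        proof -
          obtain k where "k < m - 1" "u = ss ! (1 + k)"
            using u assms(3) unfolding in_set_conv_nth by (auto simp: nth_tl)
          then show ?thesis using aother[of "1 + k"] q0 assms(3) by auto
        qed
        then show ?thesis by (simp add: filter_id_conv)
      qed
      ultimately have f: "filter (\<lambda>u. a \<notin> plabels u) (rev (take m ss)) = rev (tl (take m ss))"
        using aq q0 by simp
      have "hd (rev (tl (take m ss))) = ss ! (m - 1)"

      proof -
        have "length (take m ss) = m" using assms(3) by simp
        then have "take m ss \<noteq> []" "tl (take m ss) \<noteq> []"
          using m2 by (auto simp flip: length_greater_0_conv)
        moreover from this have "last (tl (take m ss)) = last (take m ss)" by (simp add: last_tl)
        moreover have "last (take m ss) = ss ! (m - 1)" if "take m ss \<noteq> []"
          using that assms(3) by (simp add: last_conv_nth)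
        ultimately show ?thesis by (simp add: hd_rev)
      qed
      then have "label_b i (PBranch ss) = least (ss ! (m - 1))"
        using False c f tw a by (simp add: label_b_def s Let_def)
      then show ?thesis using m2 False by simp
    qed
  qed
  show "label_tilde i (PBranch ss) = (let a = Min (plabels (PBranch ss) - {i}) in if length ss = 2 then max i a
    else max i (max a (least (ss ! (if m < 2 then 2 else m - 1)))))"
    unfolding label_tilde_def a b a_def[symmetric] by simp
qed

section \<open>Deleting a leaf\<close>

lemma delete_leaf_id: "two s \<Longrightarrow> i \<notin> plabels s \<Longrightarrow> delete_leaf i s = s"
proof (induction s)
  case (PLeaf x)
  then show ?case by simp
next
  case (PBranch ss)
  have "delete_leaf i u = u" if "u \<in> set ss" for u using PBranch that by auto
  then have "map (delete_leaf i) ss = ss" by (simp add: map_idI)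
  moreover have "filter (\<lambda>u. u \<noteq> PLeaf i) ss = ss" using PBranch.prems(2) by (auto simp: filter_id_conv)
  moreover obtain u w us where "ss = u # w # us" using two_list PBranch.prems(1) by fastforce
  ultimately show ?case by simp
qed

lemma delete_leaf_child:
  assumes "2 \<le> length ss" "\<And>k. k < length ss \<Longrightarrow> k \<noteq> m \<Longrightarrow> two (ss ! k) \<and> i \<notin> plabels (ss ! k)"
    and "m < length ss" "delete_leaf i (ss ! m) \<noteq> PLeaf i"
  shows "delete_leaf i (PBranch ss) = PBranch (ss[m := delete_leaf i (ss ! m)])"
proof -
  have m: "map (delete_leaf i) ss = ss[m := delete_leaf i (ss ! m)]"
    using assms(2,3) by (intro nth_equalityI) (auto simp: nth_list_update delete_leaf_id)
  have "ss ! k \<noteq> PLeaf i" if "k < length ss" "k \<noteq> m" for k using assms(2)[OF that] by auto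
  then have f: "filter (\<lambda>u. u \<noteq> PLeaf i) (map (delete_leaf i) ss) = map (delete_leaf i) ss"
    using assms(3,4) unfolding m by (auto simp: filter_id_conv in_set_conv_nth nth_list_update split: if_splits)
  obtain u w us where "map (delete_leaf i) ss = u # w # us" using two_list[of "map (delete_leaf i) ss"] assms(1) by auto
  then show ?thesis using f m by simp
qed

lemma delete_leaf_direct:
  assumes "\<And>u. u \<in> set (xs @ ys) \<Longrightarrow> two u \<and> i \<notin> plabels u"
  shows "delete_leaf i (PBranch (xs @ PLeaf i # ys)) = (case xs @ ys of [u] \<Rightarrow> u | us \<Rightarrow> PBranch us)"
proof -
  have "map (delete_leaf i) xs = xs" "map (delete_leaf i) ys = ys"
    using assms by (auto simp: map_idI delete_leaf_id)
  moreover have "filter (\<lambda>u. u \<noteq> PLeaf i) xs = xs" "filter (\<lambda>u. u \<noteq> PLeaf i) ys = ys"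
    using assms by (fastforce simp: filter_id_conv)+
  ultimately show ?thesis by simp
qed

lemma delete_leaf_direct2:
  assumes "\<And>u. u \<in> set (xs @ ys) \<Longrightarrow> two u \<and> i \<notin> plabels u" "2 \<le> length (xs @ ys)"
  shows "delete_leaf i (PBranch (xs @ PLeaf i # ys)) = PBranch (xs @ ys)"
proof -
  obtain u w us where "xs @ ys = u # w # us" using two_list assms(2) by blast
  then show ?thesis using delete_leaf_direct[of xs ys i] assms(1) by simp
qed

lemma Union_update:
  assumes "ok (PBranch ss)" "m < length ss"
  shows "plabels (PBranch (ss[m := u])) = plabels (PBranch ss) - plabels (ss ! m) \<union> plabels u"
proof -
  have "plabels (PBranch xs) = (\<Union>k<length xs. plabels (xs ! k))" for xs :: "nat ptree list"
  proof -
    have "set xs = (\<lambda>k. xs ! k) ` {..<length xs}" unfolding set_conv_nth by auto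
    then show ?thesis by simp
  qed
  then show ?thesis using assms(2) ok_disj_nth[OF assms(1) _ assms(2)]
    by (auto simp: nth_list_update split: if_splits)
qed

lemma plabels_delete: "ok s \<Longrightarrow> i \<in> plabels s \<Longrightarrow> s \<noteq> PLeaf i \<Longrightarrow> plabels (delete_leaf i s) = plabels s - {i}"
proof (induction s)
  case (PLeaf x)
  then show ?case by simp
next
  case (PBranch ss)
  obtain m where m: "m < length ss" "i \<in> plabels (ss ! m)" using PBranch.prems(2) by (auto simp: in_set_conv_nth)
  have o: "two (ss ! k) \<and> i \<notin> plabels (ss ! k)" if "k < length ss" "k \<noteq> m" for k
    using ok_disj_nth[OF PBranch.prems(1) m(1) that(1), of i] that(2) m(2) ok_two[OF ok_nth[OF PBranch.prems(1) that(1)]] by simp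
  show ?case
  proof (cases "ss ! m = PLeaf i")
    case True
    define xs ys where "xs = take m ss" and "ys = drop (Suc m) ss"
    have ss: "ss = xs @ PLeaf i # ys" using id_take_nth_drop[OF m(1)] unfolding True xs_def ys_def .
    have oo: "two u \<and> i \<notin> plabels u" if that2: "u \<in> set (xs @ ys)" for u
    proof -
      obtain k where "k < length ss" "k \<noteq> m" "u = ss ! k"
      proof -
        from that2 consider "u \<in> set (take m ss)" | "u \<in> set (drop (Suc m) ss)"
          by (auto simp: xs_def ys_def)
        then show thesis
        proof cases
          case 1
          then obtain k where "k < m" "u = ss ! k" by (auto simp: in_set_conv_nth)
          then show thesis using that[of k] m(1) by simp
        next
          case 2
          then obtain k where "k < length ss - Suc m" "u = ss ! (Suc m + k)" by (auto simp: in_set_conv_nth)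
          then show thesis using that[of "Suc m + k"] by auto
        qed
      qed
      then show ?thesis using o by blast
    qed
    have "plabels (delete_leaf i (PBranch ss)) = plabels (PBranch (xs @ ys))"
    proof -
      have "delete_leaf i (PBranch ss) = (case xs @ ys of [u] \<Rightarrow> u | us \<Rightarrow> PBranch us)"
        unfolding ss by (rule delete_leaf_direct) (use oo in blast)
      moreover have "plabels (case us of [u] \<Rightarrow> u | us \<Rightarrow> PBranch us) = plabels (PBranch us)" for us :: "nat ptree list"
        by (cases us; cases "tl us") auto
      ultimately show ?thesis by simp
    qed
    also have "\<dots> = plabels (PBranch ss) - {i}"
    proof -
      have "i \<notin> plabels (PBranch (xs @ ys))" using oo unfolding ptree.set by blast
      moreover have "plabels (PBranch ss) = insert i (plabels (PBranch (xs @ ys)))" unfolding ss by simp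
      ultimately show ?thesis by blast
    qed
    finally show ?thesis .
  next
    case False
    have p: "plabels (delete_leaf i (ss ! m)) = plabels (ss ! m) - {i}"
      using PBranch.IH[OF nth_mem[OF m(1)] ok_nth[OF PBranch.prems(1) m(1)] m(2) False] .
    have "delete_leaf i (ss ! m) \<noteq> PLeaf i"
    proof
      assume "delete_leaf i (ss ! m) = PLeaf i"
      then have "i \<in> plabels (delete_leaf i (ss ! m))" by simp
      then show False unfolding p by blast
    qed
    then have d: "delete_leaf i (PBranch ss) = PBranch (ss[m := delete_leaf i (ss ! m)])"
      using PBranch.prems(1) o m(1) by (intro delete_leaf_child) (simp_all add: ok_PBranch)
    show ?thesis unfolding d Union_update[OF PBranch.prems(1) m(1)] p using m(2) nth_in_plabels[OF m(1)] by blast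
  qed
qed

section \<open>Deleting a leaf after an insertion\<close>

declare delete_leaf.simps(2) [simp del]

text \<open>The parent of \<open>i\<close> is recorded by its label set and its degree; unlike the
  list of subtrees, both are determined by the projection.\<close>

definition parent_cluster :: "nat \<Rightarrow> nat ptree \<Rightarrow> nat set" where
  "parent_cluster i s = plabels (PBranch (spine i s ! 0))"

definition parent_degree :: "nat \<Rightarrow> nat ptree \<Rightarrow> nat" where
  "parent_degree i s = length (spine i s ! 0)"

text \<open>The locations that disappear with leaf \<open>i\<close>.\<close>

definition lost :: "nat \<Rightarrow> nat ptree \<Rightarrow> desc multiset" where
  "lost i s = {#E True {i}#} + (if parent_degree i s = 2
     then {#E False (parent_cluster i s), V True (parent_cluster i s) 2#}
     else {#V False (parent_cluster i s) (parent_degree i s)#})"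

text \<open>How a surviving location is described once \<open>i\<close> is gone. The parent is
  recognised by its label set \<open>P\<close>; the flag is kept because deletion preserves which
  location is rightmost.\<close>

fun strip :: "nat \<Rightarrow> nat set \<Rightarrow> desc \<Rightarrow> desc" where
  "strip i P (E b C) = E b (C - {i})"
| "strip i P (V b C c) = V b (C - {i}) (if C = P then c - 1 else c)"

text \<open>Insertions \<open>X\<close> at lost locations are undone by the deletion; insertions \<open>R\<close> elsewhere commute with it.\<close>

definition splits :: "nat \<Rightarrow> nat \<Rightarrow> nat ptree \<Rightarrow> (desc \<times> nat ptree) multiset \<Rightarrow> (desc \<times> nat ptree) multiset \<Rightarrow> bool" where
  "splits i j s X R \<longleftrightarrow> insertions j s = X + R \<and> image_mset fst X = lost i s \<and>
     (\<forall>d s'. (d, s') \<in># X \<longrightarrow> label_tilde i s' = j \<and>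
        normalise (map_ptree (\<lambda>x. if x = j then i else x) (delete_leaf i s')) = s) \<and>
     (\<forall>d s'. (d, s') \<in># R \<longrightarrow> label_tilde i s' = label_tilde i s \<and> pend i s' = pend i s \<and>
        cluster d \<noteq> {i} \<and> (parent_degree i s = 2 \<longrightarrow> cluster d \<noteq> parent_cluster i s)) \<and>
     image_mset (map_prod (strip i (parent_cluster i s)) (delete_leaf i)) R = insertions j (delete_leaf i s)"

lemma strip_id: "i \<notin> cluster d \<Longrightarrow> i \<in> P \<Longrightarrow> strip i P d = d"
  by (cases d) auto

lemma map_ptree_id: "j \<notin> plabels u \<Longrightarrow> map_ptree (\<lambda>x. if x = j then i else x) u = u"
proof -
  assume "j \<notin> plabels u"
  then have "map_ptree (\<lambda>x. if x = j then i else x) u = map_ptree id u"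
    by (intro ptree.map_cong0) auto
  then show ?thesis by (simp add: ptree.map_id)
qed

lemma normalise_pair:
  "ordered (u # w # us) \<Longrightarrow> (\<And>x. x \<in> set (u # w # us) \<Longrightarrow> normalise x = x) \<Longrightarrow>
   normalise (PBranch (u # w # us)) = PBranch (u # w # us) \<and> normalise (PBranch (w # u # us)) = PBranch (u # w # us)"
  by (auto simp: normalise_two ordered_def map_idI)

lemma normalise_id: "ok s \<Longrightarrow> sp s \<Longrightarrow> normalise s = s"
proof (induction s)
  case (PLeaf x)
  then show ?case by simp
next
  case (PBranch ss)
  obtain u w us where ss: "ss = u # w # us" using two_list PBranch.prems(1) unfolding ok_PBranch by blast
  have "normalise x = x" if "x \<in> set ss" for x
    using PBranch.IH[OF that] PBranch.prems that by (simp add: ok_PBranch sp_PBranch)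
  then show ?case using normalise_pair[of u w us] PBranch.prems(2) unfolding ss sp_PBranch by blast
qed

lemma spine_psubtrees: "ok s \<Longrightarrow> v \<in> set (spine i s) \<Longrightarrow> PBranch v \<in> psubtrees s \<and> i \<in> plabels (PBranch v)"
proof (induction s)
  case (PLeaf x)
  then show ?case by simp
next
  case (PBranch ss)
  have "i \<in> plabels (PBranch ss)" using PBranch.prems(2) spine_empty[of i "PBranch ss"] by (cases "i \<in> plabels (PBranch ss)") simp_all
  then obtain m where m: "m < length ss" "i \<in> plabels (ss ! m)" by (auto simp: in_set_conv_nth)
  consider "v = ss" | "v \<in> set (spine i (ss ! m))"
    using PBranch.prems(2) unfolding spine_PBranch[OF PBranch.prems(1) m] by auto
  then show ?case
  proof cases
    case 1
    then show ?thesis using \<open>i \<in> plabels (PBranch ss)\<close> by simp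
  next
    case 2
    have "PBranch v \<in> psubtrees (ss ! m) \<and> i \<in> plabels (PBranch v)"
      using PBranch.IH[OF nth_mem[OF m(1)] ok_nth[OF PBranch.prems(1) m(1)] 2] .
    then show ?thesis using nth_mem[OF m(1)] by auto
  qed
qed

lemma parent_cluster_props:
  assumes "ok s" "i \<in> plabels s" "s \<noteq> PLeaf i"
  shows "parent_cluster i s \<subseteq> plabels s" "i \<in> parent_cluster i s"
proof -
  have "spine i s ! 0 \<in> set (spine i s)" using spine_nonempty[OF assms(2,3)] by simp
  from spine_psubtrees[OF assms(1) this]
  show "parent_cluster i s \<subseteq> plabels s" "i \<in> parent_cluster i s"
    unfolding parent_cluster_def using plabels_subtree by blast+
qed

declare ptree.set(2) [simp del]

lemma Min_insert_big: "B \<noteq> {} \<Longrightarrow> finite B \<Longrightarrow> \<forall>x\<in>B. x < j \<Longrightarrow> Min (insert j B) = Min (B :: nat set)"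
proof -
  assume b: "B \<noteq> {}" "finite B" "\<forall>x\<in>B. x < j"
  then have "Min B < j" using Min_in by blast
  then show ?thesis using b by (simp add: Min_insert)
qed

lemma insert_update_pos:
  "m < length ss \<Longrightarrow> (take k ss @ x # drop k ss)[if m < k then m else Suc m := y] = take k (ss[m := y]) @ x # drop k (ss[m := y])"
proof (cases "m < k")
  case True
  assume "m < length ss"
  then show ?thesis using True by (simp add: list_update_append take_update_swap)
next
  case False
  assume m: "m < length ss"
  have "(take k ss)[m := y] = take k ss" using False by (intro list_update_beyond) simp
  then show ?thesis using False m by (simp add: list_update_append take_update_swap drop_update_swap Suc_diff_le min_def)
qed

lemma insert_nth_pos:
  "m < length ss \<Longrightarrow> (take k ss @ x # drop k ss) ! (if m < k then m else Suc m) = ss ! m"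
  by (auto simp: nth_append min_def Suc_diff_le)

lemma delete_neq: "ok s \<Longrightarrow> i \<in> plabels s \<Longrightarrow> s \<noteq> PLeaf i \<Longrightarrow> delete_leaf i s \<noteq> PLeaf i"
proof
  assume "ok s" "i \<in> plabels s" "s \<noteq> PLeaf i" "delete_leaf i s = PLeaf i"
  then have "plabels (PLeaf i) = plabels s - {i}" using plabels_delete[of s i] by simp
  then show False unfolding ptree.set(1) by blast
qed

text \<open>All lost locations lie inside the child containing \<open>i\<close>, so \<open>X\<close>
  is lifted from there and everything else joins \<open>R\<close>. The only interaction with the new
  top branch point is the correction term for a pending second spinal bush.\<close>

lemma splits_child:
  assumes ok: "ok (PBranch ss)" and sp: "sp (PBranch ss)" and lt: "\<forall>x\<in>plabels (PBranch ss). x < j"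
    and m: "m < length ss" and i: "i \<in> plabels (ss ! m)" and nl: "ss ! m \<noteq> PLeaf i"
    and spl: "splits i j (ss ! m) X0 R0"
  shows "\<exists>X R. splits i j (PBranch ss) X R"
proof -
  let ?s = "PBranch ss" and ?P = "parent_cluster i (ss ! m)" and ?D = "delete_leaf i (ss ! m)"
  let ?C = "plabels ?s" and ?B = "plabels (PBranch ss) - plabels (ss ! m)"
  note S = spl[unfolded splits_def]
  have j: "j \<notin> ?C" using lt by blast
  have len: "2 \<le> length ss" using ok by (simp add: ok_PBranch)
  have iC: "i \<in> ?C" using nth_in_plabels[OF m] i by blast
  have ij: "i \<noteq> j" using iC j by blast
  have other: "two (ss ! k) \<and> i \<notin> plabels (ss ! k) \<and> j \<notin> plabels (ss ! k)" if "k < length ss" "k \<noteq> m" for k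
    using ok_disj_nth[OF ok m that(1)] that(2) i ok_two[OF ok_nth[OF ok that(1)]] nth_in_plabels[OF that(1)] j by blast
  have B: "?B \<noteq> {}" "finite ?B" "\<forall>x\<in>?B. x < j"
  proof -
    obtain k where k: "k < length ss" "k \<noteq> m"
    proof -
      have "(if m = 0 then 1 else 0) < length ss" "(if m = 0 then 1 else 0) \<noteq> m" using len by auto
      then show thesis using that by blast
    qed
    have "plabels (ss ! k) \<noteq> {}" using plabels_ne[OF ok_nth[OF ok k(1)]] .
    then show "?B \<noteq> {}" using ok_disj_nth[OF ok k(1) m k(2)] nth_in_plabels[OF k(1)] by blast
  qed (use lt finite_plabels in auto)
  have sub: "plabels (ss ! m) \<subseteq> ?C" by (rule nth_in_plabels[OF m])
  have par: "parent_cluster i ?s = ?P" "parent_degree i ?s = parent_degree i (ss ! m)"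
    unfolding parent_cluster_def parent_degree_def label_tilde_child(3)[OF ok m i nl] by simp_all
  have P: "?P \<subseteq> plabels (ss ! m)" "i \<in> ?P"
    using parent_cluster_props[OF ok_nth[OF ok m] i nl] by auto
  \<comment> \<open>The new top is neither the parent of \<open>i\<close> nor the leaf
    \<open>i\<close>, so its edge and locations are not among the lost ones.\<close>
  have CP: "?C \<noteq> ?P" "?C \<noteq> {i}" using B(1) P sub i by auto
  have lts: "label_tilde i ?s = (if pend i (ss ! m) then max (label_tilde i (ss ! m)) (Min ?B) else label_tilde i (ss ! m))"
    using label_tilde_child(1)[OF ok m i nl] .
  have pds: "\<not> pend i ?s" using label_tilde_child(2)[OF ok m i nl] .
  have del: "delete_leaf i ?s = PBranch (ss[m := ?D])"
    using delete_neq[OF ok_nth[OF ok m] i nl] other m len by (intro delete_leaf_child) auto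
  have labdel: "plabels (PBranch (ss[m := ?D])) = ?C - {i}"
    using plabels_delete[OF ok iC] unfolding del by simp
  let ?edge = "(E False ?C, PBranch [?s, PLeaf j])"
  let ?loc = "\<lambda>l. (V (l = length ss - 2) ?C (length ss), PBranch (take (l + 2) ss @ PLeaf j # drop (l + 2) ss))"
  let ?ch = "\<lambda>k M. image_mset (apsnd (\<lambda>u. PBranch (ss[k := u]))) M"
  define X where "X = ?ch m X0"
  define R where "R = {#?edge#} + (\<Sum>l<length ss - 1. {#?loc l#}) + (\<Sum>k\<in>{..<length ss} - {m}. ?ch k (insertions j (ss ! k))) + ?ch m R0"
  have ins: "insertions j ?s = X + R"
  proof -
    have "insertions j ?s = {#?edge#} + (\<Sum>l<length ss - 1. {#?loc l#}) +
        (?ch m (X0 + R0) + (\<Sum>k\<in>{..<length ss} - {m}. ?ch k (insertions j (ss ! k))))"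
      unfolding insertions_PBranch sum.remove[OF finite_lessThan lessThan_iff[THEN iffD2, OF m]] using S by simp
    then show ?thesis by (simp add: X_def R_def add_ac)
  qed
  \<comment> \<open>An insertion inside child \<open>m\<close> leaves the labels \<open>?B\<close>
    of its siblings unchanged, hence also the correction term.\<close>
  have ch_prop: "label_tilde i s' = (if pend i u then max (label_tilde i u) (Min ?B) else label_tilde i u) \<and> \<not> pend i s' \<and>
      delete_leaf i s' = PBranch (ss[m := delete_leaf i u])"
    if u: "(d, u) \<in># insertions j (ss ! m)" and s': "s' = PBranch (ss[m := u])" for d u s'
  proof -
    have in': "(d, s') \<in># insertions j ?s" unfolding in_insertions_PBranch using m u s' by blast
    have ok': "ok (PBranch (ss[m := u]))" using ok_insertions[OF ok j in'] s' by simp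
    have pu: "plabels u = insert j (plabels (ss ! m))" using plabels_insertions[OF u] .
    have i': "i \<in> plabels (ss[m := u] ! m)" "ss[m := u] ! m \<noteq> PLeaf i" "m < length (ss[m := u])"
      using pu i ij m by auto
    have "plabels (PBranch (ss[m := u])) - plabels u = ?B"
      unfolding Union_update[OF ok m] pu using j by auto
    then have lt': "label_tilde i s' = (if pend i u then max (label_tilde i u) (Min ?B) else label_tilde i u) \<and> \<not> pend i s'"
      using label_tilde_child[OF ok' i'(3,1,2)] m unfolding s' by simp
    have oku: "ok u" using ok_nth[OF ok' i'(3)] m by simp
    have "delete_leaf i (PBranch (ss[m := u])) = PBranch ((ss[m := u])[m := delete_leaf i (ss[m := u] ! m)])"
      using delete_neq[OF oku] i' m other len by (intro delete_leaf_child) auto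
    then show ?thesis using lt' m unfolding s' by simp
  qed
  have X: "label_tilde i s' = j \<and> normalise (map_ptree (\<lambda>x. if x = j then i else x) (delete_leaf i s')) = ?s"
    if dX: "(d, s') \<in># X" for d s'
  proof -
    obtain u where u: "(d, u) \<in># X0" "s' = PBranch (ss[m := u])"
      using dX unfolding X_def by (auto simp: in_image_apsnd)
    have uin: "(d, u) \<in># insertions j (ss ! m)" using u(1) S by simp
    have U: "label_tilde i u = j" "normalise (map_ptree (\<lambda>x. if x = j then i else x) (delete_leaf i u)) = ss ! m"
      using S u(1) by blast+
    \<comment> \<open>So a pending correction cannot replace the value \<open>j\<close>.\<close>
    have "Min ?B < j" using Min_in[OF B(2,1)] B(3) by blast
    then have 1: "label_tilde i s' = j" using ch_prop[OF uin u(2)] U(1) by simp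
    have mid: "map (map_ptree (\<lambda>x. if x = j then i else x)) (ss[m := delete_leaf i u])
        = ss[m := map_ptree (\<lambda>x. if x = j then i else x) (delete_leaf i u)]"
      using other m by (intro nth_equalityI) (auto simp: nth_list_update map_ptree_id)
    have mn: "map normalise (ss[m := map_ptree (\<lambda>x. if x = j then i else x) (delete_leaf i u)]) = ss"
    proof (rule nth_equalityI)
      fix k assume "k < length (map normalise (ss[m := map_ptree (\<lambda>x. if x = j then i else x) (delete_leaf i u)]))"
      then have k: "k < length ss" by simp
      have "normalise (ss ! k) = ss ! k"
        using ok_nth[OF ok k] sp k by (intro normalise_id) (auto simp: sp_PBranch)
      then show "map normalise (ss[m := map_ptree (\<lambda>x. if x = j then i else x) (delete_leaf i u)]) ! k = ss ! k"
        using k m U(2) by (cases "k = m") (auto simp: nth_list_update)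
    qed simp
    have "ord2 ss = ss"
    proof -
      obtain a b us where "ss = a # b # us" using two_list len by blast
      then show ?thesis using sp by (auto simp: ord2_def sp_PBranch ordered_def)
    qed
    then have "normalise (map_ptree (\<lambda>x. if x = j then i else x) (delete_leaf i s')) = ?s"
      using ch_prop[OF uin u(2)] by (simp add: mid normalise_PBranch mn)
    then show ?thesis using 1 by blast
  qed
  have R: "label_tilde i s' = label_tilde i ?s \<and> pend i s' = pend i ?s \<and> cluster d \<noteq> {i} \<and>
      (parent_degree i ?s = 2 \<longrightarrow> cluster d \<noteq> ?P)" if dR: "(d, s') \<in># R" for d s'
  proof -
    have in': "(d, s') \<in># insertions j ?s" using dR ins by simp
    have ok': "ok s'" using ok_insertions[OF ok j in'] .
    have jB: "insert j ?C - plabels (ss ! m) = insert j ?B" using j sub by blast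
    \<comment> \<open>Outside child \<open>m\<close> the new leaf joins the siblings' labels, but it
      is too large to change their minimum.\<close>
    have MB: "Min (insert j ?B) = Min ?B" by (rule Min_insert_big[OF B])
    consider "d = E False ?C" "s' = PBranch [?s, PLeaf j]"
      | l where "l < length ss - 1" "(d, s') = ?loc l"
      | k u where "k < length ss" "k \<noteq> m" "(d, u) \<in># insertions j (ss ! k)" "s' = PBranch (ss[k := u])"
      | u where "(d, u) \<in># R0" "s' = PBranch (ss[m := u])"
      using dR unfolding R_def by (auto simp: in_sum_mset_iff in_image_apsnd)
    then show ?thesis
    proof cases
      case 1
      have "label_tilde i s' = label_tilde i ?s \<and> \<not> pend i s'"
        using label_tilde_child(1,2)[of "[?s, PLeaf j]" 0 i] ok' iC pds unfolding 1 by simp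
      then show ?thesis using pds CP 1 by simp
    next
      case 2
      \<comment> \<open>Child \<open>m\<close> moves one place to the right exactly when the new
        leaf is put before it.\<close>
      let ?m = "if m < l + 2 then m else Suc m" and ?ss = "take (l + 2) ss @ PLeaf j # drop (l + 2) ss"
      have nth: "?ss ! ?m = ss ! m" by (rule insert_nth_pos[OF m])
      have ml: "?m < length ?ss" using m by auto
      have s': "s' = PBranch ?ss" and d: "cluster d = ?C" using 2(2) by auto
      have "plabels (PBranch ?ss) = insert j ?C"
        using plabels_insertions[OF in'] unfolding s' .
      then have "label_tilde i s' = label_tilde i ?s \<and> \<not> pend i s'"
        using label_tilde_child(1,2)[of ?ss ?m i, unfolded nth, OF ok'[unfolded s'] ml i nl] lts jB MB
        unfolding s' by simp
      then show ?thesis using pds CP d by simp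
    next
      case 3
      have nth: "ss[k := u] ! m = ss ! m" using 3 by simp
      have "plabels (PBranch (ss[k := u])) = insert j ?C"
        using plabels_insertions[OF in'] unfolding 3 .
      then have "label_tilde i s' = label_tilde i ?s \<and> \<not> pend i s'"
        using label_tilde_child(1,2)[of "ss[k := u]" m i, unfolded nth] ok' m i nl lts jB MB
        unfolding 3 by simp
      moreover have "cluster d \<subseteq> plabels (ss ! k)" "cluster d \<noteq> {}"
        using cluster_insertions[OF ok_nth[OF ok 3(1)] 3(3)] by auto
      ultimately show ?thesis using pds other[OF 3(1,2)] P(2) by auto
    next
      case 4
      have "(d, u) \<in># insertions j (ss ! m)" using 4(1) S by simp
      note c = ch_prop[OF this 4(2)]
      have "label_tilde i u = label_tilde i (ss ! m)" "pend i u = pend i (ss ! m)" "cluster d \<noteq> {i}"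
        "parent_degree i (ss ! m) = 2 \<longrightarrow> cluster d \<noteq> ?P"
        using S 4(1) by blast+
      then show ?thesis using c lts pds unfolding par by simp
    qed
  qed
  \<comment> \<open>Clusters inside a sibling do not contain \<open>i\<close>, so they differ from
    the parent cluster and nothing is stripped.\<close>
  have Lc: "strip i ?P d = d" if "(d, u) \<in># insertions j (ss ! k)" "k < length ss" "k \<noteq> m" for d u k
    using cluster_insertions[OF ok_nth[OF ok that(2)] that(1)] other[OF that(2,3)] P(2)
    by (intro strip_id) auto
  have img: "image_mset (map_prod (strip i ?P) (delete_leaf i)) R = insertions j (delete_leaf i ?s)"
  proof -
    let ?F = "map_prod (strip i ?P) (delete_leaf i)"
    let ?ss = "ss[m := ?D]"
    have e: "?F ?edge = (E False (plabels (PBranch ?ss)), PBranch [PBranch ?ss, PLeaf j])"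
    proof -
      have "delete_leaf i (PBranch [?s, PLeaf j]) = PBranch (([?s, PLeaf j])[0 := delete_leaf i ([?s, PLeaf j] ! 0)])"
        using delete_neq[OF ok iC] ij by (intro delete_leaf_child) (auto simp: less_Suc_eq)
      then show ?thesis by (simp add: del labdel)
    qed
    have l: "?F (?loc l) = (V (l = length ?ss - 2) (plabels (PBranch ?ss)) (length ?ss), PBranch (take (l + 2) ?ss @ PLeaf j # drop (l + 2) ?ss))"
      if l: "l < length ss - 1" for l
    proof -
      let ?m = "if m < l + 2 then m else Suc m" and ?t = "take (l + 2) ss @ PLeaf j # drop (l + 2) ss"
      have in': "(V (l = length ss - 2) ?C (length ss), PBranch ?t) \<in># insertions j ?s"
        unfolding in_insertions_PBranch using l by blast
      have okt: "ok (PBranch ?t)" using ok_insertions[OF ok j in'] .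
      have nth: "?t ! ?m = ss ! m" by (rule insert_nth_pos[OF m])
      have ml: "?m < length ?t" using m by auto
      have "delete_leaf i (PBranch ?t) = PBranch (?t[?m := delete_leaf i (?t ! ?m)])"
      proof (rule delete_leaf_child)
        show "2 \<le> length ?t" using okt unfolding ok_PBranch by blast
        show "two (?t ! k) \<and> i \<notin> plabels (?t ! k)" if k: "k < length ?t" "k \<noteq> ?m" for k
          using ok_two[OF ok_nth[OF okt k(1)]] ok_disj_nth[OF okt ml k(1)] k(2) i unfolding nth by blast
        show "delete_leaf i (?t ! ?m) \<noteq> PLeaf i" unfolding nth using delete_neq[OF ok_nth[OF ok m] i nl] .
      qed (rule ml)
      then show ?thesis using CP unfolding nth insert_update_pos[OF m] labdel by simp
    qed
    have k: "image_mset ?F (?ch k (insertions j (ss ! k))) = image_mset (apsnd (\<lambda>u. PBranch (?ss[k := u]))) (insertions j (?ss ! k))"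
      if k: "k < length ss" "k \<noteq> m" for k
    proof -
      have "delete_leaf i (PBranch (ss[k := u])) = PBranch (?ss[k := u])" if u: "(d, u) \<in># insertions j (ss ! k)" for d u
      proof -
        have "delete_leaf i (PBranch (ss[k := u])) = PBranch ((ss[k := u])[m := delete_leaf i (ss[k := u] ! m)])"
        proof (rule delete_leaf_child)
          have u2: "two u" using ok_two[OF ok_insertions[OF ok_nth[OF ok k(1)] _ u]] other[OF k] by blast
          show "two (ss[k := u] ! l) \<and> i \<notin> plabels (ss[k := u] ! l)" if "l < length (ss[k := u])" "l \<noteq> m" for l
            using other[of l] that u2 plabels_insertions[OF u] other[OF k] ij by (cases "l = k") auto
        qed (use len m k delete_neq[OF ok_nth[OF ok m] i nl] in auto)
        then show ?thesis using k by (simp add: list_update_swap)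
      qed
      then show ?thesis using k Lc[OF _ k] unfolding multiset.map_comp
        by (auto intro!: image_mset_cong)
    qed
    have r: "image_mset ?F (?ch m R0) = image_mset (apsnd (\<lambda>u. PBranch (?ss[m := u]))) (insertions j (?ss ! m))"
    proof -
      have "image_mset (apsnd (\<lambda>u. PBranch (?ss[m := u]))) (insertions j (?ss ! m))
         = image_mset (apsnd (\<lambda>u. PBranch (?ss[m := u]))) (image_mset ?F R0)"
        using S m by simp
      also have "\<dots> = image_mset ?F (?ch m R0)"
        unfolding multiset.map_comp
      proof (rule image_mset_cong)
        fix x assume x: "x \<in># R0"
        obtain d u where du: "x = (d, u)" by (cases x)
        then have "(d, u) \<in># insertions j (ss ! m)" using x S by simp
        then show "(apsnd (\<lambda>u. PBranch (?ss[m := u])) \<circ> ?F) x = (?F \<circ> apsnd (\<lambda>u. PBranch (ss[m := u]))) x"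
          using ch_prop[of d u] unfolding du by simp
      qed
      finally show ?thesis by simp
    qed
    have "insertions j (delete_leaf i ?s) = {#?F ?edge#} + (\<Sum>l<length ss - 1. {#?F (?loc l)#}) +
        (image_mset ?F (?ch m R0) + (\<Sum>k\<in>{..<length ss} - {m}. image_mset ?F (?ch k (insertions j (ss ! k)))))"
    proof -
      have m': "m \<in> {..<length ?ss}" using m by simp
      have 1: "(\<Sum>l<length ss - 1. {#?F (?loc l)#}) = (\<Sum>l<length ?ss - 1. {#(V (l = length ?ss - 2) (plabels (PBranch ?ss)) (length ?ss), PBranch (take (l + 2) ?ss @ PLeaf j # drop (l + 2) ?ss))#})"
        by (rule sum.cong) (use l in \<open>simp_all only: length_list_update lessThan_iff\<close>)
      have 2: "(\<Sum>k\<in>{..<length ss} - {m}. image_mset ?F (?ch k (insertions j (ss ! k)))) =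
         (\<Sum>k\<in>{..<length ?ss} - {m}. image_mset (apsnd (\<lambda>u. PBranch (?ss[k := u]))) (insertions j (?ss ! k)))"
        by (rule sum.cong) (use k in auto)
      show ?thesis unfolding del insertions_PBranch sum.remove[OF finite_lessThan m'] e 1 2 r ..
    qed
    then show ?thesis unfolding R_def by (simp add: image_mset_sum add_ac)
  qed
  have "image_mset fst X = lost i ?s"
  proof -
    have "image_mset fst X = image_mset fst X0" unfolding X_def multiset.map_comp
      by (rule image_mset_cong) auto
    then show ?thesis using S unfolding lost_def par by simp
  qed
  then have "splits i j ?s X R"
    unfolding splits_def par(1) using ins X R img by blast
  then show ?thesis by blast
qed

lemma ordered_of_sp: "sp (PBranch ss) \<Longrightarrow> ordered ss"
  by (simp add: sp_PBranch)

section \<open>Insertions when the leaf is a child of the top branch point\<close>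

lemma label_set_ne:
  assumes "ok (PBranch ss)" "m < length ss" "ss ! m = PLeaf i"
  shows "plabels (PBranch ss) - {i} \<noteq> {}" "finite (plabels (PBranch ss) - {i})" "i \<in> plabels (PBranch ss)"
proof -
  have i: "plabels (ss ! m) = {i}" using assms(3) by simp
  have "2 \<le> length ss" using assms(1) by (simp add: ok_PBranch)
  then have k: "(if m = 0 then 1 else 0) < length ss" "(if m = 0 then 1 else 0) \<noteq> m" by auto
  have "plabels (ss ! (if m = 0 then 1 else 0)) \<noteq> {}" using plabels_ne[OF ok_nth[OF assms(1) k(1)]] .
  then show "plabels (PBranch ss) - {i} \<noteq> {}"
    using ok_disj_nth[OF assms(1) k(1) assms(2) k(2)] nth_in_plabels[OF k(1)] unfolding i by blast
  show "i \<in> plabels (PBranch ss)" using nth_in_plabels[OF assms(2)] unfolding i by blast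
qed (simp add: finite_plabels)

lemma Min_labels_insert:
  assumes "ok (PBranch ss)" "m < length ss" "ss ! m = PLeaf i" "\<forall>x\<in>plabels (PBranch ss). x < j"
    and "(d, s') \<in># insertions j (PBranch ss)"
  shows "Min (plabels s' - {i}) = Min (plabels (PBranch ss) - {i})" "Min (plabels (PBranch ss) - {i}) < j" "i < j"
proof -
  note ne = label_set_ne[OF assms(1-3)]
  show ij: "i < j" using assms(4) ne(3) by blast
  show "Min (plabels (PBranch ss) - {i}) < j" using Min_in[OF ne(2,1)] assms(4) by blast
  have "plabels s' - {i} = insert j (plabels (PBranch ss) - {i})"
    unfolding plabels_insertions[OF assms(5)] using ij by auto
  then show "Min (plabels s' - {i}) = Min (plabels (PBranch ss) - {i})"
    using Min_insert_big[OF ne(1,2)] assms(4) by simp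
qed

text \<open>By \<open>label_tilde_direct\<close> the label tilde is a function of \<open>a\<close>,
  of whether the parent is binary, and of one neighbour's least label; it suffices that the
  insertion preserves these three.\<close>

lemma direct_keep:
  assumes "ok (PBranch ss)" "sp (PBranch ss)" "\<forall>x\<in>plabels (PBranch ss). x < j"
    and "m < length ss" "ss ! m = PLeaf i"
    and "(d, PBranch ss') \<in># insertions j (PBranch ss)" "m' < length ss'" "ss' ! m' = PLeaf i"
    and "length ss' = 2 \<longleftrightarrow> length ss = 2"
    and "length ss \<noteq> 2 \<Longrightarrow> least (ss' ! (if m' < 2 then 2 else m' - 1)) = least (ss ! (if m < 2 then 2 else m - 1))"
  shows "label_tilde i (PBranch ss') = label_tilde i (PBranch ss) \<and> pend i (PBranch ss') = pend i (PBranch ss)"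
proof -
  have j: "j \<notin> plabels (PBranch ss)" using assms(3) by blast
  have ok': "ok (PBranch ss')" "ordered ss'"
    using ok_insertions[OF assms(1) j assms(6)] sp_insertions[OF assms(1-3,6)] ordered_of_sp by auto
  show ?thesis
    using label_tilde_direct(1,2)[OF ok' assms(7,8)] label_tilde_direct(1,2)[OF assms(1) ordered_of_sp[OF assms(2)] assms(4,5)]
      Min_labels_insert(1)[OF assms(1,4,5,3,6)] assms(9,10) by (simp add: Let_def)
qed

text \<open>Here the new leaf is the neighbour that determines \<open>b\<close>, and
  \<open>j\<close> exceeds all other candidates.\<close>

lemma direct_new:
  assumes "ok (PBranch ss)" "sp (PBranch ss)" "\<forall>x\<in>plabels (PBranch ss). x < j"
    and "m < length ss" "ss ! m = PLeaf i"
    and "(d, PBranch ss') \<in># insertions j (PBranch ss)" "m' < length ss'" "ss' ! m' = PLeaf i"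
    and "length ss' \<noteq> 2" "ss' ! (if m' < 2 then 2 else m' - 1) = PLeaf j"
  shows "label_tilde i (PBranch ss') = j"
proof -
  have j: "j \<notin> plabels (PBranch ss)" using assms(3) by blast
  have ok': "ok (PBranch ss')" "ordered ss'"
    using ok_insertions[OF assms(1) j assms(6)] sp_insertions[OF assms(1-3,6)] ordered_of_sp by auto
  have "least (PLeaf j) = j" by (simp add: least_def)
  then show ?thesis
    using label_tilde_direct(1)[OF ok' assms(7,8)] Min_labels_insert[OF assms(1,4,5,3,6)] assms(9,10) by (simp add: Let_def)
qed

lemma label_tilde_pair:
  "i < j \<Longrightarrow> label_tilde i (PBranch [PLeaf i, PLeaf j]) = j \<and> pend i (PBranch [PLeaf i, PLeaf j])"
proof -
  assume "i < j"
  moreover have "ok (PBranch [PLeaf i, PLeaf j])" "ordered [PLeaf i, PLeaf j]" if "i < j"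
    using that by (auto simp: ok_PBranch ordered_def least_def)
  moreover have "plabels (PBranch [PLeaf i, PLeaf j]) - {i} = {j}" if "i < j" using that by (auto simp: ptree.set(2))
  ultimately show ?thesis using label_tilde_direct(1,2)[of "[PLeaf i, PLeaf j]" 0 i] by simp
qed

text \<open>At the external edge of \<open>i\<close> the new leaf forms the whole first spinal bush,
  so \<open>a = j\<close>; the second bush only contributes a smaller label.\<close>

lemma pair_new:
  assumes "ok (PBranch ss)" "\<forall>x\<in>plabels (PBranch ss). x < j" "m < length ss" "ss ! m = PLeaf i"
  shows "label_tilde i (PBranch (ss[m := PBranch [PLeaf i, PLeaf j]])) = j"
    "(E True {i}, PBranch (ss[m := PBranch [PLeaf i, PLeaf j]])) \<in># insertions j (PBranch ss)"
proof -
  let ?u = "PBranch [PLeaf i, PLeaf j]"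
  have j: "j \<notin> plabels (PBranch ss)" using assms(2) by blast
  note ne = label_set_ne[OF assms(1,3,4)]
  have ij: "i < j" using assms(2) ne(3) by blast
  show in': "(E True {i}, PBranch (ss[m := ?u])) \<in># insertions j (PBranch ss)"
    unfolding in_insertions_PBranch using assms(3,4) by force
  have ok': "ok (PBranch (ss[m := ?u]))" using ok_insertions[OF assms(1) j in'] .
  have nth: "ss[m := ?u] ! m = ?u" using assms(3) by simp
  have pu: "plabels ?u = {i, j}" by (auto simp: ptree.set(2))
  have "plabels (PBranch (ss[m := ?u])) - plabels ?u = plabels (PBranch ss) - {i}"
    unfolding plabels_insertions[OF in'] pu using j by auto
  moreover have "Min (plabels (PBranch ss) - {i}) < j" using Min_in[OF ne(2,1)] assms(2) by blast
  ultimately show "label_tilde i (PBranch (ss[m := ?u])) = j"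
    using label_tilde_child(1)[OF ok', of m i, unfolded nth] assms(3) pu label_tilde_pair[OF ij] by simp
qed

text \<open>On the edge below the parent of \<open>i\<close>, the new leaf is the whole second
  spinal bush. This bush decides \<open>b\<close> when the parent is binary and is ignored when the
  parent is larger.\<close>

lemma edge_direct:
  assumes "ok (PBranch ss)" "sp (PBranch ss)" "\<forall>x\<in>plabels (PBranch ss). x < j" "m < length ss" "ss ! m = PLeaf i"
  shows "length ss = 2 \<Longrightarrow> label_tilde i (PBranch [PBranch ss, PLeaf j]) = j"
    "length ss \<noteq> 2 \<Longrightarrow> label_tilde i (PBranch [PBranch ss, PLeaf j]) = label_tilde i (PBranch ss) \<and>
      pend i (PBranch [PBranch ss, PLeaf j]) = pend i (PBranch ss)"
    "ok (PBranch [PBranch ss, PLeaf j])"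
proof -
  have j: "j \<notin> plabels (PBranch ss)" using assms(3) by blast
  note ne = label_set_ne[OF assms(1,4,5)]
  have in': "(E False (plabels (PBranch ss)), PBranch [PBranch ss, PLeaf j]) \<in># insertions j (PBranch ss)"
    unfolding in_insertions_PBranch by blast
  show ok': "ok (PBranch [PBranch ss, PLeaf j])" using ok_insertions[OF assms(1) j in'] .
  have l: "plabels (PBranch [PBranch ss, PLeaf j]) - plabels (PBranch ss) = {j}"
    unfolding plabels_insertions[OF in'] using j by auto
  have ij: "i < j" "Min (plabels (PBranch ss) - {i}) < j" using Min_labels_insert(2,3)[OF assms(1,4,5,3) in'] by auto
  note c = label_tilde_child(1,2)[OF ok', of 0 i, simplified, OF ne(3)] and e = label_tilde_direct[OF assms(1) ordered_of_sp[OF assms(2)] assms(4,5)]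
  show "label_tilde i (PBranch [PBranch ss, PLeaf j]) = j" if "length ss = 2"
    using c e that ij l by (simp add: Let_def)
  show "label_tilde i (PBranch [PBranch ss, PLeaf j]) = label_tilde i (PBranch ss) \<and>
      pend i (PBranch [PBranch ss, PLeaf j]) = pend i (PBranch ss)" if "length ss \<noteq> 2"
    using c e that by simp
qed

lemma delete_direct:
  assumes "ok (PBranch (xs @ PLeaf i # ys))"
  shows "2 \<le> length (xs @ ys) \<Longrightarrow> delete_leaf i (PBranch (xs @ PLeaf i # ys)) = PBranch (xs @ ys)"
    "xs @ ys = [u] \<Longrightarrow> delete_leaf i (PBranch (xs @ PLeaf i # ys)) = u"
proof -
  have o: "two u \<and> i \<notin> plabels u" if "u \<in> set (xs @ ys)" for u
    using assms that ok_two[of u] unfolding ok_PBranch disj_append_mid by auto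
  show "2 \<le> length (xs @ ys) \<Longrightarrow> delete_leaf i (PBranch (xs @ PLeaf i # ys)) = PBranch (xs @ ys)"
    using o by (intro delete_leaf_direct2)
  have "delete_leaf i (PBranch (xs @ PLeaf i # ys)) = (case xs @ ys of [u] \<Rightarrow> u | us \<Rightarrow> PBranch us)"
    by (rule delete_leaf_direct) (use o in blast)
  then show "xs @ ys = [u] \<Longrightarrow> delete_leaf i (PBranch (xs @ PLeaf i # ys)) = u" by simp
qed

lemma delete_pair:
  assumes "ok (PBranch (xs @ PBranch [PLeaf i, PLeaf j] # ys))" "1 \<le> length (xs @ ys)" "i \<noteq> j"
  shows "delete_leaf i (PBranch (xs @ PBranch [PLeaf i, PLeaf j] # ys)) = PBranch (xs @ PLeaf j # ys)"
proof -
  let ?ss = "xs @ PBranch [PLeaf i, PLeaf j] # ys" and ?m = "length xs"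
  have d: "delete_leaf i (PBranch [PLeaf i, PLeaf j]) = PLeaf j"
    using delete_direct(2)[of "[]" i "[PLeaf j]" "PLeaf j"] assms(3) by (simp add: ok_PBranch)
  have nth: "?ss ! ?m = PBranch [PLeaf i, PLeaf j]" by simp
  have i: "i \<in> plabels (?ss ! ?m)" by (simp add: ptree.set(2))
  have "delete_leaf i (PBranch ?ss) = PBranch (?ss[?m := delete_leaf i (?ss ! ?m)])"
  proof (rule delete_leaf_child)
    show "two (?ss ! k) \<and> i \<notin> plabels (?ss ! k)" if k: "k < length ?ss" "k \<noteq> ?m" for k
      using ok_two[OF ok_nth[OF assms(1) k(1)]] ok_disj_nth[OF assms(1) _ k(1) _ i] k(2) by auto
  qed (use assms(2,3) d in auto)
  then show ?thesis using d by simp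
qed

text \<open>With the leaf \<open>i\<close> as \<open>x\<close>, this treats both places of
  \<open>i\<close> among the two leftmost subtrees at once.\<close>

definition fr :: "bool \<Rightarrow> nat ptree \<Rightarrow> nat ptree \<Rightarrow> nat ptree list \<Rightarrow> nat ptree list" where
  "fr b x y us = (if b then x # y # us else y # x # us)"

lemma insertions_fr:
  "insertions j (PBranch (fr b x y us)) =
     {#(E False (plabels (PBranch (fr b x y us))), PBranch [PBranch (fr b x y us), PLeaf j])#}
   + (\<Sum>l\<le>length us. {#(V (l = length us) (plabels (PBranch (fr b x y us))) (length us + 2),
        PBranch (fr b x y (take l us @ PLeaf j # drop l us)))#})
   + image_mset (apsnd (\<lambda>z. PBranch (fr b z y us))) (insertions j x)
   + image_mset (apsnd (\<lambda>z. PBranch (fr b x z us))) (insertions j y)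
   + (\<Sum>k<length us. image_mset (apsnd (\<lambda>z. PBranch (fr b x y (us[k := z])))) (insertions j (us ! k)))"
proof (cases b)
  case True
  show ?thesis unfolding fr_def if_P[OF True] by (rule insertions_two)
next
  case False
  show ?thesis unfolding fr_def if_not_P[OF False] unfolding insertions_two by (rule swap34)
qed

text \<open>For the list that is left when one of the first two children has been deleted: the head
  of \<open>us\<close> is now the second subtree, which explains the shift by
  \<open>Suc\<close>.\<close>

lemma insertions_one:
  assumes "us \<noteq> []"
  shows "insertions j (PBranch (w # us)) =
     {#(E False (plabels (PBranch (w # us))), PBranch [PBranch (w # us), PLeaf j])#}
   + (\<Sum>l<length us. {#(V (Suc l = length us) (plabels (PBranch (w # us))) (length us + 1),
        PBranch (w # take (Suc l) us @ PLeaf j # drop (Suc l) us))#})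
   + image_mset (apsnd (\<lambda>x. PBranch (x # us))) (insertions j w)
   + (\<Sum>k<length us. image_mset (apsnd (\<lambda>x. PBranch (w # us[k := x]))) (insertions j (us ! k)))"
proof -
  have 1: "(\<Sum>k<length (w # us). image_mset (apsnd (\<lambda>x. PBranch ((w # us)[k := x]))) (insertions j ((w # us) ! k)))
    = image_mset (apsnd (\<lambda>x. PBranch (x # us))) (insertions j w)
   + (\<Sum>k<length us. image_mset (apsnd (\<lambda>x. PBranch (w # us[k := x]))) (insertions j (us ! k)))"
    by (simp add: sum.lessThan_Suc_shift del: sum.lessThan_Suc)
  have 2: "(\<Sum>l<length (w # us) - 1. {#(V (l = length (w # us) - 2) (plabels (PBranch (w # us))) (length (w # us)),
        PBranch (take (l + 2) (w # us) @ PLeaf j # drop (l + 2) (w # us)))#})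
    = (\<Sum>l<length us. {#(V (Suc l = length us) (plabels (PBranch (w # us))) (length us + 1),
        PBranch (w # take (Suc l) us @ PLeaf j # drop (Suc l) us))#})"
    by (rule sum.cong) (use assms in \<open>auto simp: eq_diff_iff\<close>)
  show ?thesis unfolding insertions_PBranch 1 2 by (simp only: add.assoc)
qed

text \<open>The lost location is the first one: a leaf put there is the third subtree from the left
  and hence determines \<open>b\<close>. For a binary parent this is its only location, and the edge
  below it is lost as well.\<close>

lemma splits_front:
  assumes ok: "ok (PBranch (fr b (PLeaf i) w us))" and sp: "sp (PBranch (fr b (PLeaf i) w us))"
    and lt: "\<forall>x\<in>plabels (PBranch (fr b (PLeaf i) w us)). x < j"
  shows "\<exists>X R. splits i j (PBranch (fr b (PLeaf i) w us)) X R"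
proof -
  let ?ss = "fr b (PLeaf i) w us" and ?m = "if b then 0 else 1 :: nat"
  let ?s = "PBranch ?ss" and ?C = "plabels (PBranch (fr b (PLeaf i) w us))" and ?r = "\<lambda>x. if x = j then i else x"
  have j: "j \<notin> ?C" using lt by blast
  have frs: "set (fr b x y zs) = insert x (insert y (set zs))" "length (fr b x y zs) = length zs + 2"
    "fr b x y zs ! 2 = zs ! 0" "fr b x y zs ! ?m = x" "?m < length (fr b x y zs)" "?m < 2" for x y zs
    by (auto simp: fr_def)
  have m: "?m < length ?ss" "?ss ! ?m = PLeaf i" using frs by auto
  note ne = label_set_ne[OF ok m]
  have ij: "i < j" using lt ne(3) by blast
  have sub: "plabels u \<subseteq> ?C - {i}" if "u = w \<or> u \<in> set us" for u
  proof -
    have "u \<in> set ?ss" using that frs(1) by auto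
    moreover have "i \<notin> plabels u"
      using ok that unfolding ok_PBranch fr_def by (auto split: if_splits)
    ultimately show ?thesis by (auto simp: ptree.set(2))
  qed
  have oku: "ok u" "sp u" if "u = w \<or> u \<in> set us" for u
    using ok sp that frs(1) unfolding ok_PBranch sp_PBranch by auto
  have spine: "spine i ?s = [?ss]" using label_tilde_direct(3)[OF ok ordered_of_sp[OF sp] m] .
  have P: "parent_cluster i ?s = ?C" "parent_degree i ?s = length us + 2"
    unfolding parent_cluster_def parent_degree_def spine by (simp_all add: frs)
  have okin: "ok s'" if "(d, s') \<in># insertions j ?s" for d s' using ok_insertions[OF ok j that] .
  let ?edge = "(E False ?C, PBranch [?s, PLeaf j])"
  let ?loc = "\<lambda>l. (V (l = length us) ?C (length us + 2), PBranch (fr b (PLeaf i) w (take l us @ PLeaf j # drop l us)))"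
  let ?pair = "(E True {i}, PBranch (fr b (PBranch [PLeaf i, PLeaf j]) w us))"
  define Rw where "Rw = image_mset (apsnd (\<lambda>z. PBranch (fr b (PLeaf i) z us))) (insertions j w)"
  define Ru where "Ru = (\<Sum>k<length us. image_mset (apsnd (\<lambda>z. PBranch (fr b (PLeaf i) w (us[k := z])))) (insertions j (us ! k)))"
  have ins: "insertions j ?s = {#?edge#} + ({#?loc 0#} + (\<Sum>l<length us. {#?loc (Suc l)#})) + {#?pair#} + Rw + Ru"
    unfolding insertions_fr sum.atMost_shift Rw_def Ru_def by simp
  \<comment> \<open>The renamed leaf may come out on the other side of \<open>w\<close>;
    normalisation removes this difference.\<close>
  have nrm: "normalise (PBranch (fr b' (PLeaf i) w us)) = ?s" for b'
  proof -
    have n: "normalise x = x" if "x \<in> set ?ss" for x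
      using that oku normalise_id[of x] unfolding frs(1) by auto
    show ?thesis
      using normalise_pair[of "PLeaf i" w us] normalise_pair[of w "PLeaf i" us] n ordered_of_sp[OF sp]
      unfolding frs(1) by (cases b; cases b') (auto simp: fr_def)
  qed
  have mp: "map_ptree ?r u = u" if "u = w \<or> u \<in> set us" for u
    using sub[OF that] j by (intro map_ptree_id) auto
  have mps: "map (map_ptree ?r) us = us" using mp by (simp add: map_idI)
  have del: "delete_leaf i (PBranch (fr b (PLeaf i) y zs)) = (if zs = [] then y else PBranch (y # zs))"
    if "ok (PBranch (fr b (PLeaf i) y zs))" for y zs
  proof (cases b)
    case True
    then show ?thesis
      using delete_direct[of "[]" i "y # zs"] that by (cases zs) (auto simp: fr_def)
  next
    case False
    then show ?thesis
      using delete_direct[of "[y]" i zs] that by (cases zs) (auto simp: fr_def)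
  qed
  \<comment> \<open>Once \<open>i\<close> is removed, \<open>w\<close> and the new leaf are the two
    leftmost subtrees, and renaming \<open>j\<close> to \<open>i\<close> restores the pair up to
    order.\<close>
  have X1: "label_tilde i (snd (?loc 0)) = j \<and> normalise (map_ptree ?r (delete_leaf i (snd (?loc 0)))) = ?s"
  proof -
    have in': "?loc 0 \<in># insertions j ?s" unfolding ins by simp
    have "delete_leaf i (snd (?loc 0)) = PBranch (w # PLeaf j # us)"
      using del[of w "PLeaf j # us"] okin[of "fst (?loc 0)" "snd (?loc 0)"] in' by simp
    then have "map_ptree ?r (delete_leaf i (snd (?loc 0))) = PBranch (fr False (PLeaf i) w us)"
      using mp mps by (simp add: fr_def)
    moreover have "label_tilde i (PBranch (fr b (PLeaf i) w (PLeaf j # us))) = j"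
      by (rule direct_new[OF ok sp lt m, of "fst (?loc 0)" _ ?m]) (use in' frs in auto)
    ultimately show ?thesis using nrm by simp
  qed
  have X2: "label_tilde i (snd ?pair) = j \<and> normalise (map_ptree ?r (delete_leaf i (snd ?pair))) = ?s"
  proof -
    have in': "?pair \<in># insertions j ?s" unfolding ins by simp
    have up: "fr b (PBranch [PLeaf i, PLeaf j]) w us = ?ss[?m := PBranch [PLeaf i, PLeaf j]]" by (simp add: fr_def)
    have okp: "ok (PBranch (fr b (PBranch [PLeaf i, PLeaf j]) w us))" using okin[OF in'] .
    have "delete_leaf i (snd ?pair) = PBranch (fr b (PLeaf j) w us)"
      using delete_pair[of "[]" i j "w # us"] delete_pair[of "[w]" i j us] okp ij by (cases b) (auto simp: fr_def)
    then have "map_ptree ?r (delete_leaf i (snd ?pair)) = PBranch (fr b (PLeaf i) w us)"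
      using mp mps by (simp add: fr_def)
    then show ?thesis using nrm pair_new(1)[OF ok lt m] up by simp
  qed
  \<comment> \<open>The binary parent is suppressed, and the new branch point with children
    \<open>w\<close> and \<open>j\<close> takes over its role.\<close>
  have X3: "label_tilde i (snd ?edge) = j \<and> normalise (map_ptree ?r (delete_leaf i (snd ?edge))) = ?s" if "us = []"
  proof -
    have 1: "delete_leaf i ?s = w" using del[OF ok] that by simp
    have "delete_leaf i (PBranch [?s, PLeaf j]) = PBranch (([?s, PLeaf j])[0 := delete_leaf i ([?s, PLeaf j] ! 0)])"
      using sub[of w] 1 ij by (intro delete_leaf_child) (auto simp: less_Suc_eq)
    then have "map_ptree ?r (delete_leaf i (snd ?edge)) = PBranch (fr False (PLeaf i) w us)"
      using 1 mp that by (simp add: fr_def)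
    then show ?thesis using nrm edge_direct(1)[OF ok sp lt m] that frs by simp
  qed
  have cl: "cluster d \<subseteq> ?C - {i} \<and> cluster d \<noteq> {}" if "u = w \<or> u \<in> set us" "(d, z) \<in># insertions j u" for d z u
    using cluster_insertions[OF oku(1)[OF that(1)] that(2)] sub[OF that(1)] by blast
  have le: "least z = least u" if "u = w \<or> u \<in> set us" "(d, z) \<in># insertions j u" for d z u
    using least_insertions[OF that(2) plabels_ne[OF oku(1)[OF that(1)]]] sub[OF that(1)] lt by blast
  have st: "strip i ?C d = d" if "u = w \<or> u \<in> set us" "(d, z) \<in># insertions j u" for d z u
    using cl[OF that] ne(3) by (intro strip_id) auto
  have Rkeep: "label_tilde i s' = label_tilde i ?s \<and> pend i s' = pend i ?s \<and> cluster d \<noteq> {i} \<and> cluster d \<noteq> ?C"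
    if dR: "(d, s') \<in># Rw + Ru" for d s'
  proof -
    have in': "(d, s') \<in># insertions j ?s" using dR unfolding ins by auto
    have keep: "label_tilde i s' = label_tilde i ?s \<and> pend i s' = pend i ?s"
      if "s' = PBranch (fr b (PLeaf i) y zs)" "length zs = length us" "us \<noteq> [] \<Longrightarrow> least (zs ! 0) = least (us ! 0)" for y zs
    proof -
      have "(d, PBranch (fr b (PLeaf i) y zs)) \<in># insertions j ?s" using in' that by simp
      from direct_keep[OF ok sp lt m this frs(5,4)] that frs show ?thesis by (cases us) auto
    qed
    consider z where "(d, z) \<in># insertions j w" "s' = PBranch (fr b (PLeaf i) z us)"
      | k z where "k < length us" "(d, z) \<in># insertions j (us ! k)" "s' = PBranch (fr b (PLeaf i) w (us[k := z]))"
      using dR unfolding Rw_def Ru_def by (auto simp: in_sum_mset_iff in_image_apsnd)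
    then show ?thesis
    proof cases
      case 1
      then show ?thesis using keep[of z us] cl[of w d z] ne(3) by auto
    next
      case 2
      have "least (us[k := z] ! 0) = least (us ! 0)" using le[of "us ! k" d z] 2 by (cases "k = 0") auto
      then show ?thesis using keep[of w "us[k := z]"] cl[of "us ! k" d z] ne(3) 2 by auto
    qed
  qed
  let ?F = "map_prod (strip i ?C) (delete_leaf i)"
  have Fw: "image_mset ?F Rw = image_mset (apsnd (\<lambda>z. if us = [] then z else PBranch (z # us))) (insertions j w)"
    unfolding Rw_def multiset.map_comp
  proof (rule image_mset_cong)
    fix x assume x: "x \<in># insertions j w"
    obtain d z where dz: "x = (d, z)" by (cases x)
    have "(d, PBranch (fr b (PLeaf i) z us)) \<in># insertions j ?s"
      using x dz unfolding ins Rw_def by (auto simp: in_image_apsnd)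
    then show "(?F \<circ> apsnd (\<lambda>z. PBranch (fr b (PLeaf i) z us))) x = apsnd (\<lambda>z. if us = [] then z else PBranch (z # us)) x"
      using del[OF okin] st[of w d z] x dz by simp
  qed
  have Fu: "image_mset ?F (image_mset (apsnd (\<lambda>z. PBranch (fr b (PLeaf i) w (us[k := z])))) (insertions j (us ! k)))
     = image_mset (apsnd (\<lambda>z. PBranch (w # us[k := z]))) (insertions j (us ! k))" if k: "k < length us" for k
    unfolding multiset.map_comp
  proof (rule image_mset_cong)
    fix x assume x: "x \<in># insertions j (us ! k)"
    obtain d z where dz: "x = (d, z)" by (cases x)
    have "(d, PBranch (fr b (PLeaf i) w (us[k := z]))) \<in># insertions j ?s"
      using x dz k unfolding ins Ru_def by (auto simp: in_image_apsnd in_sum_mset_iff)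
    then show "(?F \<circ> apsnd (\<lambda>z. PBranch (fr b (PLeaf i) w (us[k := z])))) x = apsnd (\<lambda>z. PBranch (w # us[k := z])) x"
      using del[OF okin] st[of "us ! k" d z] x dz k by auto
  qed
  show ?thesis
  proof (cases "us = []")
    case True
    \<comment> \<open>With two children, \<open>?loc 0\<close> is also the rightmost location, as
      \<open>V True\<close> in \<open>lost\<close> requires.\<close>
    define X where "X = {#?pair, ?edge, ?loc 0#}"
    have "image_mset fst X = lost i ?s" unfolding X_def lost_def P using True by simp
    moreover have "insertions j ?s = X + Rw" unfolding ins X_def Ru_def using True by simp
    moreover have "label_tilde i s' = j \<and> normalise (map_ptree ?r (delete_leaf i s')) = ?s" if "(d, s') \<in># X" for d s'
      using that X1 X2 X3[OF True] unfolding X_def by auto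
    moreover have "label_tilde i s' = label_tilde i ?s \<and> pend i s' = pend i ?s \<and> cluster d \<noteq> {i} \<and> cluster d \<noteq> ?C"
      if "(d, s') \<in># Rw" for d s' using Rkeep[of d s'] that by simp
    moreover have "image_mset ?F Rw = insertions j (delete_leaf i ?s)"
    proof -
      have "apsnd (\<lambda>z. z) = (id :: desc \<times> nat ptree \<Rightarrow> _)" by (rule ext) auto
      then show ?thesis unfolding Fw using True del[OF ok] by simp
    qed
    ultimately have "splits i j ?s X Rw" unfolding splits_def P(1) by blast
    then show ?thesis by blast
  next
    case False
    \<comment> \<open>With three or more children, \<open>?loc 0\<close> is not the rightmost
      location, in agreement with \<open>V False\<close> in \<open>lost\<close>.\<close>
    define X where "X = {#?pair, ?loc 0#}"
    define R where "R = {#?edge#} + (\<Sum>l<length us. {#?loc (Suc l)#}) + Rw + Ru"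
    have D: "delete_leaf i ?s = PBranch (w # us)" using del[OF ok] False by simp
    have lD: "plabels (PBranch (w # us)) = ?C - {i}"
      using plabels_delete[OF ok ne(3)] unfolding D by simp
    have "image_mset fst X = lost i ?s" unfolding X_def lost_def P using False by simp
    moreover have "insertions j ?s = X + R" unfolding ins X_def R_def by simp
    moreover have "label_tilde i s' = j \<and> normalise (map_ptree ?r (delete_leaf i s')) = ?s" if "(d, s') \<in># X" for d s'
      using that X1 X2 unfolding X_def by auto
    moreover have "label_tilde i s' = label_tilde i ?s \<and> pend i s' = pend i ?s \<and> cluster d \<noteq> {i}"
      if dR: "(d, s') \<in># R" for d s'
    proof -
      have in': "(d, s') \<in># insertions j ?s" using dR unfolding ins R_def by auto
      have Ci: "?C \<noteq> {i}" using ne(1) by auto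
      consider "d = E False ?C" "s' = PBranch [?s, PLeaf j]" | l where "l < length us" "(d, s') = ?loc (Suc l)" | "(d, s') \<in># Rw + Ru"
        using dR unfolding R_def by (auto simp: in_sum_mset_iff)
      then show ?thesis
      proof cases
        case 1
        then show ?thesis using edge_direct(2)[OF ok sp lt m] False frs Ci by simp
      next
        case 2
        let ?zs = "take (Suc l) us @ PLeaf j # drop (Suc l) us"
        have s': "s' = PBranch (fr b (PLeaf i) w ?zs)" and d: "cluster d = ?C" using 2 by auto
        have "label_tilde i s' = label_tilde i ?s \<and> pend i s' = pend i ?s"
          unfolding s' by (rule direct_keep[OF ok sp lt m in'[unfolded s'] frs(5,4)]) (use frs False in \<open>auto simp: nth_append\<close>)
        then show ?thesis using d Ci by simp
      next
        case 3
        then show ?thesis using Rkeep by blast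
      qed
    qed
    moreover have "image_mset ?F R = insertions j (delete_leaf i ?s)"
    proof -
      have e: "?F ?edge = (E False (?C - {i}), PBranch [PBranch (w # us), PLeaf j])"
      proof -
        have "delete_leaf i (PBranch [?s, PLeaf j]) = PBranch (([?s, PLeaf j])[0 := delete_leaf i ([?s, PLeaf j] ! 0)])"
          using delete_neq[OF ok ne(3)] ij by (intro delete_leaf_child) (auto simp: less_Suc_eq)
        then show ?thesis using D by simp
      qed
      \<comment> \<open>The location with index \<open>Suc l\<close> becomes the one with index
        \<open>l\<close>; the rightmost remains rightmost.\<close>
      have l: "?F (?loc (Suc l)) = (V (Suc l = length us) (?C - {i}) (length us + 1), PBranch (w # take (Suc l) us @ PLeaf j # drop (Suc l) us))"
        if l: "l < length us" for l
      proof -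
        have "?loc (Suc l) \<in># insertions j ?s" unfolding ins using l by (auto simp: in_sum_mset_iff)
        then show ?thesis using del[OF okin] by simp
      qed
      have 1: "(\<Sum>l<length us. {#?F (?loc (Suc l))#}) = (\<Sum>l<length us. {#(V (Suc l = length us) (?C - {i}) (length us + 1), PBranch (w # take (Suc l) us @ PLeaf j # drop (Suc l) us))#})"
        by (rule sum.cong) (use l in \<open>simp_all only: lessThan_iff\<close>)
      have 2: "image_mset ?F Ru = (\<Sum>k<length us. image_mset (apsnd (\<lambda>x. PBranch (w # us[k := x]))) (insertions j (us ! k)))"
        unfolding Ru_def image_mset_sum[OF finite_lessThan] by (rule sum.cong) (use Fu in auto)
      have 3: "image_mset ?F Rw = image_mset (apsnd (\<lambda>x. PBranch (x # us))) (insertions j w)"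
        unfolding Fw using False by simp
      show ?thesis unfolding D insertions_one[OF False] lD R_def image_mset_union image_mset_single image_mset_sum[OF finite_lessThan] e 1 2 3 ..
    qed
    ultimately have "splits i j ?s X R" unfolding splits_def P(1) using P(2) False by simp
    then show ?thesis by blast
  qed
qed

lemma sum_atMost_mid:
  "(\<Sum>l\<le>p + Suc q. f l) = (\<Sum>l<p. f l) + f p + (\<Sum>l\<le>q. f (Suc (p + l)))"
  "(\<Sum>l\<le>p + q. f l) = (\<Sum>l<p. f l) + (\<Sum>l\<le>q. f (p + l))"
  "(\<Sum>l<p + Suc q. f l) = (\<Sum>l<p. f l) + f p + (\<Sum>l<q. f (Suc (p + l)))"
  "(\<Sum>l<p + q. f l) = (\<Sum>l<p. f l) + (\<Sum>l<q. f (p + l))"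
  for f :: "nat \<Rightarrow> 'a :: comm_monoid_add"
proof -
  show 4: "(\<Sum>l<p + q. f l) = (\<Sum>l<p. f l) + (\<Sum>l<q. f (p + l))" for q
    by (induction q) (auto simp: add_ac)
  show 2: "(\<Sum>l\<le>p + q. f l) = (\<Sum>l<p. f l) + (\<Sum>l\<le>q. f (p + l))" for q
    using 4[of "Suc q"] by (simp add: lessThan_Suc_atMost del: sum.lessThan_Suc)
  show "(\<Sum>l\<le>p + Suc q. f l) = (\<Sum>l<p. f l) + f p + (\<Sum>l\<le>q. f (Suc (p + l)))"
    unfolding 2 by (simp add: sum.atMost_Suc_shift add.assoc del: sum.atMost_Suc)
  show "(\<Sum>l<p + Suc q. f l) = (\<Sum>l<p. f l) + f p + (\<Sum>l<q. f (Suc (p + l)))"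
    unfolding 4 by (simp add: sum.lessThan_Suc_shift add.assoc del: sum.lessThan_Suc)
qed

text \<open>The lost location is the one immediately left of \<open>i\<close>: a leaf put there
  becomes the left neighbour that determines \<open>b\<close>. It is never rightmost, since
  \<open>i\<close> stands to its right. The parent has at least three children, so no edge below it
  is lost.\<close>

lemma splits_back:
  assumes ok: "ok (PBranch (u # w # as @ PLeaf i # bs))" and sp: "sp (PBranch (u # w # as @ PLeaf i # bs))"
    and lt: "\<forall>x\<in>plabels (PBranch (u # w # as @ PLeaf i # bs)). x < j"
  shows "\<exists>X R. splits i j (PBranch (u # w # as @ PLeaf i # bs)) X R"
proof -
  let ?ss = "u # w # as @ PLeaf i # bs" and ?p = "length as" and ?q = "length bs"
  let ?m = "length as + 2"
  let ?s = "PBranch ?ss" and ?r = "\<lambda>x. if x = j then i else x"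
  define C where "C = plabels ?s"
  have j: "j \<notin> plabels ?s" using lt by blast
  have m: "?m < length ?ss" "?ss ! ?m = PLeaf i" by auto
  note ne = label_set_ne[OF ok m]
  have ij: "i < j" using lt ne(3) by blast
  have Ci: "C \<noteq> {i}" "i \<in> C" using ne(1,3) unfolding C_def by auto
  have sub: "plabels x \<subseteq> plabels ?s - {i}" if "x \<in> set (u # w # as @ bs)" for x
  proof -
    have "i \<notin> plabels x"
    proof -
      have "disj ((u # w # as) @ PLeaf i # bs)" using ok by (simp add: ok_PBranch)
      then have "\<forall>y\<in>set (u # w # as) \<union> set bs. plabels y \<inter> plabels (PLeaf i) = {}" unfolding disj_append_mid by blast
      then show ?thesis using that by auto
    qed
    then show ?thesis using that by (auto simp: ptree.set(2))
  qed
  have oku: "ok x" "sp x" if "x \<in> set (u # w # as @ bs)" for x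
    using ok sp that unfolding ok_PBranch sp_PBranch by auto
  have spine: "spine i ?s = [?ss]" using label_tilde_direct(3)[OF ok ordered_of_sp[OF sp] m] .
  have P: "parent_cluster i ?s = C" "parent_degree i ?s = length as + length bs + 3"
    unfolding parent_cluster_def parent_degree_def spine C_def by simp_all
  have okin: "ok s'" if "(d, s') \<in># insertions j ?s" for d s' using ok_insertions[OF ok j that] .
  let ?D = "u # w # as @ bs"
  let ?edge = "(E False C, PBranch [?s, PLeaf j])"
  let ?V = "\<lambda>b. V b C (length as + length bs + 3)"
  let ?V' = "\<lambda>b. V b (C - {i}) (length as + length bs + 2)"
  let ?loc1 = "\<lambda>l. (?V False, PBranch (u # w # take l as @ PLeaf j # drop l as @ PLeaf i # bs))"
  let ?loc = "(?V False, PBranch (u # w # as @ PLeaf j # PLeaf i # bs))"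
  let ?loc2 = "\<lambda>l. (?V (l = length bs), PBranch (u # w # as @ PLeaf i # take l bs @ PLeaf j # drop l bs))"
  let ?pair = "(E True {i}, PBranch (u # w # as @ PBranch [PLeaf i, PLeaf j] # bs))"
  let ?Iu = "image_mset (apsnd (\<lambda>x. PBranch (x # w # as @ PLeaf i # bs))) (insertions j u)"
  let ?Iw = "image_mset (apsnd (\<lambda>x. PBranch (u # x # as @ PLeaf i # bs))) (insertions j w)"
  let ?Ia = "\<lambda>k. image_mset (apsnd (\<lambda>x. PBranch (u # w # as[k := x] @ PLeaf i # bs))) (insertions j (as ! k))"
  let ?Ib = "\<lambda>k. image_mset (apsnd (\<lambda>x. PBranch (u # w # as @ PLeaf i # bs[k := x]))) (insertions j (bs ! k))"
  define X where "X = {#?pair, ?loc#}"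
  define R where "R = {#?edge#} + (\<Sum>l<?p. {#?loc1 l#}) + (\<Sum>l\<le>?q. {#?loc2 l#}) + ?Iu + ?Iw + (\<Sum>k<?p. ?Ia k) + (\<Sum>k<?q. ?Ib k)"
  have ins: "insertions j ?s = X + R"
  proof -
    let ?us = "as @ PLeaf i # bs"
    let ?f = "\<lambda>l. {#(V (l = length ?us) C (length ?us + 2), PBranch (u # w # take l ?us @ PLeaf j # drop l ?us))#}"
    let ?g = "\<lambda>k. image_mset (apsnd (\<lambda>x. PBranch (u # w # ?us[k := x]))) (insertions j (?us ! k))"
    have len: "length ?us = ?p + Suc ?q" by simp
    have 1: "(\<Sum>l<?p. ?f l) = (\<Sum>l<?p. {#?loc1 l#})" by (rule sum.cong) auto
    have 2: "(\<Sum>l\<le>?q. ?f (Suc (?p + l))) = (\<Sum>l\<le>?q. {#?loc2 l#})" by (rule sum.cong) auto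
    have 3: "?f ?p = {#?loc#}" by simp
    have 4: "(\<Sum>k<?p. ?g k) = (\<Sum>k<?p. ?Ia k)" by (rule sum.cong) (auto simp: list_update_append nth_append)
    have 5: "(\<Sum>k<?q. ?g (Suc (?p + k))) = (\<Sum>k<?q. ?Ib k)" by (rule sum.cong) (auto simp: list_update_append nth_append)
    have 6: "?g ?p = {#?pair#}" by simp
    have f: "(\<Sum>l\<le>length ?us. ?f l) = (\<Sum>l<?p. {#?loc1 l#}) + {#?loc#} + (\<Sum>l\<le>?q. {#?loc2 l#})"
      unfolding sum_atMost_mid(1)[of ?f ?p ?q, folded len] 1 2 3 ..
    have g: "(\<Sum>k<length ?us. ?g k) = (\<Sum>k<?p. ?Ia k) + {#?pair#} + (\<Sum>k<?q. ?Ib k)"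
      unfolding sum_atMost_mid(3)[of ?g ?p ?q, folded len] 4 5 6 ..
    have "insertions j ?s = {#?edge#} + (\<Sum>l\<le>length ?us. ?f l) + ?Iu + ?Iw + (\<Sum>k<length ?us. ?g k)"
      unfolding insertions_two C_def[symmetric] ..
    then show ?thesis unfolding f g X_def R_def by simp
  qed
  have mp: "map_ptree ?r x = x" if "x \<in> set ?D" for x
    using sub[OF that] j by (intro map_ptree_id) auto
  have mps: "map (map_ptree ?r) as = as" "map (map_ptree ?r) bs = bs" using mp by (simp_all add: map_idI)
  have nrm: "normalise ?s = ?s" using normalise_id[OF ok sp] .
  have del: "delete_leaf i (PBranch (x # y # xs @ PLeaf i # ys)) = PBranch (x # y # xs @ ys)"
    if "ok (PBranch (x # y # xs @ PLeaf i # ys))" for x y xs ys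
    using delete_direct(1)[of "x # y # xs" i ys] that by simp
  have X1: "label_tilde i (snd ?loc) = j \<and> normalise (map_ptree ?r (delete_leaf i (snd ?loc))) = ?s"
  proof -
    have in': "?loc \<in># insertions j ?s" unfolding ins X_def by simp
    have "delete_leaf i (snd ?loc) = PBranch (u # w # as @ PLeaf j # bs)"
      using del[of u w "as @ [PLeaf j]" bs] okin[of "fst ?loc" "snd ?loc"] in' by simp
    then have "map_ptree ?r (delete_leaf i (snd ?loc)) = ?s" using mp mps by simp
    moreover have "label_tilde i (PBranch (u # w # as @ PLeaf j # PLeaf i # bs)) = j"
      by (rule direct_new[OF ok sp lt m, of "fst ?loc" _ "?p + 3"]) (use in' in \<open>auto simp: nth_append numeral_3_eq_3\<close>)
    ultimately show ?thesis using nrm by simp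
  qed
  have X2: "label_tilde i (snd ?pair) = j \<and> normalise (map_ptree ?r (delete_leaf i (snd ?pair))) = ?s"
  proof -
    have in': "?pair \<in># insertions j ?s" unfolding ins X_def by simp
    have up: "u # w # as @ PBranch [PLeaf i, PLeaf j] # bs = ?ss[?m := PBranch [PLeaf i, PLeaf j]]"
      by (simp add: list_update_append)
    have okp: "ok (PBranch (u # w # as @ PBranch [PLeaf i, PLeaf j] # bs))" using okin[OF in'] .
    have "delete_leaf i (snd ?pair) = PBranch (u # w # as @ PLeaf j # bs)"
      using delete_pair[of "u # w # as" i j bs] okp ij by simp
    then have "map_ptree ?r (delete_leaf i (snd ?pair)) = ?s" using mp mps by simp
    then show ?thesis using nrm pair_new(1)[OF ok lt m, folded up] by simp
  qed
  have cl: "cluster d \<subseteq> C - {i} \<and> cluster d \<noteq> {}" if "x \<in> set ?D" "(d, z) \<in># insertions j x" for d z x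
    using cluster_insertions[OF oku(1)[OF that(1)] that(2)] sub[OF that(1)] unfolding C_def by blast
  have le: "least z = least x" if "x \<in> set ?D" "(d, z) \<in># insertions j x" for d z x
    using least_insertions[OF that(2) plabels_ne[OF oku(1)[OF that(1)]]] sub[OF that(1)] lt by blast
  have st: "strip i C d = d" if "x \<in> set ?D" "(d, z) \<in># insertions j x" for d z x
    using cl[OF that] Ci(2) by (intro strip_id) auto
  have R: "label_tilde i s' = label_tilde i ?s \<and> pend i s' = pend i ?s \<and> cluster d \<noteq> {i}"
    if dR: "(d, s') \<in># R" for d s'
  proof -
    have in': "(d, s') \<in># insertions j ?s" using dR unfolding ins by auto
    \<comment> \<open>Only the left neighbour of \<open>i\<close> matters; it is \<open>w\<close> if
      \<open>as\<close> is empty, hence the formulation with \<open>last (w # as)\<close>.\<close>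
    have keep: "label_tilde i s' = label_tilde i ?s \<and> pend i s' = pend i ?s"
      if "s' = PBranch (x # y # xs @ PLeaf i # ys)" "least (last (y # xs)) = least (last (w # as))" for x y xs ys
    proof -
      have in2: "(d, PBranch (x # y # xs @ PLeaf i # ys)) \<in># insertions j ?s" using in' that by simp
      have nth: "(x # y # xs @ PLeaf i # ys) ! (length xs + 1) = last (y # xs)" for x y xs ys
        by (cases xs rule: rev_cases) (auto simp: nth_append)
      have "label_tilde i (PBranch (x # y # xs @ PLeaf i # ys)) = label_tilde i ?s \<and> pend i (PBranch (x # y # xs @ PLeaf i # ys)) = pend i ?s"
        by (rule direct_keep[OF ok sp lt m in2, of "length xs + 2"])
          (use that(2) nth[of x y xs ys] nth[of u w as bs] in simp_all)
      then show ?thesis unfolding that(1) .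
    qed
    consider "d = E False C" "s' = PBranch [?s, PLeaf j]" | l where "l < ?p" "(d, s') = ?loc1 l"
      | l where "l \<le> ?q" "(d, s') = ?loc2 l"
      | x where "(d, x) \<in># insertions j u" "s' = PBranch (x # w # as @ PLeaf i # bs)"
      | x where "(d, x) \<in># insertions j w" "s' = PBranch (u # x # as @ PLeaf i # bs)"
      | k x where "k < ?p" "(d, x) \<in># insertions j (as ! k)" "s' = PBranch (u # w # as[k := x] @ PLeaf i # bs)"
      | k x where "k < ?q" "(d, x) \<in># insertions j (bs ! k)" "s' = PBranch (u # w # as @ PLeaf i # bs[k := x])"
      using dR unfolding R_def by (auto simp: in_sum_mset_iff in_image_apsnd)
    then show ?thesis
    proof cases
      case 1
      then show ?thesis using edge_direct(2)[OF ok sp lt m] Ci by simp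
    next
      case 2
      have "label_tilde i s' = label_tilde i ?s \<and> pend i s' = pend i ?s"
        by (rule keep[of u w "take l as @ PLeaf j # drop l as" bs]) (use 2 in auto)
      then show ?thesis using 2 Ci by auto
    next
      case 3
      have "label_tilde i s' = label_tilde i ?s \<and> pend i s' = pend i ?s"
        by (rule keep[of u w as "take l bs @ PLeaf j # drop l bs"]) (use 3 in auto)
      then show ?thesis using 3 Ci by auto
    next
      case 4
      then show ?thesis using keep[of x w as bs] cl[of u d x] by auto
    next
      case 5
      then show ?thesis using keep[of u x as bs] cl[of w d x] le[of w d x] by auto
    next
      case 6
      have "least (last (w # as[k := x])) = least (last (w # as))"
        using 6(1) le[of "as ! k" d x] 6(2) by (cases "k = length as - 1") (auto simp: last_list_update last_conv_nth)
      then show ?thesis using keep[of u w "as[k := x]" bs] cl[of "as ! k" d x] 6 by auto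
    next
      case 7
      then show ?thesis using keep[of u w as "bs[k := x]"] cl[of "bs ! k" d x] by auto
    qed
  qed
  let ?F = "map_prod (strip i C) (delete_leaf i)"
  have D: "delete_leaf i ?s = PBranch ?D" using del[OF ok] by simp
  have lD: "plabels (PBranch ?D) = C - {i}"
    using plabels_delete[OF ok ne(3)] unfolding D C_def by simp
  have delin: "delete_leaf i (PBranch (x # y # xs @ PLeaf i # ys)) = PBranch (x # y # xs @ ys)"
    if "(d, PBranch (x # y # xs @ PLeaf i # ys)) \<in># insertions j ?s" for d x y xs ys
    using del[OF okin[OF that]] .
  have img: "image_mset ?F (image_mset (apsnd f) (insertions j x)) = image_mset (apsnd g) (insertions j x)"
    if "x \<in> set ?D" "\<And>d z. (d, z) \<in># insertions j x \<Longrightarrow> delete_leaf i (f z) = g z" for f g x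
    unfolding multiset.map_comp
  proof (rule image_mset_cong)
    fix y assume y: "y \<in># insertions j x"
    obtain d z where dz: "y = (d, z)" by (cases y)
    show "(?F \<circ> apsnd f) y = apsnd g y" using that(2)[of d z] st[OF that(1), of d z] y dz by simp
  qed
  have inR: "x \<in># insertions j ?s" if "x \<in># R" for x using that ins by simp
  have Fu: "image_mset ?F ?Iu = image_mset (apsnd (\<lambda>x. PBranch (x # w # as @ bs))) (insertions j u)"
  proof (rule img)
    fix d z assume z: "(d, z) \<in># insertions j u"
    have "(d, PBranch (z # w # as @ PLeaf i # bs)) \<in># R" using z unfolding R_def by (auto simp: in_image_apsnd)
    then show "delete_leaf i (PBranch (z # w # as @ PLeaf i # bs)) = PBranch (z # w # as @ bs)" using delin inR by blast
  qed simp
  have Fw: "image_mset ?F ?Iw = image_mset (apsnd (\<lambda>x. PBranch (u # x # as @ bs))) (insertions j w)"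
  proof (rule img)
    fix d z assume z: "(d, z) \<in># insertions j w"
    have "(d, PBranch (u # z # as @ PLeaf i # bs)) \<in># R" using z unfolding R_def by (auto simp: in_image_apsnd)
    then show "delete_leaf i (PBranch (u # z # as @ PLeaf i # bs)) = PBranch (u # z # as @ bs)" using delin inR by blast
  qed simp
  have Fa: "image_mset ?F (?Ia k) = image_mset (apsnd (\<lambda>x. PBranch (u # w # as[k := x] @ bs))) (insertions j (as ! k))"
    if k: "k < ?p" for k
  proof (rule img)
    fix d z assume z: "(d, z) \<in># insertions j (as ! k)"
    have "(d, PBranch (u # w # as[k := z] @ PLeaf i # bs)) \<in># R" using z k unfolding R_def by (auto simp: in_image_apsnd in_sum_mset_iff)
    then show "delete_leaf i (PBranch (u # w # as[k := z] @ PLeaf i # bs)) = PBranch (u # w # as[k := z] @ bs)" using delin inR by blast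
  qed (use k in simp)
  have Fb: "image_mset ?F (?Ib k) = image_mset (apsnd (\<lambda>x. PBranch (u # w # as @ bs[k := x]))) (insertions j (bs ! k))"
    if k: "k < ?q" for k
  proof (rule img)
    fix d z assume z: "(d, z) \<in># insertions j (bs ! k)"
    have "(d, PBranch (u # w # as @ PLeaf i # bs[k := z])) \<in># R" using z k unfolding R_def by (auto simp: in_image_apsnd in_sum_mset_iff)
    then show "delete_leaf i (PBranch (u # w # as @ PLeaf i # bs[k := z])) = PBranch (u # w # as @ bs[k := z])" using delin inR by blast
  qed (use k in simp)
  have e: "?F ?edge = (E False (C - {i}), PBranch [PBranch ?D, PLeaf j])"
  proof -
    have "delete_leaf i (PBranch [?s, PLeaf j]) = PBranch (([?s, PLeaf j])[0 := delete_leaf i ([?s, PLeaf j] ! 0)])"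
      using delete_neq[OF ok ne(3)] ij by (intro delete_leaf_child) (auto simp: less_Suc_eq)
    then show ?thesis using D by simp
  qed
  have l1: "?F (?loc1 l) = (?V' False, PBranch (u # w # take l as @ PLeaf j # drop l as @ bs))" if l: "l < ?p" for l
  proof -
    have "?loc1 l \<in># R" unfolding R_def using l by (auto simp: in_sum_mset_iff)
    then show ?thesis using delin[of "?V False" u w "take l as @ PLeaf j # drop l as" bs] inR by simp
  qed
  have l2: "?F (?loc2 l) = (?V' (l = ?q), PBranch (u # w # as @ take l bs @ PLeaf j # drop l bs))" if l: "l \<le> ?q" for l
  proof -
    have "?loc2 l \<in># R" unfolding R_def using l by (auto simp: in_sum_mset_iff)
    then show ?thesis using delin[of "?V (l = ?q)" u w as "take l bs @ PLeaf j # drop l bs"] inR by simp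
  qed
  have imgR: "image_mset ?F R = insertions j (delete_leaf i ?s)"
  proof -
    let ?us = "as @ bs"
    let ?f = "\<lambda>l. {#(V (l = length ?us) (C - {i}) (length ?us + 2), PBranch (u # w # take l ?us @ PLeaf j # drop l ?us))#}"
    let ?g = "\<lambda>k. image_mset (apsnd (\<lambda>x. PBranch (u # w # ?us[k := x]))) (insertions j (?us ! k))"
    have len: "length ?us = ?p + ?q" by simp
    have 1: "(\<Sum>l<?p. ?f l) = (\<Sum>l<?p. {#?F (?loc1 l)#})" by (rule sum.cong) (use l1 in auto)
    have 2: "(\<Sum>l\<le>?q. ?f (?p + l)) = (\<Sum>l\<le>?q. {#?F (?loc2 l)#})" by (rule sum.cong) (use l2 in auto)
    have 4: "(\<Sum>k<?p. ?g k) = (\<Sum>k<?p. image_mset ?F (?Ia k))"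
      by (rule sum.cong) (use Fa in \<open>auto simp: list_update_append nth_append\<close>)
    have 5: "(\<Sum>k<?q. ?g (?p + k)) = (\<Sum>k<?q. image_mset ?F (?Ib k))"
      by (rule sum.cong) (use Fb in \<open>auto simp: list_update_append nth_append\<close>)
    have f: "(\<Sum>l\<le>length ?us. ?f l) = (\<Sum>l<?p. {#?F (?loc1 l)#}) + (\<Sum>l\<le>?q. {#?F (?loc2 l)#})"
      unfolding sum_atMost_mid(2)[of ?f ?p ?q, folded len] 1 2 ..
    have g: "(\<Sum>k<length ?us. ?g k) = (\<Sum>k<?p. image_mset ?F (?Ia k)) + (\<Sum>k<?q. image_mset ?F (?Ib k))"
      unfolding sum_atMost_mid(4)[of ?g ?p ?q, folded len] 4 5 ..
    have "insertions j (delete_leaf i ?s) = {#?F ?edge#} + (\<Sum>l\<le>length ?us. ?f l) + image_mset ?F ?Iu + image_mset ?F ?Iw + (\<Sum>k<length ?us. ?g k)"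
      unfolding D insertions_two lD e Fu Fw ..
    also have "\<dots> = image_mset ?F R"
      unfolding f g R_def image_mset_union image_mset_single image_mset_sum[OF finite_lessThan] image_mset_sum[OF finite_atMost]
      by (simp only: add.assoc)
    finally show ?thesis by simp
  qed
  have "image_mset fst X = lost i ?s" unfolding X_def lost_def P by simp
  moreover have "label_tilde i s' = j \<and> normalise (map_ptree ?r (delete_leaf i s')) = ?s" if "(d, s') \<in># X" for d s'
    using that X1 X2 unfolding X_def by auto
  ultimately have "splits i j ?s X R" unfolding splits_def P(1) using ins R imgR P(2) by simp
  then show ?thesis by blast
qed

text \<open>Descends to the parent of \<open>i\<close>. There the two leftmost positions and the
  others need different arguments, because they look for \<open>b\<close> on different
  sides.\<close>

theorem splits_exists:
  "ok s \<Longrightarrow> sp s \<Longrightarrow> \<forall>x\<in>plabels s. x < j \<Longrightarrow> i \<in> plabels s \<Longrightarrow> s \<noteq> PLeaf i \<Longrightarrow> \<exists>X R. splits i j s X R"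
proof (induction s)
  case (PLeaf x)
  then show ?case by simp
next
  case (PBranch ss)
  note ok = PBranch.prems(1) and sp = PBranch.prems(2) and lt = PBranch.prems(3)
  obtain m where m: "m < length ss" "i \<in> plabels (ss ! m)"
    using PBranch.prems(4) by (auto simp: ptree.set(2) in_set_conv_nth)
  show ?case
  proof (cases "ss ! m = PLeaf i")
    case False
    have "\<forall>x\<in>plabels (ss ! m). x < j" using nth_in_plabels[OF m(1)] lt by blast
    moreover have "sp (ss ! m)" using sp m(1) by (simp add: sp_PBranch)
    ultimately obtain X R where "splits i j (ss ! m) X R"
      using PBranch.IH[OF nth_mem[OF m(1)] ok_nth[OF ok m(1)] _ _ m(2) False] by blast
    then show ?thesis using splits_child[OF ok sp lt m False] by blast
  next
    case True
    obtain u w us where ss: "ss = u # w # us" using two_list ok unfolding ok_PBranch by blast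
    consider "ss = fr True (PLeaf i) w us" | "ss = fr False (PLeaf i) u us" | "2 \<le> m"
    proof -
      have "m = 0 \<or> m = 1 \<or> 2 \<le> m" by auto
      then show thesis using that True by (auto simp: ss fr_def)
    qed
    then show ?thesis
    proof cases
      case 1
      then show ?thesis using splits_front ok sp lt by blast
    next
      case 2
      then show ?thesis using splits_front ok sp lt by blast
    next
      case 3
      have "us ! (m - 2) = PLeaf i" "m - 2 < length us" using True 3 m(1) by (auto simp: ss nth_Cons' numeral_2_eq_2)
      then have "us = take (m - 2) us @ PLeaf i # drop (Suc (m - 2)) us" using id_take_nth_drop[of "m - 2" us] by simp
      then obtain as bs where "us = as @ PLeaf i # bs" by blast
      then show ?thesis using splits_back ok sp lt unfolding ss by blast
    qed
  qed
qed

section \<open>The deletion step\<close>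

lemma map_ptree_eq_PLeaf: "map_ptree f u = PLeaf y \<longleftrightarrow> (\<exists>x. u = PLeaf x \<and> f x = y)"
  by (cases u) auto

lemma delete_leaf_map: "inj f \<Longrightarrow> delete_leaf (f i) (map_ptree f s) = map_ptree f (delete_leaf i s)"
proof (induction s)
  case (PLeaf x)
  then show ?case by simp
next
  case (PBranch ss)
  have "map (delete_leaf (f i)) (map (map_ptree f) ss) = map (map_ptree f) (map (delete_leaf i) ss)"
    using PBranch by simp
  moreover have "filter (\<lambda>u. u \<noteq> PLeaf (f i)) (map (map_ptree f) us) = map (map_ptree f) (filter (\<lambda>u. u \<noteq> PLeaf i) us)" for us
    unfolding filter_map using injD[OF PBranch.prems]
    by (intro arg_cong[of _ _ "map _"] filter_cong) (auto simp: map_ptree_eq_PLeaf)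
  ultimately have "filter (\<lambda>u. u \<noteq> PLeaf (f i)) (map (delete_leaf (f i)) (map (map_ptree f) ss))
      = map (map_ptree f) (filter (\<lambda>u. u \<noteq> PLeaf i) (map (delete_leaf i) ss))"
    by (simp only:)
  then show ?case
    by (simp only: delete_leaf.simps(2) ptree.map) (auto split: list.splits)
qed

text \<open>The swap with \<open>k\<close> followed by closing the gap at \<open>k\<close>, as one
  map.\<close>

definition relabel :: "nat \<Rightarrow> nat \<Rightarrow> nat \<Rightarrow> nat" where
  "relabel i k x = (let y = Transposition.transpose i k x in if k < y then y - 1 else y)"

text \<open>Deletion commutes with injective relabelling, so \<open>i\<close> itself may be deleted
  first and all relabelling done afterwards; in this order \<open>splits\<close> applies.\<close>

lemma down_step_eq: "down_step i s = normalise (map_ptree (relabel i (label_tilde i s)) (delete_leaf i s))"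
proof -
  let ?k = "label_tilde i s" and ?t = "Transposition.transpose i (label_tilde i s)"
  have "delete_leaf ?k (map_ptree ?t s) = map_ptree ?t (delete_leaf i s)"
    using delete_leaf_map[of ?t i s] by simp
  then show ?thesis unfolding down_step_def Let_def
    by (simp add: ptree.map_comp comp_def relabel_def[abs_def] Let_def)
qed

text \<open>In particular, the largest label is its own label tilde.\<close>

lemma label_tilde_range:
  "ok s \<Longrightarrow> sp s \<Longrightarrow> i \<in> plabels s \<Longrightarrow> s \<noteq> PLeaf i \<Longrightarrow> label_tilde i s \<in> plabels s \<and> i \<le> label_tilde i s"
proof (induction s)
  case (PLeaf x)
  then show ?case by simp
next
  case (PBranch ss)
  note ok = PBranch.prems(1) and sp = PBranch.prems(2)
  obtain m where m: "m < length ss" "i \<in> plabels (ss ! m)"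
    using PBranch.prems(3) by (auto simp: ptree.set(2) in_set_conv_nth)
  show ?case
  proof (cases "ss ! m = PLeaf i")
    case False
    have "sp (ss ! m)" using sp m(1) by (simp add: sp_PBranch)
    then have IH: "label_tilde i (ss ! m) \<in> plabels (ss ! m)" "i \<le> label_tilde i (ss ! m)"
      using PBranch.IH[OF nth_mem[OF m(1)] ok_nth[OF ok m(1)] _ m(2) False] by auto
    let ?B = "plabels (PBranch ss) - plabels (ss ! m)"
    have "Min ?B \<in> ?B"
    proof (rule Min_in)
      have "2 \<le> length ss" using ok by (simp add: ok_PBranch)
      then have k: "(if m = 0 then 1 else 0) < length ss" "(if m = 0 then 1 else 0) \<noteq> m" by auto
      have "plabels (ss ! (if m = 0 then 1 else 0)) \<noteq> {}" using plabels_ne[OF ok_nth[OF ok k(1)]] .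
      then show "?B \<noteq> {}" using ok_disj_nth[OF ok k(1) m(1) k(2)] nth_in_plabels[OF k(1)] by blast
    qed (simp add: finite_plabels)
    then show ?thesis using label_tilde_child(1)[OF ok m False] IH nth_in_plabels[OF m(1)]
      by (auto simp: max_def)
  next
    case True
    note ne = label_set_ne[OF ok m(1) True]
    have a: "Min (plabels (PBranch ss) - {i}) \<in> plabels (PBranch ss)" using Min_in[OF ne(2,1)] by blast
    have b: "least (ss ! (if m < 2 then 2 else m - 1)) \<in> plabels (PBranch ss)" if "length ss \<noteq> 2"
    proof -
      have l: "(if m < 2 then 2 else m - 1) < length ss" using that m(1) ok by (auto simp: ok_PBranch)
      show ?thesis using least_in[OF ok_nth[OF ok l]] nth_in_plabels[OF l] by blast
    qed
    show ?thesis
      using label_tilde_direct(1)[OF ok ordered_of_sp[OF sp] m(1) True] a b ne(3)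
      by (cases "length ss = 2") (auto simp: Let_def max_def)
  qed
qed

lemma delete_inserted: "ok s \<Longrightarrow> j \<notin> plabels s \<Longrightarrow> (d, s') \<in># insertions j s \<Longrightarrow> delete_leaf j s' = s"
proof (induction s arbitrary: s' d)
  case (PLeaf x)
  then show ?case using delete_direct(2)[of "[PLeaf x]" j "[]" "PLeaf x"] by (simp add: ok_PBranch)
next
  case (PBranch ss)
  note okin = ok_insertions[OF PBranch.prems]
  have len: "2 \<le> length ss" using PBranch.prems(1) by (simp add: ok_PBranch)
  from PBranch.prems(3) consider "s' = PBranch [PBranch ss, PLeaf j]"
    | l where "s' = PBranch (take (l + 2) ss @ PLeaf j # drop (l + 2) ss)"
    | k u where "k < length ss" "(d, u) \<in># insertions j (ss ! k)" "s' = PBranch (ss[k := u])"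
    unfolding in_insertions_PBranch by blast
  then show ?case
  proof cases
    case 1
    then show ?thesis using delete_direct(2)[of "[PBranch ss]" j "[]" "PBranch ss"] okin by simp
  next
    case 2
    then show ?thesis using delete_direct(1)[of "take (l + 2) ss" j "drop (l + 2) ss"] okin len
      unfolding append_take_drop_id by simp
  next
    case 3
    have jk: "j \<notin> plabels (ss ! k)" using PBranch.prems(2) nth_in_plabels[OF 3(1)] by blast
    have du: "delete_leaf j u = ss ! k"
      using PBranch.IH[OF nth_mem[OF 3(1)] ok_nth[OF PBranch.prems(1) 3(1)] jk 3(2)] .
    have "delete_leaf j (PBranch (ss[k := u])) = PBranch ((ss[k := u])[k := delete_leaf j (ss[k := u] ! k)])"
    proof (rule delete_leaf_child)
      show "two (ss[k := u] ! l) \<and> j \<notin> plabels (ss[k := u] ! l)" if "l < length (ss[k := u])" "l \<noteq> k" for l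
        using that ok_two[OF ok_nth[OF PBranch.prems(1), of l]] PBranch.prems(2) nth_in_plabels[of l ss] by auto
      show "delete_leaf j (ss[k := u] ! k) \<noteq> PLeaf j" using du jk 3(1) by auto
    qed (use len 3(1) in auto)
    then show ?thesis using du 3 by simp
  qed
qed

text \<open>A leaf with the largest label also has the largest least label among its siblings, so it
  precedes none of the subtrees whose order is prescribed.\<close>

lemma least_max_delete:
  assumes "ok (PBranch ss)" "\<forall>x\<in>plabels (PBranch ss). x \<le> j" "m < length ss" "ss ! m = PLeaf j" "sp (PBranch ss)"
  shows "m = 1 \<and> length ss = 2 \<or> 2 \<le> m"
proof -
  have l: "least (ss ! k) \<le> j" if "k < length ss" for k
    using least_in[OF ok_nth[OF assms(1) that]] nth_in_plabels[OF that] assms(2) by blast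
  have lm: "least (ss ! m) = j" using assms(4) by (simp add: least_def)
  have o: "least (ss ! 0) < least (ss ! 1)" "\<forall>k\<in>{2..<length ss}. least (ss ! 1) < least (ss ! k)"
    using assms(5) by (simp_all add: sp_PBranch ordered_nth)
  have len: "2 \<le> length ss" using assms(1) by (simp add: ok_PBranch)
  have "m \<noteq> 0" using o(1) lm l[of 1] len by (cases m) auto
  moreover have "length ss = 2" if "m = 1"
  proof (rule ccontr)
    assume "length ss \<noteq> 2"
    then have "least (ss ! 1) < least (ss ! 2)" "least (ss ! 2) \<le> j" using o(2) l[of 2] len by auto
    then show False using lm that by simp
  qed
  ultimately show ?thesis by linarith
qed

text \<open>With \<open>delete_inserted\<close>: every drawing arises from exactly one smaller
  drawing by insertion of its largest label. This supports all inductions on the number of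
  leaves.\<close>

lemma uninsert:
  "ok s \<Longrightarrow> sp s \<Longrightarrow> \<forall>x\<in>plabels s. x \<le> j \<Longrightarrow> j \<in> plabels s \<Longrightarrow> s \<noteq> PLeaf j \<Longrightarrow>
   ok (delete_leaf j s) \<and> sp (delete_leaf j s) \<and> (\<exists>d. (d, s) \<in># insertions j (delete_leaf j s))"
proof (induction s)
  case (PLeaf x)
  then show ?case by simp
next
  case (PBranch ss)
  note ok = PBranch.prems(1) and sp = PBranch.prems(2) and le = PBranch.prems(3)
  obtain m where m: "m < length ss" "j \<in> plabels (ss ! m)"
    using PBranch.prems(4) by (auto simp: ptree.set(2) in_set_conv_nth)
  have len: "2 \<le> length ss" using ok by (simp add: ok_PBranch)
  show ?case
  proof (cases "ss ! m = PLeaf j")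
    case False
    let ?D = "delete_leaf j (ss ! m)" and ?ss = "ss[m := delete_leaf j (ss ! m)]"
    have okm: "ok (ss ! m)" "sp (ss ! m)" using ok_nth[OF ok m(1)] sp m(1) by (simp_all add: sp_PBranch)
    have "\<forall>x\<in>plabels (ss ! m). x \<le> j" using le nth_in_plabels[OF m(1)] by blast
    then obtain d where D: "ok ?D" "sp ?D" "(d, ss ! m) \<in># insertions j ?D"
      using PBranch.IH[OF nth_mem[OF m(1)] okm _ m(2) False] by blast
    have pD: "plabels ?D = plabels (ss ! m) - {j}" using plabels_delete[OF okm(1) m(2) False] .
    have del: "delete_leaf j (PBranch ss) = PBranch ?ss"
      using delete_neq[OF okm(1) m(2) False] ok_disj_nth[OF ok m(1)] m ok_two[OF ok_nth[OF ok]] len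
      by (intro delete_leaf_child) auto
    have "disj ?ss"
      unfolding sorted_wrt_iff_nth_less
    proof (intro allI impI)
      fix a b assume ab: "a < b" "b < length ?ss"
      then show "plabels (?ss ! a) \<inter> plabels (?ss ! b) = {}"
        using disj_nth[of ss a b] ok pD m(1) by (auto simp: ok_PBranch nth_list_update)
    qed
    then have 1: "ok (PBranch ?ss)"
      using ok D(1) len set_update_subset_insert[of ss m ?D] by (auto simp: ok_PBranch)
    have lD: "least ?D = least (ss ! m)"
    proof -
      have "\<forall>x\<in>plabels ?D. x < j" using pD le nth_in_plabels[OF m(1)] by force
      then show ?thesis using least_insertions[OF D(3) plabels_ne[OF D(1)]] by simp
    qed
    then have "least (?ss ! k) = least (ss ! k)" for k using m(1) by (cases "k = m") auto
    then have "ordered ?ss" using sp by (simp add: sp_PBranch ordered_nth)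
    then have 2: "sp (PBranch ?ss)"
      using sp D(2) set_update_subset_insert[of ss m ?D] by (auto simp: sp_PBranch)
    have "(d, PBranch (?ss[m := ss ! m])) \<in># insertions j (PBranch ?ss)"
      unfolding in_insertions_PBranch using m(1) D(3) by (metis length_list_update nth_list_update_eq)
    then show ?thesis unfolding del using 1 2 by auto
  next
    case True
    consider "m = 1" "length ss = 2" | "2 \<le> m" using least_max_delete[OF ok le m(1) True sp] by blast
    then show ?thesis
    proof cases
      case 1
      then obtain u where ss: "ss = [u, PLeaf j]" using True
        by (cases ss; cases "tl ss") auto
      have del: "delete_leaf j (PBranch ss) = u" using delete_direct(2)[of "[u]" j "[]" u] ok unfolding ss by simp
      have "\<exists>d. (d, PBranch [u, PLeaf j]) \<in># insertions j u"
      proof (cases u)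
        case (PBranch us)
        then show ?thesis unfolding PBranch in_insertions_PBranch by blast
      qed auto
      then show ?thesis unfolding del using ok sp by (simp add: ss ok_PBranch sp_PBranch)
    next
      case 2
      let ?xs = "take m ss" and ?ys = "drop (Suc m) ss"
      have ss: "?xs @ PLeaf j # ?ys = ss" using id_take_nth_drop[OF m(1)] True by simp
      have len2: "2 \<le> length (?xs @ ?ys)" using m(1) 2 by simp
      have del: "delete_leaf j (PBranch ss) = PBranch (?xs @ ?ys)"
        using delete_direct(1)[of ?xs j ?ys] ok len2 unfolding ss by simp
      have "disj (?xs @ PLeaf j # ?ys)" using ok unfolding ss ok_PBranch by blast
      then have "disj (?xs @ ?ys)" unfolding disj_append_mid by blast
      moreover have sub: "set (?xs @ ?ys) \<subseteq> set ss" using set_take_subset set_drop_subset by fastforce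
      ultimately have 1: "ok (PBranch (?xs @ ?ys))" using ok len2 unfolding ok_PBranch by blast
      have "ordered (?xs @ ?ys)"
      proof -
        have "(?xs @ ?ys) ! 0 = ss ! 0" "(?xs @ ?ys) ! 1 = ss ! 1" using 2 m(1) by (auto simp: nth_append)
        moreover have "set (drop 2 (?xs @ ?ys)) \<subseteq> set (drop 2 ss)"
        proof -
          have "drop 2 ss = drop 2 ?xs @ PLeaf j # ?ys" using arg_cong[OF ss, of "drop 2"] 2 m(1) by simp
          moreover have "drop 2 (?xs @ ?ys) = drop 2 ?xs @ ?ys" using 2 m(1) by simp
          ultimately show ?thesis by (metis set_append Un_mono subset_insertI subset_refl list.simps(15))
        qed
        ultimately show ?thesis using sp unfolding sp_PBranch ordered_def by auto
      qed
      then have 3: "sp (PBranch (?xs @ ?ys))" using sp sub unfolding sp_PBranch by blast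
      have e: "m - 2 + 2 = m" using 2 by simp
      have "take (m - 2 + 2) (?xs @ ?ys) = ?xs" "drop (m - 2 + 2) (?xs @ ?ys) = ?ys" "m - 2 < length (?xs @ ?ys) - 1"
        using 2 m(1) unfolding e by auto
      then have "(V (m - 2 = length (?xs @ ?ys) - 2) (plabels (PBranch (?xs @ ?ys))) (length (?xs @ ?ys)), PBranch (?xs @ PLeaf j # ?ys)) \<in># insertions j (PBranch (?xs @ ?ys))"
        unfolding in_insertions_PBranch by metis
      then show ?thesis unfolding del using 1 3 unfolding ss by blast
    qed
  qed
qed

section \<open>Enumeration of semi-planar trees by insertions\<close>

definition simple_mset :: "'a multiset \<Rightarrow> bool" where
  "simple_mset M \<longleftrightarrow> (\<forall>x. count M x \<le> 1)"

lemma simple_mset_single: "simple_mset {#x#}"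
  by (simp add: simple_mset_def)

lemma simple_mset_union:
  assumes "simple_mset A" "simple_mset B" "set_mset A \<inter> set_mset B = {}"
  shows "simple_mset (A + B)"
  unfolding simple_mset_def
proof
  fix x
  have "count A x = 0 \<or> count B x = 0" using assms(3) by (metis disjoint_iff not_in_iff)
  then show "count (A + B) x \<le> 1" using assms(1,2) by (auto simp: simple_mset_def)
qed

lemma simple_mset_sum:
  "finite I \<Longrightarrow> (\<And>k. k \<in> I \<Longrightarrow> simple_mset (M k)) \<Longrightarrow>
   (\<And>k l. k \<in> I \<Longrightarrow> l \<in> I \<Longrightarrow> k \<noteq> l \<Longrightarrow> set_mset (M k) \<inter> set_mset (M l) = {}) \<Longrightarrow> simple_mset (\<Sum>k\<in>I. M k)"
proof (induction I rule: finite_induct)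
  case empty
  then show ?case by (simp add: simple_mset_def)
next
  case (insert k I)
  have "set_mset (M k) \<inter> set_mset (\<Sum>l\<in>I. M l) = {}"
  proof -
    have "x \<notin># M k" if x: "x \<in># (\<Sum>l\<in>I. M l)" for x
    proof -
      obtain l where l: "l \<in> I" "x \<in># M l" using x insert.hyps(1) by (auto simp: in_sum_mset_iff)
      then have "set_mset (M k) \<inter> set_mset (M l) = {}" using insert.prems(2)[of k l] insert.hyps(2) by auto
      then show ?thesis using l by blast
    qed
    then show ?thesis by blast
  qed
  then show ?case using insert by (simp add: simple_mset_union)
qed

lemma simple_mset_image:
  assumes "simple_mset M" "inj_on f (set_mset M)"
  shows "simple_mset (image_mset f M)"
  unfolding simple_mset_def
proof
  fix y
  show "count (image_mset f M) y \<le> 1"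
  proof (cases "y \<in> f ` set_mset M")
    case True
    then obtain x where x: "x \<in># M" "y = f x" by blast
    then have "f -` {y} \<inter> set_mset M = {x}" using assms(2) by (auto simp: inj_on_def)
    then show ?thesis using assms(1) by (simp add: count_image_mset simple_mset_def)
  next
    case False
    then have "y \<notin># image_mset f M" by simp
    then have "count (image_mset f M) y = 0" unfolding not_in_iff .
    then show ?thesis by simp
  qed
qed

lemma simple_mset_eq: "simple_mset M \<Longrightarrow> M = mset_set (set_mset M)"
proof (rule multiset_eqI)
  fix x assume "simple_mset M"
  then have "count M x \<le> 1" by (simp add: simple_mset_def)
  then show "count M x = count (mset_set (set_mset M)) x"
  proof (cases "x \<in># M")
    case True
    then have "0 < count M x" by simp
    then have "count M x = 1" using \<open>count M x \<le> 1\<close> by linarith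
    then show ?thesis using True by simp
  next
    case False
    then show ?thesis by (simp add: not_in_iff)
  qed
qed

text \<open>Descriptions can repeat but resulting trees cannot: the length of the top list and the
  place of the fresh label \<open>j\<close> reveal where the insertion took place.\<close>

lemma simple_insertions: "ok s \<Longrightarrow> j \<notin> plabels s \<Longrightarrow> simple_mset (image_mset snd (insertions j s))"
proof (induction s)
  case (PLeaf x)
  then show ?case by (simp add: simple_mset_single)
next
  case (PBranch ss)
  note ok = PBranch.prems(1) and j = PBranch.prems(2)
  have len: "2 \<le> length ss" using ok by (simp add: ok_PBranch)
  have jk: "j \<notin> plabels (ss ! k)" "ss ! k \<noteq> PLeaf j" if "k < length ss" for k
    using nth_in_plabels[OF that] j by auto
  let ?e = "PBranch [PBranch ss, PLeaf j]"
  let ?loc = "\<lambda>l. take (l + 2) ss @ PLeaf j # drop (l + 2) ss"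
  let ?ch = "\<lambda>k. image_mset (\<lambda>u. PBranch (ss[k := u])) (image_mset snd (insertions j (ss ! k)))"
  have new: "j \<in> plabels u" "plabels (ss ! k) \<subseteq> plabels u" if "u \<in># image_mset snd (insertions j (ss ! k))" for u k
    using that plabels_insertions[of _ u j "ss ! k"] by auto
  have eq: "image_mset snd (insertions j (PBranch ss)) = {#?e#} + (\<Sum>l<length ss - 1. {#PBranch (?loc l)#}) + (\<Sum>k<length ss. ?ch k)"
    unfolding insertions_PBranch by (simp add: image_mset_sum multiset.map_comp comp_def)
  have locne: "?loc l1 \<noteq> ?loc l2" if "l1 < l2" "l2 < length ss - 1" for l1 l2
  proof
    assume "?loc l1 = ?loc l2"
    then have "?loc l1 ! (l1 + 2) = ?loc l2 ! (l1 + 2)" by simp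
    moreover have "?loc l1 ! (l1 + 2) = PLeaf j" using that by (simp add: nth_append min_def)
    moreover have "?loc l2 ! (l1 + 2) = ss ! (l1 + 2)" using that by (simp add: nth_append)
    moreover have "l1 + 2 < length ss" using that by linarith
    ultimately show False using jk(2)[of "l1 + 2"] by metis
  qed
  have 1: "simple_mset (\<Sum>l<length ss - 1. {#PBranch (?loc l)#})"
  proof (rule simple_mset_sum)
    fix k l assume "k \<in> {..<length ss - 1}" "l \<in> {..<length ss - 1}" "k \<noteq> l"
    then have "?loc k \<noteq> ?loc l" using locne[of k l] locne[of l k] by (cases "k < l") auto
    then show "set_mset {#PBranch (?loc k)#} \<inter> set_mset {#PBranch (?loc l)#} = {}" by simp
  qed (simp_all add: simple_mset_single)
  have 2: "simple_mset (\<Sum>k<length ss. ?ch k)"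
  proof (rule simple_mset_sum)
    fix k assume "k \<in> {..<length ss}"
    then have k: "k < length ss" by simp
    have "inj_on (\<lambda>u. PBranch (ss[k := u])) A" for A
      using k by (intro inj_onI) (metis nth_list_update_eq ptree.inject(2))
    then show "simple_mset (?ch k)"
      using PBranch.IH[OF nth_mem[OF k] ok_nth[OF ok k] jk(1)[OF k]] by (rule simple_mset_image[rotated])
  next
    fix k l assume "k \<in> {..<length ss}" "l \<in> {..<length ss}" "k \<noteq> l"
    then have kl: "k < length ss" "l < length ss" "k \<noteq> l" by simp_all
    have "ss[k := u] \<noteq> ss[l := v]" if "u \<in># image_mset snd (insertions j (ss ! k))" for u v
    proof
      assume "ss[k := u] = ss[l := v]"
      then have "ss[k := u] ! k = ss[l := v] ! k" by simp
      then have "u = ss ! k" using kl by simp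
      then show False using new(1)[OF that] jk(1)[OF kl(1)] by simp
    qed
    then show "set_mset (?ch k) \<inter> set_mset (?ch l) = {}" by auto
  qed simp
  have d1: "set_mset {#?e#} \<inter> set_mset (\<Sum>l<length ss - 1. {#PBranch (?loc l)#}) = {}"
  proof -
    have "length (?loc l) \<noteq> 2" for l using len by auto
    then have "[PBranch ss, PLeaf j] \<noteq> ?loc l" for l by (metis One_nat_def Suc_1 length_Cons list.size(3))
    then show ?thesis by (auto simp: in_sum_mset_iff)
  qed
  have d2: "set_mset ({#?e#} + (\<Sum>l<length ss - 1. {#PBranch (?loc l)#})) \<inter> set_mset (\<Sum>k<length ss. ?ch k) = {}"
  proof -
    have N: "ss[k := u] \<noteq> ?loc l \<and> ss[k := u] \<noteq> [PBranch ss, PLeaf j]"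
      if k: "k < length ss" "u \<in># image_mset snd (insertions j (ss ! k))" for k u l
    proof
      have "length (ss[k := u]) \<noteq> length (?loc l)" using len by auto
      then show "ss[k := u] \<noteq> ?loc l" by metis
      show "ss[k := u] \<noteq> [PBranch ss, PLeaf j]"
      proof
        assume e: "ss[k := u] = [PBranch ss, PLeaf j]"
        then have l2: "length ss = 2" by (metis One_nat_def Suc_1 length_Cons length_list_update list.size(3))
        have one: "ss[k := u] ! 1 = PLeaf j" unfolding e by simp
        show False
        proof (cases "k = 1")
          case True
          then have "u = PLeaf j" using one k(1) by simp
          then show False using new[OF k(2)] plabels_ne[OF ok_nth[OF ok k(1)]] jk(1)[OF k(1)] by auto
        next
          case False
          then show False using one jk(2)[of 1] l2 by simp
        qed
      qed
    qed
    have False if x: "x \<in># {#?e#} + (\<Sum>l<length ss - 1. {#PBranch (?loc l)#})" "x \<in># (\<Sum>k<length ss. ?ch k)" for x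
    proof -
      obtain k where k: "k < length ss" "x \<in># ?ch k" using x(2) unfolding in_sum_mset_iff[OF finite_lessThan] by blast
      then obtain u where u: "u \<in># image_mset snd (insertions j (ss ! k))" "x = PBranch (ss[k := u])"
        unfolding set_image_mset by blast
      have "x = ?e \<or> x \<in># (\<Sum>l<length ss - 1. {#PBranch (?loc l)#})" using x(1) by simp
      then show False
      proof
        assume "x = ?e"
        then show False using N[OF k(1) u(1)] u(2) by (metis ptree.inject(2))
      next
        assume "x \<in># (\<Sum>l<length ss - 1. {#PBranch (?loc l)#})"
        then obtain l where "x \<in># {#PBranch (?loc l)#}" unfolding in_sum_mset_iff[OF finite_lessThan] by blast
        then have "x = PBranch (?loc l)" by (simp only: set_mset_add_mset_insert set_mset_empty singleton_iff)
        then show False using N[OF k(1) u(1)] u(2) by (metis ptree.inject(2))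
      qed
    qed
    then show ?thesis by blast
  qed
  show ?case unfolding eq by (intro simple_mset_union d1 d2 1 2 simple_mset_single)
qed

abbreviation (input) SP :: "nat \<Rightarrow> nat ptree set" where
  "SP n \<equiv> semiplanar {1..n}"

lemma SP_1: "SP 1 = {PLeaf 1}"
proof (intro equalityI subsetI)
  fix s assume "s \<in> SP 1"
  then have s: "plabels s = {1}" "ok s" by (auto simp: semiplanar_iff)
  show "s \<in> {PLeaf 1}"
  proof (cases s)
    case (PLeaf x)
    then show ?thesis using s by simp
  next
    case (PBranch ss)
    then have "0 < length ss" "1 < length ss" using s(2) by (auto simp: ok_PBranch)
    then have "plabels (ss ! 0) = {1}" "plabels (ss ! 1) = {1}"
      using nth_in_plabels[of 0 ss] nth_in_plabels[of 1 ss] s plabels_ne[OF ok_nth[of ss]] PBranch by (auto simp: subset_singleton_iff)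
    then show ?thesis using ok_disj_nth[of ss 0 1 1] s(2) \<open>1 < length ss\<close> \<open>0 < length ss\<close> PBranch by simp
  qed
qed (auto simp: semiplanar_iff)

lemma SP_props:
  assumes "s \<in> SP n"
  shows "ok s" "sp s" "plabels s = {1..n}" "\<forall>x\<in>plabels s. x < Suc n" "Suc n \<notin> plabels s" "normalise s = s"
  using assms normalise_id by (auto simp: semiplanar_iff)

lemma SP_not_leaf: "s \<in> SP n \<Longrightarrow> 2 \<le> n \<Longrightarrow> s \<noteq> PLeaf i"
proof
  assume "s \<in> SP n" "2 \<le> n" "s = PLeaf i"
  then have "{1..n} = {i}" by (simp add: semiplanar_iff)
  moreover have "1 \<in> {1..n}" "2 \<in> {1..n}" using \<open>2 \<le> n\<close> by auto
  ultimately show False by auto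
qed

lemma insertions_SP:
  assumes "s \<in> SP n" "(d, s') \<in># insertions (Suc n) s"
  shows "s' \<in> SP (Suc n)" "delete_leaf (Suc n) s' = s"
proof -
  note s = SP_props[OF assms(1)]
  have "insert (Suc n) {1..n} = {1..Suc n}" by auto
  then show "s' \<in> SP (Suc n)"
    using ok_insertions[OF s(1,5) assms(2)] sp_insertions[OF s(1,2,4) assms(2)] plabels_insertions[OF assms(2)] s(3)
    by (simp add: semiplanar_iff)
  show "delete_leaf (Suc n) s' = s" using delete_inserted[OF s(1,5) assms(2)] .
qed

lemma SP_delete:
  assumes "s \<in> SP (Suc n)" "1 \<le> n"
  shows "delete_leaf (Suc n) s \<in> SP n" "\<exists>d. (d, s) \<in># insertions (Suc n) (delete_leaf (Suc n) s)"
proof -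
  note s = SP_props[OF assms(1)]
  have nl: "s \<noteq> PLeaf (Suc n)" using SP_not_leaf[OF assms(1)] assms(2) by simp
  have j: "Suc n \<in> plabels s" "\<forall>x\<in>plabels s. x \<le> Suc n" using s(3) by auto
  note u = uninsert[OF s(1,2) j(2,1) nl]
  show "\<exists>d. (d, s) \<in># insertions (Suc n) (delete_leaf (Suc n) s)" using u by blast
  have "{1..Suc n} - {Suc n} = {1..n}" by auto
  then show "delete_leaf (Suc n) s \<in> SP n"
    using u plabels_delete[OF s(1) j(1) nl] s(3) by (simp add: semiplanar_iff)
qed

lemma SP_Suc: "1 \<le> n \<Longrightarrow> SP (Suc n) = (\<Union>s\<in>SP n. set_mset (image_mset snd (insertions (Suc n) s)))"
proof (intro equalityI subsetI)
  fix s assume n: "1 \<le> n" and s: "s \<in> SP (Suc n)"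
  obtain d where "(d, s) \<in># insertions (Suc n) (delete_leaf (Suc n) s)" using SP_delete(2)[OF s n] by blast
  then have "s \<in># image_mset snd (insertions (Suc n) (delete_leaf (Suc n) s))" by force
  then show "s \<in> (\<Union>s\<in>SP n. set_mset (image_mset snd (insertions (Suc n) s)))" using SP_delete(1)[OF s n] by blast
next
  fix s assume "s \<in> (\<Union>s\<in>SP n. set_mset (image_mset snd (insertions (Suc n) s)))"
  then obtain s0 d where "s0 \<in> SP n" "(d, s) \<in># insertions (Suc n) s0" by auto
  then show "s \<in> SP (Suc n)" by (rule insertions_SP(1))
qed

lemma finite_SP: "1 \<le> n \<Longrightarrow> finite (SP n)"
proof (induction n rule: dec_induct)
  case base
  then show ?case by (simp only: SP_1) simp
next
  case (step n)
  then show ?case unfolding SP_Suc[OF step(1)] by auto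
qed

text \<open>Deleting \<open>n + 1\<close> shows that different trees have disjoint sets of
  insertions, and no insertion is repeated, so the set sum equals the multiset sums.\<close>

lemma sum_SP_Suc:
  fixes g :: "nat ptree \<Rightarrow> real"
  assumes "1 \<le> n"
  shows "(\<Sum>s'\<in>SP (Suc n). g s') = (\<Sum>s\<in>SP n. \<Sum>x\<in>#insertions (Suc n) s. g (snd x))"
proof -
  have "(\<Sum>s'\<in>SP (Suc n). g s') = (\<Sum>s\<in>SP n. \<Sum>s'\<in>set_mset (image_mset snd (insertions (Suc n) s)). g s')"
    unfolding SP_Suc[OF assms]
  proof (rule sum.UNION_disjoint)
    show "\<forall>s\<in>SP n. \<forall>t\<in>SP n. s \<noteq> t \<longrightarrow> set_mset (image_mset snd (insertions (Suc n) s)) \<inter> set_mset (image_mset snd (insertions (Suc n) t)) = {}"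
    proof (intro ballI impI)
      fix s t assume st: "s \<in> SP n" "t \<in> SP n" "s \<noteq> t"
      have False if x: "x \<in># image_mset snd (insertions (Suc n) s)" "x \<in># image_mset snd (insertions (Suc n) t)" for x
      proof -
        obtain d e where "(d, x) \<in># insertions (Suc n) s" "(e, x) \<in># insertions (Suc n) t" using x by auto
        then have "delete_leaf (Suc n) x = s" "delete_leaf (Suc n) x = t" using st insertions_SP(2) by blast+
        then show False using st by simp
      qed
      then show "set_mset (image_mset snd (insertions (Suc n) s)) \<inter> set_mset (image_mset snd (insertions (Suc n) t)) = {}" by blast
    qed
  qed (use finite_SP[OF assms] in auto)
  also have "\<dots> = (\<Sum>s\<in>SP n. \<Sum>x\<in>#insertions (Suc n) s. g (snd x))"
  proof (rule sum.cong)
    fix s assume s: "s \<in> SP n"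
    let ?M = "image_mset snd (insertions (Suc n) s)"
    have "?M = mset_set (set_mset ?M)"
      by (rule simple_mset_eq[OF simple_insertions]) (use SP_props[OF s] in auto)
    then have "(\<Sum>s'\<in>set_mset ?M. g s') = sum_mset (image_mset g ?M)"
      unfolding sum_unfold_sum_mset by simp
    then show "(\<Sum>s'\<in>set_mset ?M. g s') = (\<Sum>x\<in>#insertions (Suc n) s. g (snd x))"
      by (simp add: multiset.map_comp comp_def)
  qed simp
  finally show ?thesis .
qed

section \<open>The deletion step applied to an inserted tree\<close>

definition shift_desc :: "nat \<Rightarrow> nat ptree \<Rightarrow> desc \<Rightarrow> desc" where
  "shift_desc i s d = map_cluster (image (relabel i (label_tilde i s))) (strip i (parent_cluster i s) d)"

text \<open>Both the swap and the closing of the gap are trivial here.\<close>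

lemma down_step_last:
  assumes "s \<in> SP n" "1 \<le> n" "(d, s') \<in># insertions (Suc n) s"
  shows "label_tilde (Suc n) s' = Suc n" "down_step (Suc n) s' = s"
proof -
  note s' = insertions_SP[OF assms(1,3)] and s = SP_props[OF assms(1)]
  note p = SP_props[OF s'(1)]
  have nl: "s' \<noteq> PLeaf (Suc n)" using SP_not_leaf[OF s'(1)] assms(2) by simp
  show l: "label_tilde (Suc n) s' = Suc n"
    using label_tilde_range[OF p(1,2) _ nl] p(3) by auto
  have "map_ptree (relabel (Suc n) (Suc n)) s = map_ptree id s"
    by (rule ptree.map_cong0) (use s(3) in \<open>auto simp: relabel_def\<close>)
  then show "down_step (Suc n) s' = s" unfolding down_step_eq l s'(2) by (simp add: ptree.map_id s(6))
qed

text \<open>The content of \<open>splits\<close> after relabelling: the part \<open>R\<close> is now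
  matched with the insertions of \<open>n\<close> into the tree after the whole deletion
  step.\<close>

definition down_splits :: "nat \<Rightarrow> nat \<Rightarrow> nat ptree \<Rightarrow> (desc \<times> nat ptree) multiset \<Rightarrow> (desc \<times> nat ptree) multiset \<Rightarrow> bool" where
  "down_splits n i s X R \<longleftrightarrow> insertions (Suc n) s = X + R \<and> image_mset fst X = lost i s \<and>
     (\<forall>d s'. (d, s') \<in># X \<longrightarrow> label_tilde i s' = Suc n \<and> down_step i s' = s) \<and>
     (\<forall>d s'. (d, s') \<in># R \<longrightarrow> label_tilde i s' = label_tilde i s \<and> cluster d \<noteq> {i} \<and>
       (parent_degree i s = 2 \<longrightarrow> cluster d \<noteq> parent_cluster i s)) \<and>
     image_mset (map_prod (shift_desc i s) (down_step i)) R = insertions n (down_step i s) \<and>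
     label_tilde i s \<in> {i..n}"

lemma down_splits_exist:
  assumes "s \<in> SP n" "2 \<le> n" "i \<in> {1..n}"
  shows "\<exists>X R. down_splits n i s X R"
proof -
  note s = SP_props[OF assms(1)]
  have nl: "s \<noteq> PLeaf i" using SP_not_leaf[OF assms(1,2)] .
  have i: "i \<in> plabels s" using assms(3) s(3) by simp
  obtain X R where "splits i (Suc n) s X R" using splits_exists[OF s(1,2,4) i nl] by blast
  note S = this[unfolded splits_def]
  let ?k = "label_tilde i s"
  have k: "?k \<in> {i..n}" using label_tilde_range[OF s(1,2) i nl] s(3) by simp
  have X: "label_tilde i s' = Suc n \<and> down_step i s' = s" if x: "(d, s') \<in># X" for d s'
  proof -
    have l: "label_tilde i s' = Suc n" using S x by blast
    have in': "(d, s') \<in># insertions (Suc n) s" using S x by simp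
    note p = SP_props[OF insertions_SP(1)[OF assms(1) in']]
    have nl': "s' \<noteq> PLeaf i" using SP_not_leaf[OF insertions_SP(1)[OF assms(1) in']] assms(2) by simp
    have "plabels (delete_leaf i s') = {1..Suc n} - {i}"
      using plabels_delete[OF p(1) _ nl'] p(3) assms(3) by simp
    \<comment> \<open>No label lies above the gap at \<open>n + 1\<close>, so the relabelling merely
      writes \<open>i\<close> for \<open>n + 1\<close>.\<close>
    then have "map_ptree (relabel i (Suc n)) (delete_leaf i s') = map_ptree (\<lambda>x. if x = Suc n then i else x) (delete_leaf i s')"
      using assms(3) by (intro ptree.map_cong0) (auto simp: relabel_def Transposition.transpose_def)
    then show ?thesis unfolding down_step_eq l using S x by simp
  qed
  have R: "label_tilde i s' = ?k" if "(d, s') \<in># R" for d s' using S that by blast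
  have img: "image_mset (map_prod (shift_desc i s) (down_step i)) R = insertions n (down_step i s)"
  proof -
    let ?f = "relabel i ?k"
    \<comment> \<open>The gap lies at or below \<open>n\<close>, so the new leaf
      \<open>n + 1\<close> becomes \<open>n\<close>.\<close>
    have fn: "?f (Suc n) = n" using k assms(3) by (simp add: relabel_def)
    have lD: "plabels (delete_leaf i s) = {1..n} - {i}" using plabels_delete[OF s(1) i nl] s(3) by simp
    have lt: "?f x < n" if "x \<in> {1..n} - {i}" for x
      using that k by (auto simp: relabel_def Transposition.transpose_def Let_def)
    \<comment> \<open>A branch point that would be left with one child is suppressed, so the weak
      invariant for \<open>insertions_normalise\<close> holds.\<close>
    have two: "two (map_ptree ?f (delete_leaf i s))"
    proof -
      have "two u \<Longrightarrow> two (map_ptree ?f u)" for u by (induction u) auto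
      moreover have "ok u \<Longrightarrow> i \<in> plabels u \<Longrightarrow> u \<noteq> PLeaf i \<Longrightarrow> two (delete_leaf i u)" for u
      proof (induction u)
        case (PBranch ss)
        obtain m where m: "m < length ss" "i \<in> plabels (ss ! m)"
          using PBranch.prems(2) by (auto simp: ptree.set(2) in_set_conv_nth)
        have t: "two u" if "u \<in> set ss" for u using ok_two ok_child[OF PBranch.prems(1) that] by blast
        have len: "2 \<le> length ss" using PBranch.prems(1) by (simp add: ok_PBranch)
        show ?case
        proof (cases "ss ! m = PLeaf i")
          case True
          let ?xs = "take m ss" and ?ys = "drop (Suc m) ss"
          have ss: "?xs @ PLeaf i # ?ys = ss" using id_take_nth_drop[OF m(1)] True by simp
          have sub: "set (?xs @ ?ys) \<subseteq> set ss" using set_take_subset set_drop_subset by fastforce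
          show ?thesis
          proof (cases "2 \<le> length (?xs @ ?ys)")
            case True
            then have "delete_leaf i (PBranch ss) = PBranch (?xs @ ?ys)"
              using delete_direct(1)[of ?xs i ?ys] PBranch.prems(1) unfolding ss by blast
            then show ?thesis using True sub t by auto
          next
            case False
            have "1 \<le> length (?xs @ ?ys)" using len m(1) by simp
            then have "length (?xs @ ?ys) = 1" using False by linarith
            then obtain u where u: "?xs @ ?ys = [u]" by (cases "?xs @ ?ys") auto
            then have "delete_leaf i (PBranch ss) = u"
              using delete_direct(2)[of ?xs i ?ys u] PBranch.prems(1) unfolding ss by blast
            then show ?thesis using sub t u by simp
          qed
        next
          case False
          have "delete_leaf i (PBranch ss) = PBranch (ss[m := delete_leaf i (ss ! m)])"
            using delete_neq[OF ok_nth[OF PBranch.prems(1) m(1)] m(2) False] ok_disj_nth[OF PBranch.prems(1) m(1)] m t len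
            by (intro delete_leaf_child) auto
          moreover have "two (delete_leaf i (ss ! m))"
            using PBranch.IH[OF nth_mem[OF m(1)] ok_nth[OF PBranch.prems(1) m(1)] m(2) False] .
          ultimately show ?thesis using len t set_update_subset_insert[of ss m "delete_leaf i (ss ! m)"] by auto
        qed
      qed simp
      ultimately show ?thesis using s(1) i nl by blast
    qed
    have "insertions n (down_step i s) = image_mset (apsnd normalise) (insertions (?f (Suc n)) (map_ptree ?f (delete_leaf i s)))"
      unfolding down_step_eq fn
      by (rule insertions_normalise[OF two]) (use lt lD in \<open>auto simp: ptree.set_map\<close>)
    also have "\<dots> = image_mset (apsnd normalise) (image_mset (map_prod (map_cluster (image ?f)) (map_ptree ?f)) (insertions (Suc n) (delete_leaf i s)))"
      unfolding insertions_map ..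
    also have "insertions (Suc n) (delete_leaf i s) = image_mset (map_prod (strip i (parent_cluster i s)) (delete_leaf i)) R"
      using S by simp
    finally have e: "insertions n (down_step i s) = image_mset (apsnd normalise) (image_mset (map_prod (map_cluster (image ?f)) (map_ptree ?f))
       (image_mset (map_prod (strip i (parent_cluster i s)) (delete_leaf i)) R))" .
    show ?thesis unfolding e multiset.map_comp
    proof (rule image_mset_cong)
      fix x assume x: "x \<in># R"
      obtain d s' where ds: "x = (d, s')" by (cases x)
      then have "label_tilde i s' = ?k" using R x by blast
      then show "map_prod (shift_desc i s) (down_step i) x = (apsnd normalise \<circ> (map_prod (map_cluster (image ?f)) (map_ptree ?f) \<circ> map_prod (strip i (parent_cluster i s)) (delete_leaf i))) x"
        by (simp add: ds shift_desc_def down_step_eq)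
    qed
  qed
  show ?thesis unfolding down_splits_def using S X img k by blast
qed

lemma SP_2: "s \<in> SP 2 \<Longrightarrow> s = PBranch [PLeaf 1, PLeaf 2]"
  using SP_Suc[of 1] SP_1 by (simp add: numeral_2_eq_2)

text \<open>Avoids a direct analysis of the normalised tree: at a lost location the result is the
  smaller tree itself, elsewhere it is an insertion into a tree covered by the induction
  hypothesis.\<close>

lemma down_step_SP:
  assumes "2 \<le> n" shows "s \<in> SP n \<Longrightarrow> i \<in> {1..n} \<Longrightarrow> down_step i s \<in> SP (n - 1)"
  using assms
proof (induction n arbitrary: s i rule: dec_induct)
  case base
  have s: "s = PBranch [PLeaf 1, PLeaf 2]" using SP_2 base by simp
  note p = SP_props[OF base(1)]
  have i: "i = 1 \<or> i = 2" using base(2) by auto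
  have nl: "s \<noteq> PLeaf i" using s by simp
  have k: "label_tilde i s \<in> {i..2}" using label_tilde_range[OF p(1,2) _ nl] p(3) base(2) by simp
  have d: "delete_leaf 1 s = PLeaf 2" "delete_leaf 2 s = PLeaf 1" unfolding s by (simp_all add: delete_leaf.simps(2))
  have l: "label_tilde 1 s = 2"
    using label_tilde_pair[of 1 2] unfolding s by simp
  have "down_step i s = PLeaf 1"
    using i
  proof
    assume "i = 1"
    then show ?thesis unfolding down_step_eq \<open>i = 1\<close> l d by (simp add: relabel_def)
  next
    assume "i = 2"
    then have "label_tilde 2 s = 2" using k by simp
    then show ?thesis unfolding down_step_eq \<open>i = 2\<close> by (simp add: d relabel_def)
  qed
  then show ?case using SP_1 by simp
next
  case (step n)
  have n1: "1 \<le> n" using step(1) by simp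
  define s0 where "s0 = delete_leaf (Suc n) s"
  have s0: "s0 \<in> SP n" unfolding s0_def using SP_delete(1)[OF step.prems(1) n1] .
  obtain d where d: "(d, s) \<in># insertions (Suc n) s0" using SP_delete(2)[OF step.prems(1) n1] unfolding s0_def by blast
  show ?case
  proof (cases "i = Suc n")
    case True
    then show ?thesis using down_step_last(2)[OF s0 n1 d] s0 by simp
  next
    case False
    then have i: "i \<in> {1..n}" using step.prems(2) by auto
    obtain X R where XR: "down_splits n i s0 X R" using down_splits_exist[OF s0 step(1) i] by blast
    note XR = XR[unfolded down_splits_def]
    consider "(d, s) \<in># X" | "(d, s) \<in># R" using d XR by auto
    then show ?thesis
    proof cases
      case 1
      then show ?thesis using XR s0 by auto
    next
      case 2
      then have "(shift_desc i s0 d, down_step i s) \<in># insertions n (down_step i s0)"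
      proof -
        have "insertions n (down_step i s0) = image_mset (map_prod (shift_desc i s0) (down_step i)) R" using XR by simp
        then show ?thesis using 2 by force
      qed
      moreover have "down_step i s0 \<in> SP (n - 1)" using step.IH[OF s0 i] .
      moreover obtain m where "n = Suc m" using n1 by (cases n) auto
      ultimately show ?thesis using insertions_SP(1)[of "down_step i s0" m] by simp
    qed
  qed
qed

section \<open>The law of the left-to-right orders\<close>

lemma sigma_cong:
  assumes "map least ss = map least ss'"
  shows "sigma ss = sigma ss'"
proof
  fix r
  have len: "length ss = length ss'" using map_eq_imp_length_eq[OF assms] .
  have le: "least (ss ! k) = least (ss' ! k)" if "k < length ss" for k
    using arg_cong[OF assms, of "\<lambda>xs. xs ! k"] that len by simp
  have c: "(k \<in> {1..length ss - 2} \<and> least (ss ! (k + 1)) = x) = (k \<in> {1..length ss' - 2} \<and> least (ss' ! (k + 1)) = x)" for k x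
    using le[of "k + 1"] len by auto
  show "sigma ss r = sigma ss' r" unfolding sigma_def c unfolding assms len by (rule refl)
qed

definition row :: "nat ptree list \<Rightarrow> nat list" where
  "row ss = map (inv_into {1..length ss - 2} (sigma ss)) [1..<length ss - 2 + 1]"

lemma perm_law_sigma: "perm_law \<alpha> \<theta> (length ss - 2) (sigma ss) = row_law \<alpha> \<theta> (length ss - 2) (row ss)"
  by (simp add: perm_law_def row_def)

text \<open>The entry \<open>Suc k\<close> occurs once; its place gives \<open>j\<close>, and
  removing it gives \<open>ys\<close>.\<close>

lemma permutations_Suc_eq:
  assumes "ys \<in> permutations_of_set {1..k}" "zs \<in> permutations_of_set {1..k}" "j \<le> k" "l \<le> k"
  shows "take j ys @ Suc k # drop j ys = take l zs @ Suc k # drop l zs \<longleftrightarrow> ys = zs \<and> j = l"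
proof
  assume e: "take j ys @ Suc k # drop j ys = take l zs @ Suc k # drop l zs"
  have len: "length ys = k" "length zs = k" using assms(1,2) by (simp_all add: length_finite_permutations_of_set)
  have n: "Suc k \<notin> set ys" "Suc k \<notin> set zs" using assms(1,2) by (auto simp: permutations_of_set_def)
  have "takeWhile (\<lambda>x. x \<noteq> Suc k) (take m xs @ Suc k # drop m xs) = take m xs" if "Suc k \<notin> set xs" for m xs
  proof -
    have "\<forall>x\<in>set (take m xs). x \<noteq> Suc k" using that set_take_subset[of m xs] by blast
    then have "takeWhile (\<lambda>x. x \<noteq> Suc k) (take m xs @ Suc k # drop m xs) = take m xs @ takeWhile (\<lambda>x. x \<noteq> Suc k) (Suc k # drop m xs)"
      by (intro takeWhile_append2) blast
    then show ?thesis by simp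
  qed
  note tw = this
  have t: "take j ys = take l zs" using tw[OF n(1), of j] tw[OF n(2), of l] unfolding e by (rule trans[OF sym])
  have "j = l" using arg_cong[OF t, of length] len assms(3,4) by simp
  have d: "drop j ys = drop l zs" using e unfolding t by simp
  have "ys = take j ys @ drop j ys" by simp
  also have "\<dots> = take l zs @ drop l zs" unfolding t d ..
  also have "\<dots> = zs" by simp
  finally show "ys = zs \<and> j = l" using \<open>j = l\<close> by blast
qed simp

text \<open>Each row has a unique predecessor, so a single term of the double sum survives.\<close>

lemma row_law_Suc:
  assumes "ys \<in> permutations_of_set {1..k}" "j \<le> k"
  shows "row_law \<alpha> \<theta> (Suc k) (take j ys @ Suc k # drop j ys) = row_law \<alpha> \<theta> k ys * seat_prob \<alpha> \<theta> k j"
proof -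
  let ?x = "take j ys @ Suc k # drop j ys"
  have fin: "finite (permutations_of_set {1..k})" by simp
  have "row_law \<alpha> \<theta> (Suc k) ?x = (\<Sum>zs \<in> permutations_of_set {1..k}. \<Sum>l = 0..k.
        of_bool (?x = take l zs @ Suc k # drop l zs) * row_law \<alpha> \<theta> k zs * seat_prob \<alpha> \<theta> k l)"
    by (rule row_law.simps(2))
  also have "\<dots> = (\<Sum>zs \<in> permutations_of_set {1..k}. \<Sum>l = 0..k.
        if l = j then (if zs = ys then row_law \<alpha> \<theta> k zs * seat_prob \<alpha> \<theta> k l else 0) else 0)"
  proof (intro sum.cong refl)
    fix zs l assume "zs \<in> permutations_of_set {1..k}" "l \<in> {0..k}"
    then have e: "(?x = take l zs @ Suc k # drop l zs) = (ys = zs \<and> j = l)"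
      by (intro permutations_Suc_eq[OF assms(1) _ assms(2)]) simp_all
    show "of_bool (?x = take l zs @ Suc k # drop l zs) * row_law \<alpha> \<theta> k zs * seat_prob \<alpha> \<theta> k l
      = (if l = j then (if zs = ys then row_law \<alpha> \<theta> k zs * seat_prob \<alpha> \<theta> k l else 0) else 0)"
      unfolding e by simp
  qed
  also have "\<dots> = (\<Sum>zs \<in> permutations_of_set {1..k}. if zs = ys then row_law \<alpha> \<theta> k zs * seat_prob \<alpha> \<theta> k j else 0)"
    using assms(2) by (intro sum.cong refl) (simp only: sum.delta[OF finite_atLeastAtMost] atLeastAtMost_iff le0 simp_thms if_True)
  also have "\<dots> = row_law \<alpha> \<theta> k ys * seat_prob \<alpha> \<theta> k j"
    using assms(1) by (simp only: sum.delta[OF fin] if_True)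
  finally show ?thesis .
qed

context
  fixes ss :: "nat ptree list"
  assumes ss: "ok (PBranch ss)" "ordered ss"
begin

lemma sigma_facts: "sigma ss permutes {1..length ss - 2}"
  "\<And>j. j \<in> {1..length ss - 2} \<Longrightarrow> least (ss ! (sigma ss j + 1)) = sort (map least ss) ! (j + 1)"
  "\<And>j k. j \<in> {1..length ss - 2} \<Longrightarrow> k \<in> {1..length ss - 2} \<Longrightarrow>
      least (ss ! (k + 1)) = sort (map least ss) ! (j + 1) \<Longrightarrow> sigma ss j = k"
proof -
  have d: "distinct (map least ss)" using ss(1) distinct_least[of ss] unfolding ok_PBranch by blast
  have l: "2 \<le> length ss" using ss(1) unfolding ok_PBranch by blast
  have o: "least (ss ! 0) < least (ss ! 1)" "\<And>k. 2 \<le> k \<Longrightarrow> k < length ss \<Longrightarrow> least (ss ! 1) < least (ss ! k)"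
    using ss(2) by (auto simp: ordered_nth)
  show "sigma ss permutes {1..length ss - 2}"
    "\<And>j. j \<in> {1..length ss - 2} \<Longrightarrow> least (ss ! (sigma ss j + 1)) = sort (map least ss) ! (j + 1)"
    "\<And>j k. j \<in> {1..length ss - 2} \<Longrightarrow> k \<in> {1..length ss - 2} \<Longrightarrow>
      least (ss ! (k + 1)) = sort (map least ss) ! (j + 1) \<Longrightarrow> sigma ss j = k"
    using sigma_spec[OF d l o] by blast+
qed

lemma row_permutation: "row ss \<in> permutations_of_set {1..length ss - 2}"
proof -
  let ?L = "length ss - 2"
  have b: "bij_betw (inv_into {1..?L} (sigma ss)) {1..?L} {1..?L}"
    using bij_betw_inv_into[OF permutes_imp_bij[OF sigma_facts(1)]] .
  have s: "set [1..<?L + 1] = {1..?L}" by auto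
  have "set (row ss) = {1..?L}" unfolding row_def set_map s using b by (simp add: bij_betw_def)
  moreover have "distinct (row ss)" unfolding row_def distinct_map s using b by (simp add: bij_betw_def)
  ultimately show ?thesis by (simp add: permutations_of_set_def)
qed

text \<open>The new leaf has the largest least label, so it is the last table in the enumeration and
  is seated with \<open>l\<close> tables on its left.\<close>

lemma row_insert:
  assumes lt: "\<forall>x\<in>plabels (PBranch ss). x < j" and l: "l < length ss - 1"
    and ok': "ok (PBranch (take (l + 2) ss @ PLeaf j # drop (l + 2) ss))"
    and or': "ordered (take (l + 2) ss @ PLeaf j # drop (l + 2) ss)"
  shows "row (take (l + 2) ss @ PLeaf j # drop (l + 2) ss) = take l (row ss) @ Suc (length ss - 2) # drop l (row ss)"
proof -
  let ?L = "length ss - 2" and ?t = "take (l + 2) ss @ PLeaf j # drop (l + 2) ss"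
  have l2: "2 \<le> length ss" using ss(1) by (simp add: ok_PBranch)
  have lenT: "length ?t - 2 = Suc ?L" using l2 by auto
  have T: "sigma ?t permutes {1..Suc ?L}"
    "\<And>r k. r \<in> {1..Suc ?L} \<Longrightarrow> k \<in> {1..Suc ?L} \<Longrightarrow> least (?t ! (k + 1)) = sort (map least ?t) ! (r + 1) \<Longrightarrow> sigma ?t r = k"
  proof -
    have d: "distinct (map least ?t)" using ok' distinct_least[of ?t] unfolding ok_PBranch by blast
    have l: "2 \<le> length ?t" using ok' unfolding ok_PBranch by blast
    have o: "least (?t ! 0) < least (?t ! 1)" "\<And>k. 2 \<le> k \<Longrightarrow> k < length ?t \<Longrightarrow> least (?t ! 1) < least (?t ! k)"
      using or' by (auto simp: ordered_nth)
    show "sigma ?t permutes {1..Suc ?L}" using sigma_spec(1)[OF d l o] unfolding lenT .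
    show "\<And>r k. r \<in> {1..Suc ?L} \<Longrightarrow> k \<in> {1..Suc ?L} \<Longrightarrow> least (?t ! (k + 1)) = sort (map least ?t) ! (r + 1) \<Longrightarrow> sigma ?t r = k"
      using sigma_spec(3)[OF d l o] unfolding lenT .
  qed
  have srt: "sort (map least ?t) = sort (map least ss) @ [j]"
  proof (rule properties_for_sort)
    have "mset (map least ?t) = mset (map least (take (l + 2) ss @ drop (l + 2) ss)) + {#least (PLeaf j)#}"
      by (simp del: append_take_drop_id)
    then show "mset (sort (map least ss) @ [j]) = mset (map least ?t)"
      by (simp add: least_def)
    have "x \<le> j" if x: "x \<in> set (map least ss)" for x
    proof -
      obtain u where u: "u \<in> set ss" "x = least u" using x by auto
      have "least u \<in> plabels (PBranch ss)" using least_in[OF ok_child[OF ss(1) u(1)]] u(1) by (auto simp: ptree.set(2))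
      then show ?thesis using lt u(2) by auto
    qed
    then show "sorted (sort (map least ss) @ [j])" by (auto simp: sorted_append)
  qed
  have nthT: "?t ! k = (if k < l + 2 then ss ! k else if k = l + 2 then PLeaf j else ss ! (k - 1))" for k
  proof -
    have lt: "length (take (l + 2) ss) = l + 2" using l by simp
    consider "k < l + 2" | "k = l + 2" | m where "k = l + 3 + m"
    proof -
      have "k < l + 2 \<or> k = l + 2 \<or> k = l + 3 + (k - (l + 3))" by linarith
      then show thesis using that by blast
    qed
    then show ?thesis
    proof cases
      case 1 then show ?thesis using lt by (simp add: nth_append)
    next
      case 2 then show ?thesis using lt by (simp add: nth_append)
    next
      case 3 then show ?thesis using lt l by (simp add: nth_append)
    qed
  qed
  \<comment> \<open>Tables to the right of the new leaf move by one position.\<close>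
  define p where "p k = (if k \<le> l then k else Suc k)" for k
  have sT: "sigma ?t r = p (sigma ss r)" if r: "r \<in> {1..?L}" for r
  proof (rule T(2))
    have k: "sigma ss r \<in> {1..?L}" using permutes_in_image[OF sigma_facts(1)] r by blast
    show "r \<in> {1..Suc ?L}" "p (sigma ss r) \<in> {1..Suc ?L}" using r k by (auto simp: p_def)
    have "?t ! (p (sigma ss r) + 1) = ss ! (sigma ss r + 1)" unfolding nthT by (auto simp: p_def)
    moreover have "(sort (map least ss) @ [j]) ! (r + 1) = sort (map least ss) ! (r + 1)"
      using r by (auto simp: nth_append)
    ultimately show "least (?t ! (p (sigma ss r) + 1)) = sort (map least ?t) ! (r + 1)"
      unfolding srt using sigma_facts(2)[OF r] by simp
  qed
  have sT2: "sigma ?t (Suc ?L) = Suc l"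
  proof (rule T(2))
    show "Suc ?L \<in> {1..Suc ?L}" "Suc l \<in> {1..Suc ?L}" using l by auto
    have "?t ! (Suc l + 1) = PLeaf j" unfolding nthT by simp
    moreover have "length (sort (map least ss)) = Suc ?L + 1" using l2 by simp
    then have "(sort (map least ss) @ [j]) ! (Suc ?L + 1) = j" by (simp only: nth_append_length flip: \<open>length (sort (map least ss)) = Suc ?L + 1\<close>)
    ultimately show "least (?t ! (Suc l + 1)) = sort (map least ?t) ! (Suc ?L + 1)"
      unfolding srt by (simp add: least_def)
  qed
  have injT: "inj_on (sigma ?t) {1..Suc ?L}" using permutes_inj_on[OF T(1)] .
  have lenr: "length (row ss) = ?L" by (simp add: row_def del: upt_Suc)
  show ?thesis
  proof (rule nth_equalityI)
    show "length (row ?t) = length (take l (row ss) @ Suc ?L # drop l (row ss))"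
    proof -
      have "length (row ?t) = Suc ?L" unfolding row_def lenT by (simp del: upt_Suc)
      moreover have "length (take l xs @ x # drop l xs) = Suc (length xs)" for x :: nat and xs by (simp add: min_def)
      ultimately show ?thesis unfolding lenr[symmetric] by (simp only:)
    qed
  next
    fix k assume "k < length (row ?t)"
    then have k: "k < Suc ?L" unfolding row_def lenT by (simp del: upt_Suc)
    have lhs: "row ?t ! k = inv_into {1..Suc ?L} (sigma ?t) (Suc k)"
      unfolding row_def lenT using k by (simp del: upt_Suc)
    have rhs: "(take l (row ss) @ Suc ?L # drop l (row ss)) ! k
      = (if k < l then row ss ! k else if k = l then Suc ?L else row ss ! (k - 1))"
      using k l by (auto simp: nth_append lenr min_def not_less nth_Cons')
    have rw: "row ss ! m = inv_into {1..?L} (sigma ss) (Suc m)" if "m < ?L" for m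
      unfolding row_def using that by (simp del: upt_Suc)
    have inv: "inv_into {1..?L} (sigma ss) m \<in> {1..?L}" "sigma ss (inv_into {1..?L} (sigma ss) m) = m" if "m \<in> {1..?L}" for m
    proof -
      have im: "m \<in> sigma ss ` {1..?L}" unfolding permutes_image[OF sigma_facts(1)] by (rule that)
      show "inv_into {1..?L} (sigma ss) m \<in> {1..?L}" "sigma ss (inv_into {1..?L} (sigma ss) m) = m"
        using inv_into_into[OF im] f_inv_into_f[OF im] by blast+
    qed
    have fe: "inv_into {1..Suc ?L} (sigma ?t) m = r" if "r \<in> {1..Suc ?L}" "sigma ?t r = m" for m r
      using inv_into_f_eq[OF injT that] .
    consider "k < l" | "k = l" | "l < k" by linarith
    then show "row ?t ! k = (take l (row ss) @ Suc ?L # drop l (row ss)) ! k"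
    proof cases
      case 1
      then have kL: "Suc k \<in> {1..?L}" using l by auto
      have "inv_into {1..Suc ?L} (sigma ?t) (Suc k) = inv_into {1..?L} (sigma ss) (Suc k)"
        by (rule fe) (use inv[OF kL] sT[OF inv(1)[OF kL]] 1 in \<open>auto simp: p_def\<close>)
      then show ?thesis unfolding lhs rhs using 1 rw[of k] kL by simp
    next
      case 2
      have "Suc ?L \<in> {1..Suc ?L}" by simp
      then show ?thesis unfolding lhs rhs unfolding 2 using fe[OF _ sT2] by simp
    next
      case 3
      then have kL: "k \<in> {1..?L}" using k by auto
      have "inv_into {1..Suc ?L} (sigma ?t) (Suc k) = inv_into {1..?L} (sigma ss) k"
        by (rule fe) (use inv[OF kL] sT[OF inv(1)[OF kL]] 3 in \<open>auto simp: p_def\<close>)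
      then show ?thesis unfolding lhs rhs using 3 rw[of "k - 1"] kL by simp
    qed
  qed
qed

end

section \<open>The weight of a drawing within its fibre\<close>

definition pi_weight :: "real \<Rightarrow> real \<Rightarrow> nat ptree \<Rightarrow> real" where
  "pi_weight \<alpha> \<theta> s = (\<Prod>ss \<in> pbranch_points s. perm_law \<alpha> \<theta> (length ss - 2) (sigma ss))"

text \<open>The tree \<open>t\<close> enters only through the indicator. Hence the mixtures of these
  laws are the functions \<open>m (proj s) * pi_weight s\<close>.\<close>

lemma Pi_kernel_eq: "Pi_kernel \<alpha> \<gamma> t s = of_bool (proj s = t) * pi_weight \<alpha> (\<alpha> - \<gamma>) s"
  by (simp add: Pi_kernel_def pi_weight_def)

lemma finite_pbranch_points: "finite (pbranch_points s)"
  by (induction s) (auto simp: pbranch_points_PLeaf pbranch_points_PBranch)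

lemma pbranch_points_labels: "ok s \<Longrightarrow> ss \<in> pbranch_points s \<Longrightarrow> plabels (PBranch ss) \<subseteq> plabels s \<and> plabels (PBranch ss) \<noteq> {}"
  unfolding pbranch_points_def using plabels_subtree[of "PBranch ss" s] plabels_ne[OF ok_sub[of s "PBranch ss"]] by auto

lemma pi_weight_PLeaf: "pi_weight \<alpha> \<theta> (PLeaf i) = 1"
  by (simp add: pi_weight_def pbranch_points_PLeaf)

text \<open>The product over a set may be taken position by position, since different children have
  different branch points (their label sets are disjoint) and no branch point lies above
  itself.\<close>

lemma pi_weight_PBranch:
  assumes "ok (PBranch ss)"
  shows "pi_weight \<alpha> \<theta> (PBranch ss) = row_law \<alpha> \<theta> (length ss - 2) (row ss) * (\<Prod>k<length ss. pi_weight \<alpha> \<theta> (ss ! k))"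
proof -
  let ?f = "\<lambda>ss. perm_law \<alpha> \<theta> (length ss - 2) (sigma ss)"
  have eq: "pbranch_points (PBranch ss) = insert ss (\<Union>k<length ss. pbranch_points (ss ! k))"
    unfolding pbranch_points_PBranch set_conv_nth by blast
  have no: "ss \<notin> (\<Union>k<length ss. pbranch_points (ss ! k))"
  proof
    assume "ss \<in> (\<Union>k<length ss. pbranch_points (ss ! k))"
    then obtain k where k: "k < length ss" "ss \<in> pbranch_points (ss ! k)" by blast
    have "size u \<le> size v" if "u \<in> psubtrees v" for u v :: "nat ptree"
      using that
    proof (induction v)
      case (PBranch vs)
      show ?case
      proof (cases "u = PBranch vs")
        case False
        then obtain w where w: "w \<in> set vs" "u \<in> psubtrees w" using PBranch.prems by auto
        then have "size u \<le> size w" using PBranch.IH by blast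
        also have "size w \<le> size_list size vs" by (rule size_list_estimation'[OF w(1) order.refl])
        finally show ?thesis by simp
      qed simp
    qed simp
    then have "size (PBranch ss) \<le> size (ss ! k)" using k(2) unfolding pbranch_points_def by blast
    moreover have "size (ss ! k) \<le> size_list size ss" by (rule size_list_estimation'[OF nth_mem[OF k(1)] order.refl])
    ultimately show False by simp
  qed
  have "(\<Prod>ss\<in>(\<Union>k<length ss. pbranch_points (ss ! k)). ?f ss) = (\<Prod>k<length ss. \<Prod>ss\<in>pbranch_points (ss ! k). ?f ss)"
  proof (rule prod.UNION_disjoint)
    show "\<forall>k\<in>{..<length ss}. \<forall>l\<in>{..<length ss}. k \<noteq> l \<longrightarrow> pbranch_points (ss ! k) \<inter> pbranch_points (ss ! l) = {}"
    proof (intro ballI impI)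
      fix k l assume kl: "k \<in> {..<length ss}" "l \<in> {..<length ss}" "k \<noteq> l"
      have "plabels (ss ! k) \<inter> plabels (ss ! l) = {}" using disj_nth[of ss k l] kl assms unfolding ok_PBranch by blast
      moreover have "ok (ss ! k)" "ok (ss ! l)" using ok_nth[OF assms] kl by auto
      ultimately show "pbranch_points (ss ! k) \<inter> pbranch_points (ss ! l) = {}"
        using pbranch_points_labels[of "ss ! k"] pbranch_points_labels[of "ss ! l"] by blast
    qed
  qed (simp_all add: finite_pbranch_points)
  moreover have "finite (\<Union>k<length ss. pbranch_points (ss ! k))" by (simp add: finite_pbranch_points)
  ultimately show ?thesis unfolding pi_weight_def eq using no by (simp add: perm_law_sigma)
qed

text \<open>A branch point with \<open>c\<close> children has a row of \<open>c - 2\<close> tables.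
  All places but the rightmost are equally likely, so the leftmost place 0 represents them.\<close>

fun seat :: "real \<Rightarrow> real \<Rightarrow> desc \<Rightarrow> real" where
  "seat \<alpha> \<theta> (E b C) = 1"
| "seat \<alpha> \<theta> (V b C c) = seat_prob \<alpha> \<theta> (c - 2) (if b then c - 2 else 0)"

text \<open>Only the row at the chosen branch point changes, by one seating; elsewhere the least
  labels are unchanged. A branch point created on an edge has an empty row and contributes the
  factor 1.\<close>

lemma pi_weight_insertions:
  "ok s \<Longrightarrow> sp s \<Longrightarrow> \<forall>x\<in>plabels s. x < j \<Longrightarrow> (d, s') \<in># insertions j s \<Longrightarrow> pi_weight \<alpha> \<theta> s' = pi_weight \<alpha> \<theta> s * seat \<alpha> \<theta> d"
proof (induction s arbitrary: s' d)
  case (PLeaf x)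
  then have "s' = PBranch [PLeaf x, PLeaf j]" "d = E True {x}" "ok s'" using ok_insertions[OF PLeaf.prems(1) _ PLeaf.prems(4)] by auto
  then show ?case using pi_weight_PBranch[of "[PLeaf x, PLeaf j]"] by (simp add: pi_weight_PLeaf row_def lessThan_Suc)
next
  case (PBranch ss)
  note ok = PBranch.prems(1) and sp = PBranch.prems(2) and lt = PBranch.prems(3)
  have j: "j \<notin> plabels (PBranch ss)" using lt by blast
  have len: "2 \<le> length ss" using ok by (simp add: ok_PBranch)
  have ok': "ok s'" using ok_insertions[OF ok j PBranch.prems(4)] .
  have sp': "sp s'" using sp_insertions[OF ok sp lt PBranch.prems(4)] .
  from PBranch.prems(4) consider "s' = PBranch [PBranch ss, PLeaf j]" "d = E False (plabels (PBranch ss))"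
    | l where "l < length ss - 1" "s' = PBranch (take (l + 2) ss @ PLeaf j # drop (l + 2) ss)"
       "d = V (l = length ss - 2) (plabels (PBranch ss)) (length ss)"
    | k u where "k < length ss" "(d, u) \<in># insertions j (ss ! k)" "s' = PBranch (ss[k := u])"
    unfolding in_insertions_PBranch by blast
  then show ?case
  proof cases
    case 1
    then show ?thesis using pi_weight_PBranch[of "[PBranch ss, PLeaf j]"] ok'
      by (simp add: pi_weight_PLeaf row_def lessThan_Suc)
  next
    case 2
    let ?t = "take (l + 2) ss @ PLeaf j # drop (l + 2) ss"
    have okt: "ok (PBranch ?t)" "ordered ?t" using ok' sp' 2(2) by (auto simp: sp_PBranch)
    have lent: "length ?t - 2 = Suc (length ss - 2)" using len by auto
    have r: "row_law \<alpha> \<theta> (length ?t - 2) (row ?t) = row_law \<alpha> \<theta> (length ss - 2) (row ss) * seat_prob \<alpha> \<theta> (length ss - 2) l"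
      unfolding lent row_insert[OF ok ordered_of_sp[OF sp] lt 2(1) okt]
      by (rule row_law_Suc[OF row_permutation[OF ok ordered_of_sp[OF sp]]]) (use 2(1) in auto)
    have p: "(\<Prod>k<length xs. pi_weight \<alpha> \<theta> (xs ! k)) = prod_list (map (pi_weight \<alpha> \<theta>) xs)" for xs
      by (simp add: prod.list_conv_set_nth atLeast0LessThan)
    have q: "prod_list (map (pi_weight \<alpha> \<theta>) ?t) = prod_list (map (pi_weight \<alpha> \<theta>) ss)"
    proof -
      have "prod_list (map (pi_weight \<alpha> \<theta>) ?t) = prod_list (map (pi_weight \<alpha> \<theta>) (take (l + 2) ss @ drop (l + 2) ss))"
        by (simp add: pi_weight_PLeaf del: append_take_drop_id)
      then show ?thesis by simp
    qed
    have s: "seat \<alpha> \<theta> d = seat_prob \<alpha> \<theta> (length ss - 2) l"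
      using 2(1) unfolding 2(3) by (auto simp: seat_prob_def)
    show ?thesis unfolding 2(2) pi_weight_PBranch[OF okt(1)] pi_weight_PBranch[OF ok] p q r s by simp
  next
    case 3
    have lab: "\<forall>x\<in>plabels (ss ! k). x < j" using lt nth_in_plabels[OF 3(1)] by blast
    have le: "least u = least (ss ! k)" using least_insertions[OF 3(2) plabels_ne[OF ok_nth[OF ok 3(1)]] lab] .
    have "sp (ss ! k)" using sp 3(1) by (simp add: sp_PBranch)
    then have IH: "pi_weight \<alpha> \<theta> u = pi_weight \<alpha> \<theta> (ss ! k) * seat \<alpha> \<theta> d"
      using PBranch.IH[OF nth_mem[OF 3(1)] ok_nth[OF ok 3(1)] _ lab 3(2)] by blast
    have ml: "map least (ss[k := u]) = map least ss"
      using le 3(1) by (intro nth_equalityI) (auto simp: nth_list_update)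
    have r: "row (ss[k := u]) = row ss" unfolding row_def sigma_cong[OF ml] by simp
    have k: "k \<in> {..<length ss}" using 3(1) by simp
    have "(\<Prod>l<length ss. pi_weight \<alpha> \<theta> (ss[k := u] ! l)) = (\<Prod>l<length ss. pi_weight \<alpha> \<theta> (ss ! l)) * seat \<alpha> \<theta> d"
      unfolding prod.remove[OF finite_lessThan k] using 3(1) IH by simp
    then show ?thesis using pi_weight_PBranch[OF ok] pi_weight_PBranch[of "ss[k := u]"] ok' 3(3) r by simp
  qed
qed

section \<open>Projection to trees\<close>

lemma proj_PBranch_eq: "proj (PBranch ss) = proj (PBranch ts) \<longleftrightarrow> proj ` set ss = proj ` set ts"
proof -
  have "proj (PBranch ss) = proj (PBranch ts) \<longleftrightarrow> fset (fset_of_list (map proj ss)) = fset (fset_of_list (map proj ts))"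
    unfolding fset_inject by simp
  then show ?thesis by (simp add: fset_of_list.rep_eq)
qed

lemma proj_PLeaf: "proj t = proj (PLeaf x) \<longleftrightarrow> t = PLeaf x"
  by (cases t) auto

lemma plabels_proj: "proj s = proj t \<Longrightarrow> plabels s = plabels t"
  by (metis labels_proj)

text \<open>Two drawings of one tree have the same children up to order and up to redrawing; this
  allows a parallel descent into both.\<close>

lemma proj_parallel:
  assumes "ok (PBranch ss)" "ok (PBranch ts)" "proj (PBranch ss) = proj (PBranch ts)"
  shows "length ss = length ts" "m < length ss \<Longrightarrow> \<exists>m'<length ts. proj (ts ! m') = proj (ss ! m)"
    "inj_on proj (set ss)" "distinct ss"
proof -
  have e: "proj ` set ss = proj ` set ts" using assms(3) unfolding proj_PBranch_eq .
  have d: "distinct (map proj xs)" if "ok (PBranch xs)" for xs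
    using that distinct_proj[of xs] unfolding ok_PBranch by blast
  show "inj_on proj (set ss)" "distinct ss" using d[OF assms(1)] by (simp_all add: distinct_map)
  have "length (map proj ss) = length (map proj ts)"
    using d[OF assms(1)] d[OF assms(2)] distinct_card[of "map proj ss"] distinct_card[of "map proj ts"] e by simp
  then show "length ss = length ts" by simp
  assume "m < length ss"
  then have "proj (ss ! m) \<in> proj ` set ts" using e by (metis imageI nth_mem)
  then obtain w where "w \<in> set ts" "proj (ss ! m) = proj w" by blast
  then show "\<exists>m'<length ts. proj (ts ! m') = proj (ss ! m)" by (metis in_set_conv_nth)
qed

lemma spine_child_nth:
  assumes "ok (PBranch ss)" "m < length ss" "i \<in> plabels (ss ! m)"
  shows "ss ! m \<noteq> PLeaf i \<Longrightarrow> spine i (PBranch ss) ! 0 = spine i (ss ! m) ! 0"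
    "ss ! m = PLeaf i \<Longrightarrow> spine i (PBranch ss) ! 0 = ss"
  using spine_PBranch[OF assms] spine_nonempty[OF assms(3)] by (auto simp: nth_append)

text \<open>Both drawings are followed to the child containing \<open>i\<close>. No such statement
  holds for the label tilde, which depends on the left-to-right order.\<close>

lemma parent_proj:
  "ok s \<Longrightarrow> ok t \<Longrightarrow> proj s = proj t \<Longrightarrow> i \<in> plabels s \<Longrightarrow> s \<noteq> PLeaf i \<Longrightarrow>
   parent_cluster i s = parent_cluster i t \<and> parent_degree i s = parent_degree i t \<and> proj (delete_leaf i s) = proj (delete_leaf i t)"
proof (induction s arbitrary: t)
  case (PLeaf x)
  then show ?case by simp
next
  case (PBranch ss)
  obtain ts where t: "t = PBranch ts" using PBranch.prems(3) by (cases t) auto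
  note oks = PBranch.prems(1) and okt = PBranch.prems(2)[unfolded t] and e = PBranch.prems(3)[unfolded t]
  note par = proj_parallel[OF oks okt e] and par' = proj_parallel[OF okt oks e[symmetric]]
  have es: "proj ` set ss = proj ` set ts" using e unfolding proj_PBranch_eq .
  obtain m where m: "m < length ss" "i \<in> plabels (ss ! m)"
    using PBranch.prems(4) by (auto simp: ptree.set(2) in_set_conv_nth)
  obtain m' where m': "m' < length ts" "proj (ts ! m') = proj (ss ! m)" using par(2)[OF m(1)] by blast
  have i': "i \<in> plabels (ts ! m')" using plabels_proj[OF m'(2)] m(2) by simp
  have upd: "proj ` set (xs[k := D]) = insert (proj D) (proj ` set xs - {proj (xs ! k)})"
    if "distinct xs" "inj_on proj (set xs)" "k < length xs" for xs k D
    using that by (auto simp: set_update_distinct inj_on_def)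
  show ?case
  proof (cases "ss ! m = PLeaf i")
    case False
    have nl': "ts ! m' \<noteq> PLeaf i" using False m'(2) proj_PLeaf by metis
    have IH: "parent_cluster i (ss ! m) = parent_cluster i (ts ! m')" "parent_degree i (ss ! m) = parent_degree i (ts ! m')"
      "proj (delete_leaf i (ss ! m)) = proj (delete_leaf i (ts ! m'))"
      using PBranch.IH[OF nth_mem[OF m(1)] ok_nth[OF oks m(1)] ok_nth[OF okt m'(1)] m'(2)[symmetric] m(2) False] by auto
    have del: "delete_leaf i (PBranch xs) = PBranch (xs[k := delete_leaf i (xs ! k)])"
      if "ok (PBranch xs)" "k < length xs" "i \<in> plabels (xs ! k)" "xs ! k \<noteq> PLeaf i" for xs k
      using that delete_neq[OF ok_nth[OF that(1,2)] that(3,4)] ok_disj_nth[OF that(1,2)] ok_two[OF ok_nth[OF that(1)]]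
      by (intro delete_leaf_child) (auto simp: ok_PBranch)
    have "proj (delete_leaf i (PBranch ss)) = proj (delete_leaf i (PBranch ts))"
      unfolding del[OF oks m False] del[OF okt m'(1) i' nl'] proj_PBranch_eq
        upd[OF par(4,3) m(1)] upd[OF par'(4,3) m'(1)] es m'(2) IH(3) ..
    then show ?thesis unfolding t parent_cluster_def parent_degree_def
        spine_child_nth(1)[OF oks m False] spine_child_nth(1)[OF okt m'(1) i' nl']
      using IH unfolding parent_cluster_def parent_degree_def by blast
  next
    case True
    have l': "ts ! m' = PLeaf i" using m'(2) True proj_PLeaf by metis
    have pl: "plabels (PBranch ss) = plabels (PBranch ts)" using plabels_proj[OF e] .
    have rm: "proj ` set (take k xs @ drop (Suc k) xs) = proj ` set xs - {proj (xs ! k)}"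
      if "distinct xs" "inj_on proj (set xs)" "k < length xs" for xs k
    proof -
      have "distinct (take k xs @ xs ! k # drop (Suc k) xs)" using that(1,3) id_take_nth_drop by metis
      then have "set (take k xs @ drop (Suc k) xs) = set (take k xs @ xs ! k # drop (Suc k) xs) - {xs ! k}" by auto
      also have "take k xs @ xs ! k # drop (Suc k) xs = xs" using id_take_nth_drop[OF that(3)] by simp
      finally show ?thesis using that(2,3) by (auto simp: inj_on_def)
    qed
    have del: "delete_leaf i (PBranch xs) = (if length xs = 2 then hd (take k xs @ drop (Suc k) xs) else PBranch (take k xs @ drop (Suc k) xs))"
      "length xs = 2 \<Longrightarrow> take k xs @ drop (Suc k) xs = [hd (take k xs @ drop (Suc k) xs)]"
      if "ok (PBranch xs)" "k < length xs" "xs ! k = PLeaf i" for xs k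
    proof -
      have xs: "take k xs @ PLeaf i # drop (Suc k) xs = xs" using id_take_nth_drop[OF that(2)] that(3) by simp
      have len: "length (take k xs @ drop (Suc k) xs) = length xs - 1" using that(2) by simp
      show one: "take k xs @ drop (Suc k) xs = [hd (take k xs @ drop (Suc k) xs)]" if "length xs = 2"
        using len that by (cases "take k xs @ drop (Suc k) xs") auto
      show "delete_leaf i (PBranch xs) = (if length xs = 2 then hd (take k xs @ drop (Suc k) xs) else PBranch (take k xs @ drop (Suc k) xs))"
      proof (cases "length xs = 2")
        case True
        then show ?thesis using delete_direct(2)[of "take k xs" i "drop (Suc k) xs"] that(1) one[OF True] unfolding xs by simp
      next
        case False
        then have "2 \<le> length (take k xs @ drop (Suc k) xs)" using len that(1) unfolding ok_PBranch by linarith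
        then show ?thesis using delete_direct(1)[of "take k xs" i "drop (Suc k) xs"] that(1) False unfolding xs by simp
      qed
    qed
    have r: "proj ` set (take m ss @ drop (Suc m) ss) = proj ` set (take m' ts @ drop (Suc m') ts)"
      unfolding rm[OF par(4,3) m(1)] rm[OF par'(4,3) m'(1)] es m'(2) ..
    have "proj (delete_leaf i (PBranch ss)) = proj (delete_leaf i (PBranch ts))"
    proof (cases "length ss = 2")
      case True2: True
      then have lt2: "length ts = 2" using par(1) by simp
      have "{proj (hd (take m ss @ drop (Suc m) ss))} = {proj (hd (take m' ts @ drop (Suc m') ts))}"
        using r del(2)[OF oks m(1) True True2] del(2)[OF okt m'(1) l' lt2]
        by (metis list.set(1) list.set(2) image_empty image_insert)
      then show ?thesis unfolding del(1)[OF oks m(1) True] del(1)[OF okt m'(1) l'] using True2 lt2 by simp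
    next
      case False2: False
      then have lt2: "length ts \<noteq> 2" using par(1) by simp
      show ?thesis unfolding del(1)[OF oks m(1) True] del(1)[OF okt m'(1) l'] if_not_P[OF False2] if_not_P[OF lt2]
          proj_PBranch_eq by (rule r)
    qed
    then show ?thesis unfolding t parent_cluster_def parent_degree_def
        spine_child_nth(2)[OF oks m True] spine_child_nth(2)[OF okt m'(1) i' l']
      using pl par(1) by simp
  qed
qed

text \<open>What remains of a location after projection.\<close>

fun key :: "desc \<Rightarrow> desc" where
  "key (E b C) = E b C"
| "key (V b C c) = V True C c"

lemma cluster_key: "cluster (key d) = cluster d"
  by (cases d) auto

text \<open>The key can be read off from the enlarged tree at the parent of \<open>j\<close>: a
  binary parent was created on an edge, a larger one existed before with one child less.\<close>

lemma key_insertions: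
  "ok s \<Longrightarrow> j \<notin> plabels s \<Longrightarrow> (d, s') \<in># insertions j s \<Longrightarrow>
   cluster d = parent_cluster j s' - {j} \<and> key d = (if parent_degree j s' = 2 then E (card (cluster d) = 1) (cluster d) else V True (cluster d) (parent_degree j s' - 1))"
proof (induction s arbitrary: s' d)
  case (PLeaf x)
  then have s': "s' = PBranch [PLeaf x, PLeaf j]" "d = E True {x}" by auto
  have ok': "ok (PBranch [PLeaf x, PLeaf j])" using ok_insertions[OF PLeaf] s' by simp
  have "spine j s' ! 0 = [PLeaf x, PLeaf j]"
    using spine_child_nth(2)[OF ok', of 1 j] unfolding s' by simp
  then show ?case using s' PLeaf.prems(2) by (auto simp: parent_cluster_def parent_degree_def ptree.set(2))
next
  case (PBranch ss)
  note ok = PBranch.prems(1) and j = PBranch.prems(2)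
  have len: "2 \<le> length ss" using ok by (simp add: ok_PBranch)
  note ok' = ok_insertions[OF PBranch.prems] and pl = plabels_insertions[OF PBranch.prems(3)]
  \<comment> \<open>A branch point carries at least two labels, so the size of the cluster tells
    external edges from internal ones.\<close>
  have card1: "card (plabels (PBranch ss)) \<noteq> 1"
  proof
    assume "card (plabels (PBranch ss)) = 1"
    then obtain x where x: "plabels (PBranch ss) = {x}" by (metis One_nat_def card_1_singletonE)
    have 01: "0 < length ss" "1 < length ss" using len by auto
    have "plabels (ss ! 0) = {x}" "plabels (ss ! 1) = {x}"
      using nth_in_plabels[OF 01(1)] nth_in_plabels[OF 01(2)] plabels_ne[OF ok_nth[OF ok 01(1)]] plabels_ne[OF ok_nth[OF ok 01(2)]]
      unfolding x by blast+
    then show False using ok_disj_nth[OF ok 01, of x] by simp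
  qed
  from PBranch.prems(3) consider "s' = PBranch [PBranch ss, PLeaf j]" "d = E False (plabels (PBranch ss))"
    | l where "l < length ss - 1" "s' = PBranch (take (l + 2) ss @ PLeaf j # drop (l + 2) ss)"
       "d = V (l = length ss - 2) (plabels (PBranch ss)) (length ss)"
    | k u where "k < length ss" "(d, u) \<in># insertions j (ss ! k)" "s' = PBranch (ss[k := u])"
    unfolding in_insertions_PBranch by blast
  then show ?case
  proof cases
    case 1
    have sp: "spine j s' ! 0 = [PBranch ss, PLeaf j]"
      using spine_child_nth(2)[of "[PBranch ss, PLeaf j]" 1 j] ok' unfolding 1 by simp
    then show ?thesis using pl j card1 1 unfolding parent_cluster_def parent_degree_def sp by auto
  next
    case 2
    let ?t = "take (l + 2) ss @ PLeaf j # drop (l + 2) ss"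
    have nth: "?t ! (l + 2) = PLeaf j" "l + 2 < length ?t" using 2(1) by (auto simp: nth_append)
    have sp: "spine j s' ! 0 = ?t"
      using spine_child_nth(2)[of ?t "l + 2" j, unfolded nth(1)] ok' nth(2) unfolding 2 by simp
    have lt: "length ?t = length ss + 1" using len by simp
    show ?thesis using pl j len 2 unfolding parent_cluster_def parent_degree_def sp lt by auto
  next
    case 3
    have jk: "j \<notin> plabels (ss ! k)" using j nth_in_plabels[OF 3(1)] by blast
    note IH = PBranch.IH[OF nth_mem[OF 3(1)] ok_nth[OF ok 3(1)] jk 3(2)]
    have pu: "plabels u = insert j (plabels (ss ! k))" using plabels_insertions[OF 3(2)] .
    have "u \<noteq> PLeaf j" using pu plabels_ne[OF ok_nth[OF ok 3(1)]] jk by auto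
    then have sp: "spine j s' ! 0 = spine j u ! 0"
      using spine_child_nth(1)[of "ss[k := u]" k j] ok' pu 3(1) unfolding 3(3) by simp
    show ?thesis using IH unfolding parent_cluster_def parent_degree_def sp .
  qed
qed

text \<open>The projected result of an insertion of the largest label determines the old tree and
  the key, because the parent data and the deletion descend to projections.\<close>

lemma proj_insertions_cancel:
  assumes "s \<in> SP n" "t \<in> SP n" "1 \<le> n" "(d, s') \<in># insertions (Suc n) s" "(e, t') \<in># insertions (Suc n) t" "proj s' = proj t'"
  shows "proj s = proj t" "key d = key e"
proof -
  note S = SP_props[OF assms(1)] and T = SP_props[OF assms(2)]
  note s' = insertions_SP[OF assms(1,4)] and t' = insertions_SP[OF assms(2,5)]
  have nl: "s' \<noteq> PLeaf (Suc n)" using SP_not_leaf[OF s'(1)] assms(3) by simp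
  note P = parent_proj[OF SP_props(1)[OF s'(1)] SP_props(1)[OF t'(1)] assms(6) _ nl]
  have P: "parent_cluster (Suc n) s' = parent_cluster (Suc n) t'" "parent_degree (Suc n) s' = parent_degree (Suc n) t'"
    "proj (delete_leaf (Suc n) s') = proj (delete_leaf (Suc n) t')"
    using P SP_props(3)[OF s'(1)] by auto
  show "proj s = proj t" using P(3) s'(2) t'(2) by simp
  have "cluster d = cluster e" using key_insertions[OF S(1,5) assms(4)] key_insertions[OF T(1,5) assms(5)] P(1) by simp
  then show "key d = key e" using key_insertions[OF S(1,5) assms(4)] key_insertions[OF T(1,5) assms(5)] P(2) by simp
qed

section \<open>Recursive insertions and insertion sites\<close>

fun pdesc :: "psite \<Rightarrow> desc" where
  "pdesc (PEdge (PLeaf i)) = E True {i}"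
| "pdesc (PEdge (PBranch ss)) = E False (plabels (PBranch ss))"
| "pdesc (PVertex ss l) = V (l = length ss - 1) (plabels (PBranch ss)) (length ss)"

lemma psubtrees_size: "u \<in> psubtrees v \<Longrightarrow> size u \<le> size (v :: nat ptree)"
proof (induction v)
  case (PBranch vs)
  show ?case
  proof (cases "u = PBranch vs")
    case False
    then obtain w where w: "w \<in> set vs" "u \<in> psubtrees w" using PBranch.prems by auto
    then have "size u \<le> size w" using PBranch.IH by blast
    also have "size w \<le> size_list size vs" by (rule size_list_estimation'[OF w(1) order.refl])
    finally show ?thesis by simp
  qed simp
qed simp

lemma PBranch_notin_child:
  fixes ss :: "nat ptree list"
  shows "k < length ss \<Longrightarrow> PBranch ss \<notin> psubtrees (ss ! k)"
proof
  assume k: "k < length ss" and p: "PBranch ss \<in> psubtrees (ss ! k)"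
  have "size (ss ! k) \<le> size_list size ss" by (rule size_list_estimation'[OF nth_mem[OF k] order.refl])
  then show False using psubtrees_size[OF p] by simp
qed

lemma psubtrees_disjoint:
  assumes "ok (PBranch ss)" "k < length ss" "l < length ss" "k \<noteq> l" "u \<in> psubtrees (ss ! k)"
  shows "u \<notin> psubtrees (ss ! l)"
proof
  assume "u \<in> psubtrees (ss ! l)"
  then have "plabels u \<subseteq> plabels (ss ! k) \<inter> plabels (ss ! l)" using assms(5) plabels_subtree by blast
  moreover have "plabels u \<noteq> {}" using plabels_ne[OF ok_sub[OF ok_nth[OF assms(1,2)] assms(5)]] .
  moreover have "plabels (ss ! k) \<inter> plabels (ss ! l) = {}" using disj_nth[of ss k l] assms unfolding ok_PBranch by blast
  ultimately show False by blast
qed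

lemma psites_PBranch:
  "psites (PBranch ss) = insert (PEdge (PBranch ss)) (PVertex ss ` {1..length ss - 1}) \<union> (\<Union>k<length ss. psites (ss ! k))"
proof -
  have s: "(\<Union>u\<in>set ss. f u) = (\<Union>k<length ss. f (ss ! k))" for f :: "nat ptree \<Rightarrow> 'z set"
    unfolding set_conv_nth by blast
  show ?thesis unfolding psites_def pbranch_points_PBranch psubtrees.simps set_map s by auto
qed

lemma finite_psubtrees: "finite (psubtrees s)"
  by (induction s) auto

lemma finite_psites: "finite (psites s)"
proof -
  have "psites s \<subseteq> PEdge ` psubtrees s \<union> (\<Union>ss\<in>pbranch_points s. PVertex ss ` {1..length ss - 1})"
    unfolding psites_def by auto
  then show ?thesis by (rule finite_subset) (simp add: finite_psubtrees finite_pbranch_points)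
qed

lemma preplace_id: "u \<notin> psubtrees s \<Longrightarrow> preplace u u' s = s"
  by (induction s) (auto simp: map_idI)

text \<open>Replacement acts on every occurrence of a subtree; since label sets of children are
  disjoint, it takes effect in one child only.\<close>

lemma pinsert_child:
  assumes "ok (PBranch ss)" "k < length ss" "x \<in> psites (ss ! k)"
  shows "pinsert j x (PBranch ss) = PBranch (ss[k := pinsert j x (ss ! k)])"
proof -
  have "preplace u u' (PBranch ss) = PBranch (ss[k := preplace u u' (ss ! k)])" if u: "u \<in> psubtrees (ss ! k)" for u u'
  proof -
    have ne: "PBranch ss \<noteq> u" using PBranch_notin_child[OF assms(2)] u by blast
    have "map (preplace u u') ss = ss[k := preplace u u' (ss ! k)]"
      using psubtrees_disjoint[OF assms(1,2) _ _ u] preplace_id assms(2)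
      by (intro nth_equalityI) (auto simp: nth_list_update)
    then show ?thesis using ne by simp
  qed
  moreover obtain u u' where "u \<in> psubtrees (ss ! k)" "\<And>s. pinsert j x s = preplace u u' s"
  proof (cases x)
    case (PEdge u)
    then have "u \<in> psubtrees (ss ! k)" using assms(3) by (auto simp: psites_def)
    then show thesis by (rule that) (simp add: PEdge)
  next
    case (PVertex ts l)
    then have "PBranch ts \<in> psubtrees (ss ! k)" using assms(3) by (auto simp: psites_def pbranch_points_def)
    then show thesis by (rule that) (simp add: PVertex)
  qed
  ultimately show ?thesis by simp
qed

text \<open>Connects the set of sites in the definition of the growth step with the recursive
  multiset. Location \<open>Suc l\<close> of a site corresponds to the index \<open>l\<close> in
  \<open>insertions\<close>. The function \<open>F\<close> is arbitrary so that indicators may be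
  used too.\<close>

lemma sum_psites:
  fixes F :: "desc \<Rightarrow> nat ptree \<Rightarrow> real"
  shows "ok s \<Longrightarrow> (\<Sum>x\<in>psites s. F (pdesc x) (pinsert j x s)) = (\<Sum>y\<in>#insertions j s. F (fst y) (snd y))"
proof (induction s arbitrary: F)
  case (PLeaf i)
  have "psites (PLeaf i) = {PEdge (PLeaf i)}" by (auto simp: psites_def pbranch_points_PLeaf)
  then show ?case by simp
next
  case (PBranch ss)
  note ok = PBranch.prems
  have len: "2 \<le> length ss" using ok by (simp add: ok_PBranch)
  let ?G = "\<lambda>x. F (pdesc x) (pinsert j x (PBranch ss))"
  let ?A = "\<Union>k<length ss. psites (ss ! k)"
  have fin: "finite ?A" by (simp add: finite_psites)
  have dA: "insert (PEdge (PBranch ss)) (PVertex ss ` {1..length ss - 1}) \<inter> ?A = {}"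
    using PBranch_notin_child unfolding psites_def pbranch_points_def by auto
  have "(\<Sum>x\<in>psites (PBranch ss). ?G x) = (\<Sum>x\<in>insert (PEdge (PBranch ss)) (PVertex ss ` {1..length ss - 1}). ?G x) + (\<Sum>x\<in>?A. ?G x)"
    unfolding psites_PBranch by (rule sum.union_disjoint[OF _ fin dA]) simp
  also have "(\<Sum>x\<in>insert (PEdge (PBranch ss)) (PVertex ss ` {1..length ss - 1}). ?G x) = ?G (PEdge (PBranch ss)) + (\<Sum>x\<in>PVertex ss ` {1..length ss - 1}. ?G x)"
    by (rule sum.insert) auto
  also have "(\<Sum>x\<in>PVertex ss ` {1..length ss - 1}. ?G x) = (\<Sum>l<length ss - 1. ?G (PVertex ss (Suc l)))"
  proof -
    have "(\<Sum>x\<in>PVertex ss ` {1..length ss - 1}. ?G x) = (\<Sum>l\<in>{1..length ss - 1}. ?G (PVertex ss l))"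
      by (subst sum.reindex) (auto simp: inj_on_def)
    also have "\<dots> = (\<Sum>l<length ss - 1. ?G (PVertex ss (Suc l)))"
      by (rule sum.reindex_bij_witness[of _ Suc "\<lambda>l. l - 1"]) auto
    finally show ?thesis .
  qed
  also have "(\<Sum>x\<in>?A. ?G x) = (\<Sum>k<length ss. \<Sum>x\<in>psites (ss ! k). ?G x)"
  proof (rule sum.UNION_disjoint)
    show "\<forall>k\<in>{..<length ss}. \<forall>l\<in>{..<length ss}. k \<noteq> l \<longrightarrow> psites (ss ! k) \<inter> psites (ss ! l) = {}"
      using psubtrees_disjoint[OF ok] unfolding psites_def pbranch_points_def by fast
  qed (simp_all add: finite_psites)
  also have "(\<Sum>k<length ss. \<Sum>x\<in>psites (ss ! k). ?G x) = (\<Sum>k<length ss. \<Sum>y\<in>#insertions j (ss ! k). F (fst y) (PBranch (ss[k := snd y])))"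
  proof (rule sum.cong[OF refl])
    fix k assume "k \<in> {..<length ss}"
    then have k: "k < length ss" by simp
    have "(\<Sum>x\<in>psites (ss ! k). ?G x) = (\<Sum>x\<in>psites (ss ! k). F (pdesc x) (PBranch (ss[k := pinsert j x (ss ! k)])))"
      by (rule sum.cong[OF refl]) (simp add: pinsert_child[OF ok k])
    also have "\<dots> = (\<Sum>y\<in>#insertions j (ss ! k). F (fst y) (PBranch (ss[k := snd y])))"
      using PBranch.IH[OF nth_mem[OF k] ok_nth[OF ok k], of "\<lambda>d u. F d (PBranch (ss[k := u]))"] .
    finally show "(\<Sum>x\<in>psites (ss ! k). ?G x) = (\<Sum>y\<in>#insertions j (ss ! k). F (fst y) (PBranch (ss[k := snd y])))" .
  qed
  finally have L: "(\<Sum>x\<in>psites (PBranch ss). ?G x) = ?G (PEdge (PBranch ss)) + (\<Sum>l<length ss - 1. ?G (PVertex ss (Suc l)))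
     + (\<Sum>k<length ss. \<Sum>y\<in>#insertions j (ss ! k). F (fst y) (PBranch (ss[k := snd y])))" .
  have R: "(\<Sum>y\<in>#insertions j (PBranch ss). F (fst y) (snd y)) = F (E False (plabels (PBranch ss))) (PBranch [PBranch ss, PLeaf j])
     + (\<Sum>l<length ss - 1. F (V (l = length ss - 2) (plabels (PBranch ss)) (length ss)) (PBranch (take (l + 2) ss @ PLeaf j # drop (l + 2) ss)))
     + (\<Sum>k<length ss. \<Sum>y\<in>#insertions j (ss ! k). F (fst y) (PBranch (ss[k := snd y])))"
    unfolding insertions_PBranch image_mset_union sum_mset.union sum_mset_image_sum[OF finite_lessThan]
    by (simp add: multiset.map_comp comp_def)
  have "(\<Sum>l<length ss - 1. ?G (PVertex ss (Suc l))) = (\<Sum>l<length ss - 1. F (V (l = length ss - 2) (plabels (PBranch ss)) (length ss)) (PBranch (take (l + 2) ss @ PLeaf j # drop (l + 2) ss)))"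
  proof (rule sum.cong[OF refl])
    fix l assume "l \<in> {..<length ss - 1}"
    then have "(Suc l = length ss - 1) = (l = length ss - 2)" by auto
    then show "?G (PVertex ss (Suc l)) = F (V (l = length ss - 2) (plabels (PBranch ss)) (length ss)) (PBranch (take (l + 2) ss @ PLeaf j # drop (l + 2) ss))"
      by simp
  qed
  then show ?case unfolding L R by simp
qed

text \<open>The hypothesis ensures that projecting does not create further occurrences of the
  replaced subtree.\<close>

lemma proj_preplace:
  "(\<And>w. w \<in> psubtrees s \<Longrightarrow> proj w = proj u \<Longrightarrow> w = u) \<Longrightarrow> proj (preplace u u' s) = replace (proj u) (proj u') (proj s)"
proof (induction s)
  case (PLeaf i)
  have "PLeaf i = u \<longleftrightarrow> Leaf i = proj u" using PLeaf[of "PLeaf i"] by auto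
  then show ?case by simp
next
  case (PBranch ss)
  have e: "PBranch ss = u \<longleftrightarrow> Branch (fset_of_list (map proj ss)) = proj u" using PBranch.prems[of "PBranch ss"] by auto
  have IH: "proj (preplace u u' x) = replace (proj u) (proj u') (proj x)" if x: "x \<in> set ss" for x
    by (rule PBranch.IH[OF x]) (use PBranch.prems x in auto)
  have "fset_of_list (map proj (map (preplace u u') ss)) = replace (proj u) (proj u') |`| fset_of_list (map proj ss)"
    by (rule fset_inject[THEN iffD1]) (use IH in \<open>auto simp: fset_of_list.rep_eq image_iff\<close>)
  then show ?case using e by simp
qed

fun projsite :: "psite \<Rightarrow> site" where
  "projsite (PEdge u) = Edge (proj u)"
| "projsite (PVertex ss l) = Vertex (fset_of_list (map proj ss))"

fun site_key :: "site \<Rightarrow> desc" where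
  "site_key (Edge (Leaf i)) = E True {i}"
| "site_key (Edge (Branch cs)) = E False (labels (Branch cs))"
| "site_key (Vertex cs) = V True (labels (Branch cs)) (fcard cs)"

context
  fixes s n
  assumes s: "s \<in> SP n"
begin

lemma psubtrees_inj: "u \<in> psubtrees s \<Longrightarrow> w \<in> psubtrees s \<Longrightarrow> plabels u = plabels w \<Longrightarrow> u = w"
  by (rule psubtrees_eqI[OF s])

lemma proj_pinsert: "x \<in> psites s \<Longrightarrow> proj (pinsert j x s) = insert_leaf j (projsite x) (proj s)"
proof -
  assume x: "x \<in> psites s"
  have i: "w = u" if "u \<in> psubtrees s" "w \<in> psubtrees s" "proj w = proj u" for u w
    using psubtrees_inj[of w u] plabels_proj[of w u] that by blast
  show ?thesis
  proof (cases x)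
    case (PEdge u)
    then have "u \<in> psubtrees s" using x by (auto simp: psites_def)
    then have "proj (preplace u (PBranch [u, PLeaf j]) s) = replace (proj u) (proj (PBranch [u, PLeaf j])) (proj s)"
      using i by (intro proj_preplace) blast
    then show ?thesis by (simp add: PEdge)
  next
    case (PVertex ss l)
    then have u: "PBranch ss \<in> psubtrees s" using x by (auto simp: psites_def pbranch_points_def)
    let ?t = "take (l + 1) ss @ PLeaf j # drop (l + 1) ss"
    have "proj (preplace (PBranch ss) (PBranch ?t) s) = replace (proj (PBranch ss)) (proj (PBranch ?t)) (proj s)"
      using i[OF u] by (intro proj_preplace) blast
    moreover have "proj (PBranch ?t) = Branch (finsert (Leaf j) (fset_of_list (map proj ss)))"
    proof -
      have "fset (fset_of_list (map proj ?t)) = fset (finsert (Leaf j) (fset_of_list (map proj ss)))"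
        unfolding fset_of_list.rep_eq finsert.rep_eq set_map set_take_insert by simp
      then show ?thesis unfolding fset_inject by simp
    qed
    ultimately show ?thesis by (simp add: PVertex)
  qed
qed

lemma site_key_projsite: "x \<in> psites s \<Longrightarrow> site_key (projsite x) = key (pdesc x)"
proof (cases x)
  case (PEdge u)
  then show ?thesis by (cases u) (auto simp: fset_of_list.rep_eq labels_proj ptree.set(2))
next
  case (PVertex ss l)
  assume "x \<in> psites s"
  then have u: "PBranch ss \<in> psubtrees s" using PVertex by (auto simp: psites_def pbranch_points_def)
  have "fcard (fset_of_list (map proj ss)) = length ss" using semiplanar_top(5)[OF semiplanar_subtree[OF s u]] .
  moreover have "labels (Branch (fset_of_list (map proj ss))) = plabels (PBranch ss)" by (metis labels_proj proj.simps(2))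
  ultimately show ?thesis by (simp add: PVertex)
qed

lemma cluster_pdesc: "x \<in> psites s \<Longrightarrow> cluster (pdesc x) \<in> plabels ` psubtrees s"
proof (cases x)
  case (PEdge u)
  assume x: "x \<in> psites s"
  have "cluster (pdesc (PEdge u)) = plabels u" by (cases u) simp_all
  then show ?thesis using PEdge x by (auto simp: psites_def)
next
  case (PVertex ss l)
  assume "x \<in> psites s"
  then show ?thesis using PVertex by (auto simp: psites_def pbranch_points_def)
qed

lemma sites_proj: "sites (proj s) = projsite ` psites s"
proof -
  have 1: "Edge ` subtrees (proj s) = projsite ` (PEdge ` psubtrees s)"
    unfolding subtrees_proj image_image by simp
  have "ss \<in> pbranch_points s \<Longrightarrow> 1 \<in> {1..length ss - 1}" for ss
    using semiplanar_top(4)[OF semiplanar_subtree[OF s, of "PBranch ss"]] by (auto simp: pbranch_points_def)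
  then have 2: "Vertex ` branch_points (proj s) = projsite ` {PVertex ss l | ss l. ss \<in> pbranch_points s \<and> l \<in> {1..length ss - 1}}"
    unfolding branch_points_proj by (force simp: image_iff)
  show ?thesis unfolding sites_def psites_def 1 2 by blast
qed

text \<open>A subtree of a well-formed tree is determined by its label set.\<close>

lemma site_key_inj: "x \<in> psites s \<Longrightarrow> y \<in> psites s \<Longrightarrow> key (pdesc x) = key (pdesc y) \<Longrightarrow> projsite x = projsite y"
proof -
  assume x: "x \<in> psites s" and y: "y \<in> psites s" and k: "key (pdesc x) = key (pdesc y)"
  define top where "top z = (case z of PEdge u \<Rightarrow> u | PVertex ss l \<Rightarrow> PBranch ss)" for z
  have t: "top z \<in> psubtrees s \<and> plabels (top z) = cluster (pdesc z)" if "z \<in> psites s" for z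
    using that by (cases z rule: pdesc.cases) (auto simp: top_def psites_def pbranch_points_def)
  have "plabels (top x) = plabels (top y)" using t[OF x] t[OF y] k cluster_key by metis
  then have e: "top x = top y" using psubtrees_inj t[OF x] t[OF y] by blast
  show ?thesis
    using k e by (cases x rule: pdesc.cases; cases y rule: pdesc.cases) (auto simp: top_def)
qed

text \<open>Taken from \<open>sum_psites\<close> with an indicator: without a suitable site the sum
  over sites would vanish, while the multiset sum counts the given insertion.\<close>

lemma insertions_psites: "(d, s') \<in># insertions j s \<Longrightarrow> \<exists>x\<in>psites s. pdesc x = d \<and> pinsert j x s = s'"
proof (rule ccontr)
  assume d: "(d, s') \<in># insertions j s" and no: "\<not> (\<exists>x\<in>psites s. pdesc x = d \<and> pinsert j x s = s')"
  have ok: "ok s" using SP_props(1)[OF s] .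
  have "(\<Sum>y\<in>#insertions j s. of_bool (fst y = d \<and> snd y = s') :: real) = (\<Sum>x\<in>psites s. of_bool (pdesc x = d \<and> pinsert j x s = s'))"
    using sum_psites[OF ok, of "\<lambda>e u. of_bool (e = d \<and> u = s')" j] by simp
  also have "\<dots> = 0" by (rule sum.neutral) (use no in auto)
  finally have z: "(\<Sum>y\<in>#insertions j s. of_bool (fst y = d \<and> snd y = s') :: real) = 0" .
  obtain M where M: "insertions j s = add_mset (d, s') M" using d by (metis multi_member_split)
  have "0 \<le> (\<Sum>y\<in>#M. of_bool (fst y = d \<and> snd y = s') :: real)" by (induction M) auto
  then show False using z unfolding M by simp
qed

end

section \<open>Forgetting the location within a branch point\<close>

lemma seat_sum:
  assumes "0 \<le> \<alpha>" "0 \<le> \<theta>" "2 \<le> c"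
  shows "(\<Sum>l\<in>{1..c - 1}. seat \<alpha> \<theta> (V (l = c - 1) C c)) = 1"
proof -
  have i: "{1..c - 1} = insert (c - 1) {1..c - 2}" "c - 1 \<notin> {1..c - 2}" using assms(3) by auto
  have "(\<Sum>l\<in>{1..c - 1}. seat \<alpha> \<theta> (V (l = c - 1) C c)) = seat \<alpha> \<theta> (V True C c) + (\<Sum>l\<in>{1..c - 2}. seat \<alpha> \<theta> (V (l = c - 1) C c))"
    unfolding i(1) using i(2) by (subst sum.insert) auto
  also have "(\<Sum>l\<in>{1..c - 2}. seat \<alpha> \<theta> (V (l = c - 1) C c)) = (\<Sum>l\<in>{1..c - 2}. seat_prob \<alpha> \<theta> (c - 2) 0)"
    by (rule sum.cong) (use assms(3) in auto)
  finally have e: "(\<Sum>l\<in>{1..c - 1}. seat \<alpha> \<theta> (V (l = c - 1) C c)) = seat_prob \<alpha> \<theta> (c - 2) (c - 2) + real (c - 2) * seat_prob \<alpha> \<theta> (c - 2) 0"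
    by simp
  show ?thesis
  proof (cases "c = 2")
    case True
    then show ?thesis unfolding e by (simp add: seat_prob_def)
  next
    case False
    then have L: "0 < real (c - 2)" using assms(3) by simp
    show ?thesis
    proof (cases "\<alpha> = 0 \<and> \<theta> = 0")
      case True
      then show ?thesis unfolding e using L by (simp add: seat_prob_def)
    next
      case False2: False
      have "0 < real (c - 2) * \<alpha> + \<theta>"
      proof (cases "\<alpha> = 0")
        case True
        then show ?thesis using False2 assms(2) by simp
      next
        case False
        then have "0 < real (c - 2) * \<alpha>" using L assms(1) by simp
        then show ?thesis using assms(2) by linarith
      qed
      then have "\<theta> / (real (c - 2) * \<alpha> + \<theta>) + real (c - 2) * (\<alpha> / (real (c - 2) * \<alpha> + \<theta>)) = 1"
        by (simp add: add_divide_distrib[symmetric] add.commute)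
      then show ?thesis unfolding e using L False2 by (simp add: seat_prob_def)
    qed
  qed
qed

text \<open>The sites over one site of the projected tree are a single edge or all locations of one
  branch point; in both cases the seating probabilities add up to 1.\<close>

lemma lump:
  assumes s: "s \<in> SP n" and par: "0 \<le> \<alpha>" "0 \<le> \<theta>"
  shows "(\<Sum>y\<in>#insertions j s. g (key (fst y)) * seat \<alpha> \<theta> (fst y) * m (proj (snd y))) =
    (\<Sum>x\<in>sites (proj s). g (site_key x) * m (insert_leaf j x (proj s)))"
proof -
  have ok: "ok s" using SP_props(1)[OF s] .
  have "(\<Sum>y\<in>#insertions j s. g (key (fst y)) * seat \<alpha> \<theta> (fst y) * m (proj (snd y))) =
     (\<Sum>x\<in>psites s. g (key (pdesc x)) * seat \<alpha> \<theta> (pdesc x) * m (proj (pinsert j x s)))"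
    using sum_psites[OF ok, of "\<lambda>d u. g (key d) * seat \<alpha> \<theta> d * m (proj u)" j] by simp
  also have "\<dots> = (\<Sum>x\<in>psites s. g (site_key (projsite x)) * m (insert_leaf j (projsite x) (proj s)) * seat \<alpha> \<theta> (pdesc x))"
    by (rule sum.cong) (simp_all add: site_key_projsite[OF s] proj_pinsert[OF s])
  also have "\<dots> = (\<Sum>y\<in>projsite ` psites s. \<Sum>x\<in>{x \<in> psites s. projsite x = y}. g (site_key (projsite x)) * m (insert_leaf j (projsite x) (proj s)) * seat \<alpha> \<theta> (pdesc x))"
    by (rule sum.image_gen[OF finite_psites])
  also have "\<dots> = (\<Sum>y\<in>projsite ` psites s. g (site_key y) * m (insert_leaf j y (proj s)))"
  proof (rule sum.cong[OF refl])
    fix y assume "y \<in> projsite ` psites s"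
    then obtain x where x: "x \<in> psites s" "y = projsite x" by blast
    have "(\<Sum>x\<in>{x \<in> psites s. projsite x = y}. seat \<alpha> \<theta> (pdesc x)) = 1"
    proof (cases x)
      case (PEdge u)
      have u: "u \<in> psubtrees s" using x PEdge by (auto simp: psites_def)
      have "{x \<in> psites s. projsite x = y} = {x}"
      proof (intro equalityI subsetI)
        fix z assume z: "z \<in> {x \<in> psites s. projsite x = y}"
        then obtain w where w: "z = PEdge w" "proj w = proj u" unfolding x(2) PEdge by (cases z) auto
        have "w \<in> psubtrees s" using z w by (auto simp: psites_def)
        then show "z \<in> {x}" using psubtrees_inj[OF s, of w u] u w plabels_proj[OF w(2)] PEdge by simp
      qed (use x in auto)
      then show ?thesis unfolding PEdge by (cases u) simp_all
    next
      case (PVertex ss l)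
      have u: "PBranch ss \<in> psubtrees s" using x PVertex by (auto simp: psites_def pbranch_points_def)
      have "{x \<in> psites s. projsite x = y} = PVertex ss ` {1..length ss - 1}"
      proof (intro equalityI subsetI)
        fix z assume z: "z \<in> {x \<in> psites s. projsite x = y}"
        then obtain ts k where w: "z = PVertex ts k" "fset_of_list (map proj ts) = fset_of_list (map proj ss)" unfolding x(2) PVertex by (cases z) auto
        have t: "PBranch ts \<in> psubtrees s" "k \<in> {1..length ts - 1}" using z w(1) by (auto simp: psites_def pbranch_points_def)
        have "proj (PBranch ts) = proj (PBranch ss)" using w(2) by simp
        then have "ts = ss" using psubtrees_inj[OF s t(1) u plabels_proj] by simp
        then show "z \<in> PVertex ss ` {1..length ss - 1}" using t(2) w(1) by blast
      next
        fix z assume "z \<in> PVertex ss ` {1..length ss - 1}"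
        then show "z \<in> {x \<in> psites s. projsite x = y}" using u x PVertex by (auto simp: psites_def pbranch_points_def)
      qed
      then have "(\<Sum>x\<in>{x \<in> psites s. projsite x = y}. seat \<alpha> \<theta> (pdesc x)) = (\<Sum>l\<in>{1..length ss - 1}. seat \<alpha> \<theta> (V (l = length ss - 1) (plabels (PBranch ss)) (length ss)))"
        by (simp add: sum.reindex inj_on_def)
      then show ?thesis using seat_sum[OF par semiplanar_top(4)[OF semiplanar_subtree[OF s u]]] by simp
    qed
    then show "(\<Sum>x\<in>{x \<in> psites s. projsite x = y}. g (site_key (projsite x)) * m (insert_leaf j (projsite x) (proj s)) * seat \<alpha> \<theta> (pdesc x)) = g (site_key y) * m (insert_leaf j y (proj s))"
      by (simp add: sum_distrib_left[symmetric])
  qed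
  finally show ?thesis unfolding sites_proj[OF s] .
qed

text \<open>Insertion into a tree with the key as the only address; by \<open>site_key_inj\<close>
  the key determines the site.\<close>

definition inserted :: "nat \<Rightarrow> nat tree \<Rightarrow> desc \<Rightarrow> nat tree" where
  "inserted j t \<kappa> = insert_leaf j (THE x. x \<in> sites t \<and> site_key x = \<kappa>) t"

lemma proj_insertions:
  assumes s: "s \<in> SP n" and d: "(d, s') \<in># insertions j s"
  shows "proj s' = inserted j (proj s) (key d)"
proof -
  obtain x where x: "x \<in> psites s" "pdesc x = d" "pinsert j x s = s'" using insertions_psites[OF s d] by blast
  have "(THE y. y \<in> sites (proj s) \<and> site_key y = key d) = projsite x"
  proof (rule the_equality)
    show "projsite x \<in> sites (proj s) \<and> site_key (projsite x) = key d"
      unfolding sites_proj[OF s] using x site_key_projsite[OF s x(1)] by simp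
    fix y assume y: "y \<in> sites (proj s) \<and> site_key y = key d"
    then obtain z where z: "z \<in> psites s" "y = projsite z" unfolding sites_proj[OF s] by blast
    then have "key (pdesc z) = key (pdesc x)" using y site_key_projsite[OF s z(1)] x(2) by simp
    then show "y = projsite x" using site_key_inj[OF s z(1) x(1)] z(2) by simp
  qed
  then show ?thesis unfolding inserted_def using proj_pinsert[OF s x(1), of j] x(3) by simp
qed

lemma desc_bounds: "ok s \<Longrightarrow> (V b C c, s') \<in># insertions j s \<Longrightarrow> 2 \<le> c \<and> (\<not> b \<longrightarrow> 3 \<le> c)"
proof (induction s arbitrary: s')
  case (PBranch ss)
  have len: "2 \<le> length ss" using PBranch.prems(1) by (simp add: ok_PBranch)
  consider l where "l < length ss - 1" "V b C c = V (l = length ss - 2) (plabels (PBranch ss)) (length ss)"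
    | k u where "k < length ss" "(V b C c, u) \<in># insertions j (ss ! k)"
    using PBranch.prems(2) unfolding in_insertions_PBranch by blast
  then show ?case
  proof cases
    case 1
    then show ?thesis using len by auto
  next
    case 2
    then show ?thesis using PBranch.IH[OF nth_mem[OF 2(1)] ok_nth[OF PBranch.prems(1) 2(1)]] by blast
  qed
qed simp

text \<open>Removing \<open>i\<close> makes two clusters equal only for a binary parent of
  \<open>i\<close> and the sibling of \<open>i\<close>. The locations of such a parent are lost, so
  surviving clusters stay distinct.\<close>

lemma cluster_collision:
  "ok s \<Longrightarrow> u \<in> psubtrees s \<Longrightarrow> w \<in> psubtrees s \<Longrightarrow> i \<in> plabels u \<Longrightarrow> plabels u \<noteq> {i} \<Longrightarrow> plabels w = plabels u - {i} \<Longrightarrow>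
   parent_degree i s = 2 \<and> plabels u = parent_cluster i s"
proof (induction s)
  case (PLeaf x)
  then show ?case by simp
next
  case (PBranch ss)
  note ok = PBranch.prems(1)
  have us: "plabels u \<subseteq> plabels (PBranch ss)" using plabels_subtree[OF PBranch.prems(2)] .
  obtain m where m: "m < length ss" "i \<in> plabels (ss ! m)"
  proof -
    have "i \<in> plabels (PBranch ss)" using us PBranch.prems(4) by blast
    then show thesis using that by (auto simp: ptree.set(2) in_set_conv_nth)
  qed
  have wne: "plabels w \<noteq> {}" using plabels_ne[OF ok_sub[OF ok PBranch.prems(3)]] .
  have len: "2 \<le> length ss" using ok by (simp add: ok_PBranch)
  have other: "plabels (ss ! l) \<noteq> {}" if "l < length ss" for l using plabels_ne[OF ok_nth[OF ok that]] .
  have cases: "v = PBranch ss \<or> (\<exists>k<length ss. v \<in> psubtrees (ss ! k))" if "v \<in> psubtrees (PBranch ss)" for v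
    using that by (auto simp: in_set_conv_nth)
  show ?case
  proof (cases "u = PBranch ss")
    case True
    have "w \<noteq> PBranch ss" using PBranch.prems(4,6) True by auto
    then obtain k where k: "k < length ss" "w \<in> psubtrees (ss ! k)" using cases[OF PBranch.prems(3)] by blast
    have sub: "plabels (PBranch ss) - {i} \<subseteq> plabels (ss ! k)" using plabels_subtree[OF k(2)] PBranch.prems(6) True by simp
    have one: "l = k" if l: "l < length ss" "x \<in> plabels (ss ! l)" "x \<noteq> i" for l x
    proof (rule ccontr)
      assume "l \<noteq> k"
      then have "x \<notin> plabels (ss ! k)" using ok_disj_nth[OF ok l(1) k(1) _ l(2)] by simp
      then show False using sub l nth_in_plabels[OF l(1)] by blast
    qed
    \<comment> \<open>Every child other than \<open>m\<close> carries a label different from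
      \<open>i\<close>, and all these labels lie in child \<open>k\<close>; so the top is
      binary.\<close>
    have eqm: "l = k" if l: "l < length ss" "l \<noteq> m" for l
    proof -
      obtain x where x: "x \<in> plabels (ss ! l)" using other[OF l(1)] by blast
      have "x \<noteq> i" using x ok_disj_nth[OF ok m(1) l(1) _ m(2)] l(2) by auto
      then show ?thesis using one[OF l(1) x] by simp
    qed
    have km: "k \<noteq> m"
    proof
      assume "k = m"
      have "(if m = 0 then 1 else 0) < length ss" "(if m = 0 then 1 else 0) \<noteq> m" using len by auto
      then show False using eqm[of "if m = 0 then 1 else 0"] \<open>k = m\<close> by auto
    qed
    have leaf: "ss ! m = PLeaf i"
    proof -
      have pm: "plabels (ss ! m) = {i}" using one[OF m(1)] km m(2) by auto
      show ?thesis
      proof (cases "ss ! m")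
        case (PBranch vs)
        have okv: "ok (PBranch vs)" using ok_nth[OF ok m(1)] PBranch by simp
        then have 01: "0 < length vs" "1 < length vs" by (auto simp: ok_PBranch)
        have "plabels (vs ! 0) = {i}" "plabels (vs ! 1) = {i}"
          using nth_in_plabels[OF 01(1)] nth_in_plabels[OF 01(2)] plabels_ne[OF ok_nth[OF okv 01(1)]] plabels_ne[OF ok_nth[OF okv 01(2)]]
          unfolding pm[unfolded PBranch] by blast+
        then show ?thesis using ok_disj_nth[OF okv 01, of i] by simp
      qed (use pm in simp)
    qed
    have "length ss = 2"
    proof -
      have "{..<length ss} \<subseteq> {m, k}" using eqm by auto
      then have "card {..<length ss} \<le> card {m, k}" by (rule card_mono[rotated]) simp
      then have "length ss \<le> 2" using km by simp
      then show ?thesis using len by simp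
    qed
    then show ?thesis unfolding parent_degree_def parent_cluster_def spine_child_nth(2)[OF ok m leaf] True by simp
  next
    case False
    then obtain k where k: "k < length ss" "u \<in> psubtrees (ss ! k)" using cases[OF PBranch.prems(2)] by blast
    have "k = m"
      using ok_disj_nth[OF ok k(1) m(1) _ subsetD[OF plabels_subtree[OF k(2)] PBranch.prems(4)]] m(2) by blast
    then have um: "u \<in> psubtrees (ss ! m)" using k by simp
    have wm: "w \<in> psubtrees (ss ! m)"
    proof -
      have wsub: "plabels w \<subseteq> plabels (ss ! m)" using PBranch.prems(6) plabels_subtree[OF um] by blast
      have disjm: "plabels (ss ! l) \<inter> plabels (ss ! m) = {}" if "l < length ss" "l \<noteq> m" for l
        using disj_nth[of ss l m] that m(1) ok unfolding ok_PBranch by blast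
      have wn: "w \<noteq> PBranch ss"
      proof
        assume w: "w = PBranch ss"
        have l: "(if m = 0 then 1 else 0) < length ss" "(if m = 0 then 1 else 0) \<noteq> m" using len by auto
        then show False using disjm[OF l] other[OF l(1)] nth_in_plabels[OF l(1)] wsub w by blast
      qed
      then obtain l where l: "l < length ss" "w \<in> psubtrees (ss ! l)" using cases[OF PBranch.prems(3)] by blast
      have "l = m" using disjm[OF l(1)] plabels_subtree[OF l(2)] wsub wne by blast
      then show ?thesis using l by simp
    qed
    have nl: "ss ! m \<noteq> PLeaf i" using um PBranch.prems(4,5) by auto
    show ?thesis using PBranch.IH[OF nth_mem[OF m(1)] ok_nth[OF ok m(1)] um wm PBranch.prems(4-6)]
      unfolding parent_degree_def parent_cluster_def spine_child_nth(1)[OF ok m nl] .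
  qed
qed

section \<open>The left-to-right orders after a deletion step\<close>

text \<open>The quotient of the normalising constants with one table less and with all tables, so it
  is the same for every surviving place in the row. The first case follows the convention for
  \<open>\<alpha> = \<theta> = 0\<close>.\<close>

definition ratio :: "real \<Rightarrow> real \<Rightarrow> nat \<Rightarrow> real" where
  "ratio \<alpha> \<theta> c = (if \<alpha> = 0 \<and> \<theta> = 0 then real (c - 3) / real (c - 2)
     else (real (c - 3) * \<alpha> + \<theta>) / (real (c - 2) * \<alpha> + \<theta>))"

lemma seat_ratio:
  assumes "0 \<le> \<alpha>" "0 \<le> \<theta>" "3 \<le> c" "\<not> b \<longrightarrow> 4 \<le> c"
  shows "seat \<alpha> \<theta> (V b C c) = ratio \<alpha> \<theta> c * seat \<alpha> \<theta> (V b C' (c - 1))"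
proof -
  obtain L where c: "c = L + 3" using assms(3) by (metis add.commute le_Suc_ex)
  have s: "c - 2 = Suc L" "c - 1 - 2 = L" "c - 3 = L" unfolding c by simp_all
  have LL: "\<not> b \<longrightarrow> 0 < L" using assms(4) c by auto
  show ?thesis
  proof (cases "\<alpha> = 0 \<and> \<theta> = 0")
    case True
    then show ?thesis unfolding seat.simps ratio_def s using LL by (cases b) (auto simp: seat_prob_def)
  next
    case False
    have pos: "0 < real (Suc L) * \<alpha> + \<theta>"
      using False assms(1,2) by (metis add_nonneg_pos add_pos_nonneg less_eq_real_def mult_nonneg_nonneg mult_pos_pos of_nat_0_le_iff of_nat_0_less_iff zero_less_Suc)
    have pos2: "real L * \<alpha> + \<theta> \<noteq> 0" if "0 < L"
      using False assms(1,2) that by (metis add_nonneg_eq_0_iff mult_eq_0_iff mult_nonneg_nonneg of_nat_0_eq_iff of_nat_0_le_iff less_irrefl)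
    show ?thesis
    proof (cases "L = 0")
      \<comment> \<open>With three children only the rightmost place survives, and an empty row
        seats with probability 1.\<close>
      case True
      then have "b" using LL by simp
      then show ?thesis unfolding seat.simps ratio_def s True using False by (auto simp: seat_prob_def)
    next
      case L: False
      then show ?thesis unfolding seat.simps ratio_def s using False pos pos2 by (auto simp: seat_prob_def)
    qed
  qed
qed

text \<open>The change of the seating probability caused by the missing table at the parent. It
  ignores the flag and is therefore a function of the key.\<close>

fun rho :: "real \<Rightarrow> real \<Rightarrow> nat set \<Rightarrow> desc \<Rightarrow> real" where
  "rho \<alpha> \<theta> P (E b C) = 1"
| "rho \<alpha> \<theta> P (V b C c) = (if C = P then ratio \<alpha> \<theta> c else 1)"

text \<open>\<open>shift_desc\<close> on keys, with the label tilde as a fixed parameter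
  \<open>k\<close> because the projection does not determine it.\<close>

definition shift_key :: "nat \<Rightarrow> nat \<Rightarrow> nat set \<Rightarrow> desc \<Rightarrow> desc" where
  "shift_key i k P \<kappa> = map_cluster (image (relabel i k)) (strip i P \<kappa>)"

lemma key_shift: "key (shift_desc i s d) = shift_key i (label_tilde i s) (parent_cluster i s) (key d)"
  by (cases d) (simp_all add: shift_desc_def shift_key_def)

text \<open>That the shifted location occurs in the smaller tree supplies the bounds on the number
  of children needed for \<open>seat_ratio\<close>.\<close>

lemma seat_shift:
  assumes "0 \<le> \<alpha>" "0 \<le> \<theta>" "ok s1" "(shift_desc i s d, s'') \<in># insertions j s1"
  shows "seat \<alpha> \<theta> d = rho \<alpha> \<theta> (parent_cluster i s) (key d) * seat \<alpha> \<theta> (shift_desc i s d)"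
proof (cases d)
  case (V b C c)
  show ?thesis
  proof (cases "C = parent_cluster i s")
    case True
    let ?C = "relabel i (label_tilde i s) ` (C - {i})"
    have "shift_desc i s d = V b ?C (c - 1)" unfolding V shift_desc_def using True by simp
    moreover from this have "2 \<le> c - 1 \<and> (\<not> b \<longrightarrow> 3 \<le> c - 1)" using desc_bounds[OF assms(3)] assms(4) by metis
    then have "3 \<le> c" "\<not> b \<longrightarrow> 4 \<le> c" by auto
    ultimately show ?thesis using seat_ratio[OF assms(1,2), of c b C ?C] True unfolding V by simp
  next
    case False
    then show ?thesis unfolding V shift_desc_def by simp
  qed
qed (simp add: shift_desc_def)

text \<open>Label \<open>i\<close> must be left out: it is sent to \<open>k\<close>, and so is
  \<open>k + 1\<close>.\<close>

lemma relabel_inj: "k \<in> {i..n} \<Longrightarrow> inj_on (relabel i k) ({1..n} - {i})"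
  by (rule inj_onI) (auto simp: relabel_def Transposition.transpose_def Let_def split: if_splits)

context
  fixes \<alpha> \<theta> :: real
  assumes par: "0 \<le> \<alpha>" "0 \<le> \<theta>"
begin

abbreviation "W \<equiv> pi_weight \<alpha> \<theta>"

lemma W_insertions: "s \<in> SP n \<Longrightarrow> (d, s') \<in># insertions (Suc n) s \<Longrightarrow> W s' = W s * seat \<alpha> \<theta> d"
  using pi_weight_insertions SP_props by blast

text \<open>The new density at \<open>s'\<close> is the product of the old density and the rate
  \<open>g\<close>, and both factors can be read off from \<open>proj s'\<close>; the seating factor
  is absorbed by \<open>W\<close>.\<close>

lemma mix_insert:
  assumes n: "1 \<le> n"
  shows "\<exists>m'. \<forall>f. (\<Sum>s\<in>SP n. m (proj s) * W s * (\<Sum>y\<in>#insertions (Suc n) s. g (key (fst y)) * seat \<alpha> \<theta> (fst y) * f (snd y)))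
     = (\<Sum>s\<in>SP (Suc n). m' (proj s) * W s * f s)"
proof -
  \<comment> \<open>Any insertion with projected result \<open>t\<close> may be chosen; all of them
    give the same value.\<close>
  define Q where "Q t p \<longleftrightarrow> (case p of (s, d, s') \<Rightarrow> s \<in> SP n \<and> (d, s') \<in># insertions (Suc n) s \<and> proj s' = t)" for t p
  define m' where "m' t = (case (SOME p. Q t p) of (s, d, s') \<Rightarrow> m (proj s) * g (key d))" for t
  have m': "m' (proj s') = m (proj s) * g (key d)" if s: "s \<in> SP n" and d: "(d, s') \<in># insertions (Suc n) s" for s d s'
  proof -
    have "Q (proj s') (s, d, s')" using s d by (simp add: Q_def)
    then have q: "Q (proj s') (SOME p. Q (proj s') p)" by (rule someI)
    obtain r e r' where r: "(SOME p. Q (proj s') p) = (r, e, r')" by (metis prod_cases3)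
    have "Q (proj s') (r, e, r')" using q unfolding r .
    then have "r \<in> SP n" "(e, r') \<in># insertions (Suc n) r" "proj r' = proj s'" unfolding Q_def by simp_all
    then have "proj r = proj s" "key e = key d" using proj_insertions_cancel[OF _ s n _ d] by blast+
    then show ?thesis unfolding m'_def r by simp
  qed
  show ?thesis
  proof (intro exI[of _ m'] allI)
    fix f
    have "(\<Sum>s\<in>SP (Suc n). m' (proj s) * W s * f s) = (\<Sum>s\<in>SP n. \<Sum>y\<in>#insertions (Suc n) s. m' (proj (snd y)) * W (snd y) * f (snd y))"
      by (rule sum_SP_Suc[OF n])
    also have "\<dots> = (\<Sum>s\<in>SP n. m (proj s) * W s * (\<Sum>y\<in>#insertions (Suc n) s. g (key (fst y)) * seat \<alpha> \<theta> (fst y) * f (snd y)))"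
    proof (rule sum.cong[OF refl])
      fix s assume s: "s \<in> SP n"
      have "(\<Sum>y\<in>#insertions (Suc n) s. m' (proj (snd y)) * W (snd y) * f (snd y))
        = (\<Sum>y\<in>#insertions (Suc n) s. m (proj s) * W s * (g (key (fst y)) * seat \<alpha> \<theta> (fst y) * f (snd y)))"
      proof (intro arg_cong[of _ _ sum_mset] image_mset_cong)
        fix y assume y: "y \<in># insertions (Suc n) s"
        obtain d s' where ds: "y = (d, s')" by (cases y)
        show "m' (proj (snd y)) * W (snd y) * f (snd y) = m (proj s) * W s * (g (key (fst y)) * seat \<alpha> \<theta> (fst y) * f (snd y))"
          using m'[OF s] W_insertions[OF s] y unfolding ds by simp
      qed
      then show "(\<Sum>y\<in>#insertions (Suc n) s. m' (proj (snd y)) * W (snd y) * f (snd y)) =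
         m (proj s) * W s * (\<Sum>y\<in>#insertions (Suc n) s. g (key (fst y)) * seat \<alpha> \<theta> (fst y) * f (snd y))"
        by (simp add: sum_mset_distrib_left)
    qed
    finally show "(\<Sum>s\<in>SP n. m (proj s) * W s * (\<Sum>y\<in>#insertions (Suc n) s. g (key (fst y)) * seat \<alpha> \<theta> (fst y) * f (snd y)))
     = (\<Sum>s\<in>SP (Suc n). m' (proj s) * W s * f s)" by simp
  qed
qed

lemma parent_proj_SP:
  assumes "s \<in> SP n" "t \<in> SP n" "proj s = proj t" "2 \<le> n" "i \<in> {1..n}"
  shows "parent_cluster i s = parent_cluster i t" "parent_degree i s = parent_degree i t" "lost i s = lost i t"
  using parent_proj[OF SP_props(1)[OF assms(1)] SP_props(1)[OF assms(2)] assms(3) _ SP_not_leaf[OF assms(1,4)], of i]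
    SP_props(3)[OF assms(1)] assms(5) by (simp_all add: lost_def)

text \<open>Makes it possible to recover the old key, and thus the old density, after the deletion.
  \<open>NX\<close> consists of the keys of surviving locations, over all drawings of the same tree;
  the only clusters that could collide are excluded from it.\<close>

lemma shift_key_inj:
  assumes s: "s \<in> SP n" and n: "2 \<le> n" and i: "i \<in> {1..n}" and k: "k \<in> {i..n}"
  defines "NX \<equiv> {\<kappa>. \<exists>r d r'. r \<in> SP n \<and> proj r = proj s \<and> (d, r') \<in># insertions (Suc n) r \<and> key d = \<kappa> \<and>
     cluster d \<noteq> {i} \<and> (parent_degree i s = 2 \<longrightarrow> cluster d \<noteq> parent_cluster i s)}"
  shows "inj_on (shift_key i k (parent_cluster i s)) NX"
proof (rule inj_onI)
  fix \<kappa> \<mu> assume K: "\<kappa> \<in> NX" and M: "\<mu> \<in> NX" and e: "shift_key i k (parent_cluster i s) \<kappa> = shift_key i k (parent_cluster i s) \<mu>"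
  \<comment> \<open>The key may come from another drawing \<open>r\<close>; the subtree in question
    is carried over to \<open>s\<close> through the common projection.\<close>
  have props: "\<exists>u\<in>psubtrees s. plabels u = cluster \<kappa> \<and> cluster \<kappa> \<noteq> {i} \<and> (parent_degree i s = 2 \<longrightarrow> cluster \<kappa> \<noteq> parent_cluster i s) \<and>
      (\<forall>b C c. \<kappa> = V b C c \<longrightarrow> b \<and> 2 \<le> c)" if K: "\<kappa> \<in> NX" for \<kappa>
  proof -
    obtain r d r' where r: "r \<in> SP n" "proj r = proj s" "(d, r') \<in># insertions (Suc n) r" "key d = \<kappa>"
      "cluster d \<noteq> {i}" "parent_degree i s = 2 \<longrightarrow> cluster d \<noteq> parent_cluster i s" using K unfolding NX_def by blast
    obtain x where x: "x \<in> psites r" "pdesc x = d" using insertions_psites[OF r(1,3)] by blast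
    obtain v where v: "v \<in> psubtrees r" "cluster d = plabels v" using cluster_pdesc[OF r(1) x(1)] x(2) by auto
    have "proj v \<in> subtrees (proj s)" using v(1) unfolding r(2)[symmetric] subtrees_proj by blast
    then obtain u where u: "u \<in> psubtrees s" "proj u = proj v" unfolding subtrees_proj by auto
    have "plabels u = cluster \<kappa>" using plabels_proj[OF u(2)] v(2) r(4) cluster_key by metis
    moreover have "\<forall>b C c. \<kappa> = V b C c \<longrightarrow> b \<and> 2 \<le> c"
      using r(3,4) desc_bounds[OF SP_props(1)[OF r(1)]] by (cases d) auto
    moreover have "cluster \<kappa> = cluster d" using r(4) cluster_key by blast
    ultimately show ?thesis using u(1) r(5,6) by auto
  qed
  obtain u where u: "u \<in> psubtrees s" "plabels u = cluster \<kappa>" "cluster \<kappa> \<noteq> {i}" "parent_degree i s = 2 \<longrightarrow> cluster \<kappa> \<noteq> parent_cluster i s"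
    "\<forall>b C c. \<kappa> = V b C c \<longrightarrow> b \<and> 2 \<le> c" using props[OF K] by blast
  obtain w where w: "w \<in> psubtrees s" "plabels w = cluster \<mu>" "cluster \<mu> \<noteq> {i}" "parent_degree i s = 2 \<longrightarrow> cluster \<mu> \<noteq> parent_cluster i s"
    "\<forall>b C c. \<mu> = V b C c \<longrightarrow> b \<and> 2 \<le> c" using props[OF M] by blast
  have ok: "ok s" and lab: "plabels s = {1..n}" using SP_props[OF s] by auto
  have sub: "cluster \<kappa> \<subseteq> {1..n}" "cluster \<mu> \<subseteq> {1..n}"
    using plabels_subtree[OF u(1)] plabels_subtree[OF w(1)] u(2) w(2) lab by auto
  have cs: "cluster (shift_key i k P \<nu>) = relabel i k ` (cluster \<nu> - {i})" for P \<nu>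
    by (cases \<nu>) (simp_all add: shift_key_def)
  have "relabel i k ` (cluster \<kappa> - {i}) = relabel i k ` (cluster \<mu> - {i})" using e cs by metis
  then have ci: "cluster \<kappa> - {i} = cluster \<mu> - {i}"
    using inj_on_image_eq_iff[OF relabel_inj[OF k], of "cluster \<kappa> - {i}" "cluster \<mu> - {i}"] sub by blast
  have c: "cluster \<kappa> = cluster \<mu>"
  proof (rule ccontr)
    assume ne: "cluster \<kappa> \<noteq> cluster \<mu>"
    have col: False if "x \<in> psubtrees s" "y \<in> psubtrees s" "plabels x \<noteq> {i}" "parent_degree i s = 2 \<longrightarrow> plabels x \<noteq> parent_cluster i s"
      "plabels x - {i} = plabels y - {i}" "i \<in> plabels x" "i \<notin> plabels y" for x y
      using cluster_collision[OF ok that(1,2,6,3)] that by blast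
    have "i \<in> cluster \<kappa> \<and> i \<notin> cluster \<mu> \<or> i \<in> cluster \<mu> \<and> i \<notin> cluster \<kappa>" using ne ci by blast
    then show False
    proof
      assume "i \<in> cluster \<kappa> \<and> i \<notin> cluster \<mu>"
      then show False using col[OF u(1) w(1)] u w ci by auto
    next
      assume "i \<in> cluster \<mu> \<and> i \<notin> cluster \<kappa>"
      then show False using col[OF w(1) u(1)] u w ci by auto
    qed
  qed
  show "\<kappa> = \<mu>"
  proof (cases \<kappa>)
    case (E b C)
    then show ?thesis using e c by (cases \<mu>) (auto simp: shift_key_def)
  next
    case (V b C x)
    show ?thesis
    proof (cases \<mu>)
      case (E b' C')
      then show ?thesis using e V by (simp add: shift_key_def)
    next
      case V': (V b' C' y)
      have C: "C' = C" using c V V' by simp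
      have bs: "b" "b'" "2 \<le> x" "2 \<le> y" using u(5) w(5) V V' by auto
      have "(if C = parent_cluster i s then x - 1 else x) = (if C = parent_cluster i s then y - 1 else y)"
        using e unfolding V V' C by (simp add: shift_key_def)
      then have "x = y" using bs by (auto split: if_splits)
      then show ?thesis using V V' C bs by simp
    qed
  qed
qed

text \<open>The induction writes a tree with \<open>n + 1\<close> leaves as an insertion of \<open>n + 1\<close> into \<open>s\<close>. At a lost location the deletion returns \<open>s\<close>
  itself, and the label tilde is \<open>n + 1\<close>; elsewhere it is the insertion of \<open>n\<close> into the tree obtained from \<open>s\<close>, to which the
  induction hypothesis applies. The key of the insertion determines which case occurs.\<close>

lemma conditional_down:
  assumes "2 \<le> n"
  shows "i \<in> {1..n} \<Longrightarrow> \<exists>m'. \<forall>f. (\<Sum>s\<in>SP n. m (proj s) * W s * (of_bool (label_tilde i s = k) * f (down_step i s)))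
     = (\<Sum>s\<in>SP (n - 1). m' (proj s) * W s * f s)"
  using assms
proof (induction n arbitrary: i k m rule: dec_induct)
  case base
  have d: "down_step i s = PLeaf 1" if "s \<in> SP 2" for s using down_step_SP[OF _ that base] SP_1 by simp
  \<comment> \<open>A single tree is left and its weight is 1, so the density is the constant total
    mass.\<close>
  show ?case
  proof (intro exI[of _ "\<lambda>_. \<Sum>s\<in>SP 2. m (proj s) * W s * of_bool (label_tilde i s = k)"] allI)
    fix f
    have "(\<Sum>s\<in>SP 2. m (proj s) * W s * (of_bool (label_tilde i s = k) * f (down_step i s)))
      = (\<Sum>s\<in>SP 2. m (proj s) * W s * of_bool (label_tilde i s = k) * f (PLeaf 1))"
      by (rule sum.cong) (simp_all add: d)
    moreover have e: "SP (2 - 1) = {PLeaf 1}" using SP_1 by simp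
    ultimately show "(\<Sum>s\<in>SP 2. m (proj s) * W s * (of_bool (label_tilde i s = k) * f (down_step i s)))
      = (\<Sum>s\<in>SP (2 - 1). (\<Sum>s\<in>SP 2. m (proj s) * W s * of_bool (label_tilde i s = k)) * W s * f s)"
      unfolding e by (simp add: pi_weight_PLeaf sum_distrib_right)
  qed
next
  case (step n)
  have n2: "2 \<le> n" and n1: "1 \<le> n" using step(1) by simp_all
  \<comment> \<open>The density of the larger tree, as a function of the smaller tree and the key of
    the insertion.\<close>
  define h where "h t \<kappa> = m (inserted (Suc n) t \<kappa>)" for t \<kappa>
  let ?y = "\<lambda>f s y. h (proj s) (key (fst y)) * seat \<alpha> \<theta> (fst y) * (of_bool (label_tilde i (snd y) = k) * f (down_step i (snd y)))"
  have lhs: "(\<Sum>s\<in>SP (Suc n). m (proj s) * W s * (of_bool (label_tilde i s = k) * f (down_step i s)))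
     = (\<Sum>s\<in>SP n. W s * (\<Sum>y\<in>#insertions (Suc n) s. ?y f s y))" for f
  proof -
    have "(\<Sum>s\<in>SP (Suc n). m (proj s) * W s * (of_bool (label_tilde i s = k) * f (down_step i s)))
       = (\<Sum>s\<in>SP n. \<Sum>y\<in>#insertions (Suc n) s. m (proj (snd y)) * W (snd y) * (of_bool (label_tilde i (snd y) = k) * f (down_step i (snd y))))"
      by (rule sum_SP_Suc[OF n1])
    also have "\<dots> = (\<Sum>s\<in>SP n. W s * (\<Sum>y\<in>#insertions (Suc n) s. ?y f s y))"
    proof (rule sum.cong[OF refl])
      fix s assume s: "s \<in> SP n"
      have "(\<Sum>y\<in>#insertions (Suc n) s. m (proj (snd y)) * W (snd y) * (of_bool (label_tilde i (snd y) = k) * f (down_step i (snd y))))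
         = (\<Sum>y\<in>#insertions (Suc n) s. W s * ?y f s y)"
      proof (intro arg_cong[of _ _ sum_mset] image_mset_cong)
        fix y assume y: "y \<in># insertions (Suc n) s"
        obtain d s' where ds: "y = (d, s')" by (cases y)
        show "m (proj (snd y)) * W (snd y) * (of_bool (label_tilde i (snd y) = k) * f (down_step i (snd y))) = W s * ?y f s y"
          using proj_insertions[OF s, of d s' "Suc n"] W_insertions[OF s, of d s'] y unfolding ds h_def by simp
      qed
      then show "(\<Sum>y\<in>#insertions (Suc n) s. m (proj (snd y)) * W (snd y) * (of_bool (label_tilde i (snd y) = k) * f (down_step i (snd y))))
         = W s * (\<Sum>y\<in>#insertions (Suc n) s. ?y f s y)" by (simp add: sum_mset_distrib_left)
    qed
    finally show ?thesis .
  qed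
  \<comment> \<open>Suffices in the cases where the deletion always returns \<open>s\<close>, or
    where every term vanishes.\<close>
  have reduce: ?case if "\<And>f s. s \<in> SP n \<Longrightarrow> (\<Sum>y\<in>#insertions (Suc n) s. ?y f s y) = m' (proj s) * f s" for m'
  proof (intro exI[of _ m'] allI)
    fix f
    show "(\<Sum>s\<in>SP (Suc n). m (proj s) * W s * (of_bool (label_tilde i s = k) * f (down_step i s)))
     = (\<Sum>s\<in>SP (Suc n - 1). m' (proj s) * W s * f s)"
      unfolding lhs diff_Suc_1 by (rule sum.cong) (simp_all add: that)
  qed
  show ?case
  proof (cases "i = Suc n")
    \<comment> \<open>Leaf \<open>n + 1\<close> is its own label tilde and every insertion is
      undone, so only the total over the sites of \<open>proj s\<close> remains.\<close>
    case True
    show ?thesis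
    proof (rule reduce)
      fix f s assume s: "s \<in> SP n"
      have "(\<Sum>y\<in>#insertions (Suc n) s. ?y f s y) = (\<Sum>y\<in>#insertions (Suc n) s. of_bool (Suc n = k) * f s * (1 * seat \<alpha> \<theta> (fst y) * m (proj (snd y))))"
      proof (intro arg_cong[of _ _ sum_mset] image_mset_cong)
        fix y assume y: "y \<in># insertions (Suc n) s"
        obtain d s' where ds: "y = (d, s')" by (cases y)
        show "?y f s y = of_bool (Suc n = k) * f s * (1 * seat \<alpha> \<theta> (fst y) * m (proj (snd y)))"
          using down_step_last[OF s n1, of d s'] proj_insertions[OF s, of d s' "Suc n"] y unfolding ds h_def True by simp
      qed
      also have "\<dots> = of_bool (Suc n = k) * f s * (\<Sum>x\<in>sites (proj s). m (insert_leaf (Suc n) x (proj s)))"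
        using lump[OF s par, where g = "\<lambda>_. 1" and j = "Suc n" and m = m] by (simp add: sum_mset_distrib_left[symmetric])
      finally show "(\<Sum>y\<in>#insertions (Suc n) s. ?y f s y) = (\<lambda>t. of_bool (Suc n = k) * (\<Sum>x\<in>sites t. m (insert_leaf (Suc n) x t))) (proj s) * f s"
        by simp
    qed
  next
    case False
    then have i: "i \<in> {1..n}" using step.prems by auto
    \<comment> \<open>The parent data are defined for drawings; by \<open>parent_proj_SP\<close> an
      arbitrary drawing of the tree serves.\<close>
    define rep where "rep t = (SOME s. s \<in> SP n \<and> proj s = t)" for t
    have rep: "rep (proj s) \<in> SP n" "proj (rep (proj s)) = proj s" if "s \<in> SP n" for s
      using someI[of "\<lambda>r. r \<in> SP n \<and> proj r = proj s" s] that unfolding rep_def by auto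
    note prep = parent_proj_SP[OF rep(1) _ rep(2) n2 i]
    have split: "\<exists>X R. down_splits n i s X R" if "s \<in> SP n" for s using down_splits_exist[OF that n2 i] .
    show ?thesis
    proof (cases "k = Suc n")
      \<comment> \<open>Only lost locations give the label tilde \<open>n + 1\<close>, and their
        descriptions depend on \<open>proj s\<close> alone.\<close>
      case True
      show ?thesis
      proof (rule reduce)
        fix f s assume s: "s \<in> SP n"
        obtain X R where XR: "down_splits n i s X R" using split[OF s] by blast
        note D = XR[unfolded down_splits_def]
        have "(\<Sum>y\<in>#R. ?y f s y) = 0"
        proof -
          have "(\<Sum>y\<in>#R. ?y f s y) = (\<Sum>y\<in>#R. 0)"
          proof (intro arg_cong[of _ _ sum_mset] image_mset_cong)
            fix y assume y: "y \<in># R"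
            obtain d s' where ds: "y = (d, s')" by (cases y)
            have "label_tilde i s' = label_tilde i s" "label_tilde i s \<in> {i..n}" using D y ds by blast+
            then show "?y f s y = 0" unfolding ds using True by simp
          qed
          then show ?thesis by simp
        qed
        moreover have "(\<Sum>y\<in>#X. ?y f s y) = (\<Sum>y\<in>#X. h (proj s) (key (fst y)) * seat \<alpha> \<theta> (fst y) * f s)"
        proof (intro arg_cong[of _ _ sum_mset] image_mset_cong)
          fix y assume y: "y \<in># X"
          obtain d s' where ds: "y = (d, s')" by (cases y)
          have "label_tilde i s' = Suc n" "down_step i s' = s" using D y ds by blast+
          then show "?y f s y = h (proj s) (key (fst y)) * seat \<alpha> \<theta> (fst y) * f s" unfolding ds using True by simp
        qed
        moreover have "(\<Sum>y\<in>#X. h (proj s) (key (fst y)) * seat \<alpha> \<theta> (fst y) * f s) = (\<Sum>d\<in>#image_mset fst X. h (proj s) (key d) * seat \<alpha> \<theta> d) * f s"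
          by (simp add: multiset.map_comp comp_def sum_mset_distrib_right)
        ultimately show "(\<Sum>y\<in>#insertions (Suc n) s. ?y f s y) =
          (\<lambda>t. \<Sum>d\<in>#lost i (rep t). h t (key d) * seat \<alpha> \<theta> d) (proj s) * f s"
          using D prep(3)[OF s s s] by simp
      qed
    next
      case kn: False
      show ?thesis
      proof (cases "k \<in> {i..n}")
        case False
        show ?thesis
        proof (rule reduce)
          fix f s assume s: "s \<in> SP n"
          obtain X R where XR: "down_splits n i s X R" using split[OF s] by blast
          note D = XR[unfolded down_splits_def]
          have "(\<Sum>y\<in>#insertions (Suc n) s. ?y f s y) = (\<Sum>y\<in>#insertions (Suc n) s. 0)"
          proof (intro arg_cong[of _ _ sum_mset] image_mset_cong)
            fix y assume y: "y \<in># insertions (Suc n) s"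
            obtain d s' where ds: "y = (d, s')" by (cases y)
            have "(d, s') \<in># X \<or> (d, s') \<in># R" using y ds D by simp
            then have "label_tilde i s' = Suc n \<or> label_tilde i s' \<in> {i..n}" using D by metis
            then have "label_tilde i s' \<noteq> k" using False kn by auto
            then show "?y f s y = 0" unfolding ds by simp
          qed
          then show "(\<Sum>y\<in>#insertions (Suc n) s. ?y f s y) = (\<lambda>_. 0) (proj s) * f s" by simp
        qed
      next
        case k: True
        define P where "P t = parent_cluster i (rep t)" for t
        define NX where "NX t = {\<kappa>. \<exists>r d r'. r \<in> SP n \<and> proj r = proj (rep t) \<and> (d, r') \<in># insertions (Suc n) r \<and> key d = \<kappa> \<and>
           cluster d \<noteq> {i} \<and> (parent_degree i (rep t) = 2 \<longrightarrow> cluster d \<noteq> parent_cluster i (rep t))}" for t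
        \<comment> \<open>The rate at a location of the smaller tree: \<open>shift_key_inj\<close>
          leads back to the key before the deletion, and \<open>rho\<close> accounts for the missing
          table.\<close>
        define g where "g t \<kappa>' = (let \<kappa> = inv_into (NX t) (shift_key i k (P t)) \<kappa>' in rho \<alpha> \<theta> (P t) \<kappa> * h t \<kappa>)" for t \<kappa>'
        \<comment> \<open>The tree \<open>t\<close> before the deletion is a parameter, because the
          rate \<open>g\<close> still refers to it.\<close>
        define H where "H f t s1 = (\<Sum>z\<in>#insertions n s1. g t (key (fst z)) * seat \<alpha> \<theta> (fst z) * f (snd z))" for f t s1
        have per: "(\<Sum>y\<in>#insertions (Suc n) s. ?y f s y) = of_bool (label_tilde i s = k) * H f (proj s) (down_step i s)"
          if s: "s \<in> SP n" for f s
        proof -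
          obtain X R where XR: "down_splits n i s X R" using split[OF s] by blast
          note D = XR[unfolded down_splits_def]
          have Ps: "P (proj s) = parent_cluster i s" "parent_degree i (rep (proj s)) = parent_degree i s"
            using prep(1,2)[OF s s s] unfolding P_def by auto
          have "(\<Sum>y\<in>#X. ?y f s y) = (\<Sum>y\<in>#X. 0)"
          proof (intro arg_cong[of _ _ sum_mset] image_mset_cong)
            fix y assume y: "y \<in># X"
            obtain d s' where ds: "y = (d, s')" by (cases y)
            have "label_tilde i s' = Suc n" using D y ds by blast
            then show "?y f s y = 0" unfolding ds using kn by simp
          qed
          then have X0: "(\<Sum>y\<in>#X. ?y f s y) = 0" by simp
          have "(\<Sum>y\<in>#R. ?y f s y) = of_bool (label_tilde i s = k) * H f (proj s) (down_step i s)"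
          proof (cases "label_tilde i s = k")
            case True
            have inj: "inj_on (shift_key i k (P (proj s))) (NX (proj s))"
              unfolding P_def NX_def by (rule shift_key_inj[OF rep(1)[OF s] n2 i k])
            have "H f (proj s) (down_step i s) = (\<Sum>y\<in>#R. g (proj s) (key (shift_desc i s (fst y))) * seat \<alpha> \<theta> (shift_desc i s (fst y)) * f (down_step i (snd y)))"
            proof -
              have "insertions n (down_step i s) = image_mset (map_prod (shift_desc i s) (down_step i)) R" using D by simp
              then show ?thesis unfolding H_def by (simp add: multiset.map_comp comp_def)
            qed
            also have "\<dots> = (\<Sum>y\<in>#R. ?y f s y)"
            proof (intro arg_cong[of _ _ sum_mset] image_mset_cong)
              fix y assume y: "y \<in># R"
              obtain d s' where ds: "y = (d, s')" by (cases y)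
              have yR: "(d, s') \<in># R" using y ds by simp
              have lt: "label_tilde i s' = k" and cl: "cluster d \<noteq> {i}" "parent_degree i s = 2 \<longrightarrow> cluster d \<noteq> parent_cluster i s"
                using D yR True by metis+
              have "(d, s') \<in># insertions (Suc n) s" using D yR by simp
              then have nx: "key d \<in> NX (proj s)"
                unfolding NX_def rep(2)[OF s] Ps(2) Ps(1)[unfolded P_def] using s cl by blast
              have "(shift_desc i s d, down_step i s') \<in># insertions n (down_step i s)"
              proof -
                have "insertions n (down_step i s) = image_mset (map_prod (shift_desc i s) (down_step i)) R" using D by simp
                then show ?thesis using yR by force
              qed
              then have st: "seat \<alpha> \<theta> d = rho \<alpha> \<theta> (P (proj s)) (key d) * seat \<alpha> \<theta> (shift_desc i s d)"
                unfolding Ps(1) using seat_shift[OF par SP_props(1)[OF down_step_SP[OF n2 s i]]] by blast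
              have "g (proj s) (key (shift_desc i s d)) = rho \<alpha> \<theta> (P (proj s)) (key d) * h (proj s) (key d)"
                unfolding key_shift True g_def Ps(1)[symmetric] Let_def inv_into_f_f[OF inj nx] ..
              then show "g (proj s) (key (shift_desc i s (fst y))) * seat \<alpha> \<theta> (shift_desc i s (fst y)) * f (down_step i (snd y)) = ?y f s y"
                unfolding ds using lt st by simp
            qed
            finally show ?thesis using True by simp
          next
            case False
            have "(\<Sum>y\<in>#R. ?y f s y) = (\<Sum>y\<in>#R. 0)"
            proof (intro arg_cong[of _ _ sum_mset] image_mset_cong)
              fix y assume y: "y \<in># R"
              obtain d s' where ds: "y = (d, s')" by (cases y)
              have "label_tilde i s' = label_tilde i s" using D y ds by blast
              then show "?y f s y = 0" unfolding ds using False by simp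
            qed
            then show ?thesis using False by simp
          qed
          then show ?thesis using D X0 by simp
        qed
        \<comment> \<open>For a fixed tree \<open>t\<close>, the induction hypothesis with the
          indicator of \<open>t\<close> handles the deletion, and \<open>mix_insert\<close> handles
          the insertion of \<open>n\<close> at rate \<open>g t\<close>. Summing over
          \<open>t\<close> afterwards removes the parameter.\<close>
        have "\<exists>m2. \<forall>f. (\<Sum>s\<in>SP n. of_bool (proj s = t) * W s * (of_bool (label_tilde i s = k) * H f t (down_step i s)))
           = (\<Sum>s\<in>SP n. m2 (proj s) * W s * f s)" for t
        proof -
          obtain p where p: "n = Suc p" "1 \<le> p" using n2 by (cases n) auto
          obtain m1 where m1: "\<And>f. (\<Sum>s\<in>SP n. of_bool (proj s = t) * W s * (of_bool (label_tilde i s = k) * f (down_step i s)))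
             = (\<Sum>s\<in>SP (n - 1). m1 (proj s) * W s * f s)"
            using step.IH[OF i, of "\<lambda>u. of_bool (u = t)" k] by blast
          obtain m2 where m2: "\<And>f. (\<Sum>s\<in>SP p. m1 (proj s) * W s * (\<Sum>y\<in>#insertions (Suc p) s. g t (key (fst y)) * seat \<alpha> \<theta> (fst y) * f (snd y)))
             = (\<Sum>s\<in>SP (Suc p). m2 (proj s) * W s * f s)"
            using mix_insert[OF p(2), of m1 "g t"] by blast
          show ?thesis
          proof (intro exI[of _ m2] allI)
            fix f
            show "(\<Sum>s\<in>SP n. of_bool (proj s = t) * W s * (of_bool (label_tilde i s = k) * H f t (down_step i s))) = (\<Sum>s\<in>SP n. m2 (proj s) * W s * f s)"
              unfolding m1[of "H f t"] unfolding H_def using m2[of f] unfolding p(1) by simp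
          qed
        qed
        then obtain m2 where m2: "\<And>t f. (\<Sum>s\<in>SP n. of_bool (proj s = t) * W s * (of_bool (label_tilde i s = k) * H f t (down_step i s)))
           = (\<Sum>s\<in>SP n. m2 t (proj s) * W s * f s)" by metis
        have finT: "finite (proj ` SP n)" using finite_SP[OF n1] by simp
        show ?thesis
        proof (intro exI[of _ "\<lambda>u. \<Sum>t\<in>proj ` SP n. m2 t u"] allI)
          fix f
          have "(\<Sum>s\<in>SP (Suc n). m (proj s) * W s * (of_bool (label_tilde i s = k) * f (down_step i s)))
             = (\<Sum>s\<in>SP n. W s * (of_bool (label_tilde i s = k) * H f (proj s) (down_step i s)))"
            unfolding lhs by (rule sum.cong) (simp_all add: per)
          also have "\<dots> = (\<Sum>s\<in>SP n. \<Sum>t\<in>proj ` SP n. of_bool (proj s = t) * W s * (of_bool (label_tilde i s = k) * H f t (down_step i s)))"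
          proof (rule sum.cong[OF refl])
            fix s assume s: "s \<in> SP n"
            have "(\<Sum>t\<in>proj ` SP n. of_bool (proj s = t) * W s * (of_bool (label_tilde i s = k) * H f t (down_step i s)))
               = (\<Sum>t\<in>proj ` SP n. if t = proj s then W s * (of_bool (label_tilde i s = k) * H f t (down_step i s)) else 0)"
              by (rule sum.cong) auto
            also have "\<dots> = W s * (of_bool (label_tilde i s = k) * H f (proj s) (down_step i s))"
              using s finT by (simp add: sum.delta)
            finally show "W s * (of_bool (label_tilde i s = k) * H f (proj s) (down_step i s)) =
              (\<Sum>t\<in>proj ` SP n. of_bool (proj s = t) * W s * (of_bool (label_tilde i s = k) * H f t (down_step i s)))" by simp
          qed
          also have "\<dots> = (\<Sum>t\<in>proj ` SP n. \<Sum>s\<in>SP n. of_bool (proj s = t) * W s * (of_bool (label_tilde i s = k) * H f t (down_step i s)))"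
            by (rule sum.swap)
          also have "\<dots> = (\<Sum>t\<in>proj ` SP n. \<Sum>s\<in>SP n. m2 t (proj s) * W s * f s)" unfolding m2 ..
          also have "\<dots> = (\<Sum>s\<in>SP n. \<Sum>t\<in>proj ` SP n. m2 t (proj s) * W s * f s)" by (rule sum.swap)
          also have "\<dots> = (\<Sum>s\<in>SP (Suc n - 1). (\<Sum>t\<in>proj ` SP n. m2 t (proj s)) * W s * f s)"
            by (simp add: sum_distrib_right)
          finally show "(\<Sum>s\<in>SP (Suc n). m (proj s) * W s * (of_bool (label_tilde i s = k) * f (down_step i s))) =
             (\<Sum>s\<in>SP (Suc n - 1). (\<Sum>t\<in>proj ` SP n. m2 t (proj s)) * W s * f s)" .
        qed
      qed
    qed
  qed
qed

end

section \<open>Intertwining\<close>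

fun raw_weight :: "real \<Rightarrow> real \<Rightarrow> desc \<Rightarrow> real" where
  "raw_weight \<alpha> \<gamma> (E b C) = (if b then 1 - \<alpha> else \<gamma>)"
| "raw_weight \<alpha> \<gamma> (V b C c) = (if b then \<alpha> - \<gamma> else \<alpha>)"

fun key_weight :: "real \<Rightarrow> real \<Rightarrow> desc \<Rightarrow> real" where
  "key_weight \<alpha> \<gamma> (E b C) = (if b then 1 - \<alpha> else \<gamma>)"
| "key_weight \<alpha> \<gamma> (V b C c) = (real c - 1) * \<alpha> - \<gamma>"

text \<open>The value 1 at \<open>n = 1\<close> is the unique possible step; the quotient would be
  undefined for \<open>\<alpha> = 1\<close>.\<close>

definition up_weight :: "real \<Rightarrow> real \<Rightarrow> nat \<Rightarrow> desc \<Rightarrow> real" where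
  "up_weight \<alpha> \<gamma> n \<kappa> = (if n = 1 then 1 else key_weight \<alpha> \<gamma> \<kappa> / (real n - \<alpha>))"

lemma trees_eq: "trees {1..n} = proj ` SP n"
proof (intro equalityI subsetI)
  fix t assume t: "t \<in> trees {1..n}"
  obtain s where "s \<in> SP n" "proj s = t" using drawing_exists[OF t, of "\<lambda>_. id"] permutes_id by blast
  then show "t \<in> proj ` SP n" by blast
qed (auto simp: semiplanar_def)

locale growth =
  fixes \<alpha> \<gamma> :: real
  assumes par: "0 \<le> \<gamma>" "\<gamma> \<le> \<alpha>" "\<alpha> \<le> 1"
begin

lemma nonneg: "0 \<le> \<alpha>" "0 \<le> \<alpha> - \<gamma>"
  using par by auto

abbreviation seating where "seating \<equiv> seat \<alpha> (\<alpha> - \<gamma>)"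
abbreviation Wt where "Wt \<equiv> pi_weight \<alpha> (\<alpha> - \<gamma>)"

text \<open>The weight \<open>(c - 1) * \<alpha> - \<gamma>\<close> equals
  \<open>(c - 2) * \<alpha> + (\<alpha> - \<gamma>)\<close>, the normalising constant for
  \<open>c - 2\<close> tables with \<open>\<theta> = \<alpha> - \<gamma>\<close>. So choosing a
  branch point and then a seat is the same as choosing a location by weight.\<close>

lemma raw_weight_key:
  assumes "\<And>b C c. d = V b C c \<Longrightarrow> 2 \<le> c \<and> (\<not> b \<longrightarrow> 3 \<le> c)"
  shows "raw_weight \<alpha> \<gamma> d = key_weight \<alpha> \<gamma> (key d) * seating d"
proof (cases d)
  case (V b C c)
  then have c: "2 \<le> c" "\<not> b \<longrightarrow> 3 \<le> c" using assms by auto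
  have rc: "(real c - 1) * \<alpha> - \<gamma> = real (c - 2) * \<alpha> + (\<alpha> - \<gamma>)"
    using c(1) by (simp add: of_nat_diff algebra_simps)
  show ?thesis
  proof (cases "c = 2")
    case True
    then show ?thesis using c unfolding V by (simp add: seat_prob_def)
  next
    case False
    then have L: "0 < c - 2" using c(1) by simp
    show ?thesis
    proof (cases "\<alpha> = 0")
      case True
      then have "\<gamma> = 0" using par by simp
      then show ?thesis unfolding V using True by simp
    next
      case False
      then have "0 < real (c - 2) * \<alpha>" using L nonneg(1) by simp
      then have "real (c - 2) * \<alpha> + (\<alpha> - \<gamma>) \<noteq> 0" using nonneg(2) by linarith
      then show ?thesis unfolding V key.simps key_weight.simps rc using L False by (simp add: seat_prob_def)
    qed
  qed
qed simp

lemma raw_weight_insertions: "ok s \<Longrightarrow> (d, s') \<in># insertions j s \<Longrightarrow> raw_weight \<alpha> \<gamma> d = key_weight \<alpha> \<gamma> (key d) * seating d"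
  using desc_bounds by (intro raw_weight_key) blast

lemma pweight_pdesc: "ok s \<Longrightarrow> x \<in> psites s \<Longrightarrow> pweight \<alpha> \<gamma> x = raw_weight \<alpha> \<gamma> (pdesc x)"
proof (cases x rule: pdesc.cases)
  case (3 ss l)
  assume "ok s" "x \<in> psites s"
  then have "PBranch ss \<in> psubtrees s" "l \<in> {1..length ss - 1}" using 3 by (auto simp: psites_def pbranch_points_def)
  then show ?thesis unfolding 3 by auto
qed auto

text \<open>The growth step acting on functions, with the rate split into a factor depending on the
  key and the seating probability, as \<open>lump\<close> and \<open>mix_insert\<close>
  require.\<close>

definition Up :: "nat \<Rightarrow> (nat ptree \<Rightarrow> real) \<Rightarrow> nat ptree \<Rightarrow> real" where
  "Up n f s = (\<Sum>y\<in>#insertions (Suc n) s. up_weight \<alpha> \<gamma> n (key (fst y)) * seating (fst y) * f (snd y))"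

text \<open>Multiplied by \<open>n - \<alpha>\<close>, the identity also covers \<open>n = 1\<close>
  with \<open>\<alpha> = 1\<close>, where both sides vanish.\<close>

lemma Up_raw:
  assumes "s \<in> SP n" "1 \<le> n"
  shows "(\<Sum>y\<in>#insertions (Suc n) s. raw_weight \<alpha> \<gamma> (fst y) * f (snd y)) = (real n - \<alpha>) * Up n f s"
proof (cases "n = 1")
  case True
  then have "s = PLeaf 1" using assms(1) SP_1 by simp
  then show ?thesis unfolding Up_def True by (simp add: up_weight_def)
next
  case False
  then have "real n - \<alpha> \<noteq> 0" using assms(2) par by auto
  then have "(real n - \<alpha>) * Up n f s = (\<Sum>y\<in>#insertions (Suc n) s. key_weight \<alpha> \<gamma> (key (fst y)) * seating (fst y) * f (snd y))"
    unfolding Up_def up_weight_def sum_mset_distrib_left using False by simp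
  also have "\<dots> = (\<Sum>y\<in>#insertions (Suc n) s. raw_weight \<alpha> \<gamma> (fst y) * f (snd y))"
  proof (intro arg_cong[of _ _ sum_mset] image_mset_cong)
    fix y assume "y \<in># insertions (Suc n) s"
    then show "key_weight \<alpha> \<gamma> (key (fst y)) * seating (fst y) * f (snd y) = raw_weight \<alpha> \<gamma> (fst y) * f (snd y)"
      using raw_weight_insertions[OF SP_props(1)[OF assms(1)], of "fst y" "snd y" "Suc n"] by simp
  qed
  finally show ?thesis by simp
qed

lemma pgrowth_step_Up:
  assumes "s \<in> SP n" "1 \<le> n"
  shows "pgrowth_step \<alpha> \<gamma> n s s' = Up n (\<lambda>u. of_bool (u = s')) s"
proof (cases "n = 1")
  case True
  then have "s = PLeaf 1" using assms(1) SP_1 by simp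
  then show ?thesis unfolding Up_def True pgrowth_step_def by (auto simp: up_weight_def numeral_2_eq_2)
next
  case False
  then have n: "real n - \<alpha> \<noteq> 0" using assms(2) par by auto
  have ok: "ok s" using SP_props(1)[OF assms(1)] .
  have "pgrowth_step \<alpha> \<gamma> n s s' = (\<Sum>x | x \<in> psites s \<and> pinsert (n + 1) x s = s'. pweight \<alpha> \<gamma> x / (real n - \<alpha>))"
    unfolding pgrowth_step_def using False by simp
  also have "\<dots> = (\<Sum>x\<in>psites s. if pinsert (Suc n) x s = s' then pweight \<alpha> \<gamma> x / (real n - \<alpha>) else 0)"
    by (subst sum.inter_filter[OF finite_psites, symmetric]) simp
  also have "\<dots> = (\<Sum>x\<in>psites s. raw_weight \<alpha> \<gamma> (pdesc x) / (real n - \<alpha>) * of_bool (pinsert (Suc n) x s = s'))"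
    by (rule sum.cong) (use pweight_pdesc[OF ok] in auto)
  also have "\<dots> = (\<Sum>y\<in>#insertions (Suc n) s. raw_weight \<alpha> \<gamma> (fst y) / (real n - \<alpha>) * of_bool (snd y = s'))"
    using sum_psites[OF ok, of "\<lambda>d u. raw_weight \<alpha> \<gamma> d / (real n - \<alpha>) * of_bool (u = s')" "Suc n"] .
  also have "\<dots> = (\<Sum>y\<in>#insertions (Suc n) s. raw_weight \<alpha> \<gamma> (fst y) * of_bool (snd y = s')) / (real n - \<alpha>)"
  proof -
    have "(\<Sum>y\<in>#M. f y / (c :: real) * g y) = (\<Sum>y\<in>#M. f y * g y) / c" for M :: "(desc \<times> nat ptree) multiset" and f g c
      by (induction M) (auto simp: add_divide_distrib)
    then show ?thesis .
  qed
  finally show ?thesis unfolding Up_raw[OF assms, of "\<lambda>u. of_bool (u = s')"] using n by simp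
qed

lemma sum_pgrowth_step:
  assumes "s \<in> SP n" "1 \<le> n"
  shows "(\<Sum>s'\<in>SP (Suc n). pgrowth_step \<alpha> \<gamma> n s s' * f s') = Up n f s"
proof -
  have "(\<Sum>s'\<in>SP (Suc n). pgrowth_step \<alpha> \<gamma> n s s' * f s') = (\<Sum>s'\<in>SP (Suc n). Up n (\<lambda>u. of_bool (u = s') * f u) s)"
  proof (rule sum.cong[OF refl])
    fix s' have "Up n (\<lambda>u. of_bool (u = s')) s * f s' = Up n (\<lambda>u. of_bool (u = s') * f u) s"
      unfolding Up_def sum_mset_distrib_right by (intro arg_cong[of _ _ sum_mset] image_mset_cong) auto
    then show "pgrowth_step \<alpha> \<gamma> n s s' * f s' = Up n (\<lambda>u. of_bool (u = s') * f u) s"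
      unfolding pgrowth_step_Up[OF assms] .
  qed
  also have "\<dots> = (\<Sum>y\<in>#insertions (Suc n) s. \<Sum>s'\<in>SP (Suc n). up_weight \<alpha> \<gamma> n (key (fst y)) * seating (fst y) * (of_bool (snd y = s') * f (snd y)))"
  proof -
    have "(\<Sum>s'\<in>A. \<Sum>y\<in>#M. F y s') = (\<Sum>y\<in>#M. \<Sum>s'\<in>A. F y s')" for A :: "nat ptree set" and M :: "(desc \<times> nat ptree) multiset" and F :: "_ \<Rightarrow> _ \<Rightarrow> real"
      by (induction M) (auto simp: sum.distrib)
    then show ?thesis unfolding Up_def .
  qed
  also have "\<dots> = Up n f s"
    unfolding Up_def
  proof (intro arg_cong[of _ _ sum_mset] image_mset_cong)
    fix y assume "y \<in># insertions (Suc n) s"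
    then have "(fst y, snd y) \<in># insertions (Suc n) s" by simp
    then have y: "snd y \<in> SP (Suc n)" using insertions_SP(1)[OF assms(1)] by blast
    have fin: "finite (SP (Suc n))" using finite_SP[of "Suc n"] by simp
    have "(\<Sum>s'\<in>SP (Suc n). up_weight \<alpha> \<gamma> n (key (fst y)) * seating (fst y) * (of_bool (snd y = s') * f (snd y)))
      = (\<Sum>s'\<in>SP (Suc n). if s' = snd y then up_weight \<alpha> \<gamma> n (key (fst y)) * seating (fst y) * f (snd y) else 0)"
      by (rule sum.cong) auto
    then show "(\<Sum>s'\<in>SP (Suc n). up_weight \<alpha> \<gamma> n (key (fst y)) * seating (fst y) * (of_bool (snd y = s') * f (snd y)))
      = up_weight \<alpha> \<gamma> n (key (fst y)) * seating (fst y) * f (snd y)"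
      using y fin by (simp add: sum.delta)
  qed
  finally show ?thesis .
qed

lemma weight_key: "weight \<alpha> \<gamma> x = key_weight \<alpha> \<gamma> (site_key x)"
  by (cases x rule: site_key.cases) auto

lemma finite_sites: "s \<in> SP n \<Longrightarrow> finite (sites (proj s))"
  unfolding sites_proj by (simp add: finite_psites)

lemma growth_step_Up:
  assumes "s \<in> SP n" "1 \<le> n"
  shows "growth_step \<alpha> \<gamma> n (proj s) t = Up n (\<lambda>u. of_bool (proj u = t)) s"
proof -
  have "Up n (\<lambda>u. of_bool (proj u = t)) s = (\<Sum>x\<in>sites (proj s). up_weight \<alpha> \<gamma> n (site_key x) * of_bool (insert_leaf (Suc n) x (proj s) = t))"
    unfolding Up_def using lump[OF assms(1) nonneg, where g = "up_weight \<alpha> \<gamma> n" and m = "\<lambda>u. of_bool (u = t)" and j = "Suc n"] .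
  also have "\<dots> = growth_step \<alpha> \<gamma> n (proj s) t"
  proof (cases "n = 1")
    case True
    then have "s = PLeaf 1" using assms(1) SP_1 by simp
    moreover have "sites (Leaf 1) = {Edge (Leaf 1)}" by (auto simp: sites_def branch_points_Leaf)
    ultimately show ?thesis unfolding True growth_step_def by (auto simp: up_weight_def numeral_2_eq_2)
  next
    case False
    then have "growth_step \<alpha> \<gamma> n (proj s) t = (\<Sum>x | x \<in> sites (proj s) \<and> insert_leaf (n + 1) x (proj s) = t. weight \<alpha> \<gamma> x / (real n - \<alpha>))"
      unfolding growth_step_def by simp
    also have "\<dots> = (\<Sum>x\<in>sites (proj s). if insert_leaf (Suc n) x (proj s) = t then weight \<alpha> \<gamma> x / (real n - \<alpha>) else 0)"
      by (subst sum.inter_filter[OF finite_sites[OF assms(1)], symmetric]) simp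
    also have "\<dots> = (\<Sum>x\<in>sites (proj s). up_weight \<alpha> \<gamma> n (site_key x) * of_bool (insert_leaf (Suc n) x (proj s) = t))"
      by (rule sum.cong) (use False in \<open>auto simp: up_weight_def weight_key\<close>)
    finally show ?thesis by simp
  qed
  finally show ?thesis by simp
qed

text \<open>A branch point with \<open>c\<close> children and the edge below it contribute
  \<open>(c - 1) * \<alpha>\<close>, while the children contribute their label counts minus
  \<open>c * \<alpha>\<close>.\<close>

lemma total_raw_weight: "ok s \<Longrightarrow> (\<Sum>y\<in>#insertions j s. raw_weight \<alpha> \<gamma> (fst y)) = real (card (plabels s)) - \<alpha>"
proof (induction s)
  case (PLeaf x)
  then show ?case by simp
next
  case (PBranch ss)
  note ok = PBranch.prems
  have len: "2 \<le> length ss" using ok by (simp add: ok_PBranch)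
  have "(\<Sum>y\<in>#insertions j (PBranch ss). raw_weight \<alpha> \<gamma> (fst y)) = \<gamma> + (\<Sum>l<length ss - 1. if l = length ss - 2 then \<alpha> - \<gamma> else \<alpha>)
     + (\<Sum>k<length ss. \<Sum>y\<in>#insertions j (ss ! k). raw_weight \<alpha> \<gamma> (fst y))"
    unfolding insertions_PBranch image_mset_union sum_mset.union sum_mset_image_sum[OF finite_lessThan]
    by (simp add: multiset.map_comp comp_def)
  also have "(\<Sum>l<length ss - 1. if l = length ss - 2 then \<alpha> - \<gamma> else \<alpha>) = real (length ss - 2) * \<alpha> + (\<alpha> - \<gamma>)"
  proof -
    have "length ss - 1 = Suc (length ss - 2)" using len by simp
    moreover have "(\<Sum>l<length ss - 2. if l = length ss - 2 then \<alpha> - \<gamma> else \<alpha>) = (\<Sum>l<length ss - 2. \<alpha>)" by (rule sum.cong) auto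
    ultimately show ?thesis by simp
  qed
  also have "(\<Sum>k<length ss. \<Sum>y\<in>#insertions j (ss ! k). raw_weight \<alpha> \<gamma> (fst y)) = (\<Sum>k<length ss. real (card (plabels (ss ! k))) - \<alpha>)"
    by (rule sum.cong) (use PBranch.IH ok_nth[OF ok] in auto)
  also have "\<dots> = real (card (plabels (PBranch ss))) - real (length ss) * \<alpha>"
  proof -
    have "plabels (PBranch ss) = (\<Union>k<length ss. plabels (ss ! k))" unfolding ptree.set(2) set_conv_nth by blast
    moreover have "card (\<Union>k<length ss. plabels (ss ! k)) = (\<Sum>k<length ss. card (plabels (ss ! k)))"
    proof (rule card_UN_disjoint)
      show "\<forall>k\<in>{..<length ss}. \<forall>l\<in>{..<length ss}. k \<noteq> l \<longrightarrow> plabels (ss ! k) \<inter> plabels (ss ! l) = {}"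
        using disj_nth ok unfolding ok_PBranch by blast
    qed (simp_all add: finite_plabels)
    ultimately show ?thesis by (simp add: sum_subtractf)
  qed
  finally show ?case using len by (simp add: of_nat_diff algebra_simps)
qed

lemma Up_one:
  assumes "s \<in> SP n" "1 \<le> n"
  shows "Up n (\<lambda>_. 1) s = 1"
proof (cases "n = 1")
  case True
  then have "s = PLeaf 1" using assms(1) SP_1 by simp
  then show ?thesis unfolding Up_def True by (simp add: up_weight_def)
next
  case False
  then have "real n - \<alpha> \<noteq> 0" using assms(2) par by auto
  then show ?thesis
    using Up_raw[OF assms, of "\<lambda>_. 1"] total_raw_weight[OF SP_props(1)[OF assms(1)], of "Suc n"] SP_props(3)[OF assms(1)] by simp
qed

text \<open>The fibre of an enlarged tree consists of the insertions with one fixed key into the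
  fibre of the smaller tree, and the seating probabilities of one site add up to 1.\<close>

lemma fibre_mass: "1 \<le> n \<Longrightarrow> s \<in> SP n \<Longrightarrow> (\<Sum>r\<in>SP n. of_bool (proj r = proj s) * Wt r) = 1"
proof (induction n arbitrary: s rule: dec_induct)
  case base
  have "SP 1 = {PLeaf 1}" by (rule SP_1)
  then show ?case using base by (simp add: pi_weight_PLeaf)
next
  case (step n)
  obtain s0 d0 where s0: "s0 \<in> SP n" "(d0, s) \<in># insertions (Suc n) s0" using SP_delete[OF step.prems step(1)] by blast
  have "(\<Sum>r\<in>SP (Suc n). of_bool (proj r = proj s) * Wt r)
    = (\<Sum>r\<in>SP n. \<Sum>y\<in>#insertions (Suc n) r. of_bool (proj (snd y) = proj s) * Wt (snd y))"
    by (rule sum_SP_Suc[OF step(1)])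
  also have "\<dots> = (\<Sum>r\<in>SP n. of_bool (proj r = proj s0) * Wt r)"
  proof (rule sum.cong[OF refl])
    fix r assume r: "r \<in> SP n"
    have W: "Wt (snd y) = Wt r * seating (fst y)" if "y \<in># insertions (Suc n) r" for y
      using W_insertions[OF nonneg r, of "fst y" "snd y"] that by simp
    have iff: "proj (snd y) = proj s \<longleftrightarrow> proj r = proj s0 \<and> key (fst y) = key d0" if y: "y \<in># insertions (Suc n) r" for y
    proof
      assume "proj (snd y) = proj s"
      then show "proj r = proj s0 \<and> key (fst y) = key d0"
        using proj_insertions_cancel[OF r s0(1) step(1) _ s0(2), of "fst y" "snd y"] y by simp
    next
      assume "proj r = proj s0 \<and> key (fst y) = key d0"
      then show "proj (snd y) = proj s"
        using proj_insertions[OF r, of "fst y" "snd y" "Suc n"] proj_insertions[OF s0] y by simp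
    qed
    show "(\<Sum>y\<in>#insertions (Suc n) r. of_bool (proj (snd y) = proj s) * Wt (snd y)) = of_bool (proj r = proj s0) * Wt r"
    proof (cases "proj r = proj s0")
      case False
      have "(\<Sum>y\<in>#insertions (Suc n) r. of_bool (proj (snd y) = proj s) * Wt (snd y)) = (\<Sum>y\<in>#insertions (Suc n) r. 0)"
        by (intro arg_cong[of _ _ sum_mset] image_mset_cong) (use iff False in simp)
      then show ?thesis using False by simp
    next
      case True
      obtain x0 where x0: "x0 \<in> psites s0" "pdesc x0 = d0" using insertions_psites[OF s0] by blast
      have one: "(\<Sum>x\<in>sites (proj s0). of_bool (site_key x = key d0) * (1 :: real)) = 1"
      proof -
        have "(\<Sum>x\<in>sites (proj s0). of_bool (site_key x = key d0) * (1 :: real)) = (\<Sum>x\<in>sites (proj s0). if x = projsite x0 then 1 else 0)"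
        proof (rule sum.cong[OF refl])
          fix x assume "x \<in> sites (proj s0)"
          then obtain z where z: "z \<in> psites s0" "x = projsite z" unfolding sites_proj[OF s0(1)] by blast
          have "site_key x = key d0 \<longleftrightarrow> x = projsite x0"
            using site_key_inj[OF s0(1) z(1) x0(1)] site_key_projsite[OF s0(1) z(1)] site_key_projsite[OF s0(1) x0(1)] x0(2) z(2) by auto
          then show "of_bool (site_key x = key d0) * (1 :: real) = (if x = projsite x0 then 1 else 0)" by simp
        qed
        moreover have "projsite x0 \<in> sites (proj s0)" unfolding sites_proj[OF s0(1)] using x0(1) by blast
        ultimately show ?thesis using finite_sites[OF s0(1)] by simp
      qed
      have "(\<Sum>y\<in>#insertions (Suc n) r. of_bool (proj (snd y) = proj s) * Wt (snd y))
         = (\<Sum>y\<in>#insertions (Suc n) r. Wt r * (of_bool (key (fst y) = key d0) * seating (fst y) * 1))"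
        by (intro arg_cong[of _ _ sum_mset] image_mset_cong) (use iff W True in simp)
      also have "\<dots> = Wt r * (\<Sum>x\<in>sites (proj r). of_bool (site_key x = key d0) * 1)"
        unfolding sum_mset_distrib_left[symmetric]
        using lump[OF r nonneg, where g = "\<lambda>\<kappa>. of_bool (\<kappa> = key d0)" and m = "\<lambda>_. 1" and j = "Suc n"] by simp
      also have "\<dots> = of_bool (proj r = proj s0) * Wt r" unfolding True one by simp
      finally show ?thesis .
    qed
  qed
  also have "\<dots> = 1" using step.IH[OF s0(1)] .
  finally show ?case .
qed

text \<open>Testing against the indicator of a fibre, which has mass 1, identifies the
  density.\<close>

lemma mix_unique:
  assumes "1 \<le> n" "\<And>f. (\<Sum>s\<in>SP n. m (proj s) * Wt s * f s) = (L f :: real)" "r \<in> SP n"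
  shows "m (proj r) = L (\<lambda>s. of_bool (proj s = proj r))"
proof -
  have "L (\<lambda>s. of_bool (proj s = proj r)) = (\<Sum>s\<in>SP n. m (proj r) * (of_bool (proj s = proj r) * Wt s))"
    unfolding assms(2)[symmetric] by (rule sum.cong) auto
  also have "\<dots> = m (proj r)" unfolding sum_distrib_left[symmetric] fibre_mass[OF assms(1,3)] by simp
  finally show ?thesis by simp
qed

lemma mix_Up:
  assumes "1 \<le> n"
  shows "\<exists>m'. \<forall>f. (\<Sum>s\<in>SP n. m (proj s) * Wt s * Up n f s) = (\<Sum>s\<in>SP (Suc n). m' (proj s) * Wt s * f s)"
  unfolding Up_def by (rule mix_insert[OF nonneg assms])

text \<open>The restriction to one value of the label tilde, needed for the induction, is removed by
  summing over all values.\<close>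

lemma mix_down:
  assumes "2 \<le> n" "i \<in> {1..n}"
  shows "\<exists>m'. \<forall>f. (\<Sum>s\<in>SP n. m (proj s) * Wt s * f (down_step i s)) = (\<Sum>s\<in>SP (n - 1). m' (proj s) * Wt s * f s)"
proof -
  have "\<forall>k. \<exists>m'. \<forall>f. (\<Sum>s\<in>SP n. m (proj s) * Wt s * (of_bool (label_tilde i s = k) * f (down_step i s))) = (\<Sum>s\<in>SP (n - 1). m' (proj s) * Wt s * f s)"
    using conditional_down[OF nonneg assms] by blast
  from choice[OF this] obtain m' where m': "\<And>k f. (\<Sum>s\<in>SP n. m (proj s) * Wt s * (of_bool (label_tilde i s = k) * f (down_step i s))) = (\<Sum>s\<in>SP (n - 1). m' k (proj s) * Wt s * f s)"
    by blast
  show ?thesis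
  proof (intro exI[of _ "\<lambda>t. \<Sum>k\<in>{1..n}. m' k t"] allI)
    fix f
    have "(\<Sum>s\<in>SP n. m (proj s) * Wt s * f (down_step i s))
      = (\<Sum>s\<in>SP n. \<Sum>k\<in>{1..n}. m (proj s) * Wt s * (of_bool (label_tilde i s = k) * f (down_step i s)))"
    proof (rule sum.cong[OF refl])
      fix s assume s: "s \<in> SP n"
      have "label_tilde i s \<in> {1..n}"
        using label_tilde_range[OF SP_props(1,2)[OF s] _ SP_not_leaf[OF s assms(1)]] SP_props(3)[OF s] assms(2) by blast
      then have "(\<Sum>k\<in>{1..n}. of_bool (label_tilde i s = k) :: real) = 1" by (simp add: of_bool_def)
      then have "f (down_step i s) = (\<Sum>k\<in>{1..n}. of_bool (label_tilde i s = k) * f (down_step i s))"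
        unfolding sum_distrib_right[symmetric] by simp
      then show "m (proj s) * Wt s * f (down_step i s) = (\<Sum>k\<in>{1..n}. m (proj s) * Wt s * (of_bool (label_tilde i s = k) * f (down_step i s)))"
        unfolding sum_distrib_left[symmetric] by simp
    qed
    also have "\<dots> = (\<Sum>k\<in>{1..n}. \<Sum>s\<in>SP n. m (proj s) * Wt s * (of_bool (label_tilde i s = k) * f (down_step i s)))" by (rule sum.swap)
    also have "\<dots> = (\<Sum>k\<in>{1..n}. \<Sum>s\<in>SP (n - 1). m' k (proj s) * Wt s * f s)" unfolding m' ..
    also have "\<dots> = (\<Sum>s\<in>SP (n - 1). \<Sum>k\<in>{1..n}. m' k (proj s) * Wt s * f s)" by (rule sum.swap)
    also have "\<dots> = (\<Sum>s\<in>SP (n - 1). (\<Sum>k\<in>{1..n}. m' k (proj s)) * Wt s * f s)" by (simp add: sum_distrib_right)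
    finally show "(\<Sum>s\<in>SP n. m (proj s) * Wt s * f (down_step i s)) = (\<Sum>s\<in>SP (n - 1). (\<Sum>k\<in>{1..n}. m' k (proj s)) * Wt s * f s)" .
  qed
qed

section \<open>The chain as an operator on functions\<close>

definition Dn :: "nat \<Rightarrow> (nat ptree \<Rightarrow> real) \<Rightarrow> nat ptree \<Rightarrow> real" where
  "Dn n f s = (\<Sum>i = 1..n. 1 / real n * f (down_step i s))"

definition Ker :: "nat \<Rightarrow> (nat ptree \<Rightarrow> real) \<Rightarrow> nat ptree \<Rightarrow> real" where
  "Ker n f s = (if n = 1 then f s else Dn n (Up (n - 1) f) s)"

lemma sum_pkernel:
  assumes "s \<in> SP n" "1 \<le> n"
  shows "(\<Sum>s'\<in>SP n. pkernel \<alpha> \<gamma> n s s' * f s') = Ker n f s"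
proof (cases "n = 1")
  case True
  then show ?thesis using assms(1) SP_1 unfolding pkernel_def Ker_def by simp
next
  case False
  then have n: "2 \<le> n" using assms(2) by simp
  then obtain p where p: "n = Suc p" "1 \<le> p" by (cases n) auto
  have "(\<Sum>s'\<in>SP n. pkernel \<alpha> \<gamma> n s s' * f s') = (\<Sum>s'\<in>SP n. \<Sum>i = 1..n. 1 / real n * (pgrowth_step \<alpha> \<gamma> (n - 1) (down_step i s) s' * f s'))"
    unfolding pkernel_def using False by (simp add: sum_distrib_right mult.assoc)
  also have "\<dots> = (\<Sum>i = 1..n. \<Sum>s'\<in>SP n. 1 / real n * (pgrowth_step \<alpha> \<gamma> (n - 1) (down_step i s) s' * f s'))" by (rule sum.swap)
  also have "\<dots> = (\<Sum>i = 1..n. 1 / real n * Up (n - 1) f (down_step i s))"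
  proof (rule sum.cong[OF refl])
    fix i assume i: "i \<in> {1..n}"
    have "down_step i s \<in> SP p" using down_step_SP[OF n assms(1) i] p by simp
    then show "(\<Sum>s'\<in>SP n. 1 / real n * (pgrowth_step \<alpha> \<gamma> (n - 1) (down_step i s) s' * f s')) = 1 / real n * Up (n - 1) f (down_step i s)"
      using sum_pgrowth_step[of "down_step i s" p f] p unfolding sum_distrib_left[symmetric] by simp
  qed
  finally show ?thesis using False unfolding Ker_def Dn_def by simp
qed

lemma mix_Ker:
  assumes "1 \<le> n"
  shows "\<exists>m'. \<forall>f. (\<Sum>s\<in>SP n. m (proj s) * Wt s * Ker n f s) = (\<Sum>s\<in>SP n. m' (proj s) * Wt s * f s)"
proof (cases "n = 1")
  case True
  then show ?thesis unfolding Ker_def by auto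
next
  case False
  then obtain p where p: "n = Suc p" "1 \<le> p" using assms by (cases n) auto
  have n: "2 \<le> n" using p by simp
  have "\<exists>m'. \<forall>f. (\<Sum>s\<in>SP n. m (proj s) * Wt s * Up p f (down_step i s)) = (\<Sum>s\<in>SP n. m' (proj s) * Wt s * f s)" if i: "i \<in> {1..n}" for i
  proof -
    obtain m1 where m1: "\<And>f. (\<Sum>s\<in>SP n. m (proj s) * Wt s * f (down_step i s)) = (\<Sum>s\<in>SP p. m1 (proj s) * Wt s * f s)"
      using mix_down[OF n i, of m] p(1) by auto
    show ?thesis unfolding m1 unfolding p(1) using mix_Up[OF p(2), of m1] .
  qed
  then have "\<forall>i\<in>{1..n}. \<exists>m'. \<forall>f. (\<Sum>s\<in>SP n. m (proj s) * Wt s * Up p f (down_step i s)) = (\<Sum>s\<in>SP n. m' (proj s) * Wt s * f s)"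
    by blast
  from bchoice[OF this] obtain m' where m': "\<And>i f. i \<in> {1..n} \<Longrightarrow> (\<Sum>s\<in>SP n. m (proj s) * Wt s * Up p f (down_step i s)) = (\<Sum>s\<in>SP n. m' i (proj s) * Wt s * f s)"
    by blast
  show ?thesis
  proof (intro exI[of _ "\<lambda>t. \<Sum>i\<in>{1..n}. 1 / real n * m' i t"] allI)
    fix f
    have "(\<Sum>s\<in>SP n. m (proj s) * Wt s * Ker n f s) = (\<Sum>s\<in>SP n. \<Sum>i\<in>{1..n}. 1 / real n * (m (proj s) * Wt s * Up p f (down_step i s)))"
    proof (rule sum.cong[OF refl])
      fix s
      have "n - 1 = p" using p(1) by simp
      then have "Ker n f s = (\<Sum>i\<in>{1..n}. 1 / real n * Up p f (down_step i s))"
        unfolding Ker_def Dn_def using False by (simp only: if_False)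
      then show "m (proj s) * Wt s * Ker n f s = (\<Sum>i\<in>{1..n}. 1 / real n * (m (proj s) * Wt s * Up p f (down_step i s)))"
        by (simp only: sum_distrib_left mult.left_commute)
    qed
    also have "\<dots> = (\<Sum>i\<in>{1..n}. \<Sum>s\<in>SP n. 1 / real n * (m (proj s) * Wt s * Up p f (down_step i s)))" by (rule sum.swap)
    also have "\<dots> = (\<Sum>i\<in>{1..n}. \<Sum>s\<in>SP n. 1 / real n * (m' i (proj s) * Wt s * f s))"
      by (rule sum.cong[OF refl]) (simp only: sum_distrib_left[symmetric] m')
    also have "\<dots> = (\<Sum>s\<in>SP n. \<Sum>i\<in>{1..n}. 1 / real n * (m' i (proj s) * Wt s * f s))" by (rule sum.swap)
    also have "\<dots> = (\<Sum>s\<in>SP n. (\<Sum>i\<in>{1..n}. 1 / real n * m' i (proj s)) * Wt s * f s)"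
      by (simp only: sum_distrib_right mult.assoc)
    finally show "(\<Sum>s\<in>SP n. m (proj s) * Wt s * Ker n f s) = (\<Sum>s\<in>SP n. (\<Sum>i\<in>{1..n}. 1 / real n * m' i (proj s)) * Wt s * f s)" .
  qed
qed

lemma tree_kernel_Ker:
  assumes "1 \<le> n"
  shows "tree_kernel \<alpha> \<gamma> n t t' = (\<Sum>s\<in>SP n. of_bool (proj s = t) * Wt s * Ker n (\<lambda>s'. of_bool (proj s' = t')) s)"
  unfolding tree_kernel_def
proof (rule sum.cong[OF refl])
  fix s assume s: "s \<in> SP n"
  have "(\<Sum>s' | s' \<in> SP n \<and> proj s' = t'. pkernel \<alpha> \<gamma> n s s') = (\<Sum>s'\<in>SP n. if proj s' = t' then pkernel \<alpha> \<gamma> n s s' else 0)"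
    by (subst sum.inter_filter[OF finite_SP[OF assms], symmetric]) simp
  also have "\<dots> = (\<Sum>s'\<in>SP n. pkernel \<alpha> \<gamma> n s s' * of_bool (proj s' = t'))" by (rule sum.cong) auto
  finally show "Pi_kernel \<alpha> \<gamma> t s * (\<Sum>s' | s' \<in> SP n \<and> proj s' = t'. pkernel \<alpha> \<gamma> n s s') =
      of_bool (proj s = t) * Wt s * Ker n (\<lambda>s'. of_bool (proj s' = t')) s"
    unfolding sum_pkernel[OF s assms] Pi_kernel_eq by simp
qed

text \<open>\<open>mix_Ker\<close> provides some density for the law after one step; by
  \<open>mix_unique\<close> it must be the mass of each fibre, which is the tree kernel.\<close>

theorem intertwining:
  assumes "1 \<le> n"
  shows "(\<Sum>s\<in>SP n. of_bool (proj s = t) * Wt s * Ker n f s) = (\<Sum>s\<in>SP n. tree_kernel \<alpha> \<gamma> n t (proj s) * Wt s * f s)"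
proof -
  obtain m' where m': "\<And>f. (\<Sum>s\<in>SP n. of_bool (proj s = t) * Wt s * Ker n f s) = (\<Sum>s\<in>SP n. m' (proj s) * Wt s * f s)"
    using mix_Ker[OF assms, of "\<lambda>u. of_bool (u = t)"] by blast
  have "m' (proj r) = tree_kernel \<alpha> \<gamma> n t (proj r)" if "r \<in> SP n" for r
    unfolding tree_kernel_Ker[OF assms] by (rule mix_unique[OF assms m'[symmetric] that])
  then show ?thesis unfolding m' by simp
qed

end

section \<open>Stationarity\<close>

context growth
begin

text \<open>The weight of a single location does not involve the number of children; only for a
  whole branch point would it change with the deletion.\<close>

lemma raw_weight_shift: "raw_weight \<alpha> \<gamma> (shift_desc i s d) = raw_weight \<alpha> \<gamma> d"
  by (cases d) (simp_all add: shift_desc_def)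

text \<open>Either \<open>(1 - \<alpha>) + \<gamma> + (\<alpha> - \<gamma>)\<close> or
  \<open>(1 - \<alpha>) + \<alpha>\<close>.\<close>

lemma raw_weight_lost: "(\<Sum>d\<in>#lost i s. raw_weight \<alpha> \<gamma> d) = 1"
  by (simp add: lost_def)

text \<open>Selecting \<open>n + 1\<close> returns \<open>s\<close> with the full weight
  \<open>n - \<alpha>\<close>; each of the \<open>n\<close> other leaves returns \<open>s\<close>
  with the lost weight 1 and otherwise grows the smaller tree, whose total weight is
  \<open>n - 1 - \<alpha>\<close>.\<close>

lemma Up_Dn:
  assumes s: "s \<in> SP n" and n: "2 \<le> n"
  shows "(real n - \<alpha>) * real (Suc n) * Up n (Dn (Suc n) f) s = (2 * real n - \<alpha>) * f s + (real n - 1 - \<alpha>) * real n * Ker n f s"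
proof -
  have n1: "1 \<le> n" using n by simp
  let ?I = "insertions (Suc n) s"
  have "(real n - \<alpha>) * real (Suc n) * Up n (Dn (Suc n) f) s = real (Suc n) * (\<Sum>y\<in>#?I. raw_weight \<alpha> \<gamma> (fst y) * Dn (Suc n) f (snd y))"
    unfolding Up_raw[OF s n1, of "Dn (Suc n) f"] by simp
  also have "\<dots> = (\<Sum>y\<in>#?I. \<Sum>i\<in>{1..Suc n}. raw_weight \<alpha> \<gamma> (fst y) * f (down_step i (snd y)))"
    unfolding sum_mset_distrib_left
  proof (intro arg_cong[of _ _ sum_mset] image_mset_cong)
    fix y :: "desc \<times> nat ptree"
    have "real (Suc n) * Dn (Suc n) f (snd y) = (\<Sum>i\<in>{1..Suc n}. f (down_step i (snd y)))"
      unfolding Dn_def sum_distrib_left by (rule sum.cong) auto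
    then show "real (Suc n) * (raw_weight \<alpha> \<gamma> (fst y) * Dn (Suc n) f (snd y)) = (\<Sum>i\<in>{1..Suc n}. raw_weight \<alpha> \<gamma> (fst y) * f (down_step i (snd y)))"
      unfolding sum_distrib_left[symmetric] mult.left_commute[of "real (Suc n)"] by (rule arg_cong)
  qed
  also have "\<dots> = (\<Sum>i\<in>{1..Suc n}. \<Sum>y\<in>#?I. raw_weight \<alpha> \<gamma> (fst y) * f (down_step i (snd y)))"
  proof -
    have "(\<Sum>y\<in>#M. \<Sum>i\<in>A. F y i) = (\<Sum>i\<in>A. \<Sum>y\<in>#M. F y i)" for A :: "nat set" and M :: "(desc \<times> nat ptree) multiset" and F :: "_ \<Rightarrow> _ \<Rightarrow> real"
      by (induction M) (auto simp: sum.distrib)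
    then show ?thesis .
  qed
  also have "\<dots> = (\<Sum>i\<in>{1..n}. \<Sum>y\<in>#?I. raw_weight \<alpha> \<gamma> (fst y) * f (down_step i (snd y))) + (\<Sum>y\<in>#?I. raw_weight \<alpha> \<gamma> (fst y) * f (down_step (Suc n) (snd y)))"
    by simp
  also have "(\<Sum>y\<in>#?I. raw_weight \<alpha> \<gamma> (fst y) * f (down_step (Suc n) (snd y))) = (real n - \<alpha>) * f s"
  proof -
    have "(\<Sum>y\<in>#?I. raw_weight \<alpha> \<gamma> (fst y) * f (down_step (Suc n) (snd y))) = (\<Sum>y\<in>#?I. raw_weight \<alpha> \<gamma> (fst y) * f s)"
    proof (intro arg_cong[of _ _ sum_mset] image_mset_cong)
      fix y assume "y \<in># ?I"
      then have "down_step (Suc n) (snd y) = s" using down_step_last(2)[OF s n1, of "fst y" "snd y"] by simp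
      then show "raw_weight \<alpha> \<gamma> (fst y) * f (down_step (Suc n) (snd y)) = raw_weight \<alpha> \<gamma> (fst y) * f s" by simp
    qed
    then show ?thesis
      using total_raw_weight[OF SP_props(1)[OF s], of "Suc n"] SP_props(3)[OF s] unfolding sum_mset_distrib_right[symmetric] by simp
  qed
  also have "(\<Sum>i\<in>{1..n}. \<Sum>y\<in>#?I. raw_weight \<alpha> \<gamma> (fst y) * f (down_step i (snd y))) = (\<Sum>i\<in>{1..n}. f s + (real n - 1 - \<alpha>) * Up (n - 1) f (down_step i s))"
  proof (rule sum.cong[OF refl])
    fix i assume i: "i \<in> {1..n}"
    obtain X R where "down_splits n i s X R" using down_splits_exist[OF s n i] by blast
    note D = this[unfolded down_splits_def]
    have "(\<Sum>y\<in>#X. raw_weight \<alpha> \<gamma> (fst y) * f (down_step i (snd y))) = (\<Sum>y\<in>#X. raw_weight \<alpha> \<gamma> (fst y) * f s)"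
    proof (intro arg_cong[of _ _ sum_mset] image_mset_cong)
      fix y assume y: "y \<in># X"
      have "(fst y, snd y) \<in># X" using y by simp
      then have "down_step i (snd y) = s" using D by blast
      then show "raw_weight \<alpha> \<gamma> (fst y) * f (down_step i (snd y)) = raw_weight \<alpha> \<gamma> (fst y) * f s" by simp
    qed
    also have "\<dots> = (\<Sum>d\<in>#image_mset fst X. raw_weight \<alpha> \<gamma> d) * f s" by (simp add: multiset.map_comp comp_def sum_mset_distrib_right)
    also have "\<dots> = f s" using D raw_weight_lost[of i s] by simp
    finally have X: "(\<Sum>y\<in>#X. raw_weight \<alpha> \<gamma> (fst y) * f (down_step i (snd y))) = f s" .
    obtain p where p: "n = Suc p" "1 \<le> p" using n by (cases n) auto
    have d: "down_step i s \<in> SP p" using down_step_SP[OF n s i] p by simp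
    have "insertions n (down_step i s) = image_mset (map_prod (shift_desc i s) (down_step i)) R" using D by simp
    then have "(\<Sum>y\<in>#insertions n (down_step i s). raw_weight \<alpha> \<gamma> (fst y) * f (snd y)) = (\<Sum>y\<in>#R. raw_weight \<alpha> \<gamma> (fst y) * f (down_step i (snd y)))"
      by (simp add: multiset.map_comp comp_def raw_weight_shift)
    then have R: "(\<Sum>y\<in>#R. raw_weight \<alpha> \<gamma> (fst y) * f (down_step i (snd y))) = (real n - 1 - \<alpha>) * Up (n - 1) f (down_step i s)"
      using Up_raw[OF d p(2), of f] p(1) by simp
    show "(\<Sum>y\<in>#?I. raw_weight \<alpha> \<gamma> (fst y) * f (down_step i (snd y))) = f s + (real n - 1 - \<alpha>) * Up (n - 1) f (down_step i s)"
      using D X R by simp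
  qed
  also have "\<dots> = real n * f s + (real n - 1 - \<alpha>) * (\<Sum>i\<in>{1..n}. Up (n - 1) f (down_step i s))"
    by (simp add: sum.distrib sum_distrib_left)
  also have "(\<Sum>i\<in>{1..n}. Up (n - 1) f (down_step i s)) = real n * Ker n f s"
  proof -
    have "Ker n f s = (\<Sum>i\<in>{1..n}. 1 / real n * Up (n - 1) f (down_step i s))" using n unfolding Ker_def Dn_def by simp
    then show ?thesis using n unfolding sum_distrib_left[symmetric] by simp
  qed
  finally show ?thesis by (simp add: algebra_simps)
qed

lemma split_trees:
  assumes "1 \<le> n"
  shows "(\<Sum>s\<in>SP n. h (proj s) * F s) = (\<Sum>t\<in>trees {1..n}. h t * (\<Sum>s\<in>SP n. of_bool (proj s = t) * F s :: real))"
proof -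
  have fin: "finite (proj ` SP n)" using finite_SP[OF assms] by simp
  have "(\<Sum>t\<in>trees {1..n}. h t * (\<Sum>s\<in>SP n. of_bool (proj s = t) * F s)) = (\<Sum>s\<in>SP n. \<Sum>t\<in>proj ` SP n. h t * (of_bool (proj s = t) * F s))"
    unfolding trees_eq sum_distrib_left by (rule sum.swap)
  also have "\<dots> = (\<Sum>s\<in>SP n. h (proj s) * F s)"
  proof (rule sum.cong[OF refl])
    fix s assume s: "s \<in> SP n"
    have "(\<Sum>t\<in>proj ` SP n. h t * (of_bool (proj s = t) * F s)) = (\<Sum>t\<in>proj ` SP n. if t = proj s then h t * F s else 0)"
      by (rule sum.cong) auto
    then show "(\<Sum>t\<in>proj ` SP n. h t * (of_bool (proj s = t) * F s)) = h (proj s) * F s"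
      using s fin by (simp add: sum.delta)
  qed
  finally show ?thesis by simp
qed

lemma fibre_mass_tree: "1 \<le> n \<Longrightarrow> t \<in> trees {1..n} \<Longrightarrow> (\<Sum>s\<in>SP n. of_bool (proj s = t) * Wt s) = 1"
  unfolding trees_eq using fibre_mass by blast

lemma sum_fibre: "1 \<le> n \<Longrightarrow> (\<Sum>s\<in>SP n. h (proj s) * Wt s) = (\<Sum>t\<in>trees {1..n}. h t)"
  unfolding split_trees by (rule sum.cong) (simp_all add: fibre_mass_tree[simplified])

abbreviation glaw :: "nat \<Rightarrow> nat ptree \<Rightarrow> real" where
  "glaw n s \<equiv> growth_law \<alpha> \<gamma> n (proj s) * Wt s"

lemma growth_law_Suc: "1 \<le> n \<Longrightarrow> growth_law \<alpha> \<gamma> (Suc n) t = (\<Sum>s\<in>trees {1..n}. growth_law \<alpha> \<gamma> n s * growth_step \<alpha> \<gamma> n s t)"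
  by (cases n) simp_all

text \<open>The density provided by \<open>mix_Up\<close> is tested on fibres; by
  \<open>growth_step_Up\<close> it satisfies the recursion of the growth law.\<close>

lemma glaw_Up:
  assumes n: "1 \<le> n"
  shows "(\<Sum>s\<in>SP n. glaw n s * Up n f s) = (\<Sum>s\<in>SP (Suc n). glaw (Suc n) s * f s)"
proof -
  obtain m' where m': "\<And>f. (\<Sum>s\<in>SP n. glaw n s * Up n f s) = (\<Sum>s\<in>SP (Suc n). m' (proj s) * Wt s * f s)"
    using mix_Up[OF n, of "growth_law \<alpha> \<gamma> n"] by blast
  have "m' (proj r) = growth_law \<alpha> \<gamma> (Suc n) (proj r)" if r: "r \<in> SP (Suc n)" for r
  proof -
    have "m' (proj r) = (\<Sum>s\<in>SP n. glaw n s * Up n (\<lambda>s. of_bool (proj s = proj r)) s)"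
      by (rule mix_unique[OF _ m'[symmetric] r]) simp
    also have "\<dots> = (\<Sum>s\<in>SP n. (growth_law \<alpha> \<gamma> n (proj s) * growth_step \<alpha> \<gamma> n (proj s) (proj r)) * Wt s)"
      by (rule sum.cong) (simp_all add: growth_step_Up[OF _ n])
    also have "\<dots> = growth_law \<alpha> \<gamma> (Suc n) (proj r)"
      unfolding growth_law_Suc[OF n] by (rule sum_fibre[OF n, of "\<lambda>t. growth_law \<alpha> \<gamma> n t * growth_step \<alpha> \<gamma> n t (proj r)"])
    finally show ?thesis .
  qed
  then show ?thesis unfolding m' by simp
qed

lemma glaw_1: "(\<Sum>s\<in>SP 1. glaw 1 s * f s) = f (PLeaf 1)"
  unfolding SP_1 by (simp add: pi_weight_PLeaf)

lemma glaw_mass: "1 \<le> n \<Longrightarrow> (\<Sum>s\<in>SP n. glaw n s) = 1"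
proof (induction n rule: dec_induct)
  case base
  then show ?case using glaw_1[of "\<lambda>_. 1"] by simp
next
  case (step n)
  have "(\<Sum>s\<in>SP (Suc n). glaw (Suc n) s * 1) = (\<Sum>s\<in>SP n. glaw n s * Up n (\<lambda>_. 1) s)"
    using glaw_Up[OF step(1), of "\<lambda>_. 1"] by simp
  also have "\<dots> = (\<Sum>s\<in>SP n. glaw n s)" by (rule sum.cong) (simp_all add: Up_one[OF _ step(1), simplified])
  finally show ?case using step.IH by simp
qed

lemma Up_nonneg:
  assumes "s \<in> SP n" "1 \<le> n" "\<And>u. 0 \<le> f u"
  shows "0 \<le> Up n f s"
proof (cases "n = 1")
  case True
  then have "s = PLeaf 1" using assms(1) SP_1 by simp
  then show ?thesis unfolding Up_def True using assms(3) by (simp add: up_weight_def)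
next
  case False
  then have pos: "0 < real n - \<alpha>" using assms(2) par by auto
  have r: "0 \<le> raw_weight \<alpha> \<gamma> d" for d using par by (cases d) auto
  have "0 \<le> (\<Sum>y\<in>#M. raw_weight \<alpha> \<gamma> (fst y) * f (snd y))" for M :: "(desc \<times> nat ptree) multiset"
    by (induction M) (use r assms(3) in auto)
  then have "0 \<le> (real n - \<alpha>) * Up n f s" using Up_raw[OF assms(1,2), of f] by metis
  then show ?thesis using pos by (simp add: zero_le_mult_iff)
qed

lemma growth_law_nonneg: "1 \<le> n \<Longrightarrow> t \<in> trees {1..n} \<Longrightarrow> 0 \<le> growth_law \<alpha> \<gamma> n t"
proof (induction n arbitrary: t rule: dec_induct)
  case base
  then show ?case by simp
next
  case (step n)
  have "0 \<le> growth_step \<alpha> \<gamma> n u t" if "u \<in> trees {1..n}" for u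
  proof -
    obtain s where s: "s \<in> SP n" "u = proj s" using \<open>u \<in> trees {1..n}\<close> unfolding trees_eq by blast
    show ?thesis unfolding s(2) growth_step_Up[OF s(1) step(1)] by (rule Up_nonneg[OF s(1) step(1)]) simp
  qed
  then show ?case unfolding growth_law_Suc[OF step(1)] using step.IH by (intro sum_nonneg mult_nonneg_nonneg) auto
qed

lemma Ker_2: "s \<in> SP 2 \<Longrightarrow> Ker 2 f s = Up 1 f (PLeaf 1)"
proof -
  assume s: "s \<in> SP 2"
  have "down_step i s = PLeaf 1" if "i \<in> {1..2}" for i using down_step_SP[OF _ s that] SP_1 by simp
  then have "(\<Sum>i\<in>{1..2}. 1 / real 2 * Up 1 f (down_step i s)) = (\<Sum>i\<in>{1..2 :: nat}. 1 / real 2 * Up 1 f (PLeaf 1))"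
    by (intro sum.cong) simp_all
  then show ?thesis unfolding Ker_def Dn_def by simp
qed

text \<open>One step from level \<open>n + 1\<close> is deletion and growth; since the law there is
  grown from level \<open>n\<close>, \<open>Up_Dn\<close> and stationarity at level \<open>n\<close>
  apply to the function \<open>Up n f\<close>.\<close>

lemma glaw_stationary: "1 \<le> n \<Longrightarrow> (\<Sum>s\<in>SP n. glaw n s * Ker n f s) = (\<Sum>s\<in>SP n. glaw n s * f s)"
proof (induction n arbitrary: f rule: dec_induct)
  case base
  then show ?case by (simp add: Ker_def)
next
  case (step n)
  have sn: "Suc n \<noteq> 1" using step(1) by simp
  show ?case
  proof (cases "n = 1")
    case True
    have s2: "Suc n = 2" using True by simp
    have "(\<Sum>s\<in>SP 2. glaw 2 s * Ker 2 f s) = (\<Sum>s\<in>SP 2. glaw 2 s * Up 1 f (PLeaf 1))"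
      by (rule sum.cong) (simp_all add: Ker_2)
    also have "\<dots> = Up 1 f (PLeaf 1)" unfolding sum_distrib_right[symmetric] using glaw_mass[of 2] by simp
    also have "\<dots> = (\<Sum>s\<in>SP 2. glaw 2 s * f s)"
      using glaw_Up[of 1 f] unfolding glaw_1 by (simp add: numeral_2_eq_2)
    finally show ?thesis unfolding s2 .
  next
    case False
    then have n: "2 \<le> n" using step(1) by simp
    let ?F = "Up n f"
    let ?S = "\<Sum>s\<in>SP n. glaw n s * ?F s"
    have pos: "0 < real n - \<alpha>" using n par by auto
    have L: "(\<Sum>s\<in>SP (Suc n). glaw (Suc n) s * Ker (Suc n) f s) = (\<Sum>s\<in>SP n. glaw n s * Up n (Dn (Suc n) ?F) s)"
      unfolding glaw_Up[OF step(1)] Ker_def using sn by simp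
    have "(real n - \<alpha>) * real (Suc n) * (\<Sum>s\<in>SP n. glaw n s * Up n (Dn (Suc n) ?F) s)
      = (\<Sum>s\<in>SP n. glaw n s * ((real n - \<alpha>) * real (Suc n) * Up n (Dn (Suc n) ?F) s))"
      by (simp only: sum_distrib_left mult.left_commute)
    also have "\<dots> = (\<Sum>s\<in>SP n. glaw n s * ((2 * real n - \<alpha>) * ?F s + (real n - 1 - \<alpha>) * real n * Ker n ?F s))"
      by (rule sum.cong[OF refl]) (simp only: Up_Dn[OF _ n])
    also have "\<dots> = (2 * real n - \<alpha>) * ?S + (real n - 1 - \<alpha>) * real n * (\<Sum>s\<in>SP n. glaw n s * Ker n ?F s)"
      by (simp only: sum_distrib_left distrib_left sum.distrib mult.left_commute)
    \<comment> \<open>The two coefficients add up to the factor on the left.\<close>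
    also have "\<dots> = (real n - \<alpha>) * real (Suc n) * ?S"
      unfolding step.IH by (simp add: algebra_simps)
    finally have "(\<Sum>s\<in>SP n. glaw n s * Up n (Dn (Suc n) ?F) s) = ?S" using pos by simp
    then show ?thesis unfolding L glaw_Up[OF step(1)] .
  qed
qed

lemma singleton_law:
  assumes "SP n = {r}" "1 \<le> n"
  shows "(\<Sum>s\<in>SP n. \<nu> s * f s) = (\<Sum>s\<in>SP n. \<nu> s) * (\<Sum>s\<in>SP n. glaw n s * f s)"
  using glaw_mass[OF assms(2)] unfolding assms(1) by simp

lemma SP_2_singleton: "SP 2 = {PBranch [PLeaf 1, PLeaf 2]}"
proof -
  have "SP 2 \<noteq> {}" using glaw_mass[of 2] by auto
  then show ?thesis using SP_2 by blast
qed

text \<open>A stationary \<open>\<nu>\<close> equals \<open>\<nu>' Up\<close> with \<open>\<nu>' = \<nu> Dn\<close>, so \<open>\<nu>' Up Dn = \<nu>'\<close>, and \<open>\<nu>'\<close> is stationary one level below.\<close>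

lemma stationary_unique:
  assumes "1 \<le> n"
  shows "(\<And>f. (\<Sum>s\<in>SP n. \<nu> s * Ker n f s) = (\<Sum>s\<in>SP n. \<nu> s * f s)) \<Longrightarrow>
    (\<Sum>s\<in>SP n. \<nu> s * f s) = (\<Sum>s\<in>SP n. \<nu> s) * (\<Sum>s\<in>SP n. glaw n s * f s)"
  using assms
proof (induction n arbitrary: \<nu> f rule: dec_induct)
  case base
  show ?case by (rule singleton_law[OF SP_1]) simp
next
  case (step n)
  have sn: "Suc n \<noteq> 1" using step(1) by simp
  show ?case
  proof (cases "n = 1")
    case True
    then have s2: "Suc n = 2" by simp
    show ?thesis unfolding s2 by (rule singleton_law[OF SP_2_singleton]) simp
  next
    case False
    then have n: "2 \<le> n" using step(1) by simp
    define \<nu>' where "\<nu>' r = (\<Sum>u\<in>SP (Suc n). \<nu> u * Dn (Suc n) (\<lambda>s. of_bool (s = r)) u)" for r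
    have \<nu>': "(\<Sum>r\<in>SP n. \<nu>' r * f r) = (\<Sum>u\<in>SP (Suc n). \<nu> u * Dn (Suc n) f u)" for f
    proof -
      have "(\<Sum>r\<in>SP n. \<nu>' r * f r) = (\<Sum>r\<in>SP n. \<Sum>u\<in>SP (Suc n). \<nu> u * (Dn (Suc n) (\<lambda>s. of_bool (s = r)) u * f r))"
        unfolding \<nu>'_def by (simp only: sum_distrib_right mult.assoc)
      also have "\<dots> = (\<Sum>u\<in>SP (Suc n). \<Sum>r\<in>SP n. \<nu> u * (Dn (Suc n) (\<lambda>s. of_bool (s = r)) u * f r))" by (rule sum.swap)
      also have "\<dots> = (\<Sum>u\<in>SP (Suc n). \<nu> u * Dn (Suc n) f u)"
      proof (rule sum.cong[OF refl])
        fix u assume u: "u \<in> SP (Suc n)"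
        have "(\<Sum>r\<in>SP n. Dn (Suc n) (\<lambda>s. of_bool (s = r)) u * f r) = (\<Sum>r\<in>SP n. \<Sum>i\<in>{1..Suc n}. 1 / real (Suc n) * (of_bool (down_step i u = r) * f r))"
          unfolding Dn_def by (simp only: sum_distrib_right mult.assoc)
        also have "\<dots> = (\<Sum>i\<in>{1..Suc n}. \<Sum>r\<in>SP n. 1 / real (Suc n) * (of_bool (down_step i u = r) * f r))" by (rule sum.swap)
        also have "\<dots> = (\<Sum>i\<in>{1..Suc n}. 1 / real (Suc n) * f (down_step i u))"
        proof (rule sum.cong[OF refl])
          fix i assume i: "i \<in> {1..Suc n}"
          have d: "down_step i u \<in> SP n" using down_step_SP[OF _ u i] n by simp
          have "(\<Sum>r\<in>SP n. 1 / real (Suc n) * (of_bool (down_step i u = r) * f r)) = (\<Sum>r\<in>SP n. if r = down_step i u then 1 / real (Suc n) * f r else 0)"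
            by (rule sum.cong) auto
          then show "(\<Sum>r\<in>SP n. 1 / real (Suc n) * (of_bool (down_step i u = r) * f r)) = 1 / real (Suc n) * f (down_step i u)"
            using d finite_SP[OF step(1)] by (simp add: sum.delta)
        qed
        finally show "(\<Sum>r\<in>SP n. \<nu> u * (Dn (Suc n) (\<lambda>s. of_bool (s = r)) u * f r)) = \<nu> u * Dn (Suc n) f u"
          unfolding sum_distrib_left[symmetric] Dn_def by simp
      qed
      finally show ?thesis .
    qed
    have st: "(\<Sum>u\<in>SP (Suc n). \<nu> u * f u) = (\<Sum>r\<in>SP n. \<nu>' r * Up n f r)" for f
      unfolding \<nu>' using step.prems(1)[of f] sn unfolding Ker_def by simp
    have concl: "(\<Sum>r\<in>SP n. \<nu>' r * f r) = (\<Sum>r\<in>SP n. \<nu>' r) * (\<Sum>r\<in>SP n. glaw n r * f r)" for f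
    proof (cases "n = 2")
      \<comment> \<open>Kept apart because the coefficient \<open>n - 1 - \<alpha>\<close>, by which
        the next case divides, vanishes for \<open>\<alpha> = 1\<close>; with two leaves there is
        only one tree.\<close>
      case True
      show ?thesis unfolding True by (rule singleton_law[OF SP_2_singleton]) simp
    next
      case False
      have pos: "0 < real n - 1 - \<alpha>" using n False par by auto
      have "(\<Sum>r\<in>SP n. \<nu>' r * Ker n f r) = (\<Sum>r\<in>SP n. \<nu>' r * f r)" for f
      proof -
        let ?S = "\<Sum>r\<in>SP n. \<nu>' r * f r" and ?K = "\<Sum>r\<in>SP n. \<nu>' r * Ker n f r"
        have "?S = (\<Sum>r\<in>SP n. \<nu>' r * Up n (Dn (Suc n) f) r)" unfolding \<nu>'[of f] by (rule st)
        then have "(real n - \<alpha>) * real (Suc n) * ?S = (\<Sum>r\<in>SP n. \<nu>' r * ((real n - \<alpha>) * real (Suc n) * Up n (Dn (Suc n) f) r))"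
          by (simp only: sum_distrib_left mult.left_commute)
        also have "\<dots> = (\<Sum>r\<in>SP n. \<nu>' r * ((2 * real n - \<alpha>) * f r + (real n - 1 - \<alpha>) * real n * Ker n f r))"
          by (rule sum.cong[OF refl]) (simp only: Up_Dn[OF _ n])
        also have "\<dots> = (2 * real n - \<alpha>) * ?S + (real n - 1 - \<alpha>) * real n * ?K"
          by (simp only: sum_distrib_left distrib_left sum.distrib mult.left_commute)
        finally have "(real n - 1 - \<alpha>) * real n * ?S = (real n - 1 - \<alpha>) * real n * ?K" by (simp add: algebra_simps)
        then show ?thesis using pos n by simp
      qed
      then show ?thesis by (rule step.IH)
    qed
    have mass: "(\<Sum>r\<in>SP n. \<nu>' r) = (\<Sum>u\<in>SP (Suc n). \<nu> u)"
    proof -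
      have "(\<Sum>u\<in>SP (Suc n). \<nu> u * 1) = (\<Sum>r\<in>SP n. \<nu>' r * Up n (\<lambda>_. 1) r)" by (rule st)
      also have "\<dots> = (\<Sum>r\<in>SP n. \<nu>' r * 1)" by (rule sum.cong[OF refl]) (simp only: Up_one[OF _ step(1)])
      finally show ?thesis by simp
    qed
    show ?thesis unfolding st[of f] concl[of "Up n f"] mass glaw_Up[OF step(1)] ..
  qed
qed

theorem growth_law_stationary:
  assumes n: "1 \<le> n"
  shows "stationary (trees {1..n}) (tree_kernel \<alpha> \<gamma> n) (growth_law \<alpha> \<gamma> n)"
  unfolding stationary_def
proof (intro conjI ballI)
  show "0 \<le> growth_law \<alpha> \<gamma> n x" if "x \<in> trees {1..n}" for x using growth_law_nonneg[OF n that] .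
  show "(\<Sum>x\<in>trees {1..n}. growth_law \<alpha> \<gamma> n x) = 1"
    using sum_fibre[OF n, of "growth_law \<alpha> \<gamma> n"] glaw_mass[OF n] by simp
  fix t' assume t': "t' \<in> trees {1..n}"
  let ?f = "\<lambda>s. of_bool (proj s = t') :: real"
  have "(\<Sum>x\<in>trees {1..n}. growth_law \<alpha> \<gamma> n x * tree_kernel \<alpha> \<gamma> n x t') = (\<Sum>s\<in>SP n. growth_law \<alpha> \<gamma> n (proj s) * (Wt s * Ker n ?f s))"
    using split_trees[OF n, of "growth_law \<alpha> \<gamma> n" "\<lambda>s. Wt s * Ker n ?f s"] unfolding tree_kernel_Ker[OF n] by (simp only: mult.assoc)
  also have "\<dots> = (\<Sum>s\<in>SP n. glaw n s * ?f s)" using glaw_stationary[OF n, of ?f] by (simp only: mult.assoc)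
  also have "\<dots> = (\<Sum>s\<in>SP n. growth_law \<alpha> \<gamma> n t' * (?f s * Wt s))" by (rule sum.cong) auto
  also have "\<dots> = growth_law \<alpha> \<gamma> n t'" unfolding sum_distrib_left[symmetric] fibre_mass_tree[OF n t'] by simp
  finally show "(\<Sum>x\<in>trees {1..n}. growth_law \<alpha> \<gamma> n x * tree_kernel \<alpha> \<gamma> n x t') = growth_law \<alpha> \<gamma> n t'" .
qed

text \<open>By the intertwining, spreading a stationary law over the fibres with weight
  \<open>Wt\<close> gives a stationary law of the semi-planar chain, where
  \<open>stationary_unique\<close> applies.\<close>

theorem growth_law_unique:
  assumes n: "1 \<le> n" and st: "stationary (trees {1..n}) (tree_kernel \<alpha> \<gamma> n) \<mu>" and t: "t \<in> trees {1..n}"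
  shows "\<mu> t = growth_law \<alpha> \<gamma> n t"
proof -
  let ?\<nu> = "\<lambda>s. \<mu> (proj s) * Wt s"
  have S: "(\<Sum>x\<in>trees {1..n}. \<mu> x) = 1" "\<And>y. y \<in> trees {1..n} \<Longrightarrow> (\<Sum>x\<in>trees {1..n}. \<mu> x * tree_kernel \<alpha> \<gamma> n x y) = \<mu> y"
    using st unfolding stationary_def by blast+
  have inv: "(\<Sum>s\<in>SP n. ?\<nu> s * Ker n f s) = (\<Sum>s\<in>SP n. ?\<nu> s * f s)" for f
  proof -
    have "(\<Sum>s\<in>SP n. ?\<nu> s * Ker n f s) = (\<Sum>x\<in>trees {1..n}. \<mu> x * (\<Sum>s\<in>SP n. of_bool (proj s = x) * Wt s * Ker n f s))"
      using split_trees[OF n, of \<mu> "\<lambda>s. Wt s * Ker n f s"] by (simp only: mult.assoc)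
    also have "\<dots> = (\<Sum>x\<in>trees {1..n}. \<Sum>s\<in>SP n. \<mu> x * tree_kernel \<alpha> \<gamma> n x (proj s) * (Wt s * f s))"
      unfolding intertwining[OF n] by (simp only: sum_distrib_left mult.assoc)
    also have "\<dots> = (\<Sum>s\<in>SP n. \<Sum>x\<in>trees {1..n}. \<mu> x * tree_kernel \<alpha> \<gamma> n x (proj s) * (Wt s * f s))" by (rule sum.swap)
    also have "\<dots> = (\<Sum>s\<in>SP n. ?\<nu> s * f s)"
    proof (rule sum.cong[OF refl])
      fix s assume "s \<in> SP n"
      then have "proj s \<in> trees {1..n}" unfolding trees_eq by blast
      then show "(\<Sum>x\<in>trees {1..n}. \<mu> x * tree_kernel \<alpha> \<gamma> n x (proj s) * (Wt s * f s)) = ?\<nu> s * f s"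
        unfolding sum_distrib_right[symmetric] using S(2) by simp
    qed
    finally show ?thesis .
  qed
  let ?f = "\<lambda>s. of_bool (proj s = t) :: real"
  have fib: "(\<Sum>s\<in>SP n. h (proj s) * Wt s * ?f s) = h t" for h
  proof -
    have "(\<Sum>s\<in>SP n. h (proj s) * Wt s * ?f s) = (\<Sum>s\<in>SP n. h t * (?f s * Wt s))" by (rule sum.cong) auto
    then show ?thesis unfolding sum_distrib_left[symmetric] fibre_mass_tree[OF n t] by simp
  qed
  have "(\<Sum>s\<in>SP n. ?\<nu> s * ?f s) = (\<Sum>s\<in>SP n. ?\<nu> s) * (\<Sum>s\<in>SP n. glaw n s * ?f s)"
    by (rule stationary_unique[OF n inv])
  then show ?thesis unfolding fib sum_fibre[OF n, of \<mu>] S(1) by simp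
qed

end

section \<open>Functions of Markov chains\<close>

lemma markov_chain_event:
  assumes "markov_chain M S \<mu> K X" "\<And>k. D k \<subseteq> S"
  shows "{\<omega> \<in> space M. \<forall>k\<le>N. X k \<omega> \<in> D k} \<in> sets M"
proof -
  have X: "X k \<in> M \<rightarrow>\<^sub>M count_space S" for k using assms(1) unfolding markov_chain_def by blast
  have "{\<omega> \<in> space M. X k \<omega> \<in> D k} \<in> sets M" for k
  proof -
    have "X k -` D k \<inter> space M \<in> sets M" by (rule measurable_sets[OF X]) (use assms(2) in simp)
    moreover have "X k -` D k \<inter> space M = {\<omega> \<in> space M. X k \<omega> \<in> D k}" by auto
    ultimately show ?thesis by simp
  qed
  then have "{\<omega> \<in> space M. \<forall>k\<in>{..N}. X k \<omega> \<in> D k} \<in> sets M"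
    by (intro sets.sets_Collect_countable_Ball) auto
  then show ?thesis unfolding Ball_def atMost_iff .
qed

lemma markov_chain_split:
  assumes chain: "markov_chain M S \<mu> K X" and fin: "finite S" and D: "\<And>k. D k \<subseteq> S" and j: "j \<le> N"
  shows "measure M {\<omega> \<in> space M. \<forall>k\<le>N. X k \<omega> \<in> D k} = (\<Sum>z\<in>D j. measure M {\<omega> \<in> space M. \<forall>k\<le>N. X k \<omega> \<in> (D(j := {z})) k})"
proof -
  interpret prob_space M using chain unfolding markov_chain_def by blast
  let ?E = "\<lambda>z. {\<omega> \<in> space M. \<forall>k\<le>N. X k \<omega> \<in> (D(j := {z})) k}"
  have *: "(\<forall>k\<le>N. X k \<omega> \<in> (D(j := {z})) k) \<longleftrightarrow> X j \<omega> = z \<and> (\<forall>k\<le>N. X k \<omega> \<in> D k)" if "z \<in> D j" for z \<omega>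
    using that j by (auto split: if_splits)
  have "{\<omega> \<in> space M. \<forall>k\<le>N. X k \<omega> \<in> D k} = (\<Union>z\<in>D j. ?E z)"
    using j by (auto simp: * simp del: fun_upd_apply)
  also have "measure M \<dots> = (\<Sum>z\<in>D j. measure M (?E z))"
  proof (rule finite_measure_finite_Union)
    show "finite (D j)" using D fin finite_subset by blast
    show "?E ` D j \<subseteq> sets M"
      using D by (intro image_subsetI markov_chain_event[OF chain]) auto
    show "disjoint_family_on ?E (D j)" unfolding disjoint_family_on_def using * by (auto simp del: fun_upd_apply)
  qed
  finally show ?thesis .
qed

text \<open>A chain is defined by conditioning on complete pasts. Here the past before time
  \<open>j\<close> is known only up to sets; the induction on \<open>j\<close> splits these into
  points one time after the other.\<close>

lemma markov_chain_path:
  assumes chain: "markov_chain M S \<mu> K X" and "finite S"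
    and D: "\<And>k. D k \<subseteq> S" "\<And>k. j \<le> k \<Longrightarrow> k \<le> Suc m \<Longrightarrow> D k = {x k}" and "j \<le> m"
  shows "measure M {\<omega> \<in> space M. \<forall>k\<le>Suc m. X k \<omega> \<in> D k} = measure M {\<omega> \<in> space M. \<forall>k\<le>m. X k \<omega> \<in> D k} * K (x m) (x (Suc m))"
  using D \<open>j \<le> m\<close>
proof (induction j arbitrary: D x)
  case 0
  interpret prob_space M using chain unfolding markov_chain_def by blast
  let ?Q = "{\<omega> \<in> space M. \<forall>k\<le>m. X k \<omega> = x k}"
  let ?R = "{\<omega> \<in> space M. X (Suc m) \<omega> = x (Suc m) \<and> (\<forall>k\<le>m. X k \<omega> = x k)}"
  have xS: "x k \<in> S" if "k \<le> Suc m" for k using 0(1)[of k] 0(2)[of k] that by simp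
  have "(\<forall>k\<le>Suc m. X k \<omega> \<in> D k) \<longleftrightarrow> X (Suc m) \<omega> = x (Suc m) \<and> (\<forall>k\<le>m. X k \<omega> = x k)" for \<omega>
    using 0(2) by (auto simp: le_Suc_eq)
  then have L: "{\<omega> \<in> space M. \<forall>k\<le>Suc m. X k \<omega> \<in> D k} = ?R" by simp
  have R: "{\<omega> \<in> space M. \<forall>k\<le>m. X k \<omega> \<in> D k} = ?Q" using 0(2) by auto
  have Q: "?Q \<in> sets M" using markov_chain_event[of M S \<mu> K X D m, OF chain 0(1)] unfolding R .
  show ?case
  proof (cases "measure M ?Q > 0")
    case True
    have "cond_prob M (\<lambda>\<omega>. X (Suc m) \<omega> = x (Suc m)) (\<lambda>\<omega>. \<forall>k\<le>m. X k \<omega> = x k) = K (x m) (x (Suc m))"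
      using chain True xS unfolding markov_chain_def by simp
    then have "measure M ?R = measure M ?Q * K (x m) (x (Suc m))"
      using True unfolding cond_prob_def by (simp add: field_simps)
    then show ?thesis unfolding L R .
  next
    \<comment> \<open>Conditioning is undefined on a null event, but then both sides are 0.\<close>
    case False
    then have z: "measure M ?Q = 0" using measure_nonneg[of M ?Q] by linarith
    have "measure M ?R \<le> measure M ?Q" by (rule finite_measure_mono[OF _ Q]) auto
    then have "measure M ?R = 0" using z measure_nonneg[of M ?R] by linarith
    then show ?thesis unfolding L R z by simp
  qed
next
  case (Suc j)
  have split: "measure M {\<omega> \<in> space M. \<forall>k\<le>N. X k \<omega> \<in> D k} = (\<Sum>z\<in>D j. measure M {\<omega> \<in> space M. \<forall>k\<le>N. X k \<omega> \<in> (D(j := {z})) k})"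
    if "j \<le> N" for N
    using markov_chain_split[OF chain \<open>finite S\<close> Suc.prems(1) that] .
  have "measure M {\<omega> \<in> space M. \<forall>k\<le>Suc m. X k \<omega> \<in> (D(j := {z})) k}
      = measure M {\<omega> \<in> space M. \<forall>k\<le>m. X k \<omega> \<in> (D(j := {z})) k} * K (x m) (x (Suc m))" if z: "z \<in> D j" for z
  proof -
    have "(D(j := {z})) k \<subseteq> S" for k using Suc.prems(1)[of k] Suc.prems(1)[of j] z by auto
    moreover have "(D(j := {z})) k = {(x(j := z)) k}" if "j \<le> k" "k \<le> Suc m" for k
      using that Suc.prems(2)[of k] by auto
    ultimately show ?thesis using Suc.IH[of "D(j := {z})" "x(j := z)"] Suc.prems(3) by simp
  qed
  then show ?case using Suc.prems(3) by (simp add: split sum_distrib_right)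
qed

text \<open>The criterion of Rogers and Pitman: given the past of its image under \<open>f\<close>, the chain always has law \<open>q\<close> on the current fibre.\<close>

theorem markov_function:
  assumes chain: "markov_chain M S \<mu> K X" and fin: "finite S" and t: "t \<in> f ` S"
    and init: "\<And>s. s \<in> S \<Longrightarrow> \<mu> s = of_bool (f s = t) * q s"
    and fibre: "\<And>u. u \<in> f ` S \<Longrightarrow> (\<Sum>s\<in>S. of_bool (f s = u) * q s) = 1"
    and intertwine: "\<And>u s'. u \<in> f ` S \<Longrightarrow> s' \<in> S \<Longrightarrow> (\<Sum>s\<in>S. of_bool (f s = u) * q s * K s s') = L u (f s') * q s'"
  shows "markov_chain M (f ` S) (\<lambda>u. of_bool (u = t)) L (\<lambda>m \<omega>. f (X m \<omega>))"
proof -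
  interpret prob_space M using chain unfolding markov_chain_def by blast
  have X: "X k \<in> M \<rightarrow>\<^sub>M count_space S" for k using chain unfolding markov_chain_def by blast
  have XS: "X k \<omega> \<in> S" if "\<omega> \<in> space M" for k \<omega> using measurable_space[OF X that, of k] by simp
  let ?B = "\<lambda>\<tau> k. {s \<in> S. f s = \<tau> k}"
  \<comment> \<open>The probability that the image follows \<tau> before time \<open>m\<close> and
    the chain is at \<open>s\<close> at time \<open>m\<close>; the aim is \<open>b = d * q\<close>
    on the current fibre.\<close>
  define b where "b \<tau> m s = measure M {\<omega> \<in> space M. \<forall>k\<le>m. X k \<omega> \<in> ((?B \<tau>)(m := {s})) k}" for \<tau> m s
  define d where "d \<tau> m = measure M {\<omega> \<in> space M. \<forall>k\<le>m. f (X k \<omega>) = \<tau> k}" for \<tau> m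
  have d_b: "d \<tau> m = (\<Sum>s\<in>S. of_bool (f s = \<tau> m) * b \<tau> m s)" for \<tau> m
  proof -
    have "d \<tau> m = measure M {\<omega> \<in> space M. \<forall>k\<le>m. X k \<omega> \<in> ?B \<tau> k}"
      unfolding d_def by (intro arg_cong[of _ _ "measure M"]) (auto simp: XS)
    also have "\<dots> = (\<Sum>s\<in>?B \<tau> m. b \<tau> m s)"
      unfolding b_def by (rule markov_chain_split[OF chain fin]) auto
    also have "\<dots> = (\<Sum>s\<in>S. if f s = \<tau> m then b \<tau> m s else 0)" by (rule sum.inter_filter[OF fin])
    also have "\<dots> = (\<Sum>s\<in>S. of_bool (f s = \<tau> m) * b \<tau> m s)" by (rule sum.cong) auto
    finally show ?thesis .
  qed
  have b_Suc: "b \<tau> (Suc m) s' = (\<Sum>s\<in>S. of_bool (f s = \<tau> m) * b \<tau> m s * K s s')" if s': "s' \<in> S" for \<tau> m s'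
  proof -
    let ?D = "(?B \<tau>)(Suc m := {s'})"
    have "b \<tau> (Suc m) s' = (\<Sum>s\<in>?D m. measure M {\<omega> \<in> space M. \<forall>k\<le>Suc m. X k \<omega> \<in> (?D(m := {s})) k})"
      unfolding b_def by (rule markov_chain_split[OF chain fin]) (use s' in auto)
    also have "\<dots> = (\<Sum>s\<in>?B \<tau> m. b \<tau> m s * K s s')"
    proof (rule sum.cong)
      fix s assume s: "s \<in> ?B \<tau> m"
      have "measure M {\<omega> \<in> space M. \<forall>k\<le>Suc m. X k \<omega> \<in> (?D(m := {s})) k}
          = measure M {\<omega> \<in> space M. \<forall>k\<le>m. X k \<omega> \<in> (?D(m := {s})) k} * K ((\<lambda>k. if k = m then s else s') m) ((\<lambda>k. if k = m then s else s') (Suc m))"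
        by (rule markov_chain_path[OF chain fin, of _ m]) (use s s' in \<open>auto simp: le_Suc_eq\<close>)
      moreover have "{\<omega> \<in> space M. \<forall>k\<le>m. X k \<omega> \<in> (?D(m := {s})) k} = {\<omega> \<in> space M. \<forall>k\<le>m. X k \<omega> \<in> ((?B \<tau>)(m := {s})) k}"
        by auto
      ultimately show "measure M {\<omega> \<in> space M. \<forall>k\<le>Suc m. X k \<omega> \<in> (?D(m := {s})) k} = b \<tau> m s * K s s'"
        unfolding b_def by simp
    qed simp
    also have "\<dots> = (\<Sum>s\<in>S. if f s = \<tau> m then b \<tau> m s * K s s' else 0)" by (rule sum.inter_filter[OF fin])
    also have "\<dots> = (\<Sum>s\<in>S. of_bool (f s = \<tau> m) * b \<tau> m s * K s s')" by (rule sum.cong) auto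
    finally show ?thesis .
  qed
  have b_upd: "b (\<tau>(m := u)) m s = b \<tau> m s" for \<tau> m u s
    unfolding b_def by (intro arg_cong[of _ _ "measure M"]) auto
  have init_law: "measure M {\<omega> \<in> space M. X 0 \<omega> = s} = of_bool (f s = t) * q s" if "s \<in> S" for s
    using chain init[OF that] that unfolding markov_chain_def by simp
  have b_0: "b \<tau> 0 s = of_bool (f s = t) * q s" if "s \<in> S" for \<tau> s
    using init_law[OF that] unfolding b_def by simp
  \<comment> \<open>If the chain has law \<open>q\<close> on the current fibre, the intertwining
    gives law \<open>q\<close> on each next fibre, with mass determined by \<open>L\<close>.\<close>
  have step: "d \<tau> (Suc m) = d \<tau> m * L (\<tau> m) (\<tau> (Suc m)) \<and> (\<forall>s\<in>S. b \<tau> (Suc m) s = d \<tau> m * L (\<tau> m) (f s) * q s)"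
    if b: "\<forall>s\<in>S. f s = \<tau> m \<longrightarrow> b \<tau> m s = d \<tau> m * q s" and \<tau>: "\<tau> m \<in> f ` S" "\<tau> (Suc m) \<in> f ` S" for \<tau> m
  proof -
    have B: "b \<tau> (Suc m) s' = d \<tau> m * L (\<tau> m) (f s') * q s'" if s': "s' \<in> S" for s'
    proof -
      have "b \<tau> (Suc m) s' = (\<Sum>s\<in>S. d \<tau> m * (of_bool (f s = \<tau> m) * q s * K s s'))"
        unfolding b_Suc[OF s'] by (rule sum.cong) (use b in auto)
      also have "\<dots> = d \<tau> m * L (\<tau> m) (f s') * q s'" unfolding sum_distrib_left[symmetric] intertwine[OF \<tau>(1) s'] by simp
      finally show ?thesis .
    qed
    have "d \<tau> (Suc m) = (\<Sum>s\<in>S. d \<tau> m * L (\<tau> m) (\<tau> (Suc m)) * (of_bool (f s = \<tau> (Suc m)) * q s))"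
      unfolding d_b[of \<tau> "Suc m"] by (rule sum.cong) (use B in auto)
    also have "\<dots> = d \<tau> m * L (\<tau> m) (\<tau> (Suc m))" unfolding sum_distrib_left[symmetric] fibre[OF \<tau>(2)] by simp
    finally show ?thesis using B by blast
  qed
  have d_0: "d \<tau> 0 = of_bool (\<tau> 0 = t)" if "\<tau> 0 \<in> f ` S" for \<tau>
  proof -
    have "d \<tau> 0 = (\<Sum>s\<in>S. of_bool (\<tau> 0 = t) * (of_bool (f s = \<tau> 0) * q s))"
      unfolding d_b by (rule sum.cong) (use b_0 in auto)
    also have "\<dots> = of_bool (\<tau> 0 = t)" unfolding sum_distrib_left[symmetric] fibre[OF that] by simp
    finally show ?thesis .
  qed
  have b_d: "\<forall>s\<in>S. f s = \<tau> m \<longrightarrow> b \<tau> m s = d \<tau> m * q s" if "\<forall>k\<le>m. \<tau> k \<in> f ` S" for \<tau> m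
    using that
  proof (induction m)
    case 0
    then show ?case using d_0[of \<tau>] b_0 by auto
  next
    case (Suc m)
    then have "\<forall>s\<in>S. f s = \<tau> m \<longrightarrow> b \<tau> m s = d \<tau> m * q s" by simp
    from step[OF this] Suc.prems show ?case by auto
  qed
  show ?thesis
    unfolding markov_chain_def
  proof (intro conjI allI ballI impI)
    show "prob_space M" by (rule prob_space_axioms)
    show "(\<lambda>\<omega>. f (X m \<omega>)) \<in> M \<rightarrow>\<^sub>M count_space (f ` S)" for m
      by (rule measurable_compose[OF X]) simp
    fix u assume "u \<in> f ` S"
    then show "measure M {\<omega> \<in> space M. f (X 0 \<omega>) = u} = of_bool (u = t)" using d_0[of "\<lambda>_. u"] unfolding d_def by simp
  next
    fix m \<tau> y assume y: "y \<in> f ` S" and \<tau>: "\<forall>k\<le>m. \<tau> k \<in> f ` S"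
      and pos: "measure M {\<omega> \<in> space M. \<forall>k\<le>m. f (X k \<omega>) = \<tau> k} > 0"
    let ?\<tau> = "\<tau>(Suc m := y)"
    have dm: "d ?\<tau> m = d \<tau> m" unfolding d_def by (intro arg_cong[of _ _ "measure M"]) auto
    have *: "\<forall>k\<le>m. ?\<tau> k \<in> f ` S" and \<tau>': "?\<tau> m = \<tau> m" "?\<tau> (Suc m) = y" using \<tau> by simp_all
    have "d ?\<tau> (Suc m) = d ?\<tau> m * L (?\<tau> m) (?\<tau> (Suc m))"
      by (rule conjunct1[OF step[OF b_d[OF *]]]) (use \<tau> y in simp_all)
    then have "d ?\<tau> (Suc m) = d \<tau> m * L (\<tau> m) y" unfolding dm \<tau>' .
    moreover have "d ?\<tau> (Suc m) = measure M {\<omega> \<in> space M. f (X (Suc m) \<omega>) = y \<and> (\<forall>k\<le>m. f (X k \<omega>) = \<tau> k)}"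
      unfolding d_def by (intro arg_cong[of _ _ "measure M"]) (auto simp: le_Suc_eq)
    ultimately have e: "measure M {\<omega> \<in> space M. f (X (Suc m) \<omega>) = y \<and> (\<forall>k\<le>m. f (X k \<omega>) = \<tau> k)} = d \<tau> m * L (\<tau> m) y" by simp
    show "cond_prob M (\<lambda>\<omega>. f (X (Suc m) \<omega>) = y) (\<lambda>\<omega>. \<forall>k\<le>m. f (X k \<omega>) = \<tau> k) = L (\<tau> m) y"
      using pos unfolding cond_prob_def e by (simp add: d_def)
  qed
qed

theorem theorem5p4:
  fixes \<alpha> \<gamma> :: real and n :: nat and t :: "nat tree"
    and M :: "'w measure" and X :: "nat \<Rightarrow> 'w \<Rightarrow> nat ptree"
  assumes "0 \<le> \<gamma>" and "\<gamma> \<le> \<alpha>" and "\<alpha> \<le> 1" and "1 \<le> n"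
    and "t \<in> trees {1..n}"
    and "markov_chain M (semiplanar {1..n}) (Pi_kernel \<alpha> \<gamma> t) (pkernel \<alpha> \<gamma> n) X"
  shows "markov_chain M (trees {1..n}) (\<lambda>s. of_bool (s = t)) (tree_kernel \<alpha> \<gamma> n)
           (\<lambda>m \<omega>. proj (X m \<omega>))
       \<and> stationary (trees {1..n}) (tree_kernel \<alpha> \<gamma> n) (growth_law \<alpha> \<gamma> n)
       \<and> (\<forall>\<mu>. stationary (trees {1..n}) (tree_kernel \<alpha> \<gamma> n) \<mu> \<longrightarrow>
            (\<forall>s \<in> trees {1..n}. \<mu> s = growth_law \<alpha> \<gamma> n s))"
proof -
  interpret growth \<alpha> \<gamma> using assms(1-3) by unfold_locales
  have fin: "finite (SP n)" by (rule finite_SP[OF assms(4)])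
  have "markov_chain M (proj ` SP n) (\<lambda>s. of_bool (s = t)) (tree_kernel \<alpha> \<gamma> n) (\<lambda>m \<omega>. proj (X m \<omega>))"
  \<comment> \<open>The laws on the fibres are the restrictions of the single function
    \<open>Wt\<close>, as the criterion demands of \<open>q\<close>.\<close>
  proof (rule markov_function[OF assms(6) fin, where q = Wt])
    show "t \<in> proj ` SP n" using assms(5) unfolding trees_eq .
    show "Pi_kernel \<alpha> \<gamma> t s = of_bool (proj s = t) * Wt s" for s by (rule Pi_kernel_eq)
    show "(\<Sum>s\<in>SP n. of_bool (proj s = u) * Wt s) = 1" if "u \<in> proj ` SP n" for u
      using fibre_mass_tree[OF assms(4)] that unfolding trees_eq .
    show "(\<Sum>s\<in>SP n. of_bool (proj s = u) * Wt s * pkernel \<alpha> \<gamma> n s s') = tree_kernel \<alpha> \<gamma> n u (proj s') * Wt s'"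
      if s': "s' \<in> SP n" for u s'
    proof -
      have delta: "(\<Sum>r\<in>SP n. h r * of_bool (r = s')) = h s'" for h :: "nat ptree \<Rightarrow> real"
      proof -
        have "(\<Sum>r\<in>SP n. h r * of_bool (r = s')) = (\<Sum>r\<in>SP n. if r = s' then h s' else 0)"
          by (rule sum.cong) auto
        then show ?thesis using fin s' by (simp add: sum.delta)
      qed
      have "(\<Sum>s\<in>SP n. of_bool (proj s = u) * Wt s * pkernel \<alpha> \<gamma> n s s') = (\<Sum>s\<in>SP n. of_bool (proj s = u) * Wt s * Ker n (\<lambda>r. of_bool (r = s')) s)"
      proof (rule sum.cong[OF refl])
        fix s assume s: "s \<in> SP n"
        show "of_bool (proj s = u) * Wt s * pkernel \<alpha> \<gamma> n s s' = of_bool (proj s = u) * Wt s * Ker n (\<lambda>r. of_bool (r = s')) s"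
          unfolding sum_pkernel[OF s assms(4), symmetric] delta ..
      qed
      also have "\<dots> = tree_kernel \<alpha> \<gamma> n u (proj s') * Wt s'"
        unfolding intertwining[OF assms(4)] delta ..
      finally show ?thesis .
    qed
  qed
  then have "markov_chain M (trees {1..n}) (\<lambda>s. of_bool (s = t)) (tree_kernel \<alpha> \<gamma> n) (\<lambda>m \<omega>. proj (X m \<omega>))"
    unfolding trees_eq .
  then show ?thesis
    by (intro conjI allI impI ballI growth_law_stationary growth_law_unique assms(4))
qed

end
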